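(* Let $\varepsilon>0$, $T>0$, $A\ge0$ and $A_0\ge A_0^\star:=\frac95\left(\frac2{15}\right)^{2/3}$. Given initial data $\Phi(\cdot,t=0)\in C^6_{\rm per}(\Omega)$, suppose the point-wise positive, $\Omega$-periodic exact solution $\Phi$ of $$\partial_t\phi=\Delta\mu,\qquad \mu=-\frac83(\phi^{-9}-\phi^{-3})-\varepsilon^2\Delta\phi$$ is of regularity class $$\mathcal{R}_2:=H^{3}(0,T;C_{\rm per}(\Omega))\cap H^2(0,T;C^{2}_{\rm per}(\Omega))\cap L^{\infty}(0,T;C^{6}_{\rm per}(\Omega)).$$ Let $\phi^0=\mathcal{P}_h\Phi_N(\cdot,t=0)$, $\phi^{-1}=\phi^0-\Delta t\,\Delta_h\mu_h^0$ with $\mu_h^0=-\frac83\left((\phi^0)^{-9}-(\phi^0)^{-3}\right)-\varepsilon^2\Delta_h\phi^0$, and let $\phi^{n+1}\in\mathcal{C}_{\rm per}$, $n\ge0$, be the point-wise positive numerical solution of $$\frac{\frac32\phi^{n+1}-2\phi^n+\frac12\phi^{n-1}}{\Delta t}=\Delta_h\mu^{n+1},$$ $$\mu^{n+1}=-\frac83\left((\phi^{n+1})^{-9}-(\phi^{n+1})^{-3}\right)+\frac83A_0(\phi^{n+1}-\check\phi^{n+1})-A\,\Delta t\,\Delta_h(\phi^{n+1}-\phi^n)-\varepsilon^2\Delta_h\phi^{n+1},$$ where $\check\phi^{n+1}:=2\phi^n-\phi^{n-1}$. Set $t_m=m\Delta t$ and $\tilde\phi^m:=\mathcal{P}_h\Phi_N(\cdot,t_m)-\phi^m$.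 Then, provided $\Delta t$ and $h$ are sufficiently small, for all positive integers $n$ such that $t_n\le T$, $$\|\tilde\phi^n\|_{-1,h}+\left(\varepsilon^2\Delta t\sum_{m=1}^n\|\nabla_h\tilde\phi^m\|_2^2\right)^{1/2}\le C(\Delta t^2+h^2),$$ where $C>0$ is independent of $n$, $\Delta t$ and $h$.
   Context: Let $\Omega=(0,L)^3$, $L>0$, $N=2K+1$ with $K\in\mathbb{N}$, $h=L/N$. $C^k_{\rm per}(\Omega)$ denotes $\Omega$-periodic $C^k$ functions. $\mathcal{C}_{\rm per}$ is the space of real grid functions $\upsilon=(\upsilon_{i,j,k})_{i,j,k\in\mathbb{Z}}$ that are $N$-periodic in each index, where $\upsilon_{i,j,k}=\upsilon(p_i,p_j,p_k)$, $p_i=(i-\tfrac12)h$. The mean is $\overline{\upsilon}=\frac{h^3}{|\Omega|}\sum_{i,j,k=1}^N\upsilon_{i,j,k}$. The discrete Laplacian is $$\Delta_h\upsilon_{i,j,k}=\frac1{h^2}(\upsilon_{i+1,j,k}+\upsilon_{i-1,j,k}+\upsilon_{i,j+1,k}+\upsilon_{i,j-1,k}+\upsilon_{i,j,k+1}+\upsilon_{i,j,k-1}-6\upsilon_{i,j,k}).$$ The grid inner product is $\langle\upsilon,\xi\rangle_\Omega=h^3\sum_{i,j,k=1}^N\upsilon_{i,j,k}\xi_{i,j,k}$, and $$\|\nabla_h\upsilon\|_2^2=h^3\sum_{i,j,k=1}^N\frac{(\upsilon_{i+1,j,k}-\upsilon_{i,j,k})^2+(\upsilon_{i,j+1,k}-\upsilon_{i,j,k})^2+(\upsilon_{i,j,k+1}-\upsilon_{i,j,k})^2}{h^2}.$$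 For $f\in\mathcal{C}_{\rm per}$ with $\overline f=0$, $(-\Delta_h)^{-1}f$ is the unique $\psi\in\mathcal{C}_{\rm per}$ with $-\Delta_h\psi=f$, $\overline\psi=0$, and $\|f\|_{-1,h}=\langle f,(-\Delta_h)^{-1}f\rangle_\Omega^{1/2}$. Powers of grid functions are taken point-wise. $\Phi_N(\cdot,t)=\mathcal{P}_N\Phi(\cdot,t)$, where $\mathcal{P}_N$ is the spatial Fourier projection onto trigonometric polynomials of degree up to and including $K$: $\mathcal{P}_Nf(\mathbf{x})=\sum_{\|\mathbf{k}\|_1\le K}\hat f_{\mathbf{k}}\exp\left(\frac{2\pi\mathfrak{i}}{L}\mathbf{k}\cdot\mathbf{x}\right)$, $\hat f_{\mathbf{k}}=\frac1{L^3}\int_\Omega f(\mathbf{x})\exp\left(-\frac{2\pi\mathfrak{i}}{L}\mathbf{k}\cdot\mathbf{x}\right)d\mathbf{x}$. $\mathcal{P}_h$ is the grid projection: $(\mathcal{P}_hf)_{i,j,k}=f(p_i,p_j,p_k)$ for continuous periodic $f$. The error grid functions $\tilde\phi^m$ have zero mean. At each step the scheme has a unique point-wise positive solution $\phi^{n+1}$ with $\overline{\phi^{n+1}}=\overline{\phi^n}$; this is the numerical solution meant. *)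

theory Defs
  imports "HOL-Analysis.Analysis"
begin

section \<open>Periodic functions on the cube\<close>

definition Omega :: "real \<Rightarrow> (real^3) set" where
  "Omega L = box 0 (\<chi> i. L)"

definition periodic :: "real \<Rightarrow> (real^3 \<Rightarrow> real) \<Rightarrow> bool" where
  "periodic L f \<longleftrightarrow> (\<forall>x i. f (x + L *\<^sub>R axis i 1) = f x)"

definition partial :: "3 \<Rightarrow> (real^3 \<Rightarrow> real) \<Rightarrow> real^3 \<Rightarrow> real" where
  "partial i f x = deriv (\<lambda>s. f (x + s *\<^sub>R axis i 1)) 0"

primrec partials :: "3 list \<Rightarrow> (real^3 \<Rightarrow> real) \<Rightarrow> real^3 \<Rightarrow> real" where
  "partials [] f = f"
| "partials (i # \<alpha>) f = partial i (partials \<alpha> f)"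

definition Ck_per :: "nat \<Rightarrow> real \<Rightarrow> (real^3 \<Rightarrow> real) set" where
  "Ck_per k L = {f. periodic L f \<and>
     (\<forall>\<alpha>. length \<alpha> < k \<longrightarrow> (\<forall>x. partials \<alpha> f differentiable (at x))) \<and>
     (\<forall>\<alpha>. length \<alpha> \<le> k \<longrightarrow> continuous_on UNIV (partials \<alpha> f))}"

text \<open>The norm of the Banach space of periodic functions of class \<open>C\<^sup>k\<close>; meaningful only on
  \<^const>\<open>Ck_per\<close>, where all the suprema are finite.\<close>

definition Ck_norm :: "nat \<Rightarrow> (real^3 \<Rightarrow> real) \<Rightarrow> real" where
  "Ck_norm k f = (MAX \<alpha>\<in>{\<alpha>. length \<alpha> \<le> k}. SUP x. \<bar>partials \<alpha> f x\<bar>)"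

definition laplacian :: "(real^3 \<Rightarrow> real) \<Rightarrow> real^3 \<Rightarrow> real" where
  "laplacian f x = (\<Sum>i\<in>UNIV. partial i (partial i f) x)"


section \<open>Lebesgue--Bochner and Sobolev spaces in time\<close>

text \<open>Functions of time with values in \<open>C\<^sup>k\<^sub>p\<^sub>e\<^sub>r(\<Omega>)\<close> are written as functions of time and space.
  The spaces are taken over the open interval \<open>(0,T)\<close>. Strong measurability is spelled out since
  \<open>C\<^sup>k\<^sub>p\<^sub>e\<^sub>r(\<Omega>)\<close> depends on the period and is not a type.\<close>

definition strongly_measurable ::
    "real \<Rightarrow> nat \<Rightarrow> real \<Rightarrow> (real \<Rightarrow> real^3 \<Rightarrow> real) \<Rightarrow> bool" where
  "strongly_measurable T k L u \<longleftrightarrow>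
     (\<exists>s :: nat \<Rightarrow> real \<Rightarrow> real^3 \<Rightarrow> real.
        (\<forall>n. simple_function (lebesgue_on {0<..<T}) (s n)) \<and>
        (\<forall>n t. s n t \<in> Ck_per k L) \<and>
        (AE t in lebesgue_on {0<..<T}. u t \<in> Ck_per k L \<and>
           (\<lambda>n. Ck_norm k (\<lambda>x. s n t x - u t x)) \<longlonglongrightarrow> 0))"

definition L2_Ck :: "real \<Rightarrow> nat \<Rightarrow> real \<Rightarrow> (real \<Rightarrow> real^3 \<Rightarrow> real) set" where
  "L2_Ck T k L = {u. strongly_measurable T k L u \<and>
     integrable (lebesgue_on {0<..<T}) (\<lambda>t. (Ck_norm k (u t))\<^sup>2)}"

definition Linf_Ck :: "real \<Rightarrow> nat \<Rightarrow> real \<Rightarrow> (real \<Rightarrow> real^3 \<Rightarrow> real) set" where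
  "Linf_Ck T k L = {u. strongly_measurable T k L u \<and>
     (\<exists>M. AE t in lebesgue_on {0<..<T}. Ck_norm k (u t) \<le> M)}"

definition test_function :: "real \<Rightarrow> (real \<Rightarrow> real) \<Rightarrow> bool" where
  "test_function T \<theta> \<longleftrightarrow>
     (\<forall>n t. (deriv ^^ n) \<theta> differentiable (at t)) \<and>
     (\<exists>a b. 0 < a \<and> b < T \<and> (\<forall>t. t \<notin> {a..b} \<longrightarrow> \<theta> t = 0))"

text \<open>Point evaluations are bounded functionals on \<open>C\<^sup>k\<^sub>p\<^sub>e\<^sub>r(\<Omega>)\<close>, hence commute with the Bochner
  integral, and separate points. The identity \<open>\<integral> \<theta>' u dt = - \<integral> \<theta> v dt\<close> between Bochner integrals is
  therefore the following identity between integrals of real functions at every \<open>x\<close>.\<close>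

definition weak_time_deriv ::
    "real \<Rightarrow> (real \<Rightarrow> real^3 \<Rightarrow> real) \<Rightarrow> (real \<Rightarrow> real^3 \<Rightarrow> real) \<Rightarrow> bool" where
  "weak_time_deriv T u v \<longleftrightarrow>
     (\<forall>\<theta>. test_function T \<theta> \<longrightarrow>
        (\<forall>x. (LINT t|lebesgue_on {0<..<T}. deriv \<theta> t * u t x)
             = - (LINT t|lebesgue_on {0<..<T}. \<theta> t * v t x)))"

definition Hm_Ck :: "nat \<Rightarrow> real \<Rightarrow> nat \<Rightarrow> real \<Rightarrow> (real \<Rightarrow> real^3 \<Rightarrow> real) set" where
  "Hm_Ck m T k L = {u. \<exists>w :: nat \<Rightarrow> real \<Rightarrow> real^3 \<Rightarrow> real. w 0 = u \<and>
     (\<forall>j\<le>m. w j \<in> L2_Ck T k L) \<and>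
     (\<forall>j<m. weak_time_deriv T (w j) (w (Suc j)))}"

definition class_R2 :: "real \<Rightarrow> real \<Rightarrow> (real \<Rightarrow> real^3 \<Rightarrow> real) set" where
  "class_R2 T L = Hm_Ck 3 T 0 L \<inter> Hm_Ck 2 T 2 L \<inter> Linf_Ck T 6 L"


section \<open>The exact solution\<close>

definition nonlin :: "real \<Rightarrow> real" where
  "nonlin s = - (8/3) * (s powi (-9) - s powi (-3))"

definition chem_pot :: "real \<Rightarrow> (real^3 \<Rightarrow> real) \<Rightarrow> real^3 \<Rightarrow> real" where
  "chem_pot \<epsilon> u x = nonlin (u x) - \<epsilon>\<^sup>2 * laplacian u x"

text \<open>An element of \<open>H\<^sup>3(0,T; C\<^sub>p\<^sub>e\<^sub>r)\<close> is a class of functions modulo null sets of times, and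
  \<open>\<Phi>\<close> is its representative in \<open>C([0,T]; C\<^sub>p\<^sub>e\<^sub>r)\<close>, so that \<open>\<Phi>(\<cdot>,t)\<close> makes sense for every
  \<open>t \<in> [0,T]\<close>. Being in \<open>L\<^sup>\<infinity>(0,T; C\<^sup>6\<^sub>p\<^sub>e\<^sub>r)\<close> makes the right-hand side classically defined for
  almost every \<open>t\<close>.\<close>

definition exact_solution :: "real \<Rightarrow> real \<Rightarrow> real \<Rightarrow> (real \<Rightarrow> real^3 \<Rightarrow> real) \<Rightarrow> bool" where
  "exact_solution L T \<epsilon> \<Phi> \<longleftrightarrow>
     (\<forall>t\<in>{0..T}. \<Phi> t \<in> Ck_per 0 L \<and> (\<forall>x. \<Phi> t x > 0)) \<and>
     (\<forall>t\<in>{0..T}. ((\<lambda>s. Ck_norm 0 (\<lambda>x. \<Phi> s x - \<Phi> t x)) \<longlongrightarrow> 0) (at t within {0..T})) \<and>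
     (AE t in lebesgue_on {0<..<T}. \<forall>x.
        ((\<lambda>s. \<Phi> s x) has_real_derivative laplacian (chem_pot \<epsilon> (\<Phi> t)) x) (at t))"


section \<open>Fourier projection\<close>

definition fourier_coeff :: "real \<Rightarrow> (real^3 \<Rightarrow> real) \<Rightarrow> int^3 \<Rightarrow> complex" where
  "fourier_coeff L f k = 1 / of_real (L ^ 3) * integral (Omega L)
     (\<lambda>x. of_real (f x) * exp (- (2 * of_real pi * \<i> / of_real L) *
        of_real (\<Sum>a\<in>UNIV. of_int (k $ a) * x $ a)))"

text \<open>For real-valued \<open>f\<close> the sum is real, the index set being symmetric.\<close>

definition fourier_proj :: "real \<Rightarrow> nat \<Rightarrow> (real^3 \<Rightarrow> real) \<Rightarrow> real^3 \<Rightarrow> real" where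
  "fourier_proj L K f x = Re (\<Sum>k | (\<Sum>a\<in>UNIV. \<bar>k $ a\<bar>) \<le> int K.
     fourier_coeff L f k * exp ((2 * of_real pi * \<i> / of_real L) *
        of_real (\<Sum>a\<in>UNIV. of_int (k $ a) * x $ a)))"


section \<open>Grid functions\<close>

type_synonym grid = "int \<Rightarrow> int \<Rightarrow> int \<Rightarrow> real"

definition mesh :: "real \<Rightarrow> nat \<Rightarrow> real" where
  "mesh L N = L / real N"

definition grid_per :: "nat \<Rightarrow> grid set" where
  "grid_per N = {v. \<forall>i j k. v (i + int N) j k = v i j k \<and> v i (j + int N) k = v i j k \<and>
     v i j (k + int N) = v i j k}"

definition grid_proj :: "real \<Rightarrow> nat \<Rightarrow> (real^3 \<Rightarrow> real) \<Rightarrow> grid" where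
  "grid_proj L N f i j k =
     f (vector [(of_int i - 1/2) * mesh L N, (of_int j - 1/2) * mesh L N,
                (of_int k - 1/2) * mesh L N])"

definition grid_mean :: "real \<Rightarrow> nat \<Rightarrow> grid \<Rightarrow> real" where
  "grid_mean L N v = mesh L N ^ 3 / L ^ 3 *
     (\<Sum>i=1..int N. \<Sum>j=1..int N. \<Sum>k=1..int N. v i j k)"

definition grid_lap :: "real \<Rightarrow> nat \<Rightarrow> grid \<Rightarrow> grid" where
  "grid_lap L N v i j k = 1 / (mesh L N)\<^sup>2 *
     (v (i+1) j k + v (i-1) j k + v i (j+1) k + v i (j-1) k + v i j (k+1) + v i j (k-1)
      - 6 * v i j k)"

definition grid_inner :: "real \<Rightarrow> nat \<Rightarrow> grid \<Rightarrow> grid \<Rightarrow> real" where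
  "grid_inner L N v w = mesh L N ^ 3 *
     (\<Sum>i=1..int N. \<Sum>j=1..int N. \<Sum>k=1..int N. v i j k * w i j k)"

definition grad_norm_sq :: "real \<Rightarrow> nat \<Rightarrow> grid \<Rightarrow> real" where
  "grad_norm_sq L N v = mesh L N ^ 3 *
     (\<Sum>i=1..int N. \<Sum>j=1..int N. \<Sum>k=1..int N.
        ((v (i+1) j k - v i j k)\<^sup>2 + (v i (j+1) k - v i j k)\<^sup>2 + (v i j (k+1) - v i j k)\<^sup>2)
        / (mesh L N)\<^sup>2)"

text \<open>Meaningful only for periodic grid functions of mean zero.\<close>

definition neg_lap_inv :: "real \<Rightarrow> nat \<Rightarrow> grid \<Rightarrow> grid" where
  "neg_lap_inv L N f = (THE \<psi>. \<psi> \<in> grid_per N \<and>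
     (\<forall>i j k. - grid_lap L N \<psi> i j k = f i j k) \<and> grid_mean L N \<psi> = 0)"

definition norm_minus1 :: "real \<Rightarrow> nat \<Rightarrow> grid \<Rightarrow> real" where
  "norm_minus1 L N f = sqrt (grid_inner L N f (neg_lap_inv L N f))"


section \<open>The numerical scheme\<close>

definition discrete_chem_pot_init :: "real \<Rightarrow> nat \<Rightarrow> real \<Rightarrow> grid \<Rightarrow> grid" where
  "discrete_chem_pot_init L N \<epsilon> \<phi>0 i j k =
     nonlin (\<phi>0 i j k) - \<epsilon>\<^sup>2 * grid_lap L N \<phi>0 i j k"

text \<open>Here \<open>\<phi>2\<close>, \<open>\<phi>1\<close>, \<open>\<phi>0\<close> are the iterates with indices \<open>n + 1\<close>, \<open>n\<close>, \<open>n - 1\<close>.\<close>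

definition discrete_chem_pot ::
    "real \<Rightarrow> nat \<Rightarrow> real \<Rightarrow> real \<Rightarrow> real \<Rightarrow> real \<Rightarrow> grid \<Rightarrow> grid \<Rightarrow> grid \<Rightarrow> grid" where
  "discrete_chem_pot L N \<epsilon> A A0 dt \<phi>2 \<phi>1 \<phi>0 i j k =
     nonlin (\<phi>2 i j k)
     + 8/3 * A0 * (\<phi>2 i j k - (2 * \<phi>1 i j k - \<phi>0 i j k))
     - A * dt * grid_lap L N (\<lambda>i j k. \<phi>2 i j k - \<phi>1 i j k) i j k
     - \<epsilon>\<^sup>2 * grid_lap L N \<phi>2 i j k"

text \<open>The time index starts at \<open>-1\<close>; the values of \<open>\<phi>\<close> at smaller indices are irrelevant.\<close>

definition numerical_solution ::
    "real \<Rightarrow> nat \<Rightarrow> real \<Rightarrow> real \<Rightarrow> real \<Rightarrow> (real \<Rightarrow> real^3 \<Rightarrow> real) \<Rightarrow> real \<Rightarrow> (int \<Rightarrow> grid) \<Rightarrow> bool" where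
  "numerical_solution L K \<epsilon> A A0 \<Phi> dt \<phi> \<longleftrightarrow> (let N = 2 * K + 1 in
     \<phi> 0 = grid_proj L N (fourier_proj L K (\<Phi> 0)) \<and>
     \<phi> (-1) = (\<lambda>i j k. \<phi> 0 i j k
        - dt * grid_lap L N (discrete_chem_pot_init L N \<epsilon> (\<phi> 0)) i j k) \<and>
     (\<forall>n::int. n \<ge> 0 \<longrightarrow>
        \<phi> (n+1) \<in> grid_per N \<and>
        (\<forall>i j k. \<phi> (n+1) i j k > 0) \<and>
        grid_mean L N (\<phi> (n+1)) = grid_mean L N (\<phi> n) \<and>
        (\<forall>i j k.
           (3/2 * \<phi> (n+1) i j k - 2 * \<phi> n i j k + 1/2 * \<phi> (n-1) i j k) / dt
           = grid_lap L N
               (discrete_chem_pot L N \<epsilon> A A0 dt (\<phi> (n+1)) (\<phi> n) (\<phi> (n-1))) i j k)))"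

definition error_grid ::
    "real \<Rightarrow> nat \<Rightarrow> (real \<Rightarrow> real^3 \<Rightarrow> real) \<Rightarrow> real \<Rightarrow> (int \<Rightarrow> grid) \<Rightarrow> nat \<Rightarrow> grid" where
  "error_grid L K \<Phi> dt \<phi> m i j k =
     grid_proj L (2 * K + 1) (fourier_proj L K (\<Phi> (real m * dt))) i j k - \<phi> (int m) i j k"

end

theory Submission
  imports Defs
begin

text \<open>
  The proof compares the numerical solution with a grid function \<open>U\<close> made from the exact solution, and
  combines consistency of \<open>U\<close> with stability of the scheme.

  Stability (\<open>bdf2_energy_step\<close>, \<open>bdf2_energy_sum\<close>). The equation for the error \<open>e = U - \<phi>\<close> is tested
  with \<open>(-\<Delta>\<^sub>h)\<^sup>-\<^sup>1 e\<close>. The three-level time difference is then bounded from below by a telescoping sum,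
  the Douglas--Dupont term telescopes as well, and \<open>-\<epsilon>\<^sup>2 \<Delta>\<^sub>h e\<close> yields the gradient norm. The singular
  nonlinearity is harmless because its derivative is at least \<open>-8\<close> on the positive half-line: the constant
  in the one-sided Lipschitz condition does not depend on how close \<open>\<phi>\<close> is to \<open>0\<close>. The remaining terms
  are multiples of \<open>\<parallel>e\<parallel>\<^sup>2\<close>; interpolation between the gradient norm and the dual norm leaves them to a
  discrete Gronwall argument.

  Consistency. In space, \<open>C\<^sup>6\<close> regularity gives an error of order \<open>h\<^sup>2\<close> (\<open>space_consistency\<close>). In time,
  third derivatives exist only in \<open>L\<^sup>2\<close>. Therefore a single step need not be accurate to second order, but the
  squared error of a step is at most \<open>dt ^ 3\<close> times an increment of a bounded increasing function
  \<open>\<Gamma>\<close>, and the increments telescope (\<open>time_regularity\<close>, \<open>bdf2_consistency\<close>). The first step is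
  only of first order, but it occurs once; testing it with a weight of order \<open>1 / dt\<close> recovers the missing
  power (\<open>energy_step_first\<close>).

  The comparison function. \<open>U\<close> has to start at the initial value of the scheme and to keep its mass. So the
  samples of the exact solution are corrected by the initial interpolation error, which is of order
  \<open>h ^ 4\<close> and constant in time, and by a multiple of order \<open>h\<^sup>2\<close> of the constant function. Neither
  correction spoils consistency, and \<open>U\<close> differs from the Fourier projection by terms of order
  \<open>h\<^sup>2\<close> in the norms considered (\<open>w_bounds\<close>).

  Reduction to point values. The hypotheses speak of weak derivatives and of almost every time. The lemma of
  du Bois-Reymond turns weak into classical derivatives in time, and estimates that involve only finitely
  many point values extend to all times by continuity (\<open>reference_solution_exists\<close>). The projection error
  is of order \<open>h ^ 4\<close> at the grid points (\<open>fourier_proj_error\<close>): this is shown for discrete Fourier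
  transforms on finer and finer grids, where inversion and Parseval are finite sums, and passes to the limit.
  The projected solution conserves its grid mass, because the grid mean is the zeroth Fourier coefficient,
  which is the limit of grid means that drift by at most a multiple of the squared mesh size.
\<close>

section \<open>Summation by parts and the inverse discrete Laplacian\<close>

definition gsum :: "nat \<Rightarrow> grid \<Rightarrow> real" where
  "gsum N v = (\<Sum>i=1..int N. \<Sum>j=1..int N. \<Sum>k=1..int N. v i j k)"

lemma gsum_add: "gsum N (\<lambda>i j k. v i j k + w i j k) = gsum N v + gsum N w"
  by (simp add: gsum_def sum.distrib)

lemma gsum_diff: "gsum N (\<lambda>i j k. v i j k - w i j k) = gsum N v - gsum N w"
  by (simp add: gsum_def sum_subtractf)

lemma gsum_cmult: "gsum N (\<lambda>i j k. c * v i j k) = c * gsum N v"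
  by (simp add: gsum_def sum_distrib_left)

lemma gsum_uminus: "gsum N (\<lambda>i j k. - v i j k) = - gsum N v"
  by (simp add: gsum_def sum_negf)

lemma gsum_const: "gsum N (\<lambda>i j k. c) = real N ^ 3 * c"
  by (simp add: gsum_def power3_eq_cube)

lemma gsum_mono: "(\<And>i j k. v i j k \<le> w i j k) \<Longrightarrow> gsum N v \<le> gsum N w"
  unfolding gsum_def by (intro sum_mono)

lemma gsum_nonneg: "(\<And>i j k. 0 \<le> v i j k) \<Longrightarrow> 0 \<le> gsum N v"
  unfolding gsum_def by (intro sum_nonneg)

lemma gsum_member_le:
  assumes "\<And>i j k. 0 \<le> v i j k" "i \<in> {1..int N}" "j \<in> {1..int N}" "k \<in> {1..int N}"
  shows "v i j k \<le> gsum N v"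
proof -
  have "v i j k \<le> (\<Sum>k=1..int N. v i j k)"
    using assms by (intro member_le_sum) auto
  also have "\<dots> \<le> (\<Sum>j=1..int N. \<Sum>k=1..int N. v i j k)"
    using assms by (intro member_le_sum[where f="\<lambda>j. \<Sum>k=1..int N. v i j k"] sum_nonneg) auto
  also have "\<dots> \<le> gsum N v" unfolding gsum_def
    using assms
    by (intro member_le_sum[where f="\<lambda>i. \<Sum>j=1..int N. \<Sum>k=1..int N. v i j k"] sum_nonneg) auto
  finally show ?thesis .
qed

lemma gsum_cong:
  assumes "\<And>i j k. i \<in> {1..int N} \<Longrightarrow> j \<in> {1..int N} \<Longrightarrow> k \<in> {1..int N} \<Longrightarrow> v i j k = w i j k"
  shows "gsum N v = gsum N w"
  unfolding gsum_def using assms by (intro sum.cong) auto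

lemma grid_inner_gsum: "grid_inner L N v w = mesh L N ^ 3 * gsum N (\<lambda>i j k. v i j k * w i j k)"
  by (simp add: grid_inner_def gsum_def)

lemma grid_mean_gsum: "grid_mean L N v = mesh L N ^ 3 / L ^ 3 * gsum N v"
  by (simp add: grid_mean_def gsum_def)

lemma grid_perD:
  assumes "v \<in> grid_per N"
  shows "v (i + int N) j k = v i j k" "v i (j + int N) k = v i j k" "v i j (k + int N) = v i j k"
  using assms by (auto simp: grid_per_def)

lemma grid_perD_mult:
  assumes "v \<in> grid_per N"
  shows "v (i + int N * m) (j + int N * n) (k + int N * l) = v i j k"
proof -
  have gen: "f (x + int N * m) = f x" if "\<And>x. f (x + int N) = f x" for f :: "int \<Rightarrow> real" and x m
  proof -
    have nn: "f (x + int N * int n) = f x" for n x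
    proof (induction n arbitrary: x)
      case (Suc n)
      have "f (x + int N * int (Suc n)) = f ((x + int N) + int N * int n)"
        by (simp add: algebra_simps)
      then show ?case using Suc that by simp
    qed simp
    show ?thesis
    proof (cases "m \<ge> 0")
      case True
      then show ?thesis using nn[of x "nat m"] by simp
    next
      case False
      then show ?thesis using nn[of "x + int N * m" "nat (-m)"] by simp
    qed
  qed
  have "v (i + int N * m) (j + int N * n) (k + int N * l) = v i (j + int N * n) (k + int N * l)"
    using gen[of "\<lambda>i. v i (j + int N * n) (k + int N * l)"] assms by (simp add: grid_per_def)
  also have "\<dots> = v i j (k + int N * l)"
    using gen[of "\<lambda>j. v i j (k + int N * l)"] assms by (simp add: grid_per_def)
  also have "\<dots> = v i j k"
    using gen[of "\<lambda>k. v i j k"] assms by (simp add: grid_per_def)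
  finally show ?thesis .
qed

lemma grid_per_representative:
  fixes i j k :: int
  assumes "N > 0"
  obtains i' j' k' where "i' \<in> {1..int N}" "j' \<in> {1..int N}" "k' \<in> {1..int N}"
    "\<And>v. v \<in> grid_per N \<Longrightarrow> v i j k = v i' j' k'"
proof
  let ?r = "\<lambda>x. (x - 1) mod int N + 1"
  have e: "x = ?r x + int N * ((x - 1) div int N)" for x
    using mult_div_mod_eq[of "int N" "x - 1"] by linarith
  show "?r i \<in> {1..int N}" "?r j \<in> {1..int N}" "?r k \<in> {1..int N}"
    using assms by (auto simp: add1_zle_eq)
  show "v i j k = v (?r i) (?r j) (?r k)" if "v \<in> grid_per N" for v
    using grid_perD_mult[OF that, of "?r i" "(i-1) div int N" "?r j" "(j-1) div int N"
        "?r k" "(k-1) div int N"] e by simp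
qed

lemma grid_per_intros:
  "(\<lambda>i j k. c) \<in> grid_per N"
  "v \<in> grid_per N \<Longrightarrow> w \<in> grid_per N \<Longrightarrow> (\<lambda>i j k. v i j k + w i j k) \<in> grid_per N"
  "v \<in> grid_per N \<Longrightarrow> w \<in> grid_per N \<Longrightarrow> (\<lambda>i j k. v i j k - w i j k) \<in> grid_per N"
  "v \<in> grid_per N \<Longrightarrow> w \<in> grid_per N \<Longrightarrow> (\<lambda>i j k. v i j k * w i j k) \<in> grid_per N"
  "v \<in> grid_per N \<Longrightarrow> (\<lambda>i j k. - v i j k) \<in> grid_per N"
  "v \<in> grid_per N \<Longrightarrow> (\<lambda>i j k. v i j k ^ n) \<in> grid_per N"
  by (auto simp: grid_per_def)

lemma grid_per_comp: "v \<in> grid_per N \<Longrightarrow> (\<lambda>i j k. F (v i j k)) \<in> grid_per N"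
  by (auto simp: grid_per_def)

lemma grid_per_shift:
  assumes "v \<in> grid_per N"
  shows "(\<lambda>i j k. v (i + m) (j + n) (k + l)) \<in> grid_per N"
proof -
  have "v (x + int N + m) y z = v (x + m) y z" "v y (x + int N + m) z = v y (x + m) z"
    "v y z (x + int N + m) = v y z (x + m)" for x y z m
    using grid_perD[OF assms, of "x + m" y z] grid_perD[OF assms, of y "x + m" z]
      grid_perD[OF assms, of y z "x + m"] by (simp_all add: algebra_simps)
  then show ?thesis by (simp add: grid_per_def)
qed

lemma grid_per_lap:
  assumes "v \<in> grid_per N" shows "grid_lap L N v \<in> grid_per N"
  using grid_per_shift[OF assms, of 1 0 0] grid_per_shift[OF assms, of "-1" 0 0]
    grid_per_shift[OF assms, of 0 1 0] grid_per_shift[OF assms, of 0 "-1" 0]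
    grid_per_shift[OF assms, of 0 0 1] grid_per_shift[OF assms, of 0 0 "-1"] assms
  by (simp add: grid_per_def grid_lap_def)

lemma sum_periodic_shift:
  fixes f :: "int \<Rightarrow> 'a::comm_monoid_add"
  assumes "\<And>i. f (i + int N) = f i"
  shows "(\<Sum>i=1..int N. f (i + 1)) = (\<Sum>i=1..int N. f i)"
proof (cases "N = 0")
  case False
  have "(\<Sum>i=1..int N. f (i + 1)) = (\<Sum>i=2..int N + 1. f i)"
    by (rule sum.reindex_bij_witness[of _ "\<lambda>i. i - 1" "\<lambda>i. i + 1"]) auto
  also have "{2..int N + 1} = insert (int N + 1) {2..int N}" using False by auto
  also have "sum f \<dots> = f (int N + 1) + sum f {2..int N}" by simp
  also have "f (int N + 1) = f 1" using assms[of 1] by (simp add: add.commute)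
  also have "f 1 + sum f {2..int N} = sum f (insert 1 {2..int N})" by simp
  also have "insert 1 {2..int N} = {1..int N}" using False by auto
  finally show ?thesis .
qed auto

lemma gsum_shift:
  assumes "v \<in> grid_per N"
  shows "gsum N (\<lambda>i j k. v (i + 1) j k) = gsum N v"
    "gsum N (\<lambda>i j k. v i (j + 1) k) = gsum N v"
    "gsum N (\<lambda>i j k. v i j (k + 1)) = gsum N v"
proof -
  show "gsum N (\<lambda>i j k. v (i + 1) j k) = gsum N v"
    unfolding gsum_def
    by (rule sum_periodic_shift[of "\<lambda>i. \<Sum>j=1..int N. \<Sum>k=1..int N. v i j k"])
      (simp add: grid_perD[OF assms])
  show "gsum N (\<lambda>i j k. v i (j + 1) k) = gsum N v"
    unfolding gsum_def
    by (intro sum.cong refl sum_periodic_shift[of "\<lambda>j. \<Sum>k=1..int N. v _ j k"])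
      (simp add: grid_perD[OF assms])
  show "gsum N (\<lambda>i j k. v i j (k + 1)) = gsum N v"
    unfolding gsum_def
    by (intro sum.cong refl sum_periodic_shift) (simp add: grid_perD[OF assms])
qed

text \<open>The gradient pairing without the factor \<open>1 / h\<^sup>2\<close>; it is polarised because the energy
  identity for the three-level time difference needs mixed terms.\<close>

definition gradsum :: "nat \<Rightarrow> grid \<Rightarrow> grid \<Rightarrow> real" where
  "gradsum N v w = gsum N (\<lambda>i j k. (v (i+1) j k - v i j k) * (w (i+1) j k - w i j k)
     + (v i (j+1) k - v i j k) * (w i (j+1) k - w i j k)
     + (v i j (k+1) - v i j k) * (w i j (k+1) - w i j k))"

lemma gradsum_commute: "gradsum N v w = gradsum N w v"
  unfolding gradsum_def by (rule gsum_cong) (simp add: algebra_simps)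

lemma gradsum_nonneg: "0 \<le> gradsum N v v"
  unfolding gradsum_def by (rule gsum_nonneg) simp

lemma gradsum_add_left:
  "gradsum N (\<lambda>i j k. u i j k + v i j k) w = gradsum N u w + gradsum N v w"
  unfolding gradsum_def gsum_add[symmetric] by (rule gsum_cong) (simp add: algebra_simps)

lemma gradsum_cmult_left:
  "gradsum N (\<lambda>i j k. c * v i j k) w = c * gradsum N v w"
  unfolding gradsum_def gsum_cmult[symmetric] by (rule gsum_cong) (simp add: algebra_simps)

lemma gradsum_diff_left:
  "gradsum N (\<lambda>i j k. u i j k - v i j k) w = gradsum N u w - gradsum N v w"
  unfolding gradsum_def gsum_diff[symmetric] by (rule gsum_cong) (simp add: algebra_simps)

lemma gradsum_add_right:
  "gradsum N w (\<lambda>i j k. u i j k + v i j k) = gradsum N w u + gradsum N w v"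
  using gradsum_add_left gradsum_commute by metis

lemma gradsum_cmult_right:
  "gradsum N w (\<lambda>i j k. c * v i j k) = c * gradsum N w v"
  using gradsum_cmult_left gradsum_commute by metis

lemma gradsum_diff_right:
  "gradsum N w (\<lambda>i j k. u i j k - v i j k) = gradsum N w u - gradsum N w v"
  using gradsum_diff_left gradsum_commute by metis

lemma grad_norm_sq_gradsum:
  "grad_norm_sq L N v = mesh L N ^ 3 / (mesh L N)\<^sup>2 * gradsum N v v"
proof -
  have "grad_norm_sq L N v = mesh L N ^ 3 * gsum N (\<lambda>i j k. (1 / (mesh L N)\<^sup>2) *
     ((v (i+1) j k - v i j k) * (v (i+1) j k - v i j k)
     + (v i (j+1) k - v i j k) * (v i (j+1) k - v i j k)
     + (v i j (k+1) - v i j k) * (v i j (k+1) - v i j k)))"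
    unfolding grad_norm_sq_def gsum_def by (simp add: power2_eq_square)
  then show ?thesis unfolding gsum_cmult gradsum_def by simp
qed

lemma young: 
  fixes a b \<delta> :: real assumes "\<delta> > 0"
  shows "a * b \<le> \<delta> * a\<^sup>2 + b\<^sup>2 / (4 * \<delta>)"
proof -
  have "0 \<le> (2 * \<delta> * a - b)\<^sup>2 / (4 * \<delta>)" using assms by simp
  also have "\<dots> = \<delta> * a\<^sup>2 + b\<^sup>2 / (4 * \<delta>) - a * b"
    using assms by (simp add: power2_eq_square field_simps)
  finally show ?thesis by simp
qed

lemma gsum_young:
  assumes "\<delta> > 0"
  shows "gsum N (\<lambda>i j k. v i j k * w i j k)
    \<le> \<delta> * gsum N (\<lambda>i j k. (v i j k)\<^sup>2) + gsum N (\<lambda>i j k. (w i j k)\<^sup>2) / (4 * \<delta>)"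
proof -
  have "gsum N (\<lambda>i j k. v i j k * w i j k)
    \<le> gsum N (\<lambda>i j k. \<delta> * (v i j k)\<^sup>2 + (1 / (4 * \<delta>)) * (w i j k)\<^sup>2)"
    using young[OF assms] by (intro gsum_mono) auto
  then show ?thesis by (simp only: gsum_add gsum_cmult) simp
qed

lemma gradsum_young:
  assumes "\<delta> > 0"
  shows "gradsum N v w \<le> \<delta> * gradsum N v v + gradsum N w w / (4 * \<delta>)"
proof -
  have "0 \<le> gradsum N (\<lambda>i j k. 2 * \<delta> * v i j k - w i j k) (\<lambda>i j k. 2 * \<delta> * v i j k - w i j k)"
    by (rule gradsum_nonneg)
  also have "\<dots> = 4 * \<delta> * (\<delta> * gradsum N v v + gradsum N w w / (4 * \<delta>) - gradsum N v w)"
    using assms gradsum_commute[of N w v]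
    by (simp add: gradsum_diff_left gradsum_diff_right gradsum_cmult_left gradsum_cmult_right
       algebra_simps)
  finally show ?thesis using assms by (simp add: zero_le_mult_iff)
qed

text \<open>Summation by parts. A shift in one index does not change the sum over a period, so no
  boundary terms appear.\<close>

lemma gsum_mult_lap:
  assumes v: "v \<in> grid_per N" and w: "w \<in> grid_per N"
  shows "gsum N (\<lambda>i j k. w i j k * grid_lap L N v i j k) = - gradsum N w v / (mesh L N)\<^sup>2"
proof -
  have p: "(\<lambda>i j k. w i j k * v (i + m) (j + n) (k + l)) \<in> grid_per N" for m n l
    by (rule grid_per_intros(4)[OF w grid_per_shift[OF v]])
  have q: "(\<lambda>i j k. w i j k * v i j k) \<in> grid_per N"
    by (rule grid_per_intros(4)[OF w v])
  note s = gsum_shift[OF q] gsum_shift(1)[OF p[of "-1" 0 0]] gsum_shift(2)[OF p[of 0 "-1" 0]]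
      gsum_shift(3)[OF p[of 0 0 "-1"]]
  have e: "gradsum N w v =
    (gsum N (\<lambda>i j k. w (i+1) j k * v (i+1) j k) + gsum N (\<lambda>i j k. w i j k * v i j k)
      - gsum N (\<lambda>i j k. w (i+1) j k * v i j k) - gsum N (\<lambda>i j k. w i j k * v (i+1) j k))
    + (gsum N (\<lambda>i j k. w i (j+1) k * v i (j+1) k) + gsum N (\<lambda>i j k. w i j k * v i j k)
      - gsum N (\<lambda>i j k. w i (j+1) k * v i j k) - gsum N (\<lambda>i j k. w i j k * v i (j+1) k))
    + (gsum N (\<lambda>i j k. w i j (k+1) * v i j (k+1)) + gsum N (\<lambda>i j k. w i j k * v i j k)
      - gsum N (\<lambda>i j k. w i j (k+1) * v i j k) - gsum N (\<lambda>i j k. w i j k * v i j (k+1)))"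
    unfolding gradsum_def gsum_add[symmetric] gsum_diff[symmetric]
    by (rule gsum_cong) (simp add: algebra_simps)
  have f: "gsum N (\<lambda>i j k. w i j k * grid_lap L N v i j k) = 1 / (mesh L N)\<^sup>2 *
     (gsum N (\<lambda>i j k. w i j k * v (i+1) j k) + gsum N (\<lambda>i j k. w i j k * v (i-1) j k)
      + gsum N (\<lambda>i j k. w i j k * v i (j+1) k) + gsum N (\<lambda>i j k. w i j k * v i (j-1) k)
      + gsum N (\<lambda>i j k. w i j k * v i j (k+1)) + gsum N (\<lambda>i j k. w i j k * v i j (k-1))
      - 6 * gsum N (\<lambda>i j k. w i j k * v i j k))"
    unfolding gsum_add[symmetric] gsum_diff[symmetric] gsum_cmult[symmetric] grid_lap_def
    by (rule gsum_cong) (simp add: algebra_simps)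
  show ?thesis
    unfolding e f using s by (simp add: field_simps)
qed

lemma gsum_lap_0:
  assumes v: "v \<in> grid_per N"
  shows "gsum N (grid_lap L N v) = 0"
  using gsum_mult_lap[OF v, of "\<lambda>i j k. 1" L] by (simp add: grid_per_intros gradsum_def gsum_def)

lemma grid_lap_add:
  "grid_lap L N (\<lambda>i j k. v i j k + w i j k) i j k = grid_lap L N v i j k + grid_lap L N w i j k"
  by (simp add: grid_lap_def ring_distribs add_divide_distrib diff_divide_distrib)

lemma grid_lap_diff:
  "grid_lap L N (\<lambda>i j k. v i j k - w i j k) i j k = grid_lap L N v i j k - grid_lap L N w i j k"
  by (simp add: grid_lap_def ring_distribs add_divide_distrib diff_divide_distrib)

lemma grid_lap_cmult:
  "grid_lap L N (\<lambda>i j k. c * v i j k) i j k = c * grid_lap L N v i j k"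
  by (simp add: grid_lap_def ring_distribs add_divide_distrib diff_divide_distrib)

lemma grid_lap_const: "grid_lap L N (\<lambda>i j k. c) i j k = 0"
  by (simp add: grid_lap_def)

text \<open>Every difference \<open>f b - f a\<close> telescopes, so by Cauchy--Schwarz its square is at most \<open>N\<close>
  times the Dirichlet sum. Averaging this over all pairs \<open>a, b\<close> gives the variance of \<open>f\<close>.\<close>

lemma poincare_periodic_1d:
  fixes f :: "int \<Rightarrow> real"
  assumes "N > 0"
  shows "(\<Sum>i=1..int N. (f i)\<^sup>2) \<le> (\<Sum>i=1..int N. f i)\<^sup>2 / real N
     + (real N)\<^sup>2 / 2 * (\<Sum>i=1..int N. (f (i+1) - f i)\<^sup>2)"
proof -
  define I where "I = {1..int N}"
  define X where "X = (\<Sum>i\<in>I. (f (i+1) - f i)\<^sup>2)"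
  have step: "f b - f a = (\<Sum>i=a..b-1. f (i+1) - f i)" if "a \<le> b" for a b
    using that
  proof (induction b rule: int_ge_induct)
    case (step i)
    have "{a..i + 1 - 1} = insert i {a..i-1}" using step by auto
    then show ?case using step by simp
  qed simp
  have le: "(f b - f a)\<^sup>2 \<le> real N * X" if "a \<le> b" "a \<in> I" "b \<in> I" for a b
  proof -
    have sub: "{a..b-1} \<subseteq> I" using that by (auto simp: I_def)
    have "(f b - f a)\<^sup>2 \<le> (\<Sum>i=a..b-1. (f (i+1) - f i)\<^sup>2) * card {a..b-1}"
      unfolding step[OF that(1)] by (rule sum_squared_le_sum_of_squares)
    also have "\<dots> \<le> X * real N"
    proof (intro mult_mono)
      show "(\<Sum>i=a..b-1. (f (i+1) - f i)\<^sup>2) \<le> X"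
        unfolding X_def by (intro sum_mono2 sub) (auto simp: I_def)
      show "real (card {a..b-1}) \<le> real N"
        using that by (auto simp: I_def)
    qed (auto simp: X_def sum_nonneg)
    finally show ?thesis by (simp add: mult.commute)
  qed
  have le': "(f b - f a)\<^sup>2 \<le> real N * X" if "a \<in> I" "b \<in> I" for a b
    using le[of a b] le[of b a] that by (cases "a \<le> b") (auto simp: power2_commute)
  have cI: "card I = N" by (simp add: I_def)
  have "(\<Sum>a\<in>I. \<Sum>b\<in>I. (f b - f a)\<^sup>2) \<le> (\<Sum>a\<in>I. \<Sum>b\<in>I. real N * X)"
    by (intro sum_mono le')
  also have "\<dots> = real N ^ 3 * X" by (simp add: cI power3_eq_cube)
  finally have A: "(\<Sum>a\<in>I. \<Sum>b\<in>I. (f b - f a)\<^sup>2) \<le> real N ^ 3 * X" .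
  (* the double sum of squared differences is twice \<open>N\<close> times the variance *)
  have "(\<Sum>a\<in>I. \<Sum>b\<in>I. (f b - f a)\<^sup>2) = 
     (\<Sum>a\<in>I. \<Sum>b\<in>I. (f b)\<^sup>2 + (f a)\<^sup>2 - 2 * (f a * f b))"
    by (intro sum.cong refl) (simp add: power2_eq_square algebra_simps)
  also have "\<dots> = 2 * real N * (\<Sum>i\<in>I. (f i)\<^sup>2) - 2 * (\<Sum>i\<in>I. f i)\<^sup>2"
    by (simp add: sum.distrib sum_subtractf cI sum_distrib_left[symmetric] 
      sum_distrib_right[symmetric] power2_eq_square)
  finally have "2 * real N * (\<Sum>i\<in>I. (f i)\<^sup>2) \<le> 2 * (\<Sum>i\<in>I. f i)\<^sup>2 + real N ^ 3 * X"
    using A by simp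
  then have "(\<Sum>i\<in>I. (f i)\<^sup>2) \<le> (2 * (\<Sum>i\<in>I. f i)\<^sup>2 + real N ^ 3 * X) / (2 * real N)"
    using assms by (simp add: pos_le_divide_eq mult.commute)
  also have "\<dots> = (\<Sum>i\<in>I. f i)\<^sup>2 / real N + (real N)\<^sup>2 / 2 * X"
    using assms by (simp add: power3_eq_cube power2_eq_square field_simps)
  finally show ?thesis by (simp add: X_def I_def)
qed

lemma sum_sq_diff_le:
  fixes g :: "int \<Rightarrow> real" 
  shows "(\<Sum>i=1..int N. g i)\<^sup>2 \<le> real N * (\<Sum>i=1..int N. (g i)\<^sup>2)"
  using sum_squared_le_sum_of_squares[of g "{1..int N}"] by (simp add: mult.commute)

text \<open>The one-dimensional inequality is applied to \<open>v\<close> along the third index, to its line sums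
  \<open>V2\<close> along the second, and to the plane sums \<open>V1\<close> along the first; the vanishing mean removes
  the last remaining term.\<close>

lemma discrete_poincare:
  assumes N: "N > 0" and mean: "gsum N v = 0"
  shows "gsum N (\<lambda>i j k. (v i j k)\<^sup>2) \<le> (real N)\<^sup>2 / 2 * gradsum N v v"
proof -
  define I where "I = {1..int N}"
  define X1 where "X1 = (\<Sum>i\<in>I. \<Sum>j\<in>I. \<Sum>k\<in>I. (v (i+1) j k - v i j k)\<^sup>2)"
  define X2 where "X2 = (\<Sum>i\<in>I. \<Sum>j\<in>I. \<Sum>k\<in>I. (v i (j+1) k - v i j k)\<^sup>2)"
  define X3 where "X3 = (\<Sum>i\<in>I. \<Sum>j\<in>I. \<Sum>k\<in>I. (v i j (k+1) - v i j k)\<^sup>2)"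
  define V2 where "V2 = (\<lambda>i j. \<Sum>k\<in>I. v i j k)"
  define V1 where "V1 = (\<lambda>i. \<Sum>j\<in>I. V2 i j)"
  have G: "gradsum N v v = X1 + X2 + X3"
    by (simp add: gradsum_def gsum_def X1_def X2_def X3_def I_def sum.distrib power2_eq_square)
  have c: "real (card I) = real N" by (simp add: I_def)
  have a: "(\<Sum>i\<in>I. \<Sum>j\<in>I. \<Sum>k\<in>I. (v i j k)\<^sup>2) \<le> (\<Sum>i\<in>I. \<Sum>j\<in>I. (V2 i j)\<^sup>2 / real N)
      + (real N)\<^sup>2 / 2 * X3"
    unfolding X3_def V2_def I_def sum_distrib_left sum.distrib[symmetric]
    by (intro sum_mono poincare_periodic_1d[OF N, folded sum_distrib_left, THEN order_trans])
      (simp add: sum_distrib_left)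
  have b: "(\<Sum>i\<in>I. \<Sum>j\<in>I. (V2 i j)\<^sup>2) \<le> (\<Sum>i\<in>I. (V1 i)\<^sup>2 / real N)
      + (real N)\<^sup>2 / 2 * (\<Sum>i\<in>I. \<Sum>j\<in>I. (V2 i (j+1) - V2 i j)\<^sup>2)"
    unfolding V1_def I_def sum_distrib_left sum.distrib[symmetric]
    by (intro sum_mono poincare_periodic_1d[OF N, folded sum_distrib_left, THEN order_trans])
      (simp add: sum_distrib_left)
  have b': "(\<Sum>i\<in>I. \<Sum>j\<in>I. (V2 i (j+1) - V2 i j)\<^sup>2) \<le> real N * X2"
    unfolding X2_def V2_def I_def sum_distrib_left sum_subtractf[symmetric]
    by (intro sum_mono sum_sq_diff_le[folded sum_distrib_left, THEN order_trans])
      (simp add: sum_distrib_left)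
  have d: "(\<Sum>i\<in>I. (V1 i)\<^sup>2) \<le> (\<Sum>i\<in>I. V1 i)\<^sup>2 / real N
      + (real N)\<^sup>2 / 2 * (\<Sum>i\<in>I. (V1 (i+1) - V1 i)\<^sup>2)"
    unfolding I_def by (rule poincare_periodic_1d[OF N])
  have z: "(\<Sum>i\<in>I. V1 i) = 0"
    using mean by (simp add: V1_def V2_def gsum_def I_def)
  have d': "(\<Sum>i\<in>I. (V1 (i+1) - V1 i)\<^sup>2) \<le> (real N)\<^sup>2 * X1"
  proof -
    have "(V1 (i+1) - V1 i)\<^sup>2 \<le> (real N)\<^sup>2 * (\<Sum>j\<in>I. \<Sum>k\<in>I. (v (i+1) j k - v i j k)\<^sup>2)" for i
    proof -
      have "(V1 (i+1) - V1 i)\<^sup>2 = (\<Sum>j\<in>I. \<Sum>k\<in>I. v (i+1) j k - v i j k)\<^sup>2"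
        by (simp add: V1_def V2_def sum_subtractf)
      also have "\<dots> \<le> real N * (\<Sum>j\<in>I. (\<Sum>k\<in>I. v (i+1) j k - v i j k)\<^sup>2)"
        unfolding I_def by (rule sum_sq_diff_le)
      also have "\<dots> \<le> real N * (\<Sum>j\<in>I. real N * (\<Sum>k\<in>I. (v (i+1) j k - v i j k)\<^sup>2))"
        unfolding I_def by (intro mult_left_mono sum_mono sum_sq_diff_le) auto
      finally show ?thesis by (simp add: sum_distrib_left power2_eq_square mult.assoc)
    qed
    then show ?thesis unfolding X1_def sum_distrib_left
      by (intro sum_mono) (simp add: sum_distrib_left)
  qed
  have Np: "real N > 0" using N by simp
  have D: "(\<Sum>i\<in>I. (V1 i)\<^sup>2) \<le> (real N)^4 / 2 * X1"
  proof -
    have "(\<Sum>i\<in>I. (V1 i)\<^sup>2) \<le> (real N)\<^sup>2 / 2 * (\<Sum>i\<in>I. (V1 (i+1) - V1 i)\<^sup>2)"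
      using d z by simp
    also have "\<dots> \<le> (real N)\<^sup>2 / 2 * ((real N)\<^sup>2 * X1)"
      by (intro mult_left_mono d') simp
    finally show ?thesis by (simp add: power2_eq_square power4_eq_xxxx algebra_simps)
  qed
  have B: "(\<Sum>i\<in>I. \<Sum>j\<in>I. (V2 i j)\<^sup>2) \<le> (real N)^3 / 2 * (X1 + X2)"
  proof -
    have "(\<Sum>i\<in>I. \<Sum>j\<in>I. (V2 i j)\<^sup>2) \<le> ((real N)^4 / 2 * X1) / real N
       + (real N)\<^sup>2 / 2 * (real N * X2)"
      using divide_right_mono[OF D, of "real N"] b'
      by (intro order_trans[OF b] add_mono mult_left_mono) (auto simp: sum_divide_distrib)
    also have "\<dots> = (real N)^3 / 2 * (X1 + X2)"
      using Np by (simp add: power2_eq_square power3_eq_cube power4_eq_xxxx field_simps)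
    finally show ?thesis .
  qed
  have "(\<Sum>i\<in>I. \<Sum>j\<in>I. \<Sum>k\<in>I. (v i j k)\<^sup>2) \<le> ((real N)^3 / 2 * (X1 + X2)) / real N
      + (real N)\<^sup>2 / 2 * X3"
    using divide_right_mono[OF B, of "real N"]
    by (intro order_trans[OF a] add_mono) (auto simp: sum_divide_distrib)
  also have "\<dots> = (real N)\<^sup>2 / 2 * (X1 + X2 + X3)"
      using Np by (simp add: power2_eq_square power3_eq_cube field_simps)
  finally show ?thesis by (simp add: gsum_def G I_def)
qed

text \<open>An inverse inequality: the discrete Laplacian is a sum of six neighbour differences, and
  each squared difference occurs twice. It shows that the Richardson iteration below contracts.\<close>

lemma gsum_lap_sq_le:
  assumes v: "v \<in> grid_per N"
  shows "gsum N (\<lambda>i j k. (grid_lap L N v i j k)\<^sup>2) \<le> 12 / (mesh L N)^4 * gradsum N v v"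
proof -
  let ?a = "\<lambda>i j k. (v (i+1) j k - v i j k)\<^sup>2"
  let ?b = "\<lambda>i j k. (v i (j+1) k - v i j k)\<^sup>2"
  let ?c = "\<lambda>i j k. (v i j (k+1) - v i j k)\<^sup>2"
  let ?a' = "\<lambda>i j k. (v i j k - v (i-1) j k)\<^sup>2"
  let ?b' = "\<lambda>i j k. (v i j k - v i (j-1) k)\<^sup>2"
  let ?c' = "\<lambda>i j k. (v i j k - v i j (k-1))\<^sup>2"
  have sq6: "(x1 + x2 + x3 - y1 - y2 - y3)\<^sup>2 
      \<le> 6 * (x1\<^sup>2 + x2\<^sup>2 + x3\<^sup>2 + y1\<^sup>2 + y2\<^sup>2 + y3\<^sup>2)" for x1 x2 x3 y1 y2 y3 :: real
  proof -
    have "(\<Sum>x\<leftarrow>[x1,x2,x3,-y1,-y2,-y3]. x)\<^sup>2 \<le> 6 * (x1\<^sup>2 + x2\<^sup>2 + x3\<^sup>2 + y1\<^sup>2 + y2\<^sup>2 + y3\<^sup>2)"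
      using sum_squared_le_sum_of_squares[of "\<lambda>n. [x1,x2,x3,-y1,-y2,-y3] ! n" "{..<6::nat}"]
      by (simp add: eval_nat_numeral algebra_simps)
    then show ?thesis by (simp add: algebra_simps)
  qed
  have p: "?a' \<in> grid_per N" "?b' \<in> grid_per N" "?c' \<in> grid_per N"
    using grid_per_shift[OF v, of "-1" 0 0] grid_per_shift[OF v, of 0 "-1" 0]
      grid_per_shift[OF v, of 0 0 "-1"] v by (simp_all add: grid_per_def)
  have G: "gradsum N v v = gsum N ?a + gsum N ?b + gsum N ?c"
    unfolding gradsum_def gsum_add[symmetric] by (rule gsum_cong) (simp add: power2_eq_square)
  have s: "gsum N ?a' = gsum N ?a" "gsum N ?b' = gsum N ?b" "gsum N ?c' = gsum N ?c"
    using gsum_shift(1)[OF p(1)] gsum_shift(2)[OF p(2)] gsum_shift(3)[OF p(3)] by simp_all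
  have "gsum N (\<lambda>i j k. (grid_lap L N v i j k)\<^sup>2)
     \<le> gsum N (\<lambda>i j k. (6 / (mesh L N)^4) * (?a i j k + ?b i j k + ?c i j k + ?a' i j k + ?b' i j k + ?c' i j k))"
  proof (rule gsum_mono)
    fix i j k
    have "(grid_lap L N v i j k)\<^sup>2 = (1 / (mesh L N)^4) * 
      ((v (i+1) j k - v i j k) + (v i (j+1) k - v i j k) + (v i j (k+1) - v i j k)
        - (v i j k - v (i-1) j k) - (v i j k - v i (j-1) k) - (v i j k - v i j (k-1)))\<^sup>2"
      unfolding grid_lap_def power_mult_distrib
      by (simp add: power_one_over power2_eq_square power4_eq_xxxx algebra_simps)
    also have "\<dots> \<le> (1 / (mesh L N)^4) * (6 * (?a i j k + ?b i j k + ?c i j k + ?a' i j k + ?b' i j k + ?c' i j k))"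
      by (intro mult_left_mono sq6) simp
    finally show "(grid_lap L N v i j k)\<^sup>2 \<le>
       (6 / (mesh L N)^4) * (?a i j k + ?b i j k + ?c i j k + ?a' i j k + ?b' i j k + ?c' i j k)"
      by simp
  qed
  also have "\<dots> = 12 / (mesh L N)^4 * gradsum N v v"
    unfolding gsum_cmult gsum_add s G by simp
  finally show ?thesis .
qed

lemma mesh_pos: "L > 0 \<Longrightarrow> N > 0 \<Longrightarrow> mesh L N > 0"
  by (simp add: mesh_def)

lemma gradsum_0D:
  assumes "gradsum N v v = 0" "N > 0" "gsum N v = 0" "v \<in> grid_per N"
  shows "v i j k = 0"
proof -
  obtain i' j' k' where r: "i' \<in> {1..int N}" "j' \<in> {1..int N}" "k' \<in> {1..int N}" "v i j k = v i' j' k'"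
    using grid_per_representative[OF \<open>N > 0\<close>, of i j k] assms(4) by metis
  have "(v i' j' k')\<^sup>2 \<le> gsum N (\<lambda>i j k. (v i j k)\<^sup>2)"
    using gsum_member_le[of "\<lambda>i j k. (v i j k)\<^sup>2" i' N j' k'] r by simp
  also have "\<dots> \<le> 0" using discrete_poincare[OF assms(2,3)] assms(1) by simp
  finally show ?thesis using r by simp
qed

text \<open>The inverse is the Neumann series \<open>\<omega> * (\<Sum>n. (1 + \<omega> * \<Delta>) ^ n f)\<close>. The Poincare inequality
  bounds the Dirichlet form from below and the inverse inequality bounds \<open>\<Delta>\<close> from above, so that
  \<open>1 + \<omega> * \<Delta>\<close> is a contraction on mean-zero grid functions.\<close>

lemma neg_lap_inverse_exists:
  assumes L: "L > 0" and N: "N > 0" and f: "f \<in> grid_per N" and mean: "gsum N f = 0"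
  shows "\<exists>\<psi>. \<psi> \<in> grid_per N \<and> (\<forall>i j k. - grid_lap L N \<psi> i j k = f i j k) \<and> gsum N \<psi> = 0"
proof -
  define h where "h = mesh L N"
  (* with this relaxation parameter the iteration matrix of the Richardson method, restricted to
     grid functions of mean zero, has norm at most \<open>sqrt q\<close> *)
  define \<omega> where "\<omega> = h\<^sup>2 / 12"
  define T where "T = (\<lambda>v::grid. \<lambda>i j k. v i j k + \<omega> * grid_lap L N v i j k)"
  define F where "F = (\<lambda>n. (T ^^ n) f)"
  have F0: "F 0 = f" and FS: "F (Suc n) = T (F n)" for n by (simp_all add: F_def)
  have h: "h > 0" using mesh_pos[OF L N] by (simp add: h_def)
  have Np: "real N > 0" using N by simp
  define q where "q = 1 - 1 / (6 * (real N)\<^sup>2)"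
  have "(real N)\<^sup>2 \<ge> 1" using N by simp
  then have "6 * (real N)\<^sup>2 > 1" by linarith
  then have q01: "0 < q" "q < 1" using Np by (auto simp: q_def field_simps)
  have T_per: "T v \<in> grid_per N" if "v \<in> grid_per N" for v
    unfolding T_def by (intro grid_per_intros(1,2,4) that grid_per_lap[OF that])
  have T_mean: "gsum N (T v) = gsum N v" if "v \<in> grid_per N" for v
    unfolding T_def gsum_add gsum_cmult using gsum_lap_0[OF that] by simp
  have T_contr: "gsum N (\<lambda>i j k. (T v i j k)\<^sup>2) \<le> q * gsum N (\<lambda>i j k. (v i j k)\<^sup>2)"
    if v: "v \<in> grid_per N" and m: "gsum N v = 0" for v
  proof -
    have "gsum N (\<lambda>i j k. (T v i j k)\<^sup>2) = gsum N (\<lambda>i j k. (v i j k)\<^sup>2)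
        + 2 * \<omega> * gsum N (\<lambda>i j k. v i j k * grid_lap L N v i j k)
        + \<omega>\<^sup>2 * gsum N (\<lambda>i j k. (grid_lap L N v i j k)\<^sup>2)"
      unfolding T_def gsum_cmult[symmetric] gsum_add[symmetric]
      by (rule gsum_cong) (simp add: power2_eq_square algebra_simps)
    also have "\<dots> \<le> gsum N (\<lambda>i j k. (v i j k)\<^sup>2)
        + 2 * \<omega> * (- gradsum N v v / h\<^sup>2) + \<omega>\<^sup>2 * (12 / h^4 * gradsum N v v)"
      using gsum_lap_sq_le[OF v, of L]
      by (intro add_mono mult_left_mono) (auto simp: gsum_mult_lap[OF v v] h_def \<omega>_def)
    also have "\<dots> = gsum N (\<lambda>i j k. (v i j k)\<^sup>2) - gradsum N v v / 12"
      using h by (simp add: \<omega>_def power2_eq_square power4_eq_xxxx field_simps)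
    also have "\<dots> \<le> q * gsum N (\<lambda>i j k. (v i j k)\<^sup>2)"
      using discrete_poincare[OF N m] Np by (simp add: q_def field_simps)
    finally show ?thesis .
  qed
  have Fp: "F n \<in> grid_per N" "gsum N (F n) = 0" for n
    by (induction n) (auto simp: F0 FS f mean T_per T_mean)
  define S where "S = gsum N (\<lambda>i j k. (f i j k)\<^sup>2)"
  have S0: "S \<ge> 0" unfolding S_def by (rule gsum_nonneg) simp
  have Fn: "gsum N (\<lambda>i j k. (F n i j k)\<^sup>2) \<le> q ^ n * S" for n
  proof (induction n)
    case (Suc n)
    have "gsum N (\<lambda>i j k. (F (Suc n) i j k)\<^sup>2) \<le> q * gsum N (\<lambda>i j k. (F n i j k)\<^sup>2)"
      unfolding FS by (rule T_contr[OF Fp])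
    also have "\<dots> \<le> q * (q ^ n * S)" by (intro mult_left_mono Suc) (use q01 in simp)
    finally show ?case by simp
  qed (simp add: F0 S_def)
  have Fb: "\<bar>F n i j k\<bar> \<le> sqrt S * sqrt q ^ n" for n i j k
  proof -
    obtain i' j' k' where r: "i' \<in> {1..int N}" "j' \<in> {1..int N}" "k' \<in> {1..int N}" 
      "F n i j k = F n i' j' k'"
      using grid_per_representative[OF N, of i j k] Fp(1) by metis
    have "(F n i j k)\<^sup>2 \<le> q ^ n * S"
      using gsum_member_le[of "\<lambda>i j k. (F n i j k)\<^sup>2" i' N j' k'] r Fn[of n] by simp
    then have "\<bar>F n i j k\<bar> \<le> sqrt (q ^ n * S)" by (rule real_le_rsqrt[OF power2_abs[THEN eq_refl, THEN order_trans]])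
    then show ?thesis by (simp add: real_sqrt_mult real_sqrt_power mult.commute)
  qed
  have sq: "norm (sqrt q) < 1" using q01 by simp
  have summ: "summable (\<lambda>n. F n i j k)" for i j k
    by (rule summable_comparison_test'[where N=0, OF summable_mult[OF summable_geometric[OF sq]]])
      (use Fb in auto)
  have lim: "(\<lambda>n. F n i j k) \<longlonglongrightarrow> 0" for i j k by (rule summable_LIMSEQ_zero[OF summ])
  define \<psi> where "\<psi> = (\<lambda>i j k. \<omega> * (\<Sum>n. F n i j k))"
  have per: "\<psi> \<in> grid_per N"
    using Fp(1) by (simp add: grid_per_def \<psi>_def)
  (* the series telescopes under the Laplacian *)
  have tel: "\<omega> * grid_lap L N (F n) i j k = F (Suc n) i j k - F n i j k" for n i j k
    by (simp add: FS T_def)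
  have lap: "- grid_lap L N \<psi> i j k = f i j k" for i j k
  proof -
    have "(\<lambda>n. F n (i+1) j k + F n (i-1) j k + F n i (j+1) k + F n i (j-1) k
       + F n i j (k+1) + F n i j (k-1) - 6 * F n i j k) sums
       ((\<Sum>n. F n (i+1) j k) + (\<Sum>n. F n (i-1) j k) + (\<Sum>n. F n i (j+1) k) + (\<Sum>n. F n i (j-1) k)
        + (\<Sum>n. F n i j (k+1)) + (\<Sum>n. F n i j (k-1)) - 6 * (\<Sum>n. F n i j k))"
      by (intro sums_add sums_diff sums_mult summable_sums summ)
    from sums_mult[OF this, of "\<omega> * (1 / (mesh L N)\<^sup>2)"]
    have "(\<lambda>n. \<omega> * grid_lap L N (F n) i j k) sums (grid_lap L N \<psi> i j k)"
      by (simp add: grid_lap_def \<psi>_def algebra_simps)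
    then have 1: "(\<lambda>n. F (Suc n) i j k - F n i j k) sums (grid_lap L N \<psi> i j k)"
      by (simp add: tel)
    have "(\<lambda>n. F (Suc n) i j k - F n i j k) sums (0 - F 0 i j k)"
      by (rule telescope_sums[OF lim])
    with 1 show ?thesis by (simp add: F0 sums_iff)
  qed
  have "gsum N \<psi> = 0"
  proof -
    have "(\<lambda>n. gsum N (F n)) sums (gsum N (\<lambda>i j k. \<Sum>n. F n i j k))"
      unfolding gsum_def by (intro sums_sum summable_sums summ)
    then show ?thesis by (simp add: Fp \<psi>_def gsum_cmult sums_iff)
  qed
  with per lap show ?thesis by blast
qed

text \<open>The relational form of \<^const>\<open>neg_lap_inv\<close>, which is visibly linear in both arguments.\<close>

definition "is_inv_lap L N f \<psi> \<longleftrightarrow>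
  \<psi> \<in> grid_per N \<and> (\<forall>i j k. - grid_lap L N \<psi> i j k = f i j k) \<and> gsum N \<psi> = 0"

lemma is_inv_lap_unique:
  assumes L: "L > 0" and N: "N > 0" and "is_inv_lap L N f \<psi>" "is_inv_lap L N f \<psi>'"
  shows "\<psi> = \<psi>'"
proof (intro ext)
  fix i j k
  define w where "w = (\<lambda>i j k. \<psi> i j k - \<psi>' i j k)"
  have w: "w \<in> grid_per N" "gsum N w = 0"
    using assms(3,4) unfolding w_def is_inv_lap_def by (auto intro: grid_per_intros simp: gsum_diff)
  have "grid_lap L N w i j k = 0" for i j k
  proof -
    have "- grid_lap L N \<psi> i j k = f i j k" "- grid_lap L N \<psi>' i j k = f i j k"
      using assms(3,4) unfolding is_inv_lap_def by blast+
    then show ?thesis unfolding w_def grid_lap_diff by simp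
  qed
  then have "gradsum N w w = 0"
    using gsum_mult_lap[OF w(1) w(1), of L] mesh_pos[OF L N] by (simp add: gsum_const)
  then have "w i j k = 0" using gradsum_0D N w by blast
  then show "\<psi> i j k = \<psi>' i j k" by (simp add: w_def)
qed

lemma is_inv_lap_neg_lap_inv:
  assumes L: "L > 0" and N: "N > 0" and f: "f \<in> grid_per N" and mean: "gsum N f = 0"
  shows "is_inv_lap L N f (neg_lap_inv L N f)"
proof -
  have m: "grid_mean L N \<psi> = 0 \<longleftrightarrow> gsum N \<psi> = 0" for \<psi>
    using mesh_pos[OF L N] L by (simp add: grid_mean_gsum)
  have "\<exists>!\<psi>. is_inv_lap L N f \<psi>"
    using neg_lap_inverse_exists[OF assms] is_inv_lap_unique[OF L N] unfolding is_inv_lap_def by blast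
  from theI'[OF this] show ?thesis unfolding neg_lap_inv_def m is_inv_lap_def .
qed

lemma gsum_mult_inv_lap:
  assumes inv: "is_inv_lap L N f \<psi>" and w: "w \<in> grid_per N"
  shows "gsum N (\<lambda>i j k. f i j k * w i j k) = gradsum N w \<psi> / (mesh L N)\<^sup>2"
proof -
  have \<psi>: "\<psi> \<in> grid_per N" "\<And>i j k. f i j k = - grid_lap L N \<psi> i j k"
    using inv by (auto simp: is_inv_lap_def)
  then have "gsum N (\<lambda>i j k. f i j k * w i j k) = gsum N (\<lambda>i j k. - (w i j k * grid_lap L N \<psi> i j k))"
    by (simp add: mult.commute)
  also have "\<dots> = gradsum N w \<psi> / (mesh L N)\<^sup>2"
    unfolding gsum_uminus gsum_mult_lap[OF \<psi>(1) w] by simp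
  finally show ?thesis .
qed

text \<open>The dual norm of \<open>f\<close> is the gradient norm of its inverse Laplacian; \<open>h\<^sup>3\<close> over \<open>h\<^sup>2\<close> leaves
  one factor \<open>h\<close>.\<close>

lemma norm_minus1_is_inv_lap:
  assumes L: "L > 0" and N: "N > 0" and inv: "is_inv_lap L N f \<psi>" and f: "f \<in> grid_per N" "gsum N f = 0"
  shows "norm_minus1 L N f = sqrt (mesh L N * gradsum N \<psi> \<psi>)"
proof -
  have "neg_lap_inv L N f = \<psi>"
    using is_inv_lap_unique[OF L N is_inv_lap_neg_lap_inv[OF L N f] inv] .
  moreover have "gsum N (\<lambda>i j k. f i j k * \<psi> i j k) = gradsum N \<psi> \<psi> / (mesh L N)\<^sup>2"
    using gsum_mult_inv_lap[OF inv] inv by (simp add: is_inv_lap_def)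
  ultimately show ?thesis
    using mesh_pos[OF L N] unfolding norm_minus1_def grid_inner_gsum
    by (simp add: power2_eq_square power3_eq_cube)
qed

text \<open>The \<open>L\<^sup>2\<close> norm lies between the gradient norm and the dual norm. This is what makes the
  zero-order terms of the error equation harmless: a small part is absorbed by the surface
  diffusion and the rest is left to the Gronwall argument.\<close>

lemma interpolation_l2:
  assumes "is_inv_lap L N f \<psi>" "f \<in> grid_per N" "\<delta> > 0"
  shows "gsum N (\<lambda>i j k. (f i j k)\<^sup>2)
    \<le> \<delta> * (gradsum N f f / (mesh L N)\<^sup>2) + (gradsum N \<psi> \<psi> / (mesh L N)\<^sup>2) / (4 * \<delta>)"
proof -
  have "gsum N (\<lambda>i j k. (f i j k)\<^sup>2) = gradsum N f \<psi> / (mesh L N)\<^sup>2"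
    using gsum_mult_inv_lap[OF assms(1,2)] by (simp add: power2_eq_square)
  also have "\<dots> \<le> (\<delta> * gradsum N f f + gradsum N \<psi> \<psi> / (4 * \<delta>)) / (mesh L N)\<^sup>2"
    by (intro divide_right_mono gradsum_young assms) simp
  finally show ?thesis by (simp add: add_divide_distrib mult.commute)
qed

text \<open>Poincare for \<open>\<psi>\<close> and Cauchy--Schwarz in the pairing of \<open>f\<close> and \<open>\<psi>\<close>. It turns pointwise
  bounds into bounds in the dual norm.\<close>

lemma inv_lap_gradsum_le:
  assumes L: "L > 0" and N: "N > 0" and inv: "is_inv_lap L N f \<psi>"
  shows "gradsum N \<psi> \<psi> / (mesh L N)\<^sup>2 \<le> L\<^sup>2 / 2 * gsum N (\<lambda>i j k. (f i j k)\<^sup>2)"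
proof -
  have \<psi>: "\<psi> \<in> grid_per N" "gsum N \<psi> = 0" using inv by (auto simp: is_inv_lap_def)
  have h: "mesh L N > 0" by (rule mesh_pos[OF L N])
  define X where "X = gradsum N \<psi> \<psi> / (mesh L N)\<^sup>2"
  have P: "gsum N (\<lambda>i j k. (\<psi> i j k)\<^sup>2) \<le> L\<^sup>2 / 2 * X"
    using discrete_poincare[OF N \<psi>(2)] N L by (simp add: X_def mesh_def power_divide mult.commute)
  have "X = gsum N (\<lambda>i j k. f i j k * \<psi> i j k)"
    using gsum_mult_inv_lap[OF inv \<psi>(1)] by (simp add: X_def)
  also have "\<dots> \<le> (L\<^sup>2 / 4) * gsum N (\<lambda>i j k. (f i j k)\<^sup>2) + gsum N (\<lambda>i j k. (\<psi> i j k)\<^sup>2) / (4 * (L\<^sup>2 / 4))"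
    by (rule gsum_young) (use L in simp)
  also have "\<dots> \<le> (L\<^sup>2 / 4) * gsum N (\<lambda>i j k. (f i j k)\<^sup>2) + (L\<^sup>2 / 2 * X) / (4 * (L\<^sup>2 / 4))"
    by (intro add_left_mono divide_right_mono P) simp
  finally show ?thesis using L by (simp add: X_def[symmetric])
qed

lemma is_inv_lap_combine:
  assumes "is_inv_lap L N f \<psi>" "is_inv_lap L N g \<eta>"
  shows "is_inv_lap L N (\<lambda>i j k. a * f i j k + b * g i j k) (\<lambda>i j k. a * \<psi> i j k + b * \<eta> i j k)"
proof -
  have "grid_lap L N \<psi> i j k = - f i j k" "grid_lap L N \<eta> i j k = - g i j k" for i j k
    using assms unfolding is_inv_lap_def by (simp_all add: minus_equation_iff)
  then show ?thesis
    using assms unfolding is_inv_lap_def grid_lap_add grid_lap_cmult gsum_add gsum_cmult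
    by (auto intro!: grid_per_intros(1,2,4))
qed

section \<open>Stability of the three-level scheme\<close>

text \<open>With \<open>t = 1/s\<close> the derivative of the nonlinearity is \<open>24 * t ^ 10 - 8 * t ^ 4\<close>. The singular
  repulsive part has the good sign and dominates for \<open>t \<ge> 1\<close>; for \<open>t \<le> 1\<close> the attractive part is
  at most \<open>8\<close>. Hence the constant does not depend on how close the arguments are to \<open>0\<close>, which for
  the numerical solution is unknown.\<close>

lemma nonlin_one_sided_lipschitz:
  assumes "x > 0" "y > 0"
  shows "(nonlin x - nonlin y) * (x - y) \<ge> - 8 * (x - y)\<^sup>2"
proof -
  define F where "F = (\<lambda>s::real. nonlin s + 8 * s)"
  have mono: "F x \<le> F y" if "0 < x" "x \<le> y" for x y
  proof (rule DERIV_nonneg_imp_nondecreasing[OF that(2)])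
    fix s assume "x \<le> s" "s \<le> y"
    then have s: "s > 0" using that by simp
    have d: "(F has_real_derivative 24 * s powi (-10) - 8 * s powi (-4) + 8) (at s)"
      unfolding F_def nonlin_def
      using s by (auto intro!: derivative_eq_intros simp: field_simps)
    define t where "t = inverse s"
    have t: "t > 0" using s by (simp add: t_def)
    have e: "s powi (-10) = t ^ 10" "s powi (-4) = t ^ 4"
      by (simp_all add: t_def power_int_minus power_inverse)
    have "24 * t ^ 10 - 8 * t ^ 4 + 8 \<ge> 0"
    proof (cases "t \<le> 1")
      case True
      then have "t ^ 4 \<le> 1" using t by (simp add: power_le_one)
      moreover have "t ^ 10 \<ge> 0" using t by simp
      ultimately show ?thesis by linarith
    next
      case False
      then have "t ^ 4 \<le> t ^ 10" by (intro power_increasing) auto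
      moreover have "t ^ 4 \<ge> 0" using t by simp
      ultimately show ?thesis by linarith
    qed
    with d e show "\<exists>z. (F has_real_derivative z) (at s) \<and> 0 \<le> z" by auto
  qed
  have "0 \<le> (F x - F y) * (x - y)"
    using mono[of x y] mono[of y x] assms by (cases "x \<le> y") (auto simp: mult_nonpos_nonpos)
  then show ?thesis by (simp add: F_def power2_eq_square algebra_simps)
qed

text \<open>The G-stability identity of the second-order backward difference formula; the difference of
  the two sides is the squared gradient of the second difference of the three levels.\<close>

lemma gradsum_bdf2:
  "4 * gradsum N (\<lambda>i j k. 3/2 * u i j k - 2 * v i j k + 1/2 * w i j k) u
    \<ge> gradsum N u u + gradsum N (\<lambda>i j k. 2 * u i j k - v i j k) (\<lambda>i j k. 2 * u i j k - v i j k)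
    - gradsum N v v - gradsum N (\<lambda>i j k. 2 * v i j k - w i j k) (\<lambda>i j k. 2 * v i j k - w i j k)"
proof -
  have "0 \<le> gradsum N (\<lambda>i j k. u i j k - 2 * v i j k + w i j k) (\<lambda>i j k. u i j k - 2 * v i j k + w i j k)"
    by (rule gradsum_nonneg)
  then show ?thesis
    using gradsum_commute[of N u v] gradsum_commute[of N u w] gradsum_commute[of N v w]
    by (simp only: gradsum_diff_left gradsum_diff_right gradsum_cmult_left gradsum_cmult_right
       gradsum_add_left gradsum_add_right) (simp add: algebra_simps)
qed

text \<open>Testing the error equation with the inverse Laplacian \<open>\<psi>2\<close> of the newest error. The three
  consistency terms enter with different strength: \<open>\<alpha>\<close> is paired with \<open>\<psi>2\<close> itself and \<open>\<Delta>\<^sub>h \<beta>\<close> with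
  the error, while \<open>\<Delta>\<^sub>h (\<Delta>\<^sub>h \<eta>)\<close> is paired through gradients, so that only first differences of
  \<open>\<eta>\<close> have to be small. The weight \<open>\<rho>\<close> is left free because the first time step needs another
  choice than the later ones.\<close>

lemma bdf2_energy_step:
  fixes L dt \<epsilon> \<kappa> A \<rho> :: real
  assumes L: "L > 0" and N: "N > 0" and dt: "dt > 0" and A: "A \<ge> 0" and \<kappa>: "\<kappa> \<ge> 0" and \<epsilon>: "\<epsilon> > 0"
    and \<rho>: "\<rho> > 0"
    and inv: "is_inv_lap L N e2 \<psi>2" "is_inv_lap L N e1 \<psi>1" "is_inv_lap L N e0 \<psi>0"
    and per: "e2 \<in> grid_per N" "e1 \<in> grid_per N" "e0 \<in> grid_per N"
      "U \<in> grid_per N" "\<phi> \<in> grid_per N" "\<beta> \<in> grid_per N" "\<eta> \<in> grid_per N"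
    and pos: "\<And>i j k. U i j k > 0" "\<And>i j k. \<phi> i j k > 0"
    and e2: "\<And>i j k. e2 i j k = U i j k - \<phi> i j k"
    and eq: "\<And>i j k. (3/2 * e2 i j k - 2 * e1 i j k + 1/2 * e0 i j k) / dt
      = grid_lap L N (\<lambda>i j k. nonlin (U i j k) - nonlin (\<phi> i j k)
          + \<kappa> * (e2 i j k - 2 * e1 i j k + e0 i j k)
          - A * dt * grid_lap L N (\<lambda>i j k. e2 i j k - e1 i j k) i j k
          - \<epsilon>\<^sup>2 * grid_lap L N e2 i j k) i j k
        + \<alpha> i j k + grid_lap L N (\<lambda>i j k. \<beta> i j k + grid_lap L N \<eta> i j k) i j k"
  defines "sq \<equiv> \<lambda>v. gsum N (\<lambda>i j k. (v i j k)\<^sup>2)" and "gr \<equiv> \<lambda>v. gradsum N v v / (mesh L N)\<^sup>2"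
  shows "(gr \<psi>2 + gr (\<lambda>i j k. 2 * \<psi>2 i j k - \<psi>1 i j k) - gr \<psi>1 - gr (\<lambda>i j k. 2 * \<psi>1 i j k - \<psi>0 i j k)) / (4 * dt)
     + A * dt / 2 * (gr e2 - gr e1) + 3/4 * \<epsilon>\<^sup>2 * gr e2
    \<le> (9 + 3 * \<kappa>) * (sq e2 + sq e1 + sq e0) + \<rho> * gr \<psi>2
     + L\<^sup>2 / (8 * \<rho>) * sq \<alpha> + 1/2 * sq \<beta> + gr \<eta> / \<epsilon>\<^sup>2"
proof -
  define h2 where "h2 = (mesh L N)\<^sup>2"
  have h2: "h2 > 0" using mesh_pos[OF L N] by (simp add: h2_def)
  note iv = inv[unfolded is_inv_lap_def]
  have \<psi>2: "\<psi>2 \<in> grid_per N" "\<And>i j k. grid_lap L N \<psi>2 i j k = - e2 i j k" "gsum N \<psi>2 = 0"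
    using iv by (auto simp: minus_equation_iff)
  (* the Laplacian is moved onto \<open>\<psi>2\<close>, where it gives back the error *)
  have lapswap: "gsum N (\<lambda>i j k. \<psi>2 i j k * grid_lap L N w i j k) = - gsum N (\<lambda>i j k. w i j k * e2 i j k)"
    if w: "w \<in> grid_per N" for w
  proof -
    have "gsum N (\<lambda>i j k. \<psi>2 i j k * grid_lap L N w i j k) = gsum N (\<lambda>i j k. w i j k * grid_lap L N \<psi>2 i j k)"
      unfolding gsum_mult_lap[OF w \<psi>2(1)] gsum_mult_lap[OF \<psi>2(1) w] by (simp add: gradsum_commute)
    then show ?thesis by (simp add: \<psi>2 gsum_uminus)
  qed
  define D where "D = (\<lambda>i j k. nonlin (U i j k) - nonlin (\<phi> i j k))"
  define X where "X = (\<lambda>i j k. e2 i j k - 2 * e1 i j k + e0 i j k)"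
  define Y where "Y = (\<lambda>i j k. e2 i j k - e1 i j k)"
  define m where "m = (\<lambda>i j k. D i j k + \<kappa> * X i j k - A * dt * grid_lap L N Y i j k
          - \<epsilon>\<^sup>2 * grid_lap L N e2 i j k)"
  have Yp: "Y \<in> grid_per N" unfolding Y_def by (intro grid_per_intros(3) per)
  have Xp: "X \<in> grid_per N" unfolding X_def by (intro grid_per_intros(1-4) per)
  have Dp: "D \<in> grid_per N" unfolding D_def
    by (rule grid_per_intros(3)[OF grid_per_comp[OF per(4)] grid_per_comp[OF per(5)]])
  have mp: "m \<in> grid_per N" unfolding m_def
    by (intro grid_per_intros(1-4) Dp Xp grid_per_lap Yp per)
  have bp: "(\<lambda>i j k. \<beta> i j k + grid_lap L N \<eta> i j k) \<in> grid_per N"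
    by (intro grid_per_intros(1-4) grid_per_lap per)
  have eq2: "(3/2 * e2 i j k - 2 * e1 i j k + 1/2 * e0 i j k) / dt
    = grid_lap L N m i j k + \<alpha> i j k + grid_lap L N (\<lambda>i j k. \<beta> i j k + grid_lap L N \<eta> i j k) i j k" for i j k
    using eq unfolding m_def D_def X_def Y_def .
  define \<Psi> where "\<Psi> = (\<lambda>i j k. 3/2 * \<psi>2 i j k - 2 * \<psi>1 i j k + 1/2 * \<psi>0 i j k)"
  define E where "E = (\<lambda>i j k. 3/2 * e2 i j k - 2 * e1 i j k + 1/2 * e0 i j k)"
  have invE: "is_inv_lap L N E \<Psi>"
    using is_inv_lap_combine[OF is_inv_lap_combine[OF inv(1,2), of "3/2" "-2"] inv(3), of 1 "1/2"]
    by (simp add: E_def \<Psi>_def)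
  have "gradsum N \<Psi> \<psi>2 / h2 / dt = gsum N (\<lambda>i j k. E i j k * \<psi>2 i j k) / dt"
    using gsum_mult_inv_lap[OF invE \<psi>2(1)] by (simp add: h2_def gradsum_commute)
  also have "\<dots> = gsum N (\<lambda>i j k. (1 / dt) * (E i j k * \<psi>2 i j k))"
    unfolding gsum_cmult by simp
  also have "\<dots> = gsum N (\<lambda>i j k. \<psi>2 i j k * grid_lap L N m i j k + \<alpha> i j k * \<psi>2 i j k
      + \<psi>2 i j k * grid_lap L N (\<lambda>i j k. \<beta> i j k + grid_lap L N \<eta> i j k) i j k)"
  proof (rule gsum_cong)
    fix i j k
    have "1 / dt * (E i j k * \<psi>2 i j k) = (E i j k / dt) * \<psi>2 i j k" by simp
    then show "1 / dt * (E i j k * \<psi>2 i j k) = \<psi>2 i j k * grid_lap L N m i j k + \<alpha> i j k * \<psi>2 i j k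
      + \<psi>2 i j k * grid_lap L N (\<lambda>i j k. \<beta> i j k + grid_lap L N \<eta> i j k) i j k"
      unfolding E_def eq2 by (simp only: ring_distribs mult.commute)
  qed
  also have "\<dots> = - gsum N (\<lambda>i j k. m i j k * e2 i j k) + gsum N (\<lambda>i j k. \<alpha> i j k * \<psi>2 i j k)
      - gsum N (\<lambda>i j k. (\<beta> i j k + grid_lap L N \<eta> i j k) * e2 i j k)"
    unfolding gsum_add lapswap[OF mp] lapswap[OF bp] by simp
  finally have main: "gradsum N \<Psi> \<psi>2 / h2 / dt = - gsum N (\<lambda>i j k. m i j k * e2 i j k)
      + gsum N (\<lambda>i j k. \<alpha> i j k * \<psi>2 i j k)
      - gsum N (\<lambda>i j k. (\<beta> i j k + grid_lap L N \<eta> i j k) * e2 i j k)" .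
  have sqe: "sq v \<ge> 0" for v unfolding sq_def by (rule gsum_nonneg) simp
  have gr0: "gr v \<ge> 0" for v unfolding gr_def using gradsum_nonneg by simp
  have lhs: "(gr \<psi>2 + gr (\<lambda>i j k. 2 * \<psi>2 i j k - \<psi>1 i j k) - gr \<psi>1 - gr (\<lambda>i j k. 2 * \<psi>1 i j k - \<psi>0 i j k)) / (4 * dt)
     \<le> gradsum N \<Psi> \<psi>2 / h2 / dt"
  proof -
    have "gr \<psi>2 + gr (\<lambda>i j k. 2 * \<psi>2 i j k - \<psi>1 i j k) - gr \<psi>1 - gr (\<lambda>i j k. 2 * \<psi>1 i j k - \<psi>0 i j k)
      \<le> (4 * gradsum N \<Psi> \<psi>2) / h2"
      unfolding gr_def h2_def[symmetric] add_divide_distrib[symmetric] diff_divide_distrib[symmetric] \<Psi>_def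
      by (intro divide_right_mono gradsum_bdf2) (use h2 in simp)
    then have "(gr \<psi>2 + gr (\<lambda>i j k. 2 * \<psi>2 i j k - \<psi>1 i j k) - gr \<psi>1 - gr (\<lambda>i j k. 2 * \<psi>1 i j k - \<psi>0 i j k)) / (4 * dt)
       \<le> (4 * gradsum N \<Psi> \<psi>2) / h2 / (4 * dt)" 
      by (intro divide_right_mono) (use dt in simp_all)
    also have "\<dots> = gradsum N \<Psi> \<psi>2 / h2 / dt" using dt by simp
    finally show ?thesis .
  qed
  have m1: "gsum N (\<lambda>i j k. D i j k * e2 i j k) \<ge> - 8 * sq e2"
    unfolding sq_def gsum_cmult[symmetric] D_def e2
    by (intro gsum_mono nonlin_one_sided_lipschitz pos)
  (* the extrapolation in the stabilising term is explicit, so this term has no sign; it is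
     bounded by squares *)
  have m2: "gsum N (\<lambda>i j k. X i j k * e2 i j k) \<ge> - 3 * (sq e2 + sq e1 + sq e0)"
  proof -
    have "- 3 * (a\<^sup>2 + b\<^sup>2 + c\<^sup>2) \<le> (a - 2 * b + c) * a" for a b c :: real
    proof -
      have "(a - 2 * b + c) * a + 3 * (a\<^sup>2 + b\<^sup>2 + c\<^sup>2)
        = (a - b)\<^sup>2 + 1/2 * (a + c)\<^sup>2 + 5/2 * a\<^sup>2 + 2 * b\<^sup>2 + 5/2 * c\<^sup>2"
        by (simp add: power2_eq_square algebra_simps)
      also have "\<dots> \<ge> 0" by (intro add_nonneg_nonneg) auto
      finally show ?thesis by simp
    qed
    then have "- 3 * ((e2 i j k)\<^sup>2 + (e1 i j k)\<^sup>2 + (e0 i j k)\<^sup>2) \<le> X i j k * e2 i j k" for i j k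
      unfolding X_def by blast
    then have "gsum N (\<lambda>i j k. - 3 * ((e2 i j k)\<^sup>2 + (e1 i j k)\<^sup>2 + (e0 i j k)\<^sup>2)) \<le> gsum N (\<lambda>i j k. X i j k * e2 i j k)"
      by (intro gsum_mono)
    then show ?thesis unfolding gsum_cmult gsum_add sq_def .
  qed
  (* the Douglas-Dupont term telescopes *)
  have m3: "gsum N (\<lambda>i j k. grid_lap L N Y i j k * e2 i j k) \<le> - (gr e2 - gr e1) / 2"
  proof -
    have "gsum N (\<lambda>i j k. grid_lap L N Y i j k * e2 i j k) = - gradsum N e2 Y / h2"
      using gsum_mult_lap[OF Yp per(1), of L] by (simp add: mult.commute h2_def)
    moreover have "gradsum N e2 Y \<ge> (gradsum N e2 e2 - gradsum N e1 e1) / 2"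
      using gradsum_nonneg[of N Y] gradsum_commute[of N e1 e2] unfolding Y_def
      by (simp add: gradsum_diff_left gradsum_diff_right)
    then have "gradsum N e2 Y / h2 \<ge> (gradsum N e2 e2 - gradsum N e1 e1) / 2 / h2"
      by (rule divide_right_mono) (use h2 in simp)
    ultimately show ?thesis by (simp add: gr_def h2_def[symmetric] diff_divide_distrib)
  qed
  have m4: "gsum N (\<lambda>i j k. grid_lap L N e2 i j k * e2 i j k) = - gr e2"
    using gsum_mult_lap[OF per(1) per(1), of L] by (simp add: mult.commute gr_def)
  have mm: "gsum N (\<lambda>i j k. m i j k * e2 i j k) = gsum N (\<lambda>i j k. D i j k * e2 i j k)
     + \<kappa> * gsum N (\<lambda>i j k. X i j k * e2 i j k)
     - A * dt * gsum N (\<lambda>i j k. grid_lap L N Y i j k * e2 i j k)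
     - \<epsilon>\<^sup>2 * gsum N (\<lambda>i j k. grid_lap L N e2 i j k * e2 i j k)"
    unfolding gsum_add[symmetric] gsum_diff[symmetric] gsum_cmult[symmetric] m_def
    by (rule gsum_cong) (simp add: algebra_simps)
  have M: "gsum N (\<lambda>i j k. m i j k * e2 i j k) \<ge> - 8 * sq e2 - 3 * \<kappa> * (sq e2 + sq e1 + sq e0)
     + A * dt / 2 * (gr e2 - gr e1) + \<epsilon>\<^sup>2 * gr e2"
  proof -
    have "\<kappa> * (- 3 * (sq e2 + sq e1 + sq e0)) \<le> \<kappa> * gsum N (\<lambda>i j k. X i j k * e2 i j k)"
      by (rule mult_left_mono[OF m2 \<kappa>])
    moreover have "A * dt * gsum N (\<lambda>i j k. grid_lap L N Y i j k * e2 i j k)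
        \<le> A * dt * (- (gr e2 - gr e1) / 2)"
      by (rule mult_left_mono[OF m3]) (use A dt in simp)
    moreover have "A * dt * (- (gr e2 - gr e1) / 2) = - (A * dt / 2 * (gr e2 - gr e1))"
      "\<kappa> * (- 3 * (sq e2 + sq e1 + sq e0)) = - (3 * \<kappa> * (sq e2 + sq e1 + sq e0))" by (simp_all add: field_simps)
    ultimately show ?thesis using m1 unfolding mm m4 by linarith
  qed
  have al: "gsum N (\<lambda>i j k. \<alpha> i j k * \<psi>2 i j k) \<le> \<rho> * gr \<psi>2 + L\<^sup>2 / (8 * \<rho>) * sq \<alpha>"
  proof -
    have P: "sq \<psi>2 \<le> L\<^sup>2 / 2 * gr \<psi>2"
      using discrete_poincare[OF N \<psi>2(3)] N L
      by (simp add: gr_def sq_def mesh_def power_divide mult.commute)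
    have "gsum N (\<lambda>i j k. \<alpha> i j k * \<psi>2 i j k) \<le> (L\<^sup>2 / (8 * \<rho>)) * sq \<alpha> + sq \<psi>2 / (4 * (L\<^sup>2 / (8 * \<rho>)))"
      unfolding sq_def by (rule gsum_young) (use L \<rho> in simp)
    also have "\<dots> \<le> (L\<^sup>2 / (8 * \<rho>)) * sq \<alpha> + (L\<^sup>2 / 2 * gr \<psi>2) / (4 * (L\<^sup>2 / (8 * \<rho>)))"
      by (intro add_left_mono divide_right_mono P) (use \<rho> in simp)
    finally show ?thesis using L by (simp add: mult.commute)
  qed
  (* a quarter of the surface diffusion pays for the term with \<open>\<eta>\<close> *)
  have be: "- gsum N (\<lambda>i j k. (\<beta> i j k + grid_lap L N \<eta> i j k) * e2 i j k)
    \<le> 1/2 * sq \<beta> + 1/2 * sq e2 + gr \<eta> / \<epsilon>\<^sup>2 + \<epsilon>\<^sup>2 / 4 * gr e2"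
  proof -
    have "- gsum N (\<lambda>i j k. (\<beta> i j k + grid_lap L N \<eta> i j k) * e2 i j k)
      = gsum N (\<lambda>i j k. \<beta> i j k * (- e2 i j k)) - gsum N (\<lambda>i j k. e2 i j k * grid_lap L N \<eta> i j k)"
      unfolding gsum_uminus[symmetric] gsum_diff[symmetric]
      by (rule gsum_cong) (simp add: algebra_simps)
    moreover have "gsum N (\<lambda>i j k. \<beta> i j k * (- e2 i j k)) \<le> 1/2 * sq \<beta> + 1/2 * sq e2"
      using gsum_young[of "1/2" N \<beta> "\<lambda>i j k. - e2 i j k"] by (simp add: sq_def)
    moreover have "- gsum N (\<lambda>i j k. e2 i j k * grid_lap L N \<eta> i j k) \<le> gr \<eta> / \<epsilon>\<^sup>2 + \<epsilon>\<^sup>2 / 4 * gr e2"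
    proof -
      have "- gsum N (\<lambda>i j k. e2 i j k * grid_lap L N \<eta> i j k) = gradsum N e2 \<eta> / h2"
        unfolding gsum_mult_lap[OF per(7) per(1)] by (simp add: h2_def)
      also have "\<dots> \<le> (\<epsilon>\<^sup>2 / 4 * gradsum N e2 e2 + gradsum N \<eta> \<eta> / (4 * (\<epsilon>\<^sup>2 / 4))) / h2"
        by (intro divide_right_mono gradsum_young) (use \<epsilon> h2 in simp_all)
      also have "\<dots> = gr \<eta> / \<epsilon>\<^sup>2 + \<epsilon>\<^sup>2 / 4 * gr e2"
        by (simp add: gr_def h2_def add_divide_distrib)
      finally show ?thesis .
    qed
    ultimately show ?thesis by linarith
  qed
  have k: "8 * sq e2 + 1/2 * sq e2 + 3 * \<kappa> * (sq e2 + sq e1 + sq e0) \<le> (9 + 3 * \<kappa>) * (sq e2 + sq e1 + sq e0)"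
    using sqe[of e2] sqe[of e1] sqe[of e0] by (simp add: algebra_simps)
  show ?thesis using lhs main M al be k by linarith
qed

text \<open>The sum runs over strictly smaller indices: the newest level has to be absorbed beforehand
  by a smallness condition on the time step.\<close>

lemma discrete_gronwall:
  fixes a :: "nat \<Rightarrow> real"
  assumes "\<kappa> \<ge> 0" "B \<ge> 0"
    and le: "\<And>m. 1 \<le> m \<Longrightarrow> m \<le> M \<Longrightarrow> a m \<le> B + \<kappa> * (\<Sum>n=1..<m. a n)"
  shows "1 \<le> m \<Longrightarrow> m \<le> M \<Longrightarrow> a m \<le> B * (1 + \<kappa>) ^ (m - 1)"
proof (induction m rule: less_induct)
  case (less m)
  have "a m \<le> B + \<kappa> * (\<Sum>n=1..<m. a n)" by (rule le) (use less in auto)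
  also have "\<dots> \<le> B + \<kappa> * (\<Sum>n=1..<m. B * (1 + \<kappa>) ^ (n - 1))"
    by (intro add_left_mono mult_left_mono sum_mono less assms) (use less in auto)
  also have "(\<Sum>n=1..<m. B * (1 + \<kappa>) ^ (n - 1)) = B * (\<Sum>n<m-1. (1 + \<kappa>) ^ n)"
    unfolding sum_distrib_left
    by (rule sum.reindex_bij_witness[of _ Suc "\<lambda>n. n - 1"]) auto
  also have "B + \<kappa> * (B * (\<Sum>n<m-1. (1 + \<kappa>) ^ n)) = B * (1 + \<kappa> * (\<Sum>n<m-1. (1 + \<kappa>) ^ n))"
    by (simp add: algebra_simps)
  also have "\<kappa> * (\<Sum>n<m-1. (1 + \<kappa>) ^ n) = (1 + \<kappa>) ^ (m - 1) - 1"
    using power_diff_1_eq[of "1 + \<kappa>" "m - 1"] by simp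
  finally show ?case by simp
qed

text \<open>Summing the energy steps. Here \<open>a\<close> and \<open>c\<close> are the dual norms of the error and of its
  extrapolation, \<open>g\<close> the gradient norms, \<open>s\<close> the \<open>L\<^sup>2\<close> norms and \<open>r\<close> the sources. In the first
  step the newest dual norm may have the coefficient \<open>1 / (16 * dt)\<close> instead of \<open>1\<close>, because the
  term \<open>a 1 / (4 * dt)\<close> on the left absorbs it; with this choice of weight the source of that step
  gains a factor \<open>dt\<close>.\<close>

lemma bdf2_energy_sum:
  fixes a c g s r :: "nat \<Rightarrow> real" and dt \<epsilon> A C1 T :: real
  assumes dt: "dt > 0" and \<epsilon>: "\<epsilon> > 0" and A: "A \<ge> 0" and C1: "C1 > 0" and T: "real M * dt \<le> T"
    and nn: "\<And>n. a n \<ge> 0" "\<And>n. c n \<ge> 0" "\<And>n. g n \<ge> 0" "\<And>n. s n \<ge> 0" "\<And>n. r n \<ge> 0"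
    and init: "a 0 = 0" "c 0 = 0" "g 0 = 0" "s 0 = 0"
    and interp: "\<And>n. s n \<le> (\<epsilon>\<^sup>2 / (12 * C1)) * g n + a n / (4 * (\<epsilon>\<^sup>2 / (12 * C1)))"
    and step: "\<And>n. n < M \<Longrightarrow> (a (Suc n) + c (Suc n) - a n - c n) / (4 * dt)
       + A * dt / 2 * (g (Suc n) - g n) + 3/4 * \<epsilon>\<^sup>2 * g (Suc n)
       \<le> C1 * (s (Suc n) + s n + s (n - 1)) + (if n = 0 then 1 / (16 * dt) else 1) * a (Suc n) + r n"
  defines "K \<equiv> 9 * C1\<^sup>2 / \<epsilon>\<^sup>2 + 1"
  assumes small: "16 * K * dt \<le> 1" and m: "1 \<le> m" "m \<le> M"
  shows "a m + 2 * dt * \<epsilon>\<^sup>2 * (\<Sum>n=1..m. g n) \<le> (32 * K * T * exp (6 * K * T) + 6) * (dt * (\<Sum>n<M. r n))"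
proof -
  define R where "R = (\<Sum>n<M. r n)"
  have R0: "R \<ge> 0" unfolding R_def by (intro sum_nonneg nn)
  have K0: "K > 0" unfolding K_def by (simp add: add_nonneg_pos)
  have shift: "(\<Sum>n<m. f (Suc n)) = (\<Sum>n=1..m. f n)" for f :: "nat \<Rightarrow> real" and m
    by (rule sum.reindex_bij_witness[of _ "\<lambda>n. n - 1" Suc]) auto
  have le0: "(\<Sum>n<m. s n) \<le> (\<Sum>n=1..m. s n)" for m
  proof (induction m)
    case (Suc m)
    have "(\<Sum>n<Suc m. s n) = (\<Sum>n<m. s (Suc n))"
      unfolding sum.lessThan_Suc_shift using init by simp
    then show ?case using shift[of s m] nn by simp
  qed simp
  have le1: "(\<Sum>n<m. s (n - 1)) \<le> (\<Sum>n=1..m. s n)" for m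
  proof (cases m)
    case (Suc p)
    have "(\<Sum>n<Suc p. s (n - 1)) = s 0 + (\<Sum>n<p. s n)" by (simp only: sum.lessThan_Suc_shift) simp
    also have "\<dots> \<le> (\<Sum>n=1..p. s n)" using le0 init by simp
    also have "\<dots> \<le> (\<Sum>n=1..Suc p. s n)" using nn by simp
    finally show ?thesis using Suc by simp
  qed simp
  have sum1: "(a m + c m) / (4 * dt) + A * dt / 2 * g m + 3/4 * \<epsilon>\<^sup>2 * (\<Sum>n=1..m. g n)
     \<le> C1 * (3 * (\<Sum>n=1..m. s n)) + a 1 / (16 * dt) + (\<Sum>n=1..m. a n) + R"
    if m: "1 \<le> m" "m \<le> M" for m
  proof -
    have "(\<Sum>n<m. (a (Suc n) + c (Suc n) - a n - c n) / (4 * dt)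
       + A * dt / 2 * (g (Suc n) - g n) + 3/4 * \<epsilon>\<^sup>2 * g (Suc n))
       \<le> (\<Sum>n<m. C1 * (s (Suc n) + s n + s (n - 1)) + (if n = 0 then 1 / (16 * dt) else 1) * a (Suc n) + r n)"
      using m by (intro sum_mono step) auto
    moreover have "(\<Sum>n<m. (a (Suc n) + c (Suc n) - a n - c n) / (4 * dt)
       + A * dt / 2 * (g (Suc n) - g n) + 3/4 * \<epsilon>\<^sup>2 * g (Suc n))
       = (a m + c m) / (4 * dt) + A * dt / 2 * g m + 3/4 * \<epsilon>\<^sup>2 * (\<Sum>n=1..m. g n)"
    proof -
      have "(\<Sum>n<m. (a (Suc n) + c (Suc n) - a n - c n) / (4 * dt)) = (a m + c m) / (4 * dt)"
      proof -
        have "(\<Sum>n<m. (a (Suc n) + c (Suc n) - a n - c n)) = (a m + c m) - (a 0 + c 0)"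
          by (induction m) auto
        then show ?thesis unfolding sum_divide_distrib[symmetric] by (simp only: init) simp
      qed
      moreover have "(\<Sum>n<m. A * dt / 2 * (g (Suc n) - g n)) = A * dt / 2 * g m"
        using sum_lessThan_telescope[of g m] by (simp only: sum_distrib_left[symmetric]) (simp add: init)
      moreover have "(\<Sum>n<m. 3/4 * \<epsilon>\<^sup>2 * g (Suc n)) = 3/4 * \<epsilon>\<^sup>2 * (\<Sum>n=1..m. g n)"
        by (simp only: sum_distrib_left[symmetric] shift)
      ultimately show ?thesis by (simp only: sum.distrib)
    qed
    moreover have "(\<Sum>n<m. C1 * (s (Suc n) + s n + s (n - 1)) + (if n = 0 then 1 / (16 * dt) else 1) * a (Suc n) + r n)
      \<le> C1 * (3 * (\<Sum>n=1..m. s n)) + (a 1 / (16 * dt) + (\<Sum>n=1..m. a n)) + R"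
      unfolding sum.distrib sum_distrib_left[symmetric]
    proof (intro add_mono mult_left_mono)
      show "(\<Sum>n<m. s (Suc n)) + (\<Sum>n<m. s n) + (\<Sum>n<m. s (n - 1)) \<le> 3 * (\<Sum>n=1..m. s n)"
        using le0[of m] le1[of m] shift[of s m] by linarith
      show "(\<Sum>n<m. r n) \<le> R" unfolding R_def using m nn by (intro sum_mono2) auto
      show "(\<Sum>n<m. (if n = 0 then 1 / (16 * dt) else 1) * a (Suc n)) \<le> a 1 / (16 * dt) + (\<Sum>n=1..m. a n)"
      proof -
        obtain p where p: "m = Suc p" using m by (cases m) auto
        have "(\<Sum>n<m. (if n = 0 then 1 / (16 * dt) else 1) * a (Suc n))
           = a 1 / (16 * dt) + (\<Sum>n<p. a (Suc (Suc n)))"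
          unfolding p by (simp only: sum.lessThan_Suc_shift) simp
        moreover have "(\<Sum>n=1..m. a n) = a 1 + (\<Sum>n<p. a (Suc (Suc n)))"
          unfolding shift[symmetric] p sum.lessThan_Suc_shift by simp
        ultimately show ?thesis using nn by simp
      qed
    qed (use C1 in simp)
    ultimately show ?thesis by linarith
  qed
  (* interpolation removes the \<open>L\<^sup>2\<close> norms at the cost of a third of the remaining surface
     diffusion *)
  have sum2: "a m / (4 * dt) + 1/2 * \<epsilon>\<^sup>2 * (\<Sum>n=1..m. g n) \<le> K * (\<Sum>n=1..m. a n) + a 1 / (16 * dt) + R"
    if m: "1 \<le> m" "m \<le> M" for m
  proof -
    have "(\<Sum>n=1..m. s n) \<le> (\<Sum>n=1..m. (\<epsilon>\<^sup>2 / (12 * C1)) * g n + (3 * C1 / \<epsilon>\<^sup>2) * a n)"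
      by (intro sum_mono order_trans[OF interp]) (use \<epsilon> C1 in \<open>simp add: field_simps\<close>)
    also have "\<dots> = (\<epsilon>\<^sup>2 / (12 * C1)) * (\<Sum>n=1..m. g n) + (3 * C1 / \<epsilon>\<^sup>2) * (\<Sum>n=1..m. a n)"
      unfolding sum.distrib sum_distrib_left ..
    finally have "C1 * (3 * (\<Sum>n=1..m. s n)) \<le> C1 * (3 * ((\<epsilon>\<^sup>2 / (12 * C1)) * (\<Sum>n=1..m. g n) + (3 * C1 / \<epsilon>\<^sup>2) * (\<Sum>n=1..m. a n)))"
      using C1 by simp
    also have "\<dots> = 1/4 * \<epsilon>\<^sup>2 * (\<Sum>n=1..m. g n) + (K - 1) * (\<Sum>n=1..m. a n)"
      using C1 \<epsilon> by (simp add: K_def field_simps power2_eq_square)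
    finally have 1: "C1 * (3 * (\<Sum>n=1..m. s n)) \<le> 1/4 * \<epsilon>\<^sup>2 * (\<Sum>n=1..m. g n) + (K - 1) * (\<Sum>n=1..m. a n)" .
    have 2: "0 \<le> c m / (4 * dt)" "0 \<le> A * dt / 2 * g m" using nn dt A by auto
    show ?thesis using sum1[OF m] 1 2 by (simp add: add_divide_distrib algebra_simps)
  qed
  have sum3: "a m + 2 * dt * \<epsilon>\<^sup>2 * (\<Sum>n=1..m. g n) \<le> 4 * dt * K * (\<Sum>n=1..m. a n) + a 1 / 4 + 4 * dt * R"
    if m: "1 \<le> m" "m \<le> M" for m
    using mult_left_mono[OF sum2[OF m], of "4 * dt"] dt by (simp add: algebra_simps)
  have G0: "0 \<le> 2 * dt * \<epsilon>\<^sup>2 * (\<Sum>n=1..m. g n)" for m using dt nn by (simp add: sum_nonneg)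
  have q: "4 * dt * K \<le> 1/4" using small by (simp add: algebra_simps)
  have q': "4 * dt * K * x \<le> 1/4 * x" if "x \<ge> 0" for x using mult_right_mono[OF q that] .
  (* the first level alone, where half of \<open>a 1\<close> is absorbed *)
  have a1: "a 1 \<le> 8 * dt * R"
  proof -
    have e: "(\<Sum>n=1..(1::nat). a n) = a 1" by simp
    have "1 \<le> M" using m by linarith
    then show ?thesis using sum3[of 1] q'[OF nn(1)[of 1]] G0[of 1] unfolding e by linarith
  qed
  have sum4: "a m + 2 * dt * \<epsilon>\<^sup>2 * (\<Sum>n=1..m. g n) \<le> 4 * dt * K * (\<Sum>n=1..m. a n) + 6 * dt * R"
    if m: "1 \<le> m" "m \<le> M" for m
    using sum3[OF m] a1 by linarith
  have am: "a m \<le> 8 * dt * R * exp (6 * K * T)" if m: "1 \<le> m" "m \<le> M" for m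
  proof -
    have "a m \<le> 8 * dt * R * (1 + 6 * dt * K) ^ (m - 1)"
    proof (rule discrete_gronwall[where M = M])
      fix m assume m: "1 \<le> m" "m \<le> M"
      have "{1..m} = insert m {1..<m}" using m by auto
      then have "(\<Sum>n=1..m. a n) = a m + (\<Sum>n=1..<m. a n)" by simp
      then have "a m \<le> 1/4 * a m + 4 * dt * K * (\<Sum>n=1..<m. a n) + 6 * dt * R"
        using sum4[OF m] G0[of m] q'[OF nn(1)[of m]] by (simp add: algebra_simps)
      then have "a m \<le> (4 * (dt * K * (\<Sum>n=1..<m. a n)) + 6 * (dt * R)) * (4/3)" by simp
      moreover have "dt * K * (\<Sum>n=1..<m. a n) \<ge> 0" using dt K0 nn by (simp add: sum_nonneg)
      ultimately show "a m \<le> 8 * dt * R + 6 * dt * K * (\<Sum>n=1..<m. a n)" by simp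
    qed (use m dt K0 R0 in auto)
    also have "\<dots> \<le> 8 * dt * R * exp (6 * K * T)"
    proof (intro mult_left_mono)
      have "(1 + 6 * dt * K) ^ (m - 1) \<le> exp (6 * dt * K) ^ (m - 1)"
        using dt K0 exp_ge_add_one_self[of "6 * dt * K"] by (intro power_mono) auto
      also have "\<dots> = exp (6 * K * (real (m - 1) * dt))"
        by (simp add: exp_of_nat_mult[symmetric] algebra_simps)
      also have "\<dots> \<le> exp (6 * K * T)"
      proof -
        have "real (m - 1) * dt \<le> real M * dt" using m dt by (intro mult_right_mono) auto
        then have "real (m - 1) * dt \<le> T" using T by linarith
        then show ?thesis using K0 by simp
      qed
      finally show "(1 + 6 * dt * K) ^ (m - 1) \<le> exp (6 * K * T)" .
    qed (use dt R0 in auto)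
    finally show ?thesis .
  qed
  have "(\<Sum>n=1..m. a n) \<le> (\<Sum>n=1..m. 8 * dt * R * exp (6 * K * T))"
    using m by (intro sum_mono am) auto
  also have "\<dots> = real m * dt * (8 * R * exp (6 * K * T))" by simp
  also have "\<dots> \<le> T * (8 * R * exp (6 * K * T))"
  proof (intro mult_right_mono)
    have "real m * dt \<le> real M * dt" using m dt by (intro mult_right_mono) auto
    then show "real m * dt \<le> T" using T by linarith
  qed (use R0 in simp)
  finally have S: "(\<Sum>n=1..m. a n) \<le> T * (8 * R * exp (6 * K * T))" .
  have "4 * dt * K * (\<Sum>n=1..m. a n) \<le> 4 * dt * K * (T * (8 * R * exp (6 * K * T)))"
    using S dt K0 by (intro mult_left_mono) auto
  with sum4[OF m] have "a m + 2 * dt * \<epsilon>\<^sup>2 * (\<Sum>n=1..m. g n) \<le>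
    4 * dt * K * (T * (8 * R * exp (6 * K * T))) + 6 * dt * R" by linarith
  then show ?thesis by (simp add: R_def[symmetric] algebra_simps)
qed

section \<open>Periodic functions and consistency in space\<close>

text \<open>Derivative along a coordinate line, at every point. Partial derivatives in the sense of
  \<^const>\<open>partial\<close> give it for \<open>C\<^sup>k\<close> functions, and it passes to translates and hence to difference
  quotients.\<close>

definition has_line_deriv :: "3 \<Rightarrow> (real^3 \<Rightarrow> real) \<Rightarrow> (real^3 \<Rightarrow> real) \<Rightarrow> bool" where
  "has_line_deriv i g g' \<longleftrightarrow>
     (\<forall>x s. ((\<lambda>s. g (x + s *\<^sub>R axis i 1)) has_real_derivative g' (x + s *\<^sub>R axis i 1)) (at s))"

lemma has_line_derivI_differentiable:
  assumes "\<And>x. g differentiable (at x)"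
  shows "has_line_deriv i g (partial i g)"
proof -
  have ex: "\<exists>D. ((\<lambda>s. g (x + s *\<^sub>R axis i 1)) has_real_derivative D) (at s)" for x s
  proof -
    obtain D where D: "(g has_derivative D) (at (x + s *\<^sub>R axis i 1))"
      using assms unfolding differentiable_def by blast
    have "((\<lambda>s. x + s *\<^sub>R axis i 1) has_derivative (\<lambda>s. s *\<^sub>R axis i 1)) (at s)"
      by (auto intro!: derivative_eq_intros)
    from has_derivative_compose[OF this D]
    have "((\<lambda>s. g (x + s *\<^sub>R axis i 1)) has_derivative (\<lambda>s. D (s *\<^sub>R axis i 1))) (at s)" .
    moreover have "D (s *\<^sub>R axis i 1) = D (axis i 1) * s" for s
      using linear_cmul[OF has_derivative_linear[OF D], of s "axis i 1"] by (simp add: mult.commute)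
    ultimately show ?thesis by (auto simp: has_field_derivative_def)
  qed
  have at0: "((\<lambda>s. g (x + s *\<^sub>R axis i 1)) has_real_derivative partial i g x) (at 0)" for x
    using ex[of x 0] unfolding partial_def by (metis DERIV_imp_deriv)
  show ?thesis unfolding has_line_deriv_def
  proof (intro allI)
    fix x s
    have "((\<lambda>t. g ((x + s *\<^sub>R axis i 1) + t *\<^sub>R axis i 1)) has_real_derivative
       partial i g (x + s *\<^sub>R axis i 1)) (at 0)" by (rule at0)
    then have "((\<lambda>t. g (x + (t + s) *\<^sub>R axis i 1)) has_real_derivative
       partial i g (x + s *\<^sub>R axis i 1)) (at 0)"
      by (simp add: algebra_simps)
    then show "((\<lambda>s. g (x + s *\<^sub>R axis i 1)) has_real_derivative partial i g (x + s *\<^sub>R axis i 1)) (at s)"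
      using DERIV_shift[of "\<lambda>s. g (x + s *\<^sub>R axis i 1)" _ 0 s] by simp
  qed
qed

lemma partial_eq:
  assumes "has_line_deriv i g g'" shows "partial i g = g'"
proof
  fix x
  have "((\<lambda>s. g (x + s *\<^sub>R axis i 1)) has_real_derivative g' (x + 0 *\<^sub>R axis i 1)) (at 0)"
    using assms unfolding has_line_deriv_def by blast
  then show "partial i g x = g' x" unfolding partial_def by (simp add: DERIV_imp_deriv)
qed

lemma has_line_deriv_add:
  "has_line_deriv i f f' \<Longrightarrow> has_line_deriv i g g' \<Longrightarrow> has_line_deriv i (\<lambda>x. f x + g x) (\<lambda>x. f' x + g' x)"
  by (auto simp: has_line_deriv_def intro!: DERIV_add)

lemma has_line_deriv_diff:
  "has_line_deriv i f f' \<Longrightarrow> has_line_deriv i g g' \<Longrightarrow> has_line_deriv i (\<lambda>x. f x - g x) (\<lambda>x. f' x - g' x)"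
  by (auto simp: has_line_deriv_def intro!: DERIV_diff)

lemma has_line_deriv_mult:
  assumes "has_line_deriv i f f'" "has_line_deriv i g g'"
  shows "has_line_deriv i (\<lambda>x. f x * g x) (\<lambda>x. f' x * g x + g' x * f x)"
  using assms unfolding has_line_deriv_def by (intro allI DERIV_mult) blast+

lemma has_line_deriv_cmult:
  assumes "has_line_deriv i f f'"
  shows "has_line_deriv i (\<lambda>x. c * f x) (\<lambda>x. c * f' x)"
  using assms unfolding has_line_deriv_def by (auto intro!: DERIV_cmult)

lemma has_line_deriv_sum:
  assumes "\<And>b. b \<in> B \<Longrightarrow> has_line_deriv i (f b) (f' b)"
  shows "has_line_deriv i (\<lambda>x. \<Sum>b\<in>B. f b x) (\<lambda>x. \<Sum>b\<in>B. f' b x)"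
  using assms unfolding has_line_deriv_def by (auto intro!: DERIV_sum)

lemma has_line_deriv_comp:
  assumes "has_line_deriv i f f'" "\<And>x. (F has_real_derivative F' (f x)) (at (f x))"
  shows "has_line_deriv i (\<lambda>x. F (f x)) (\<lambda>x. F' (f x) * f' x)"
  unfolding has_line_deriv_def
proof (intro allI)
  fix x s
  have "((\<lambda>s. f (x + s *\<^sub>R axis i 1)) has_real_derivative f' (x + s *\<^sub>R axis i 1)) (at s)"
    using assms(1) unfolding has_line_deriv_def by blast
  from DERIV_chain2[OF assms(2) this]
  show "((\<lambda>s. F (f (x + s *\<^sub>R axis i 1))) has_real_derivative
    F' (f (x + s *\<^sub>R axis i 1)) * f' (x + s *\<^sub>R axis i 1)) (at s)" .
qed

lemma has_line_deriv_translate: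
  assumes "has_line_deriv i f f'"
  shows "has_line_deriv i (\<lambda>x. f (x + z)) (\<lambda>x. f' (x + z))"
  using assms unfolding has_line_deriv_def
proof (intro allI)
  fix x s assume "\<forall>x s. ((\<lambda>s. f (x + s *\<^sub>R axis i 1)) has_real_derivative f' (x + s *\<^sub>R axis i 1)) (at s)"
  then have "((\<lambda>s. f ((x + z) + s *\<^sub>R axis i 1)) has_real_derivative f' ((x + z) + s *\<^sub>R axis i 1)) (at s)"
    by blast
  then show "((\<lambda>s. f (x + s *\<^sub>R axis i 1 + z)) has_real_derivative f' (x + s *\<^sub>R axis i 1 + z)) (at s)"
    by (simp add: add.assoc add.left_commute add.commute)
qed

lemma periodic_shift_int:
  assumes "periodic L f"
  shows "f (x + (of_int n * L) *\<^sub>R axis i 1) = f x"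
proof -
  have nn: "f (x + (real n * L) *\<^sub>R axis i 1) = f x" for n x
  proof (induction n arbitrary: x)
    case (Suc n)
    have "f (x + (real (Suc n) * L) *\<^sub>R axis i 1) = f ((x + (real n * L) *\<^sub>R axis i 1) + L *\<^sub>R axis i 1)"
      by (simp add: algebra_simps)
    then show ?case using Suc assms by (simp add: periodic_def)
  qed simp
  show ?thesis
  proof (cases "n \<ge> 0")
    case True
    then show ?thesis using nn[of x "nat n"] by simp
  next
    case False
    then show ?thesis using nn[of "x + (of_int n * L) *\<^sub>R axis i 1" "nat (- n)"] by simp
  qed
qed

text \<open>The representative does not depend on the function, so that several periodic functions can
  be moved to the fundamental cell simultaneously.\<close>

lemma periodic_representative:
  assumes "L > 0"
  obtains y where "\<And>a. 0 \<le> y $ a \<and> y $ a \<le> L" "\<And>f. periodic L f \<Longrightarrow> f x = f y"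
proof
  define n where "n = (\<lambda>a. - \<lfloor>x $ a / L\<rfloor>)"
  define y where "y = x + (of_int (n 1) * L) *\<^sub>R axis 1 1 + (of_int (n 2) * L) *\<^sub>R axis 2 1 
     + (of_int (n 3) * L) *\<^sub>R (axis 3 1 :: real^3)"
  show "f x = f y" if "periodic L f" for f
    unfolding y_def periodic_shift_int[OF that] ..
  have ya: "y $ a = x $ a + of_int (n a) * L" for a
    using exhaust_3[of a] by (auto simp: y_def axis_def)
  show "0 \<le> y $ a \<and> y $ a \<le> L" for a
  proof -
    have "of_int \<lfloor>x $ a / L\<rfloor> * L \<le> x $ a"
      using pos_le_divide_eq[OF assms, of "of_int \<lfloor>x $ a / L\<rfloor>" "x $ a"] by simp
    moreover have "x $ a \<le> (of_int \<lfloor>x $ a / L\<rfloor> + 1) * L"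
      using pos_divide_le_eq[OF assms, of "x $ a" "of_int \<lfloor>x $ a / L\<rfloor> + 1"] by linarith
    ultimately show ?thesis unfolding ya n_def by (simp add: algebra_simps)
  qed
qed

lemma periodic_bounded:
  assumes L: "L > 0" and per: "periodic L f" and cont: "continuous_on UNIV f"
  shows "bounded (range f)"
proof -
  have "compact (f ` cbox 0 (\<chi> i. L))"
    by (intro compact_continuous_image continuous_on_subset[OF cont] compact_cbox) auto
  moreover have "range f \<subseteq> f ` cbox 0 (\<chi> i. L)"
  proof safe
    fix x
    obtain y where "\<And>a. 0 \<le> y $ a \<and> y $ a \<le> L" "f x = f y"
      using periodic_representative[OF L, of x] per by metis
    moreover from this(1) have "y \<in> cbox 0 (\<chi> i. L)" by (simp add: mem_box_cart)
    ultimately show "f x \<in> f ` cbox 0 (\<chi> i. L)" by simp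
  qed
  ultimately show ?thesis using bounded_subset compact_imp_bounded by blast
qed

lemma periodic_partial:
  assumes "periodic L f" shows "periodic L (partial i f)"
  unfolding periodic_def
proof (intro allI)
  fix x j
  have "f (x + L *\<^sub>R axis j 1 + s *\<^sub>R axis i 1) = f (x + s *\<^sub>R axis i 1)" for s
  proof -
    have "f ((x + s *\<^sub>R axis i 1) + L *\<^sub>R axis j 1) = f (x + s *\<^sub>R axis i 1)"
      using assms unfolding periodic_def by blast
    then show ?thesis by (simp add: add.assoc add.commute add.left_commute)
  qed
  then show "partial i f (x + L *\<^sub>R axis j 1) = partial i f x" by (simp add: partial_def)
qed

lemma periodic_partials: "periodic L f \<Longrightarrow> periodic L (partials \<alpha> f)"
  by (induction \<alpha>) (auto intro: periodic_partial)

lemma finite_multi_indices: "finite {\<alpha> :: 3 list. length \<alpha> \<le> k}"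
  using finite_lists_length_le[of "UNIV :: 3 set" k] by simp

lemma Ck_norm_bound:
  assumes L: "L > 0" and f: "f \<in> Ck_per k L" and \<alpha>: "length \<alpha> \<le> k"
  shows "\<bar>partials \<alpha> f x\<bar> \<le> Ck_norm k f"
proof -
  have "bounded (range (partials \<alpha> f))"
    using f \<alpha> by (intro periodic_bounded[OF L] periodic_partials) (auto simp: Ck_per_def)
  then obtain B where B: "\<And>x. \<bar>partials \<alpha> f x\<bar> \<le> B"
    unfolding bounded_iff by auto
  have "\<bar>partials \<alpha> f x\<bar> \<le> (SUP x. \<bar>partials \<alpha> f x\<bar>)"
    by (rule cSUP_upper) (use B in \<open>auto intro!: bdd_aboveI\<close>)
  also have "\<dots> \<le> Ck_norm k f" unfolding Ck_norm_def
    by (intro Max_ge finite_imageI finite_multi_indices imageI) (use \<alpha> in simp)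
  finally show ?thesis .
qed

lemma Ck_per_line_deriv:
  assumes "f \<in> Ck_per k L" "length \<alpha> < k"
  shows "has_line_deriv i (partials \<alpha> f) (partials (i # \<alpha>) f)"
  using has_line_derivI_differentiable[of "partials \<alpha> f" i] assms by (simp add: Ck_per_def)

definition diff2 :: "real \<Rightarrow> 3 \<Rightarrow> (real^3 \<Rightarrow> real) \<Rightarrow> real^3 \<Rightarrow> real" where
  "diff2 h i f x = (f (x + h *\<^sub>R axis i 1) + f (x + (- h) *\<^sub>R axis i 1) - 2 * f x) / h\<^sup>2"

lemma diff2_bound:
  assumes g: "has_line_deriv i g g1" "has_line_deriv i g1 g2" and B: "\<And>x. \<bar>g2 x\<bar> \<le> B" and h: "h \<noteq> 0"
  shows "\<bar>diff2 h i g x\<bar> \<le> B"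
proof -
  define G where "G = (\<lambda>n s. (if n = 0 then g else if n = Suc 0 then g1 else g2) (x + s *\<^sub>R axis i 1))"
  have D: "DERIV (G n) t :> G (Suc n) t" if "n < 2" for n t
    using g that unfolding G_def has_line_deriv_def by (cases n) auto
  have T: "\<bar>G 0 y - G 0 0 - G 1 0 * y\<bar> \<le> B / 2 * h\<^sup>2" if y: "\<bar>y\<bar> = \<bar>h\<bar>" for y
  proof -
    obtain t where "G 0 y = (\<Sum>m<2. G m 0 / fact m * y ^ m) + G 2 t / fact 2 * y ^ 2"
      using Maclaurin_bi_le[of G "G 0" 2 y] D by auto
    moreover have "(\<Sum>m<2. f m) = f 0 + f 1" for f :: "nat \<Rightarrow> real" by (simp add: numeral_2_eq_2)
    moreover have "y\<^sup>2 = h\<^sup>2" using y by (metis power2_abs)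
    ultimately have e: "G 0 y - G 0 0 - G 1 0 * y = G 2 t / 2 * h\<^sup>2" by simp
    have "\<bar>G 2 t\<bar> \<le> B" using B by (simp add: G_def)
    then show ?thesis unfolding e by (simp add: abs_mult mult_right_mono)
  qed
  have "\<bar>G 0 h + G 0 (- h) - 2 * G 0 0\<bar> \<le> B * h\<^sup>2"
  proof -
    let ?X = "\<lambda>y. G 0 y - G 0 0 - G 1 0 * y"
    have "G 0 h + G 0 (- h) - 2 * G 0 0 = ?X h + ?X (- h)" by simp
    also have "\<bar>\<dots>\<bar> \<le> \<bar>?X h\<bar> + \<bar>?X (- h)\<bar>" by (rule abs_triangle_ineq)
    also have "\<dots> \<le> B / 2 * h\<^sup>2 + B / 2 * h\<^sup>2" by (rule add_mono[OF T T]) simp_all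
    finally show ?thesis by simp
  qed
  then show ?thesis using h by (simp add: diff2_def G_def pos_divide_le_eq)
qed

text \<open>Taylor expansion of order four at \<open>x\<close> in both directions; the odd terms cancel.\<close>

lemma diff2_consistency:
  assumes g: "has_line_deriv i g g1" "has_line_deriv i g1 g2" "has_line_deriv i g2 g3" "has_line_deriv i g3 g4"
    and B: "\<And>x. \<bar>g4 x\<bar> \<le> B" and h: "h \<noteq> 0"
  shows "\<bar>diff2 h i g x - g2 x\<bar> \<le> B / 12 * h\<^sup>2"
proof -
  define G where "G = (\<lambda>n s. (if n = 0 then g else if n = Suc 0 then g1 else if n = 2 then g2
     else if n = 3 then g3 else g4) (x + s *\<^sub>R axis i 1))"
  have D: "DERIV (G n) t :> G (Suc n) t" if "n < 4" for n t
  proof -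
    have "n = 0 \<or> n = 1 \<or> n = 2 \<or> n = 3" using that by auto
    then show ?thesis using g unfolding G_def has_line_deriv_def by auto
  qed
  have s4: "(\<Sum>m<4. f m) = f 0 + f 1 + f 2 + f 3" for f :: "nat \<Rightarrow> real" by (simp add: eval_nat_numeral)
  have T: "\<bar>G 0 y - G 0 0 - G 1 0 * y - G 2 0 / 2 * y^2 - G 3 0 / 6 * y^3\<bar> \<le> B / 24 * h ^ 4" if y: "\<bar>y\<bar> = \<bar>h\<bar>" for y
  proof -
    obtain t where "G 0 y = (\<Sum>m<4. G m 0 / fact m * y ^ m) + G 4 t / fact 4 * y ^ 4"
      using Maclaurin_bi_le[of G "G 0" 4 y] D by auto
    moreover have "y ^ 4 = h ^ 4" using y power_even_abs[of 4 y] power_even_abs[of 4 h] by simp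
    ultimately have e: "G 0 y - G 0 0 - G 1 0 * y - G 2 0 / 2 * y^2 - G 3 0 / 6 * y^3 = G 4 t / 24 * h ^ 4"
      using s4 by (simp add: fact_numeral)
    have "\<bar>G 4 t\<bar> \<le> B" using B by (simp add: G_def)
    then show ?thesis unfolding e by (simp add: abs_mult mult_right_mono)
  qed
  have "\<bar>G 0 h + G 0 (- h) - 2 * G 0 0 - h\<^sup>2 * G 2 0\<bar> \<le> B / 12 * h ^ 4"
  proof -
    let ?X = "\<lambda>y. G 0 y - G 0 0 - G 1 0 * y - G 2 0 / 2 * y^2 - G 3 0 / 6 * y^3"
    have e: "G 0 h + G 0 (- h) - 2 * G 0 0 - h\<^sup>2 * G 2 0 = ?X h + ?X (- h)" by simp
    have "\<bar>G 0 h + G 0 (- h) - 2 * G 0 0 - h\<^sup>2 * G 2 0\<bar> \<le> \<bar>?X h\<bar> + \<bar>?X (- h)\<bar>"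
      unfolding e by (rule abs_triangle_ineq)
    moreover have "\<bar>?X h\<bar> \<le> B / 24 * h ^ 4" by (rule T) (rule refl)
    moreover have "\<bar>?X (- h)\<bar> \<le> B / 24 * h ^ 4" by (rule T) (rule abs_minus_cancel)
    ultimately show ?thesis by linarith
  qed
  then have "\<bar>G 0 h + G 0 (- h) - 2 * G 0 0 - h\<^sup>2 * G 2 0\<bar> / h\<^sup>2 \<le> (B / 12 * h ^ 4) / h\<^sup>2"
    by (rule divide_right_mono) simp
  moreover have "\<bar>G 0 h + G 0 (- h) - 2 * G 0 0 - h\<^sup>2 * G 2 0\<bar> / h\<^sup>2 = \<bar>diff2 h i g x - g2 x\<bar>"
  proof -
    have "diff2 h i g x - g2 x = (G 0 h + G 0 (- h) - 2 * G 0 0 - h\<^sup>2 * G 2 0) / h\<^sup>2"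
    proof -
      have G: "G 0 s = g (x + s *\<^sub>R axis i 1)" "G 2 0 = g2 x" for s by (simp_all add: G_def)
      show ?thesis unfolding diff2_def G using h by (simp add: diff_divide_distrib)
    qed
    then show ?thesis by (simp only: abs_divide abs_power2)
  qed
  moreover have "(B / 12 * h ^ 4) / h\<^sup>2 = B / 12 * h\<^sup>2"
  proof -
    show ?thesis using h by (simp add: divide_simps power2_eq_square power4_eq_xxxx)
  qed
  ultimately show ?thesis by linarith
qed

lemma has_line_deriv_diff2:
  assumes "has_line_deriv i g g'"
  shows "has_line_deriv i (diff2 h a g) (diff2 h a g')"
proof -
  have "has_line_deriv i (\<lambda>x. (1 / h\<^sup>2) * (g (x + h *\<^sub>R axis a 1) + g (x + (- h) *\<^sub>R axis a 1) - 2 * g x))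
   (\<lambda>x. (1 / h\<^sup>2) * (g' (x + h *\<^sub>R axis a 1) + g' (x + (- h) *\<^sub>R axis a 1) - 2 * g' x))"
    by (intro has_line_deriv_cmult has_line_deriv_diff has_line_deriv_add has_line_deriv_translate assms)
  then show ?thesis unfolding diff2_def[abs_def] by simp
qed

lemma diff2_lincomb:
  "diff2 h a (\<lambda>x. f x - c * (\<Sum>b\<in>B. g b x)) x = diff2 h a f x - c * (\<Sum>b\<in>B. diff2 h a (g b) x)"
proof -
  have "(\<Sum>b\<in>B. diff2 h a (g b) x) = ((\<Sum>b\<in>B. g b (x + h *\<^sub>R axis a 1))
      + (\<Sum>b\<in>B. g b (x + (- h) *\<^sub>R axis a 1)) - 2 * (\<Sum>b\<in>B. g b x)) / h\<^sup>2"
    unfolding diff2_def sum_divide_distrib[symmetric] sum_subtractf sum.distrib sum_distrib_left ..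
  then show ?thesis
    unfolding diff2_def by (simp add: diff_divide_distrib add_divide_distrib ring_distribs)
qed

lemma diff2_commute: "diff2 h a (diff2 h b f) x = diff2 h b (diff2 h a f) x"
proof -
  have c: "f (x + s *\<^sub>R axis a 1 + t *\<^sub>R axis b 1) = f (x + t *\<^sub>R axis b 1 + s *\<^sub>R axis a 1)" for s t
    by (simp only: add.assoc add.commute[of "s *\<^sub>R axis a 1"])
  show ?thesis unfolding diff2_def c by (simp add: add_divide_distrib diff_divide_distrib)
qed

definition lap_h :: "real \<Rightarrow> (real^3 \<Rightarrow> real) \<Rightarrow> real^3 \<Rightarrow> real" where
  "lap_h h f x = (\<Sum>i\<in>UNIV. diff2 h i f x)"

text \<open>The chemical potential with finite differences, at all points of space and not only on the
  grid. It involves only point values of \<open>f\<close>, so estimates for it survive pointwise limits of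
  \<open>f\<close>.\<close>

definition chem_pot_h :: "real \<Rightarrow> real \<Rightarrow> (real^3 \<Rightarrow> real) \<Rightarrow> real^3 \<Rightarrow> real" where
  "chem_pot_h h \<epsilon> f x = nonlin (f x) - \<epsilon>\<^sup>2 * lap_h h f x"

text \<open>The \<open>k\<close>-th derivative of \<^const>\<open>nonlin\<close> on the positive half-line.\<close>

definition nonlin_deriv :: "nat \<Rightarrow> real \<Rightarrow> real" where
  "nonlin_deriv k s = - (8/3) * ((\<Prod>j<k. - 9 - real j) * s powi (- 9 - int k)
     - (\<Prod>j<k. - 3 - real j) * s powi (- 3 - int k))"

lemma nonlin_deriv_0: "nonlin_deriv 0 = nonlin"
  by (rule ext) (simp add: nonlin_deriv_def nonlin_def)

lemma DERIV_nonlin_deriv: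
  assumes "s > 0"
  shows "(nonlin_deriv k has_real_derivative nonlin_deriv (Suc k) s) (at s)"
proof -
  have e: "- 9 - int (Suc k) = - 9 - int k - 1" "- 3 - int (Suc k) = - 3 - int k - 1" by simp_all
  have "((\<lambda>s. s powi n) has_real_derivative real_of_int n * s powi (n - 1)) (at s)" for n
    using assms by (auto intro!: derivative_eq_intros)
  note d = this
  show ?thesis unfolding nonlin_deriv_def[abs_def]
    by (rule DERIV_cong[OF DERIV_cmult[OF DERIV_diff[OF DERIV_cmult[OF d] DERIV_cmult[OF d]]]])
      (simp only: e prod.lessThan_Suc, simp add: algebra_simps)
qed

lemma nonlin_deriv_bounded:
  assumes m: "m > 0"
  shows "\<exists>B>0. \<forall>k\<le>4. \<forall>s\<ge>m. \<bar>nonlin_deriv k s\<bar> \<le> B"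
proof -
  have "\<exists>B. \<forall>s\<ge>m. \<bar>nonlin_deriv k s\<bar> \<le> B" for k
  proof -
    have p: "\<bar>s powi (- int p)\<bar> \<le> inverse m ^ p" if "s \<ge> m" for s p
    proof -
      have "\<bar>s powi (- int p)\<bar> = inverse s ^ p" using that m by (simp add: power_int_minus power_inverse)
      also have "\<dots> \<le> inverse m ^ p" using that m by (intro power_mono le_imp_inverse_le) auto
      finally show ?thesis .
    qed
    let ?a = "\<Prod>j<k. - 9 - real j" and ?b = "\<Prod>j<k. - 3 - real j"
    have "\<bar>nonlin_deriv k s\<bar> \<le> 8/3 * (\<bar>?a\<bar> * inverse m ^ (9 + k) + \<bar>?b\<bar> * inverse m ^ (3 + k))"
      if "s \<ge> m" for s
    proof -
      have e: "- 9 - int k = - int (9 + k)" "- 3 - int k = - int (3 + k)" by simp_all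
      have "\<bar>nonlin_deriv k s\<bar> = 8/3 * \<bar>?a * s powi (- int (9 + k)) - ?b * s powi (- int (3 + k))\<bar>"
        unfolding nonlin_deriv_def e abs_mult by simp
      also have "\<dots> \<le> 8/3 * (\<bar>?a\<bar> * \<bar>s powi (- int (9 + k))\<bar> + \<bar>?b\<bar> * \<bar>s powi (- int (3 + k))\<bar>)"
        unfolding abs_mult[symmetric] by (intro mult_left_mono abs_triangle_ineq4) simp
      also have "\<dots> \<le> 8/3 * (\<bar>?a\<bar> * inverse m ^ (9 + k) + \<bar>?b\<bar> * inverse m ^ (3 + k))"
        by (intro mult_left_mono add_mono p that) auto
      finally show ?thesis .
    qed
    then show ?thesis by blast
  qed
  then obtain B where B: "\<And>k s. s \<ge> m \<Longrightarrow> \<bar>nonlin_deriv k s\<bar> \<le> B k" by metis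
  have "\<bar>nonlin_deriv k s\<bar> \<le> (\<Sum>k\<le>4. \<bar>B k\<bar>) + 1" if "k \<le> 4" "s \<ge> m" for k s
  proof -
    have "\<bar>nonlin_deriv k s\<bar> \<le> \<bar>B k\<bar>" using B[OF that(2), of k] by linarith
    also have "\<dots> \<le> (\<Sum>k\<le>4. \<bar>B k\<bar>)" using that by (intro member_le_sum) auto
    finally show ?thesis by simp
  qed
  moreover have "(\<Sum>k\<le>4. \<bar>B k\<bar>) + 1 > 0" by (simp add: add_nonneg_pos sum_nonneg)
  ultimately show ?thesis by blast
qed

lemma nonlin_lipschitz:
  assumes m: "m > 0"
  shows "\<exists>B>0. \<forall>s\<ge>m. \<forall>t\<ge>m. \<bar>nonlin s - nonlin t\<bar> \<le> B * \<bar>s - t\<bar>"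
proof -
  obtain B where B: "B > 0" "\<And>k s. k \<le> 4 \<Longrightarrow> s \<ge> m \<Longrightarrow> \<bar>nonlin_deriv k s\<bar> \<le> B"
    using nonlin_deriv_bounded[OF m] by blast
  have "\<bar>nonlin s - nonlin t\<bar> \<le> B * \<bar>s - t\<bar>" if "s \<ge> m" "t \<ge> m" for s t
  proof -
    have "norm (nonlin s - nonlin t) \<le> B * norm (s - t)"
    proof (rule field_differentiable_bound[of "{m..}"])
      show "(nonlin has_field_derivative nonlin_deriv 1 z) (at z within {m..})" if "z \<in> {m..}" for z
        using DERIV_nonlin_deriv[of z 0] that m by (auto simp: nonlin_deriv_0 intro: has_field_derivative_at_within)
      show "norm (nonlin_deriv 1 z) \<le> B" if "z \<in> {m..}" for z using B(2)[of 1 z] that by simp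
    qed (use that in auto)
    then show ?thesis by simp
  qed
  then show ?thesis using B by blast
qed

text \<open>Second-order consistency of the spatial discretisation, uniformly over all functions with a
  given \<open>C\<^sup>6\<close> bound and a given positive lower bound. For the nonlinear part four derivatives of
  \<open>nonlin (f x)\<close> along a line are computed. For the bilaplacian one difference quotient is
  replaced at a time; since difference quotients commute and preserve line derivatives, mixed
  derivatives are never interchanged.\<close>

lemma space_consistency:
  assumes L: "L > 0" and m: "m > 0" and M: "M \<ge> 0"
  shows "\<exists>C>0. \<forall>f h x. f \<in> Ck_per 6 L \<and> Ck_norm 6 f \<le> M \<and> (\<forall>x. m \<le> f x) \<and> h \<noteq> 0 \<longrightarrow>
    \<bar>lap_h h (chem_pot_h h \<epsilon> f) x - laplacian (chem_pot \<epsilon> f) x\<bar> \<le> C * h\<^sup>2"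
proof -
  obtain B where B: "B > 0" "\<And>k s. k \<le> 4 \<Longrightarrow> s \<ge> m \<Longrightarrow> \<bar>nonlin_deriv k s\<bar> \<le> B"
    using nonlin_deriv_bounded[OF m] by blast
  define Q where "Q = B * M^4 + 6 * (B * M\<^sup>2 * M) + 3 * (B * M\<^sup>2) + 4 * (B * M * M) + B * M"
  define C where "C = Q / 4 + \<epsilon>\<^sup>2 * (3/2 * M) + 1"
  have Q0: "Q \<ge> 0" using B M by (simp add: Q_def)
  have C0: "C > 0" using Q0 M by (simp add: C_def add_nonneg_pos)
  have "\<bar>lap_h h (chem_pot_h h \<epsilon> f) x - laplacian (chem_pot \<epsilon> f) x\<bar> \<le> C * h\<^sup>2"
    if f: "f \<in> Ck_per 6 L" and fM: "Ck_norm 6 f \<le> M" and fm: "\<And>x. m \<le> f x" and h: "h \<noteq> 0" for f h x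
  proof -
    have fp: "f x > 0" for x using fm[of x] m by linarith
    have bd: "\<bar>partials \<alpha> f x\<bar> \<le> M" if "length \<alpha> \<le> 6" for \<alpha> x
      using Ck_norm_bound[OF L f that, of x] fM by linarith
    have ld: "has_line_deriv i (partials \<alpha> f) (partials (i # \<alpha>) f)" if "length \<alpha> < 6" for i \<alpha>
      by (rule Ck_per_line_deriv[OF f that])
    define F where "F = (\<lambda>k x. nonlin_deriv k (f x))"
    have F0: "(\<lambda>x. nonlin (f x)) = F 0" by (simp add: F_def nonlin_deriv_0)
    have FB: "\<bar>F k x\<bar> \<le> B" if "k \<le> 4" for k x using B(2)[OF that fm] by (simp add: F_def)
    define u where "u = (\<lambda>a n. partials (replicate n a) f)"
    have uld: "has_line_deriv a (u a n) (u a (Suc n))" if "n < 6" for a n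
      using ld[of "replicate n a" a] that by (simp add: u_def)
    have uB: "\<bar>u a n x\<bar> \<le> M" if "n \<le> 6" for a n x using bd[of "replicate n a"] that by (simp add: u_def)
    have Fld: "has_line_deriv a (F k) (\<lambda>x. F (Suc k) x * u a 1 x)" for a k
      using has_line_deriv_comp[OF ld[of "[]" a], of "nonlin_deriv k" "nonlin_deriv (Suc k)"]
        DERIV_nonlin_deriv[OF fp] by (simp add: F_def u_def)
    (* the first four derivatives of \<open>nonlin (f x)\<close> in direction \<open>a\<close> *)
    define D1 where "D1 = (\<lambda>a x. F 1 x * u a 1 x)"
    define D2 where "D2 = (\<lambda>a x. F 2 x * (u a 1 x * u a 1 x) + F 1 x * u a 2 x)"
    define D3 where "D3 = (\<lambda>a x. F 3 x * (u a 1 x * (u a 1 x * u a 1 x)) + 3 * (F 2 x * (u a 1 x * u a 2 x)) + F 1 x * u a 3 x)"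
    define D4 where "D4 = (\<lambda>a x. F 4 x * (u a 1 x)^4 + 6 * (F 3 x * (u a 1 x)\<^sup>2 * u a 2 x)
       + 3 * (F 2 x * (u a 2 x)\<^sup>2) + 4 * (F 2 x * u a 1 x * u a 3 x) + F 1 x * u a 4 x)"
    have u': "has_line_deriv a (u a 1) (u a 2)" "has_line_deriv a (u a 2) (u a 3)"
       "has_line_deriv a (u a 3) (u a 4)" for a
      using uld[of 1 a] uld[of 2 a] uld[of 3 a] by (simp_all add: eval_nat_numeral)
    have F': "has_line_deriv a (F 0) (\<lambda>x. F 1 x * u a 1 x)"
      "has_line_deriv a (F 1) (\<lambda>x. F 2 x * u a 1 x)"
      "has_line_deriv a (F 2) (\<lambda>x. F 3 x * u a 1 x)"
      "has_line_deriv a (F 3) (\<lambda>x. F 4 x * u a 1 x)" for a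
      using Fld[of a 0] Fld[of a 1] Fld[of a 2] Fld[of a 3] by (simp_all add: eval_nat_numeral)
    have l1: "has_line_deriv a (F 0) (D1 a)" for a using F'(1) by (simp add: D1_def)
    have l2: "has_line_deriv a (D1 a) (D2 a)" for a
      using has_line_deriv_mult[OF F'(2) u'(1), of a] unfolding D1_def D2_def
      by (simp add: algebra_simps)
    have l3: "has_line_deriv a (D2 a) (D3 a)" for a
      using has_line_deriv_add[OF
         has_line_deriv_mult[OF F'(3) has_line_deriv_mult[OF u'(1) u'(1)]]
         has_line_deriv_mult[OF F'(2) u'(2)], of a] unfolding D2_def D3_def
      by (simp add: algebra_simps)
    have l4: "has_line_deriv a (D3 a) (D4 a)" for a
      using has_line_deriv_add[OF has_line_deriv_add[OF
         has_line_deriv_mult[OF F'(4) has_line_deriv_mult[OF u'(1) has_line_deriv_mult[OF u'(1) u'(1)]]]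
         has_line_deriv_cmult[where c = 3, OF has_line_deriv_mult[OF F'(3) has_line_deriv_mult[OF u'(1) u'(2)]]]]
         has_line_deriv_mult[OF F'(2) u'(3)], of a] unfolding D3_def D4_def
      by (simp add: algebra_simps power2_eq_square power4_eq_xxxx)
    have D4B: "\<bar>D4 a x\<bar> \<le> Q" for a x
    proof -
      have 1: "\<bar>F 4 x * (u a 1 x)^4\<bar> \<le> B * M^4"
        unfolding abs_mult power_abs using FB[of 4 x] uB[of 1 a x] B M by (intro mult_mono power_mono) auto
      have 2: "\<bar>F 3 x * (u a 1 x)\<^sup>2 * u a 2 x\<bar> \<le> B * M\<^sup>2 * M"
        unfolding abs_mult power_abs using FB[of 3 x] uB[of 1 a x] uB[of 2 a x] B M
        by (intro mult_mono power_mono) auto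
      have 3: "\<bar>F 2 x * (u a 2 x)\<^sup>2\<bar> \<le> B * M\<^sup>2"
        unfolding abs_mult power_abs using FB[of 2 x] uB[of 2 a x] B M
        by (intro mult_mono power_mono) auto
      have 4: "\<bar>F 2 x * u a 1 x * u a 3 x\<bar> \<le> B * M * M"
        unfolding abs_mult using FB[of 2 x] uB[of 1 a x] uB[of 3 a x] B M
        by (intro mult_mono) auto
      have 5: "\<bar>F 1 x * u a 4 x\<bar> \<le> B * M"
        unfolding abs_mult using FB[of 1 x] uB[of 4 a x] B M by (intro mult_mono) auto
      show ?thesis unfolding D4_def Q_def using 1 2 3 4 5 by linarith
    qed
    have n1: "\<bar>diff2 h a (F 0) x - D2 a x\<bar> \<le> Q / 12 * h\<^sup>2" for a x
      by (rule diff2_consistency[OF l1 l2 l3 l4 D4B h])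
    have ld2: "has_line_deriv i (partials \<alpha> f) (partials (i # \<alpha>) f)"
      "has_line_deriv i (partials (i # \<alpha>) f) (partials (i # i # \<alpha>) f)" if "length \<alpha> < 5" for i \<alpha>
      using ld[of \<alpha> i] ld[of "i # \<alpha>" i] that by auto
    (* the bilaplacian: first the outer, then the inner difference quotient is replaced by the
       derivative *)
    have q1: "\<bar>diff2 h a (partials [b,b] f) x - partials [a,a,b,b] f x\<bar> \<le> M / 12 * h\<^sup>2" for a b x
      by (rule diff2_consistency[OF ld ld ld ld _ h]) (auto intro!: bd simp del: partials.simps)
    have q2: "\<bar>diff2 h b (diff2 h a f) x - diff2 h a (partials [b,b] f) x\<bar> \<le> M / 12 * h\<^sup>2" for a b x
    proof (rule diff2_consistency[OF _ _ _ _ _ h])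
      show "has_line_deriv b (diff2 h a f) (diff2 h a (partials [b] f))"
        using has_line_deriv_diff2[OF ld[of "[]" b]] by simp
      show "has_line_deriv b (diff2 h a (partials [b] f)) (diff2 h a (partials [b,b] f))"
        using has_line_deriv_diff2[OF ld[of "[b]" b]] by simp
      show "has_line_deriv b (diff2 h a (partials [b,b] f)) (diff2 h a (partials [b,b,b] f))"
        using has_line_deriv_diff2[OF ld[of "[b,b]" b]] by simp
      show "has_line_deriv b (diff2 h a (partials [b,b,b] f)) (diff2 h a (partials [b,b,b,b] f))"
        using has_line_deriv_diff2[OF ld[of "[b,b,b]" b]] by simp
      show "\<bar>diff2 h a (partials [b,b,b,b] f) x\<bar> \<le> M" for x
        by (rule diff2_bound[OF ld ld _ h]) (auto intro!: bd simp del: partials.simps)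
    qed
    have q3: "\<bar>diff2 h a (diff2 h b f) x - partials [a,a,b,b] f x\<bar> \<le> M / 6 * h\<^sup>2" for a b x
      using q1[of a b x] q2[of b a x] diff2_commute[of h a b f x] by linarith
    have lapf: "laplacian f = (\<lambda>x. \<Sum>b\<in>UNIV. partials [b,b] f x)"
      by (rule ext) (simp add: laplacian_def)
    have cp: "chem_pot \<epsilon> f = (\<lambda>x. F 0 x - \<epsilon>\<^sup>2 * (\<Sum>b\<in>UNIV. partials [b,b] f x))"
      by (rule ext) (simp add: chem_pot_def lapf F_def nonlin_deriv_0)
    have c1: "has_line_deriv a (chem_pot \<epsilon> f) (\<lambda>x. D1 a x - \<epsilon>\<^sup>2 * (\<Sum>b\<in>UNIV. partials [a,b,b] f x))" for a
      unfolding cp by (intro has_line_deriv_diff l1 has_line_deriv_cmult has_line_deriv_sum ld) simp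
    have c2: "has_line_deriv a (\<lambda>x. D1 a x - \<epsilon>\<^sup>2 * (\<Sum>b\<in>UNIV. partials [a,b,b] f x))
        (\<lambda>x. D2 a x - \<epsilon>\<^sup>2 * (\<Sum>b\<in>UNIV. partials [a,a,b,b] f x))" for a
      by (intro has_line_deriv_diff l2 has_line_deriv_cmult has_line_deriv_sum ld) simp
    have lapcp: "laplacian (chem_pot \<epsilon> f) x = (\<Sum>a\<in>UNIV. D2 a x - \<epsilon>\<^sup>2 * (\<Sum>b\<in>UNIV. partials [a,a,b,b] f x))"
      unfolding laplacian_def partial_eq[OF c1] partial_eq[OF c2] ..
    have cph: "chem_pot_h h \<epsilon> f = (\<lambda>x. F 0 x - \<epsilon>\<^sup>2 * (\<Sum>b\<in>UNIV. diff2 h b f x))"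
      by (rule ext) (simp add: chem_pot_h_def lap_h_def F_def nonlin_deriv_0)
    have lcph: "lap_h h (chem_pot_h h \<epsilon> f) x
      = (\<Sum>a\<in>UNIV. diff2 h a (F 0) x - \<epsilon>\<^sup>2 * (\<Sum>b\<in>UNIV. diff2 h a (diff2 h b f) x))"
      unfolding lap_h_def cph
      by (intro sum.cong refl diff2_lincomb)
    have "lap_h h (chem_pot_h h \<epsilon> f) x - laplacian (chem_pot \<epsilon> f) x
       = (\<Sum>a\<in>UNIV. (diff2 h a (F 0) x - D2 a x)
          - \<epsilon>\<^sup>2 * (\<Sum>b\<in>UNIV. diff2 h a (diff2 h b f) x - partials [a,a,b,b] f x))"
      unfolding lapcp lcph by (simp add: sum_subtractf right_diff_distrib del: partials.simps)
    also have "\<bar>\<dots>\<bar> \<le> (\<Sum>a\<in>(UNIV::3 set). Q / 12 * h\<^sup>2 + \<epsilon>\<^sup>2 * (\<Sum>b\<in>(UNIV::3 set). M / 6 * h\<^sup>2))"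
    proof (rule order_trans[OF sum_abs sum_mono])
      fix a :: 3
      have "\<bar>\<Sum>b\<in>UNIV. diff2 h a (diff2 h b f) x - partials [a,a,b,b] f x\<bar> \<le> (\<Sum>b\<in>(UNIV::3 set). M / 6 * h\<^sup>2)"
        by (rule order_trans[OF sum_abs sum_mono]) (rule q3)
      then have "\<bar>\<epsilon>\<^sup>2 * (\<Sum>b\<in>UNIV. diff2 h a (diff2 h b f) x - partials [a,a,b,b] f x)\<bar>
         \<le> \<epsilon>\<^sup>2 * (\<Sum>b\<in>(UNIV::3 set). M / 6 * h\<^sup>2)"
        unfolding abs_mult abs_power2 by (rule mult_left_mono) simp
      then show "\<bar>(diff2 h a (F 0) x - D2 a x) - \<epsilon>\<^sup>2 * (\<Sum>b\<in>UNIV. diff2 h a (diff2 h b f) x - partials [a,a,b,b] f x)\<bar>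
         \<le> Q / 12 * h\<^sup>2 + \<epsilon>\<^sup>2 * (\<Sum>b\<in>(UNIV::3 set). M / 6 * h\<^sup>2)"
        using n1[of a x] by linarith
    qed
    also have "\<dots> = (Q / 4 + \<epsilon>\<^sup>2 * (3/2 * M)) * h\<^sup>2" by (simp add: algebra_simps)
    also have "\<dots> \<le> C * h\<^sup>2" by (intro mult_right_mono) (simp_all add: C_def)
    finally show ?thesis .
  qed
  then show ?thesis using C0 by blast
qed

section \<open>The discrete Fourier transform\<close>

definition root_cis :: "nat \<Rightarrow> int \<Rightarrow> complex" where
  "root_cis N m = cis (2 * pi * of_int m / real N)"

lemma root_cis_add: "root_cis N (m + n) = root_cis N m * root_cis N n"
  by (simp add: root_cis_def cis_mult add_divide_distrib ring_distribs)

lemma root_cis_eq_1_iff: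
  assumes "N > 0" shows "root_cis N m = 1 \<longleftrightarrow> int N dvd m"
proof
  assume "root_cis N m = 1"
  then have "cos (2 * pi * of_int m / real N) = 1"
    by (metis root_cis_def cis.sel(1) one_complex.sel(1))
  then obtain n :: int where "2 * pi * of_int m / real N = of_int n * 2 * pi"
    using cos_one_2pi_int by blast
  then have "real_of_int m = of_int (n * int N)" using assms by (simp add: field_simps)
  then have "m = n * int N" by (simp only: of_int_eq_iff)
  then show "int N dvd m" by simp
next
  assume "int N dvd m"
  then obtain n where "m = int N * n" by blast
  then have "2 * pi * of_int m / real N = 2 * pi * of_int n" using assms by simp
  then show "root_cis N m = 1" by (simp only: root_cis_def cis_multiple_2pi Ints_of_int)
qed

text \<open>A shift of the summation index multiplies the sum by \<open>root_cis N m\<close>, so it vanishes unless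
  that root is \<open>1\<close>.\<close>

lemma sum_root_cis:
  assumes N: "N > 0"
  shows "(\<Sum>k=1..int N. root_cis N (k * m)) = (if int N dvd m then of_nat N else 0)"
proof (cases "int N dvd m")
  case True
  then have "root_cis N (k * m) = 1" for k
    using root_cis_eq_1_iff[OF N, of "k * m"] by simp
  then show ?thesis using True by simp
next
  case False
  have p: "root_cis N ((k + int N) * m) = root_cis N (k * m)" for k
    using root_cis_eq_1_iff[OF N, of "int N * m"] by (simp add: ring_distribs root_cis_add)
  let ?S = "\<Sum>k=1..int N. root_cis N (k * m)"
  have "?S = (\<Sum>k=1..int N. root_cis N ((k + 1) * m))"
    using sum_periodic_shift[of "\<lambda>k. root_cis N (k * m)" N, OF p] by simp
  also have "\<dots> = root_cis N m * ?S"
    by (simp add: ring_distribs root_cis_add sum_distrib_left mult.commute)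
  finally have "(root_cis N m - 1) * ?S = 0" by (simp add: algebra_simps)
  then show ?thesis using False root_cis_eq_1_iff[OF N, of m] by simp
qed

lemma sum_root_cis_symmetric:
  assumes N: "N = 2 * K + 1"
  shows "(\<Sum>k | \<bar>k\<bar> \<le> int K. root_cis N (k * m)) = (if int N dvd m then of_nat N else 0)"
proof -
  define c where "c = root_cis N (- ((int K + 1) * m))"
  have "(\<Sum>k | \<bar>k\<bar> \<le> int K. root_cis N (k * m)) = (\<Sum>k=1..int N. root_cis N ((k - (int K + 1)) * m))"
    by (rule sum.reindex_bij_witness[of _ "\<lambda>k. k - (int K + 1)" "\<lambda>k. k + (int K + 1)"])
      (auto simp: N)
  also have "\<dots> = (\<Sum>k=1..int N. root_cis N (k * m) * c)"
  proof (rule sum.cong[OF refl])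
    fix k
    have "(k - (int K + 1)) * m = k * m + - ((int K + 1) * m)" by (simp add: algebra_simps)
    then show "root_cis N ((k - (int K + 1)) * m) = root_cis N (k * m) * c"
      unfolding c_def by (simp only: root_cis_add)
  qed
  also have "\<dots> = c * (\<Sum>k=1..int N. root_cis N (k * m))"
    by (simp add: sum_distrib_left mult.commute)
  also have "\<dots> = (if int N dvd m then c * of_nat N else 0)"
    using sum_root_cis[of N m] N by simp
  also have "\<dots> = (if int N dvd m then of_nat N else 0)"
  proof -
    have "c = 1" if "int N dvd m" 
      unfolding c_def using that N by (subst root_cis_eq_1_iff) auto
    then show ?thesis by simp
  qed
  finally show ?thesis .
qed

lemma sum_vec3:
  "(\<Sum>k::int^3 | (\<forall>a. k $ a \<in> I). f (k $ 1) (k $ 2) (k $ 3)) = (\<Sum>a\<in>I. \<Sum>b\<in>I. \<Sum>c\<in>I. f a b c)"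
proof -
  have "(\<Sum>k::int^3 | (\<forall>a. k $ a \<in> I). f (k $ 1) (k $ 2) (k $ 3))
     = (\<Sum>p\<in>I \<times> I \<times> I. f (fst p) (fst (snd p)) (snd (snd p)))"
    by (rule sum.reindex_bij_witness[of _ "\<lambda>p. vector [fst p, fst (snd p), snd (snd p)]"
          "\<lambda>k. (k $ 1, k $ 2, k $ 3)"])
      (auto simp: vec_eq_iff forall_3 vector_3)
  then show ?thesis by (simp add: sum.cartesian_product split_def)
qed

lemma finite_vec3:
  assumes "finite I" shows "finite {k::int^3. \<forall>a. k $ a \<in> I}"
proof (rule finite_subset)
  show "{k::int^3. \<forall>a. k $ a \<in> I} \<subseteq> (\<lambda>p. vector [fst p, fst (snd p), snd (snd p)]) ` (I \<times> I \<times> I)"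
  proof
    fix k :: "int^3" assume "k \<in> {k. \<forall>a. k $ a \<in> I}"
    then have "(k $ 1, k $ 2, k $ 3) \<in> I \<times> I \<times> I" by simp
    moreover have "k = vector [fst (k $ 1, k $ 2, k $ 3), fst (snd (k $ 1, k $ 2, k $ 3)), snd (snd (k $ 1, k $ 2, k $ 3))]"
      by (simp add: vec_eq_iff forall_3 vector_3)
    ultimately show "k \<in> (\<lambda>p. vector [fst p, fst (snd p), snd (snd p)]) ` (I \<times> I \<times> I)"
      by (rule rev_image_eqI)
  qed
qed (use assms in auto)

text \<open>The cube of resolved frequencies. For \<open>N = 2 * K + 1\<close> it is a full set of representatives
  modulo \<open>N\<close>; the ball of the Fourier projection is contained in it.\<close>

definition freqs :: "nat \<Rightarrow> (int^3) set" where "freqs K = {k. \<forall>a. k $ a \<in> {m. \<bar>m\<bar> \<le> int K}}"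

lemma finite_freqs: "finite (freqs K)"
proof -
  have "{m::int. \<bar>m\<bar> \<le> int K} = {- int K..int K}" by auto
  then show ?thesis unfolding freqs_def by (intro finite_vec3) simp
qed

definition csum :: "nat \<Rightarrow> (int \<Rightarrow> int \<Rightarrow> int \<Rightarrow> complex) \<Rightarrow> complex" where
  "csum N v = (\<Sum>i=1..int N. \<Sum>j=1..int N. \<Sum>k=1..int N. v i j k)"

definition grid_indices :: "nat \<Rightarrow> (int \<times> int \<times> int) set" where
  "grid_indices N = {1..int N} \<times> {1..int N} \<times> {1..int N}"

lemma finite_grid_indices: "finite (grid_indices N)" by (simp add: grid_indices_def)

lemma csum_grid_indices: "csum N v = (\<Sum>(i,j,l)\<in>grid_indices N. v i j l)"
  by (simp add: csum_def grid_indices_def sum.cartesian_product)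

lemma gsum_grid_indices: "gsum N v = (\<Sum>(i,j,l)\<in>grid_indices N. v i j l)"
  by (simp add: gsum_def grid_indices_def sum.cartesian_product)

lemma csum_of_real: "csum N (\<lambda>i j l. of_real (v i j l)) = of_real (gsum N v)"
  by (simp add: csum_def gsum_def)

text \<open>The Fourier mode sampled at the shifted grid points \<open>(i - 1/2) * h\<close>.\<close>

definition wave1 :: "nat \<Rightarrow> int \<Rightarrow> int \<Rightarrow> complex" where
  "wave1 N k i = cis (2 * pi * (of_int k * (of_int i - 1/2)) / real N)"

definition wave :: "nat \<Rightarrow> int^3 \<Rightarrow> int \<Rightarrow> int \<Rightarrow> int \<Rightarrow> complex" where
  "wave N k i j l = wave1 N (k $ 1) i * wave1 N (k $ 2) j * wave1 N (k $ 3) l"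

definition dft :: "nat \<Rightarrow> grid \<Rightarrow> int^3 \<Rightarrow> complex" where
  "dft N v k = csum N (\<lambda>i j l. of_real (v i j l) * cnj (wave N k i j l)) / of_nat N ^ 3"

lemma wave1_mult_cnj: "wave1 N k i * cnj (wave1 N k j) = root_cis N (k * (i - j))"
proof -
  have "2 * pi * X / real N + - (2 * pi * Y / real N) = 2 * pi * (X - Y) / real N" for X Y
    by (simp add: diff_divide_distrib right_diff_distrib)
  moreover have "of_int k * (of_int i - 1/2) - of_int k * (of_int j - 1/2) = real_of_int (k * (i - j))"
    by (simp add: right_diff_distrib)
  ultimately show ?thesis unfolding wave1_def root_cis_def cis_cnj cis_mult by (simp only:)
qed

lemma wave1_shift: "wave1 N k (i + 1) = root_cis N k * wave1 N k i"
proof -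
  have "2 * pi * Y / real N + 2 * pi * X / real N = 2 * pi * (Y + X) / real N" for X Y
    by (simp add: add_divide_distrib ring_distribs)
  moreover have "real_of_int k * (of_int (i + 1) - 1/2) = of_int k + of_int k * (of_int i - 1/2)"
    by (simp add: ring_distribs)
  ultimately show ?thesis unfolding wave1_def root_cis_def cis_mult by (simp only:)
qed

lemma wave1_period: "N > 0 \<Longrightarrow> wave1 N k (i + int N) = wave1 N k i"
proof -
  assume N: "N > 0"
  have "wave1 N k (i + int N) = cis (2 * pi * (of_int k * (of_int i - 1/2)) / real N + 2 * pi * of_int k)"
  proof -
    have "2 * pi * (of_int k * (of_int (i + int N) - 1/2)) / real N
      = 2 * pi * (of_int k * (of_int i - 1/2)) / real N + 2 * pi * of_int k" for k i :: int
    proof -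
      have "of_int k * (of_int (i + int N) - 1/2) = of_int k * (of_int i - 1/2) + of_int k * real N"
        by (simp add: ring_distribs)
      moreover have "2 * pi * (X + Y * real N) / real N = 2 * pi * X / real N + 2 * pi * Y" for X Y
        using N by (simp add: add_divide_distrib ring_distribs)
      ultimately show ?thesis by (simp only:)
    qed
    then show ?thesis by (simp only: wave1_def)
  qed
  also have "\<dots> = wave1 N k i * cis (2 * pi * of_int k)" by (simp only: cis_mult[symmetric] wave1_def)
  finally show ?thesis by (simp only: cis_multiple_2pi Ints_of_int mult_1_right)
qed

lemma wave_orthogonal:
  assumes N: "N = 2 * K + 1" and p: "(i,j,l) \<in> grid_indices N" "(i',j',l') \<in> grid_indices N"
  shows "(\<Sum>k\<in>freqs K. wave N k i j l * cnj (wave N k i' j' l'))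
    = (if (i,j,l) = (i',j',l') then of_nat N ^ 3 else 0)"
proof -
  let ?I = "{m. \<bar>m\<bar> \<le> int K}"
  have d: "int N dvd (a - b) \<longleftrightarrow> a = b" if "a \<in> {1..int N}" "b \<in> {1..int N}" for a b
  proof
    assume "int N dvd (a - b)"
    then have "int N \<le> \<bar>a - b\<bar>" if "a \<noteq> b" using dvd_imp_le_int[of "a - b" "int N"] that by simp
    moreover have "\<bar>a - b\<bar> < int N" using that by auto
    ultimately show "a = b" by linarith
  qed simp
  have "(\<Sum>k\<in>freqs K. wave N k i j l * cnj (wave N k i' j' l'))
    = (\<Sum>k\<in>freqs K. root_cis N (k $ 1 * (i - i')) * (root_cis N (k $ 2 * (j - j')) * root_cis N (k $ 3 * (l - l'))))"
  proof (rule sum.cong[OF refl])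
    fix k
    have "a1 * a2 * a3 * (b1 * b2 * b3) = (a1 * b1) * ((a2 * b2) * (a3 * b3))" for a1 a2 a3 b1 b2 b3 :: complex
      by simp
    then show "wave N k i j l * cnj (wave N k i' j' l') =
      root_cis N (k $ 1 * (i - i')) * (root_cis N (k $ 2 * (j - j')) * root_cis N (k $ 3 * (l - l')))"
      unfolding wave_def complex_cnj_mult wave1_mult_cnj[symmetric] .
  qed
  also have "\<dots> = (\<Sum>a\<in>?I. \<Sum>b\<in>?I. \<Sum>c\<in>?I. root_cis N (a * (i - i')) * (root_cis N (b * (j - j')) * root_cis N (c * (l - l'))))"
    unfolding freqs_def by (rule sum_vec3)
  also have "\<dots> = (\<Sum>a\<in>?I. root_cis N (a * (i - i'))) * ((\<Sum>b\<in>?I. root_cis N (b * (j - j'))) *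
     (\<Sum>c\<in>?I. root_cis N (c * (l - l'))))"
    by (simp only: sum_distrib_left[symmetric] sum_distrib_right[symmetric])
  also have "\<dots> = (if (i,j,l) = (i',j',l') then of_nat N ^ 3 else 0)"
    unfolding sum_root_cis_symmetric[OF N] using p d by (auto simp: grid_indices_def power3_eq_cube)
  finally show ?thesis .
qed

lemma dft_inversion:
  assumes N: "N = 2 * K + 1" and p: "(i,j,l) \<in> grid_indices N"
  shows "(\<Sum>k\<in>freqs K. dft N v k * wave N k i j l) = of_real (v i j l)"
proof -
  have N0: "N > 0" using N by simp
  have "(\<Sum>k\<in>freqs K. dft N v k * wave N k i j l)
    = (\<Sum>k\<in>freqs K. \<Sum>(i',j',l')\<in>grid_indices N. of_real (v i' j' l') * (wave N k i j l * cnj (wave N k i' j' l')) / of_nat N ^ 3)"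
    unfolding dft_def csum_grid_indices sum_divide_distrib sum_distrib_right
    by (intro sum.cong refl) (auto simp: mult_ac)
  also have "\<dots> = (\<Sum>(i',j',l')\<in>grid_indices N. \<Sum>k\<in>freqs K. of_real (v i' j' l') * (wave N k i j l * cnj (wave N k i' j' l')) / of_nat N ^ 3)"
    by (subst sum.swap) (simp add: split_def)
  also have "\<dots> = (\<Sum>(i',j',l')\<in>grid_indices N. of_real (v i' j' l') * (if (i,j,l) = (i',j',l') then of_nat N ^ 3 else 0) / of_nat N ^ 3)"
    by (intro sum.cong refl)
      (auto simp: sum_distrib_left[symmetric] sum_divide_distrib[symmetric] wave_orthogonal[OF N p])
  also have "\<dots> = (\<Sum>q\<in>grid_indices N. if (i,j,l) = q then of_real (v i j l) else 0)"
    by (intro sum.cong refl) (use N0 in \<open>auto simp: split_def\<close>)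
  also have "\<dots> = of_real (v i j l)" using p by (simp add: finite_grid_indices)
  finally show ?thesis .
qed

lemma dft_parseval:
  assumes N: "N = 2 * K + 1"
  shows "(\<Sum>k\<in>freqs K. (cmod (dft N v k))\<^sup>2) = gsum N (\<lambda>i j l. (v i j l)\<^sup>2) / real N ^ 3"
proof -
  have "complex_of_real (\<Sum>k\<in>freqs K. (cmod (dft N v k))\<^sup>2) = (\<Sum>k\<in>freqs K. dft N v k * cnj (dft N v k))"
    by (simp add: complex_norm_square[symmetric])
  also have "\<dots> = (\<Sum>k\<in>freqs K. \<Sum>(i,j,l)\<in>grid_indices N. of_real (v i j l) * (dft N v k * wave N k i j l) / of_nat N ^ 3)"
  proof (intro sum.cong refl)
    fix k
    have "cnj (dft N v k) = (\<Sum>(i,j,l)\<in>grid_indices N. of_real (v i j l) * wave N k i j l) / of_nat N ^ 3"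
      unfolding dft_def csum_grid_indices by (simp add: split_def)
    then show "dft N v k * cnj (dft N v k) = (\<Sum>(i,j,l)\<in>grid_indices N. of_real (v i j l) * (dft N v k * wave N k i j l) / of_nat N ^ 3)"
      by (simp only:) (simp add: sum_distrib_left sum_divide_distrib split_def mult_ac)
  qed
  also have "\<dots> = (\<Sum>(i,j,l)\<in>grid_indices N. \<Sum>k\<in>freqs K. of_real (v i j l) * (dft N v k * wave N k i j l) / of_nat N ^ 3)"
    by (subst sum.swap) (simp add: split_def)
  also have "\<dots> = (\<Sum>(i,j,l)\<in>grid_indices N. of_real ((v i j l)\<^sup>2 / real N ^ 3))"
  proof (intro sum.cong refl, clarify)
    fix i j l assume p: "(i,j,l) \<in> grid_indices N"
    show "(\<Sum>k\<in>freqs K. of_real (v i j l) * (dft N v k * wave N k i j l) / of_nat N ^ 3) = of_real ((v i j l)\<^sup>2 / real N ^ 3)"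
      unfolding sum_divide_distrib[symmetric] sum_distrib_left[symmetric] dft_inversion[OF N p]
      by (simp add: power2_eq_square)
  qed
  also have "\<dots> = of_real (gsum N (\<lambda>i j l. (v i j l)\<^sup>2) / real N ^ 3)"
    unfolding gsum_grid_indices of_real_sum sum_divide_distrib by (simp add: split_def)
  finally show ?thesis by (simp only: of_real_eq_iff)
qed

text \<open>Unit step in direction \<open>a\<close> of the \<open>b\<close>-th index; it allows one formula for the three
  coordinate directions.\<close>

definition offset :: "3 \<Rightarrow> 3 \<Rightarrow> int" where "offset a b = (if a = b then 1 else 0)"

definition gdiff :: "3 \<Rightarrow> grid \<Rightarrow> grid" where
  "gdiff a v i j l = v (i + offset a 1) (j + offset a 2) (l + offset a 3) - v i j l"

lemma gdiff_per: "v \<in> grid_per N \<Longrightarrow> gdiff a v \<in> grid_per N"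
  using grid_per_intros(3)[OF grid_per_shift] by (simp add: gdiff_def[abs_def])

lemma csum_shift:
  assumes per: "\<And>i j l. v (i + int N) j l = v i j l" "\<And>i j l. v i (j + int N) l = v i j l"
    "\<And>i j l. v i j (l + int N) = v i j l"
  shows "csum N (\<lambda>i j l. v (i + offset a 1) (j + offset a 2) (l + offset a 3)) = csum N v"
proof -
  have 1: "csum N (\<lambda>i j l. v (i + 1) j l) = csum N v" unfolding csum_def
    by (rule sum_periodic_shift[of "\<lambda>i. \<Sum>j=1..int N. \<Sum>l=1..int N. v i j l"]) (simp add: per)
  have 2: "csum N (\<lambda>i j l. v i (j + 1) l) = csum N v" unfolding csum_def
    by (intro sum.cong refl sum_periodic_shift[of "\<lambda>j. \<Sum>l=1..int N. v _ j l"]) (simp add: per)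
  have 3: "csum N (\<lambda>i j l. v i j (l + 1)) = csum N v" unfolding csum_def
    by (intro sum.cong refl sum_periodic_shift) (simp add: per)
  show ?thesis using exhaust_3[of a] 1 2 3 by (auto simp: offset_def)
qed

lemma dft_gdiff:
  assumes N: "N > 0" and v: "v \<in> grid_per N"
  shows "dft N (gdiff a v) k = (root_cis N (k $ a) - 1) * dft N v k"
proof -
  define w where "w = (\<lambda>i j l. of_real (v i j l) * cnj (wave N k i j l))"
  have wp: "w (i + int N) j l = w i j l" "w i (j + int N) l = w i j l" "w i j (l + int N) = w i j l" for i j l
    by (simp_all add: w_def grid_perD[OF v] wave_def wave1_period[OF N])
  have ws: "wave N k (i + offset a 1) (j + offset a 2) (l + offset a 3) = root_cis N (k $ a) * wave N k i j l" for i j l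
    using exhaust_3[of a] by (auto simp: wave_def offset_def wave1_shift)
  have u: "cnj (root_cis N (k $ a)) * root_cis N (k $ a) = 1"
    by (simp add: root_cis_def cis_cnj cis_mult)
  have "csum N (\<lambda>i j l. of_real (gdiff a v i j l) * cnj (wave N k i j l))
     = csum N (\<lambda>i j l. root_cis N (k $ a) * w (i + offset a 1) (j + offset a 2) (l + offset a 3) - w i j l)"
  proof -
    have "of_real (gdiff a v i j l) * cnj (wave N k i j l) = 
      root_cis N (k $ a) * w (i + offset a 1) (j + offset a 2) (l + offset a 3) - w i j l" for i j l
    proof -
      have "root_cis N (k $ a) * w (i + offset a 1) (j + offset a 2) (l + offset a 3)
        = (cnj (root_cis N (k $ a)) * root_cis N (k $ a)) * (of_real (v (i + offset a 1) (j + offset a 2) (l + offset a 3)) * cnj (wave N k i j l))"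
        unfolding w_def ws by (simp add: mult_ac)
      then show ?thesis unfolding u by (auto simp: gdiff_def w_def left_diff_distrib)
    qed
    then show ?thesis by simp
  qed
  also have "\<dots> = root_cis N (k $ a) * csum N (\<lambda>i j l. w (i + offset a 1) (j + offset a 2) (l + offset a 3)) - csum N w"
    by (simp add: csum_def sum_subtractf sum_distrib_left)
  also have "\<dots> = (root_cis N (k $ a) - 1) * csum N w"
    unfolding csum_shift[where v = w, OF wp] by (simp add: left_diff_distrib)
  finally show ?thesis unfolding dft_def w_def by simp
qed

lemma dft_gdiff_power:
  assumes N: "N > 0" and v: "v \<in> grid_per N"
  shows "(gdiff a ^^ n) v \<in> grid_per N \<and> dft N ((gdiff a ^^ n) v) k = (root_cis N (k $ a) - 1) ^ n * dft N v k"
  by (induction n) (auto simp: v gdiff_per dft_gdiff[OF N])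

text \<open>The chord is at least a fixed fraction of the arc; this gives a lower bound for the symbol
  of the difference operator.\<close>

lemma cmod_cis_minus_1_ge:
  assumes "\<bar>\<theta>\<bar> \<le> pi"
  shows "cmod (cis \<theta> - 1) \<ge> \<bar>\<theta>\<bar> / 2"
proof -
  have sin_ge: "sin y \<ge> y / 2" if "0 \<le> y" "y \<le> pi / 2" for y :: real
  proof -
    have y: "y \<le> 8/5" using that(2) pi_less_4 pi_approx by simp
    have "\<bar>sin y - (\<Sum>m<3. sin_coeff m * y ^ m)\<bar> \<le> inverse (fact 3) * \<bar>y\<bar> ^ 3"
      by (rule Maclaurin_sin_bound)
    moreover have "(\<Sum>m<3. sin_coeff m * y ^ m) = y"
      by (simp add: eval_nat_numeral sin_coeff_def)
    moreover have "inverse (fact 3) * \<bar>y\<bar> ^ 3 = y ^ 3 / 6" using that by (simp add: fact_numeral)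
    ultimately have 1: "sin y \<ge> y - y ^ 3 / 6" by linarith
    have "y ^ 3 \<le> y * (8/5)\<^sup>2" unfolding power3_eq_cube power2_eq_square mult.assoc
      using that y by (intro mult_left_mono mult_mono) auto
    then have "y ^ 3 / 6 \<le> y / 2" using that by (simp add: power2_eq_square)
    with 1 show ?thesis by linarith
  qed
  have sq: "(cmod (cis \<theta> - 1))\<^sup>2 = (2 * sin (\<bar>\<theta>\<bar> / 2))\<^sup>2"
  proof -
    have "(cmod (cis \<theta> - 1))\<^sup>2 = (cos \<theta> - 1)\<^sup>2 + (sin \<theta>)\<^sup>2" by (simp add: cmod_power2)
    also have "\<dots> = 2 - 2 * cos \<theta>" using sin_cos_squared_add[of \<theta>] by (simp add: power2_eq_square algebra_simps)
    also have "cos \<theta> = cos (2 * (\<bar>\<theta>\<bar> / 2))" by simp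
    also have "\<dots> = 1 - 2 * (sin (\<bar>\<theta>\<bar> / 2))\<^sup>2" by (simp only: cos_double_sin)
    finally show ?thesis by (simp add: power_mult_distrib)
  qed
  have ge: "sin (\<bar>\<theta>\<bar> / 2) \<ge> \<bar>\<theta>\<bar> / 2 / 2" using assms by (intro sin_ge) auto
  then have "0 \<le> 2 * sin (\<bar>\<theta>\<bar> / 2)" by linarith
  with sq have "cmod (cis \<theta> - 1) = 2 * sin (\<bar>\<theta>\<bar> / 2)"
    by (rule power2_eq_imp_eq[OF _ norm_ge_zero])
  then show ?thesis using ge by linarith
qed

lemma cmod_root_cis_minus_1_ge:
  assumes N: "N = 2 * K + 1" and m: "\<bar>m\<bar> \<le> int K"
  shows "cmod (root_cis N m - 1) \<ge> real_of_int \<bar>m\<bar> / real N"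
proof -
  have N0: "real N > 0" using N by simp
  have a: "\<bar>2 * pi * of_int m / real N\<bar> = pi * (2 * real_of_int \<bar>m\<bar> / real N)"
    using N0 by (simp add: abs_mult)
  have "2 * \<bar>m\<bar> \<le> int N" using m N by simp
  then have "2 * real_of_int \<bar>m\<bar> \<le> real N" by linarith
  then have "2 * real_of_int \<bar>m\<bar> / real N \<le> 1" using N0 by (simp add: pos_divide_le_eq)
  then have "pi * (2 * real_of_int \<bar>m\<bar> / real N) \<le> pi * 1" by (intro mult_left_mono) auto
  then have "\<bar>2 * pi * of_int m / real N\<bar> \<le> pi" unfolding a by (simp only: mult_1_right)
  then have "cmod (root_cis N m - 1) \<ge> pi * (2 * real_of_int \<bar>m\<bar> / real N) / 2"
    unfolding root_cis_def a[symmetric] by (rule cmod_cis_minus_1_ge)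
  moreover have "1 * (real_of_int \<bar>m\<bar> / real N) \<le> pi * (real_of_int \<bar>m\<bar> / real N)"
    using pi_gt3 by (intro mult_right_mono) auto
  ultimately show ?thesis by simp
qed

text \<open>Differencing multiplies the discrete Fourier coefficients by \<open>root_cis N (k $ a) - 1\<close>, which
  for resolved frequencies is at least \<open>\<bar>k $ a\<bar> / N\<close>. With Parseval, bounded differences therefore
  give a discrete Sobolev bound.\<close>

lemma dft_decay:
  assumes N: "N = 2 * K + 1" and v: "v \<in> grid_per N" and B: "\<And>i j l. \<bar>(gdiff a ^^ n) v i j l\<bar> \<le> B"
  shows "(\<Sum>k\<in>freqs K. (real_of_int \<bar>k $ a\<bar>) ^ (2 * n) * (cmod (dft N v k))\<^sup>2) \<le> (real N ^ n * B)\<^sup>2"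
proof -
  have N0: "N > 0" using N by simp
  have "(\<Sum>k\<in>freqs K. (real_of_int \<bar>k $ a\<bar> / real N) ^ (2 * n) * (cmod (dft N v k))\<^sup>2)
     \<le> (\<Sum>k\<in>freqs K. (cmod (dft N ((gdiff a ^^ n) v) k))\<^sup>2)"
  proof (rule sum_mono)
    fix k assume "k \<in> freqs K"
    then have "real_of_int \<bar>k $ a\<bar> / real N \<le> cmod (root_cis N (k $ a) - 1)"
      by (intro cmod_root_cis_minus_1_ge[OF N]) (simp add: freqs_def)
    then have "(real_of_int \<bar>k $ a\<bar> / real N) ^ (2 * n) \<le> cmod (root_cis N (k $ a) - 1) ^ (2 * n)"
      by (intro power_mono) auto
    then have "(real_of_int \<bar>k $ a\<bar> / real N) ^ (2 * n) * (cmod (dft N v k))\<^sup>2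
      \<le> cmod (root_cis N (k $ a) - 1) ^ (2 * n) * (cmod (dft N v k))\<^sup>2"
      by (intro mult_right_mono) auto
    also have "\<dots> = (cmod (dft N ((gdiff a ^^ n) v) k))\<^sup>2"
      using dft_gdiff_power[OF N0 v, where a = a and n = n and k = k]
      by (simp add: norm_mult norm_power power_mult_distrib power_mult[symmetric] mult.commute)
    finally show "(real_of_int \<bar>k $ a\<bar> / real N) ^ (2 * n) * (cmod (dft N v k))\<^sup>2 \<le> (cmod (dft N ((gdiff a ^^ n) v) k))\<^sup>2" .
  qed
  also have "\<dots> = gsum N (\<lambda>i j l. ((gdiff a ^^ n) v i j l)\<^sup>2) / real N ^ 3" by (rule dft_parseval[OF N])
  also have "\<dots> \<le> gsum N (\<lambda>i j l. B\<^sup>2) / real N ^ 3"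
  proof (intro divide_right_mono gsum_mono)
    fix i j l
    have "\<bar>(gdiff a ^^ n) v i j l\<bar>\<^sup>2 \<le> B\<^sup>2" by (intro power_mono B) simp
    then show "((gdiff a ^^ n) v i j l)\<^sup>2 \<le> B\<^sup>2" by simp
  qed simp
  also have "\<dots> = B\<^sup>2" using N0 by (simp add: gsum_const)
  finally have "(\<Sum>k\<in>freqs K. (real_of_int \<bar>k $ a\<bar> / real N) ^ (2 * n) * (cmod (dft N v k))\<^sup>2) \<le> B\<^sup>2" .
  then have "real N ^ (2 * n) * (\<Sum>k\<in>freqs K. (real_of_int \<bar>k $ a\<bar> / real N) ^ (2 * n) * (cmod (dft N v k))\<^sup>2) \<le> real N ^ (2 * n) * B\<^sup>2"
    by (rule mult_left_mono) simp
  moreover have "real N ^ (2 * n) * (\<Sum>k\<in>freqs K. (real_of_int \<bar>k $ a\<bar> / real N) ^ (2 * n) * (cmod (dft N v k))\<^sup>2)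
     = (\<Sum>k\<in>freqs K. (real_of_int \<bar>k $ a\<bar>) ^ (2 * n) * (cmod (dft N v k))\<^sup>2)"
    unfolding sum_distrib_left using N0 by (intro sum.cong refl) (simp add: power_divide)
  ultimately show ?thesis by (simp add: power_mult_distrib power_mult[symmetric] mult.commute)
qed

definition grid_point :: "real \<Rightarrow> nat \<Rightarrow> int \<Rightarrow> int \<Rightarrow> int \<Rightarrow> real^3" where
  "grid_point L N i j l = vector [(of_int i - 1/2) * mesh L N, (of_int j - 1/2) * mesh L N, (of_int l - 1/2) * mesh L N]"

lemma grid_proj_eval: "grid_proj L N f i j l = f (grid_point L N i j l)"
  by (simp add: grid_proj_def grid_point_def)

lemma grid_point_nth:
  "grid_point L N i j l $ 1 = (of_int i - 1/2) * mesh L N"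
  "grid_point L N i j l $ 2 = (of_int j - 1/2) * mesh L N"
  "grid_point L N i j l $ 3 = (of_int l - 1/2) * mesh L N"
  by (simp_all add: grid_point_def vector_3)

lemma grid_point_shift:
  "grid_point L N (i + m) j l = grid_point L N i j l + (of_int m * mesh L N) *\<^sub>R axis 1 1"
  "grid_point L N i (j + m) l = grid_point L N i j l + (of_int m * mesh L N) *\<^sub>R axis 2 1"
  "grid_point L N i j (l + m) = grid_point L N i j l + (of_int m * mesh L N) *\<^sub>R axis 3 1"
  by (simp_all add: vec_eq_iff forall_3 grid_point_nth axis_def algebra_simps)

lemma grid_point_offset:
  "grid_point L N (i + offset a 1) (j + offset a 2) (l + offset a 3) = grid_point L N i j l + mesh L N *\<^sub>R axis a 1"
  using exhaust_3[of a] grid_point_shift[of L N, where m = 1] by (auto simp: offset_def)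

lemma grid_proj_per:
  assumes f: "periodic L f" and N: "N > 0"
  shows "grid_proj L N f \<in> grid_per N"
proof -
  have "real N * mesh L N = L" using N by (simp add: mesh_def)
  then show ?thesis using f
    by (simp add: grid_per_def grid_proj_eval grid_point_shift periodic_def)
qed

lemma grid_lap_grid_proj:
  "grid_lap L N (grid_proj L N f) i j l = lap_h (mesh L N) f (grid_point L N i j l)"
  using grid_point_shift[of L N, where m = 1] grid_point_shift[of L N, where m = "-1"]
  by (simp add: grid_lap_def lap_h_def diff2_def grid_proj_eval sum_3 add_divide_distrib diff_divide_distrib)

definition fdiff :: "real \<Rightarrow> 3 \<Rightarrow> (real^3 \<Rightarrow> real) \<Rightarrow> real^3 \<Rightarrow> real" where
  "fdiff h a f x = f (x + h *\<^sub>R axis a 1) - f x"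

lemma gdiff_grid_proj_power:
  "(gdiff a ^^ n) (grid_proj L N f) = grid_proj L N ((fdiff (mesh L N) a ^^ n) f)"
proof (induction n)
  case (Suc n)
  have "gdiff a (grid_proj L N g) = grid_proj L N (fdiff (mesh L N) a g)" for g
    by (intro ext) (simp add: gdiff_def grid_proj_eval fdiff_def grid_point_offset)
  then show ?case using Suc by simp
qed simp

lemma has_line_deriv_fdiff:
  "has_line_deriv a g g' \<Longrightarrow> has_line_deriv a (fdiff h b g) (fdiff h b g')"
  unfolding fdiff_def[abs_def] by (intro has_line_deriv_diff has_line_deriv_translate)

text \<open>One mean value step per difference; the derivative of a difference is the difference of the
  derivative.\<close>

lemma fdiff_power_bound:
  assumes "\<And>m. m < n \<Longrightarrow> has_line_deriv a (u m) (u (Suc m))" "\<And>x. \<bar>u n x\<bar> \<le> B"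
  shows "\<bar>(fdiff h a ^^ n) (u 0) x\<bar> \<le> \<bar>h\<bar> ^ n * B"
  using assms
proof (induction n arbitrary: u x)
  case (Suc n)
  have ld: "has_line_deriv a ((fdiff h a ^^ n) (u 0)) ((fdiff h a ^^ n) (u 1))"
  proof -
    have "has_line_deriv a ((fdiff h a ^^ m) (u 0)) ((fdiff h a ^^ m) (u 1))" for m
      by (induction m) (use Suc.prems(1)[of 0] in \<open>auto intro: has_line_deriv_fdiff\<close>)
    then show ?thesis .
  qed
  have b: "\<bar>(fdiff h a ^^ n) (u 1) y\<bar> \<le> \<bar>h\<bar> ^ n * B" for y
    using Suc.IH[of "\<lambda>m. u (Suc m)" y] Suc.prems by auto
  let ?g = "\<lambda>s. (fdiff h a ^^ n) (u 0) (x + s *\<^sub>R axis a 1)"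
  have "norm (?g h - ?g 0) \<le> (\<bar>h\<bar> ^ n * B) * norm (h - 0)"
  proof (rule field_differentiable_bound[of UNIV])
    show "(?g has_field_derivative (fdiff h a ^^ n) (u 1) (x + s *\<^sub>R axis a 1)) (at s within UNIV)" for s
      using ld unfolding has_line_deriv_def by simp
    show "norm ((fdiff h a ^^ n) (u 1) (x + s *\<^sub>R axis a 1)) \<le> \<bar>h\<bar> ^ n * B" for s using b by simp
  qed auto
  moreover have "(fdiff h a ^^ Suc n) (u 0) x = ?g h - ?g 0"
    by (simp add: fdiff_def[of h a "(fdiff h a ^^ n) (u 0)"])
  ultimately show ?case by (simp add: mult_ac)
qed simp

text \<open>The norm that defines the frequency ball of the projection, as a real number.\<close>

definition l1norm :: "int^3 \<Rightarrow> real" where "l1norm k = of_int (\<Sum>a\<in>UNIV. \<bar>k $ a\<bar>)"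

lemma l1norm_nonneg: "l1norm k \<ge> 0" by (simp add: l1norm_def sum_nonneg)

text \<open>Six differences of a \<open>C\<^sup>6\<close> function are of size \<open>h ^ 6\<close>, and \<open>N ^ 6 * h ^ 6 = L ^ 6\<close>: the
  bound does not depend on the grid.\<close>

lemma dft_sobolev:
  assumes L: "L > 0" and f: "f \<in> Ck_per 6 L" and M: "Ck_norm 6 f \<le> M" and N: "N = 2 * K + 1"
  shows "(\<Sum>k\<in>freqs K. l1norm k ^ 12 * (cmod (dft N (grid_proj L N f) k))\<^sup>2) \<le> 3 ^ 13 * (L ^ 6 * M)\<^sup>2"
proof -
  let ?v = "grid_proj L N f"
  have N0: "N > 0" using N by simp
  have per: "?v \<in> grid_per N" using f by (intro grid_proj_per N0) (simp add: Ck_per_def)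
  have h: "mesh L N > 0" by (rule mesh_pos[OF L N0])
  have D: "(\<Sum>k\<in>freqs K. (real_of_int \<bar>k $ a\<bar>) ^ 12 * (cmod (dft N ?v k))\<^sup>2) \<le> (L ^ 6 * M)\<^sup>2" for a
  proof -
    have B: "\<bar>(gdiff a ^^ 6) ?v i j l\<bar> \<le> mesh L N ^ 6 * M" for i j l
    proof -
      define u where "u = (\<lambda>n. partials (replicate n a) f)"
      have "\<bar>(fdiff (mesh L N) a ^^ 6) (u 0) (grid_point L N i j l)\<bar> \<le> \<bar>mesh L N\<bar> ^ 6 * M"
      proof (rule fdiff_power_bound)
        show "has_line_deriv a (u m) (u (Suc m))" if "m < 6" for m
          using Ck_per_line_deriv[OF f, of "replicate m a" a] that by (simp add: u_def)
        show "\<bar>u 6 x\<bar> \<le> M" for x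
          using Ck_norm_bound[OF L f, of "replicate 6 a" x] M by (simp add: u_def del: partials.simps)
      qed
      then show ?thesis unfolding gdiff_grid_proj_power grid_proj_eval using h by (simp add: u_def)
    qed
    have e: "real N ^ 6 * (mesh L N ^ 6 * M) = L ^ 6 * M"
      using N0 by (simp add: mesh_def power_divide)
    show ?thesis using dft_decay[OF N per B] unfolding e by simp
  qed
  have "l1norm k ^ 12 \<le> 3 ^ 12 * (\<Sum>a\<in>UNIV. (real_of_int \<bar>k $ a\<bar>) ^ 12)" for k
  proof -
    (* the largest component carries at least a third of the norm *)
    have "\<exists>a. \<forall>b. \<bar>k $ b\<bar> \<le> \<bar>k $ a\<bar>"
    proof -
      have "\<exists>a\<in>UNIV. \<forall>b\<in>UNIV. \<bar>k $ b\<bar> \<le> \<bar>k $ a\<bar>"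
        using Max_in[of "range (\<lambda>a. \<bar>k $ a\<bar>)"] Max_ge[of "range (\<lambda>a. \<bar>k $ a\<bar>)"] by fastforce
      then show ?thesis by blast
    qed
    then obtain a where a: "\<And>b. \<bar>k $ b\<bar> \<le> \<bar>k $ a\<bar>" by blast
    have "(\<Sum>b\<in>UNIV. \<bar>k $ b\<bar>) \<le> (\<Sum>b\<in>(UNIV::3 set). \<bar>k $ a\<bar>)" by (intro sum_mono a)
    then have "(\<Sum>b\<in>UNIV. \<bar>k $ b\<bar>) \<le> 3 * \<bar>k $ a\<bar>" by simp
    then have "l1norm k \<le> 3 * real_of_int \<bar>k $ a\<bar>"
      unfolding l1norm_def by (metis of_int_le_iff of_int_mult of_int_numeral)
    then have "l1norm k ^ 12 \<le> (3 * real_of_int \<bar>k $ a\<bar>) ^ 12" using l1norm_nonneg by (rule power_mono)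
    also have "\<dots> = 3 ^ 12 * (real_of_int \<bar>k $ a\<bar>) ^ 12" by (rule power_mult_distrib)
    also have "\<dots> \<le> 3 ^ 12 * (\<Sum>a\<in>UNIV. (real_of_int \<bar>k $ a\<bar>) ^ 12)"
      by (intro mult_left_mono member_le_sum) auto
    finally show ?thesis .
  qed
  then have "(\<Sum>k\<in>freqs K. l1norm k ^ 12 * (cmod (dft N ?v k))\<^sup>2)
    \<le> (\<Sum>k\<in>freqs K. 3 ^ 12 * (\<Sum>a\<in>UNIV. (real_of_int \<bar>k $ a\<bar>) ^ 12) * (cmod (dft N ?v k))\<^sup>2)"
    by (intro sum_mono mult_right_mono) auto
  also have "\<dots> = 3 ^ 12 * (\<Sum>a\<in>UNIV. \<Sum>k\<in>freqs K. (real_of_int \<bar>k $ a\<bar>) ^ 12 * (cmod (dft N ?v k))\<^sup>2)"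
    unfolding sum_3 by (simp only: sum_distrib_left sum.distrib[symmetric] ring_distribs mult.assoc)
  also have "\<dots> \<le> 3 ^ 12 * (\<Sum>a\<in>(UNIV::3 set). (L ^ 6 * M)\<^sup>2)"
    by (intro mult_left_mono sum_mono D) simp
  finally show ?thesis by simp
qed

text \<open>Of the twelve powers eight give the rate and four make the sum over three-dimensional
  frequencies converge: \<open>1 / l1norm k ^ 4\<close> is bounded by a product of three one-dimensional
  summable factors with exponent \<open>4/3\<close>.\<close>

lemma sum_l1norm_tail:
  "\<exists>Z>0. \<forall>K (K0::nat). (\<Sum>k\<in>{k \<in> freqs K. l1norm k > real K0}. 1 / l1norm k ^ 12) \<le> Z / (real K0 + 1) ^ 8"
proof -
  define s where "s = (\<lambda>m::int. (1 + real_of_int \<bar>m\<bar>) powr (- 4/3))"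
  define Z where "Z = (\<Sum>n. real (Suc n) powr (- 4/3))"
  have sm: "summable (\<lambda>n. real (Suc n) powr (- 4/3))"
    using summable_Suc_iff[of "\<lambda>n. real n powr (- 4/3)"] summable_real_powr_iff[of "- 4/3"] by simp
  have Z0: "Z \<ge> 0" unfolding Z_def by (intro suminf_nonneg sm) simp
  have s0: "s m \<ge> 0" for m by (simp add: s_def)
  have S: "(\<Sum>m | \<bar>m\<bar> \<le> int K. s m) \<le> 2 * Z" for K
  proof -
    have "{m. \<bar>m\<bar> \<le> int K} = int ` {..K} \<union> (\<lambda>n. - int n) ` {..K}"
    proof (intro equalityI subsetI)
      fix m assume "m \<in> {m. \<bar>m\<bar> \<le> int K}"
      then have "m = int (nat m) \<and> nat m \<le> K \<or> m = - int (nat (- m)) \<and> nat (- m) \<le> K" by auto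
      then show "m \<in> int ` {..K} \<union> (\<lambda>n. - int n) ` {..K}" by blast
    qed auto
    then have "(\<Sum>m | \<bar>m\<bar> \<le> int K. s m) \<le> sum s (int ` {..K}) + sum s ((\<lambda>n. - int n) ` {..K})"
      using sum_Un[of "int ` {..K}" "(\<lambda>n. - int n) ` {..K}" s]
        sum_nonneg[of "int ` {..K} \<inter> (\<lambda>n. - int n) ` {..K}" s] s0 by simp
    also have "sum s (int ` {..K}) = (\<Sum>n\<le>K. real (Suc n) powr (- 4/3))"
      by (subst sum.reindex) (auto simp: inj_on_def s_def add.commute)
    also have "sum s ((\<lambda>n. - int n) ` {..K}) = (\<Sum>n\<le>K. real (Suc n) powr (- 4/3))"
      by (subst sum.reindex) (auto simp: inj_on_def s_def add.commute)
    also have "(\<Sum>n\<le>K. real (Suc n) powr (- 4/3)) \<le> Z"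
      unfolding Z_def by (intro sum_le_suminf sm) auto
    finally show ?thesis by simp
  qed
  have le: "1 / l1norm k ^ 4 \<le> 16 * (s (k $ 1) * (s (k $ 2) * s (k $ 3)))" if "l1norm k \<ge> 1" for k
  proof -
    have n: "1 + real_of_int \<bar>k $ a\<bar> \<le> 2 * l1norm k" for a
    proof -
      have "\<bar>k $ a\<bar> \<le> (\<Sum>a\<in>UNIV. \<bar>k $ a\<bar>)" by (intro member_le_sum) auto
      then have "real_of_int \<bar>k $ a\<bar> \<le> l1norm k" unfolding l1norm_def by (simp only: of_int_le_iff)
      then show ?thesis using that by linarith
    qed
    have m: "(2 * l1norm k) powr (- 4/3) \<le> s (k $ a)" for a
      unfolding s_def using n[of a] by (intro powr_mono2') auto
    have "1 / (16 * l1norm k ^ 4) = (2 * l1norm k) powr (- 4/3) * ((2 * l1norm k) powr (- 4/3) * (2 * l1norm k) powr (- 4/3))"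
    proof -
      have "(2 * l1norm k) powr (- 4/3) * ((2 * l1norm k) powr (- 4/3) * (2 * l1norm k) powr (- 4/3)) = (2 * l1norm k) powr (- 4)"
        unfolding powr_add[symmetric] by simp
      also have "\<dots> = 1 / (2 * l1norm k) ^ 4"
      proof -
        have "(2 * l1norm k) powr 4 = (2 * l1norm k) ^ 4" using that by (intro powr_numeral) linarith
        then show ?thesis by (simp only: powr_minus_divide)
      qed
      also have "(2 * l1norm k) ^ 4 = 16 * l1norm k ^ 4" unfolding power_mult_distrib by simp
      finally show ?thesis by (rule sym)
    qed
    also have "\<dots> \<le> s (k $ 1) * (s (k $ 2) * s (k $ 3))"
      by (intro mult_mono m mult_nonneg_nonneg s0) auto
    finally show ?thesis by simp
  qed
  have "(\<Sum>k\<in>{k \<in> freqs K. l1norm k > real K0}. 1 / l1norm k ^ 12) \<le> (16 * (2 * Z) ^ 3 + 1) / (real K0 + 1) ^ 8" for K K0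
  proof -
    have "(\<Sum>k\<in>{k \<in> freqs K. l1norm k > real K0}. 1 / l1norm k ^ 12)
      \<le> (\<Sum>k\<in>{k \<in> freqs K. l1norm k > real K0}. (1 / (real K0 + 1) ^ 8) * (16 * (s (k $ 1) * (s (k $ 2) * s (k $ 3)))))"
    proof (rule sum_mono)
      fix k assume "k \<in> {k \<in> freqs K. l1norm k > real K0}"
      then have "real_of_int (int K0) < of_int (\<Sum>a\<in>UNIV. \<bar>k $ a\<bar>)"
        unfolding l1norm_def by (simp only: mem_Collect_eq of_int_of_nat_eq)
      then have "int K0 < (\<Sum>a\<in>UNIV. \<bar>k $ a\<bar>)" by (simp only: of_int_less_iff)
      then have "int K0 + 1 \<le> (\<Sum>a\<in>UNIV. \<bar>k $ a\<bar>)" by simp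
      then have g: "l1norm k \<ge> real K0 + 1" unfolding l1norm_def by linarith
      then have g1: "l1norm k \<ge> 1" by linarith
      have "1 / l1norm k ^ 12 = (1 / l1norm k ^ 8) * (1 / l1norm k ^ 4)" by (simp add: power_add[symmetric])
      also have "\<dots> \<le> (1 / (real K0 + 1) ^ 8) * (16 * (s (k $ 1) * (s (k $ 2) * s (k $ 3))))"
        using g g1 by (intro mult_mono le divide_left_mono power_mono mult_pos_pos zero_less_power) auto
      finally show "1 / l1norm k ^ 12 \<le> (1 / (real K0 + 1) ^ 8) * (16 * (s (k $ 1) * (s (k $ 2) * s (k $ 3))))" .
    qed
    also have "\<dots> \<le> (\<Sum>k\<in>freqs K. (1 / (real K0 + 1) ^ 8) * (16 * (s (k $ 1) * (s (k $ 2) * s (k $ 3)))))"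
      by (intro sum_mono2 finite_freqs) (auto simp: s0)
    also have "\<dots> = (1 / (real K0 + 1) ^ 8) * (16 * (\<Sum>k\<in>freqs K. s (k $ 1) * (s (k $ 2) * s (k $ 3))))"
      by (simp only: sum_distrib_left)
    also have "(\<Sum>k\<in>freqs K. s (k $ 1) * (s (k $ 2) * s (k $ 3)))
        = (\<Sum>m | \<bar>m\<bar> \<le> int K. s m) * ((\<Sum>m | \<bar>m\<bar> \<le> int K. s m) * (\<Sum>m | \<bar>m\<bar> \<le> int K. s m))"
      unfolding freqs_def sum_vec3[of "\<lambda>a b c. s a * (s b * s c)"]
      by (simp only: sum_distrib_left[symmetric] sum_distrib_right[symmetric])
    also have "(1 / (real K0 + 1) ^ 8) * (16 * \<dots>) \<le> (1 / (real K0 + 1) ^ 8) * (16 * ((2 * Z) * ((2 * Z) * (2 * Z))))"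
      using Z0 by (intro mult_left_mono mult_mono S mult_nonneg_nonneg sum_nonneg s0) auto
    also have "\<dots> = (16 * (2 * Z) ^ 3) / (real K0 + 1) ^ 8"
      by (simp add: power3_eq_cube)
    also have "\<dots> \<le> (16 * (2 * Z) ^ 3 + 1) / (real K0 + 1) ^ 8"
      by (intro divide_right_mono) auto
    finally show ?thesis .
  qed
  moreover have "16 * (2 * Z) ^ 3 + 1 > 0" using Z0 by (simp add: add_nonneg_pos)
  ultimately show ?thesis by blast
qed

lemma cmod_wave: "cmod (wave N k i j l) = 1"
  by (simp add: wave_def wave1_def norm_mult)

text \<open>Truncation error of the discrete Fourier expansion at the grid points, with the cut-off \<open>K0\<close>
  independent of the grid. It follows from the discrete Sobolev bound by Cauchy--Schwarz; the rate
  four is six minus two, and \<open>2 > 3/2\<close>.\<close>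

lemma dft_truncation:
  assumes L: "L > 0"
  shows "\<exists>C>0. \<forall>f M K K0 i j l. f \<in> Ck_per 6 L \<and> Ck_norm 6 f \<le> M \<and> (i,j,l) \<in> grid_indices (2 * K + 1) \<longrightarrow>
    cmod (of_real (f (grid_point L (2 * K + 1) i j l))
      - (\<Sum>k\<in>{k \<in> freqs K. l1norm k \<le> real K0}. dft (2 * K + 1) (grid_proj L (2 * K + 1) f) k * wave (2 * K + 1) k i j l))
    \<le> C * M / (real K0 + 1) ^ 4"
proof -
  obtain Z where Z: "Z > 0" "\<And>K K0. (\<Sum>k\<in>{k \<in> freqs K. l1norm k > real K0}. 1 / l1norm k ^ 12) \<le> Z / (real K0 + 1) ^ 8"
    using sum_l1norm_tail by blast
  define C where "C = sqrt (Z * 3 ^ 13) * L ^ 6"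
  have C0: "C > 0" using Z L by (simp add: C_def)
  have "cmod (of_real (f (grid_point L N i j l)) - (\<Sum>k\<in>{k \<in> freqs K. l1norm k \<le> real K0}. dft N (grid_proj L N f) k * wave N k i j l))
     \<le> C * M / (real K0 + 1) ^ 4"
    if f: "f \<in> Ck_per 6 L" and M: "Ck_norm 6 f \<le> M" and p: "(i,j,l) \<in> grid_indices N" and N: "N = 2 * K + 1" for f M N K K0 i j l
  proof -
    have M0: "M \<ge> 0" using Ck_norm_bound[OF L f, of "[]" 0] M by simp
    let ?v = "dft N (grid_proj L N f)"
    define A where "A = {k \<in> freqs K. l1norm k \<le> real K0}"
    define B where "B = {k \<in> freqs K. l1norm k > real K0}"
    have AB: "freqs K = A \<union> B" "A \<inter> B = {}" "finite A" "finite B"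
      using finite_freqs by (auto simp: A_def B_def intro: finite_subset)
    have "of_real (f (grid_point L N i j l)) = (\<Sum>k\<in>freqs K. ?v k * wave N k i j l)"
      using dft_inversion[OF N p, of "grid_proj L N f"] by (simp add: grid_proj_eval)
    also have "\<dots> = (\<Sum>k\<in>A. ?v k * wave N k i j l) + (\<Sum>k\<in>B. ?v k * wave N k i j l)"
      unfolding AB(1) by (rule sum.union_disjoint) (use AB in auto)
    finally have "cmod (of_real (f (grid_point L N i j l)) - (\<Sum>k\<in>A. ?v k * wave N k i j l)) = cmod (\<Sum>k\<in>B. ?v k * wave N k i j l)"
      by simp
    also have "\<dots> \<le> (\<Sum>k\<in>B. cmod (?v k))"
      by (rule order_trans[OF norm_sum]) (simp add: norm_mult cmod_wave)
    also have "\<dots> \<le> C * M / (real K0 + 1) ^ 4"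
    proof (rule power2_le_imp_le)
      have "(\<Sum>k\<in>B. cmod (?v k)) = (\<Sum>k\<in>B. (1 / l1norm k ^ 6) * (l1norm k ^ 6 * cmod (?v k)))"
        by (intro sum.cong refl) (auto simp: B_def)
      then have "(\<Sum>k\<in>B. cmod (?v k))\<^sup>2 \<le> (\<Sum>k\<in>B. (1 / l1norm k ^ 6)\<^sup>2) * (\<Sum>k\<in>B. (l1norm k ^ 6 * cmod (?v k))\<^sup>2)"
        using Cauchy_Schwarz_ineq_sum[of "\<lambda>k. 1 / l1norm k ^ 6" "\<lambda>k. l1norm k ^ 6 * cmod (?v k)" B] by simp
      also have "(\<Sum>k\<in>B. (1 / l1norm k ^ 6)\<^sup>2) = (\<Sum>k\<in>B. 1 / l1norm k ^ 12)"
        by (simp add: power_one_over power_divide power_mult[symmetric])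
      also have "(\<Sum>k\<in>B. (l1norm k ^ 6 * cmod (?v k))\<^sup>2) = (\<Sum>k\<in>B. l1norm k ^ 12 * (cmod (?v k))\<^sup>2)"
        by (simp add: power_mult_distrib power_mult[symmetric])
      also have "(\<Sum>k\<in>B. 1 / l1norm k ^ 12) * (\<Sum>k\<in>B. l1norm k ^ 12 * (cmod (?v k))\<^sup>2)
        \<le> (Z / (real K0 + 1) ^ 8) * (3 ^ 13 * (L ^ 6 * M)\<^sup>2)"
      proof (intro mult_mono)
        show "(\<Sum>k\<in>B. 1 / l1norm k ^ 12) \<le> Z / (real K0 + 1) ^ 8" unfolding B_def by (rule Z)
        have "(\<Sum>k\<in>B. l1norm k ^ 12 * (cmod (?v k))\<^sup>2) \<le> (\<Sum>k\<in>freqs K. l1norm k ^ 12 * (cmod (?v k))\<^sup>2)"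
          by (intro sum_mono2 finite_freqs) (auto simp: B_def l1norm_nonneg)
        also have "\<dots> \<le> 3 ^ 13 * (L ^ 6 * M)\<^sup>2" by (rule dft_sobolev[OF L f M N])
        finally show "(\<Sum>k\<in>B. l1norm k ^ 12 * (cmod (?v k))\<^sup>2) \<le> 3 ^ 13 * (L ^ 6 * M)\<^sup>2" .
      qed (use Z in \<open>auto intro!: sum_nonneg simp: l1norm_nonneg\<close>)
      also have "\<dots> = (C * M / (real K0 + 1) ^ 4)\<^sup>2"
        using Z by (simp add: C_def power_mult_distrib power_divide power_mult[symmetric] del: of_nat_Suc)
      finally show "(\<Sum>k\<in>B. cmod (?v k))\<^sup>2 \<le> (C * M / (real K0 + 1) ^ 4)\<^sup>2" .
    qed (use C0 M0 in simp)
    finally show ?thesis unfolding A_def .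
  qed
  then show ?thesis using C0 by blast
qed

section \<open>The Fourier projection\<close>

lemma Omega_eq_box: "Omega L = box 0 (\<chi> i. L)" by (simp add: Omega_def)

lemma content_cube3:
  fixes a b :: "real^3"
  assumes "\<And>i. b $ i = a $ i + h" "h \<ge> 0"
  shows "measure lborel (cbox a b) = h ^ 3"
proof -
  have "a \<in> cbox a b" using assms by (simp add: mem_box_cart)
  then have "cbox a b \<noteq> {}" by blast
  then have "measure lborel (cbox a b) = (\<Prod>i\<in>UNIV. b $ i - a $ i)" by (rule content_cbox_cart)
  also have "\<dots> = (\<Prod>i\<in>(UNIV::3 set). h)" by (intro prod.cong refl) (simp add: assms(1))
  finally show ?thesis by simp
qed

text \<open>The midpoint values define a step function on the half-open cells \<open>C p\<close>, which differs from
  \<open>F\<close> by at most the oscillation of \<open>F\<close>; its integral is the Riemann sum.\<close>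

lemma riemann_sum_error:
  fixes F :: "real^3 \<Rightarrow> complex"
  assumes L: "L > 0" and N: "N > 0" and cont: "continuous_on UNIV F"
    and e: "\<And>x y. x \<in> cbox 0 (\<chi> i. L) \<Longrightarrow> y \<in> cbox 0 (\<chi> i. L) \<Longrightarrow> dist x y < 4 * mesh L N \<Longrightarrow> dist (F x) (F y) \<le> e"
  shows "cmod (csum N (\<lambda>i j l. F (grid_point L N i j l)) / of_nat N ^ 3 - integral (Omega L) F / of_real (L ^ 3)) \<le> e"
proof -
  define h where "h = mesh L N"
  have h: "h > 0" and hN: "real N * h = L" using mesh_pos[OF L N] N by (simp_all add: h_def mesh_def)
  define C where "C = (\<lambda>(i::int,j::int,l::int). {x::real^3. (of_int i - 1) * h \<le> x $ 1 \<and> x $ 1 < of_int i * h \<and>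
     (of_int j - 1) * h \<le> x $ 2 \<and> x $ 2 < of_int j * h \<and> (of_int l - 1) * h \<le> x $ 3 \<and> x $ 3 < of_int l * h} \<inter> Omega L)"
  define G where "G = (\<lambda>(i,j,l). F (grid_point L N i j l))"
  have ci: "((\<lambda>x. if x \<in> C p then G p else 0) has_integral (h ^ 3 *\<^sub>R G p)) (Omega L)" if p: "p \<in> grid_indices N" for p
  proof -
    obtain i j l where pe: "p = (i,j,l)" by (cases p)
    have r: "1 \<le> i" "i \<le> int N" "1 \<le> j" "j \<le> int N" "1 \<le> l" "l \<le> int N"
      using p by (auto simp: pe grid_indices_def)
    define a :: "real^3" where "a = vector [(of_int i - 1) * h, (of_int j - 1) * h, (of_int l - 1) * h]"
    define b :: "real^3" where "b = vector [of_int i * h, of_int j * h, of_int l * h]"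
    have ab: "a $ 1 = (of_int i - 1) * h" "a $ 2 = (of_int j - 1) * h" "a $ 3 = (of_int l - 1) * h"
      "b $ 1 = of_int i * h" "b $ 2 = of_int j * h" "b $ 3 = of_int l * h"
      by (simp_all add: a_def b_def vector_3)
    have lo: "0 \<le> (of_int m - 1) * h" if "1 \<le> m" for m :: int using that h by simp
    have hi: "of_int m * h \<le> L" if "m \<le> int N" for m :: int
      unfolding hN[symmetric] using that h by (intro mult_right_mono) auto
    have sub1: "box a b \<subseteq> C p"
    proof
      fix x assume "x \<in> box a b"
      then show "x \<in> C p"
        using lo[OF r(1)] lo[OF r(3)] lo[OF r(5)] hi[OF r(2)] hi[OF r(4)] hi[OF r(6)]
        by (auto simp: C_def pe Omega_def mem_box_cart forall_3 ab)
    qed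
    have sub2: "C p \<subseteq> cbox a b"
      by (auto simp: C_def pe mem_box_cart forall_3 ab)
    have neg: "negligible S" if "S \<subseteq> cbox a b - box a b" for S
      using negligible_frontier_interval negligible_subset that by blast
    have "measure lborel (cbox a b) = h ^ 3"
    proof (rule content_cube3)
      show "b $ i = a $ i + h" for i using exhaust_3[of i] by (auto simp: ab algebra_simps)
    qed (use h in simp)
    then have "((\<lambda>x. G p) has_integral (h ^ 3 *\<^sub>R G p)) (cbox a b)"
      using has_integral_const[of "G p" a b] by simp
    then have "((\<lambda>x. G p) has_integral (h ^ 3 *\<^sub>R G p)) (C p)"
      by (rule has_integral_spike_set_eq[THEN iffD1, rotated 2]) (use sub1 sub2 in \<open>auto intro!: neg\<close>)
    moreover have "C p \<subseteq> Omega L" by (auto simp: C_def pe)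
    ultimately show ?thesis by simp
  qed
  define fN where "fN = (\<lambda>x. \<Sum>p\<in>grid_indices N. if x \<in> C p then G p else 0)"
  have int1: "(fN has_integral (\<Sum>p\<in>grid_indices N. h ^ 3 *\<^sub>R G p)) (Omega L)"
    unfolding fN_def by (intro has_integral_sum finite_grid_indices ci)
  have Fi: "F integrable_on Omega L"
    unfolding Omega_eq_box integrable_on_open_interval
    by (rule integrable_continuous) (rule continuous_on_subset[OF cont], simp)
  have bound: "norm (fN x - F x) \<le> e" if x: "x \<in> Omega L" for x
  proof -
    define n where "n = (\<lambda>a. \<lfloor>x $ a / h\<rfloor> + 1)"
    have xa: "0 < x $ a" "x $ a < L" for a using x by (auto simp: Omega_def mem_box_cart)
    have na: "(of_int (n a) - 1) * h \<le> x $ a" "x $ a < of_int (n a) * h" for a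
    proof -
      have "of_int \<lfloor>x $ a / h\<rfloor> * h \<le> x $ a"
        using of_int_floor_le[of "x $ a / h"] unfolding pos_le_divide_eq[OF h] .
      moreover have "x $ a / h < of_int \<lfloor>x $ a / h\<rfloor> + 1" by linarith
      then have "x $ a < (of_int \<lfloor>x $ a / h\<rfloor> + 1) * h" unfolding pos_divide_less_eq[OF h] .
      ultimately show "(of_int (n a) - 1) * h \<le> x $ a" "x $ a < of_int (n a) * h"
        by (simp_all add: n_def)
    qed
    have uniq: "m = n a" if "(of_int m - 1) * h \<le> x $ a" "x $ a < of_int m * h" for m a
    proof -
      have "(of_int m - 1) * h < of_int (n a) * h" "(of_int (n a) - 1) * h < of_int m * h"
        using that na[of a] by linarith+
      then have "(of_int m - 1 :: real) < of_int (n a)" "(of_int (n a) - 1 :: real) < of_int m"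
        unfolding mult_less_cancel_right_pos[OF h] .
      then show ?thesis by linarith
    qed
    have nr: "1 \<le> n a" "n a \<le> int N" for a
    proof -
      have "0 < of_int (n a) * h" using na(2)[of a] xa(1)[of a] by linarith
      then show "1 \<le> n a" using h by (simp add: zero_less_mult_iff)
      have "(of_int (n a) - 1) * h < real N * h" using na(1)[of a] xa(2)[of a] hN by linarith
      then have "of_int (n a) - 1 < real N" unfolding mult_less_cancel_right_pos[OF h] .
      then show "n a \<le> int N" by linarith
    qed
    (* the only cell that contains \<open>x\<close> *)
    define q where "q = (n 1, n 2, n 3)"
    have q: "q \<in> grid_indices N" by (simp add: q_def grid_indices_def nr)
    have "x \<in> C p \<longleftrightarrow> p = q" for p
      using uniq na x by (cases p) (auto simp: C_def q_def)
    then have "fN x = (\<Sum>p\<in>grid_indices N. if p = q then G p else 0)" unfolding fN_def by simp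
    also have "\<dots> = G q" using q by (simp add: finite_grid_indices)
    finally have fx: "fN x = F (grid_point L N (n 1) (n 2) (n 3))" by (simp add: G_def q_def)
    let ?y = "grid_point L N (n 1) (n 2) (n 3)"
    have ya: "?y $ a = (of_int (n a) - 1/2) * h" for a
      using exhaust_3[of a] by (auto simp: grid_point_nth h_def)
    have d1: "\<bar>(?y - x) $ a\<bar> \<le> h" for a
    proof -
      have "(of_int (n a) - 1/2) * h - x $ a \<le> h" "x $ a - (of_int (n a) - 1/2) * h \<le> h"
        using na[of a] h by (simp_all add: algebra_simps)
      then show ?thesis using ya[of a] by (simp add: abs_le_iff)
    qed
    have "dist ?y x \<le> (\<Sum>a\<in>UNIV. \<bar>(?y - x) $ a\<bar>)" unfolding dist_norm by (rule norm_le_l1_cart)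
    also have "\<dots> \<le> (\<Sum>a\<in>(UNIV::3 set). h)" by (intro sum_mono d1)
    also have "\<dots> < 4 * mesh L N" using h by (simp add: h_def)
    finally have d: "dist ?y x < 4 * mesh L N" .
    have "?y \<in> cbox 0 (\<chi> i. L)"
    proof -
      have "0 \<le> ?y $ a \<and> ?y $ a \<le> L" for a
      proof -
        have 1: "(1::real) \<le> of_int (n a)" "of_int (n a) \<le> real N" using nr[of a] by linarith+
        then have "(of_int (n a) - 1/2) * h \<le> real N * h" using h by (intro mult_right_mono) auto
        moreover have "0 \<le> (of_int (n a) - 1/2) * h" using 1 h by simp
        ultimately show ?thesis unfolding ya hN by simp
      qed
      then show ?thesis by (simp add: mem_box_cart)
    qed
    moreover have "x \<in> cbox 0 (\<chi> i. L)" using xa by (auto simp: mem_box_cart less_imp_le)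
    ultimately show ?thesis using e d fx by (simp add: dist_norm)
  qed
  have "norm (integral (Omega L) (\<lambda>x. fN x - F x)) \<le> integral (Omega L) (\<lambda>x. e)"
    by (rule Henstock_Kurzweil_Integration.integral_norm_bound_integral)
      (use int1 Fi bound in \<open>auto intro!: Henstock_Kurzweil_Integration.integrable_diff simp: has_integral_iff Omega_eq_box integrable_on_open_interval\<close>)
  moreover have "integral (Omega L) (\<lambda>x. e) = L ^ 3 * e"
    unfolding Omega_eq_box integral_open_interval using content_cube3[of "\<chi> i. L" 0 L] L by simp
  moreover have "integral (Omega L) (\<lambda>x. fN x - F x) = (\<Sum>p\<in>grid_indices N. h ^ 3 *\<^sub>R G p) - integral (Omega L) F"
    using int1 Fi by (subst Henstock_Kurzweil_Integration.integral_diff) (auto simp: has_integral_iff)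
  ultimately have b: "norm ((\<Sum>p\<in>grid_indices N. h ^ 3 *\<^sub>R G p) - integral (Omega L) F) \<le> L ^ 3 * e" by simp
  have "(\<Sum>p\<in>grid_indices N. h ^ 3 *\<^sub>R G p) = of_real (h ^ 3) * csum N (\<lambda>i j l. F (grid_point L N i j l))"
    unfolding csum_grid_indices sum_distrib_left by (intro sum.cong) (auto simp: G_def scaleR_conv_of_real)
  moreover have "h ^ 3 = L ^ 3 / real N ^ 3" by (simp add: h_def mesh_def power_divide)
  ultimately have e1: "((\<Sum>p\<in>grid_indices N. h ^ 3 *\<^sub>R G p) - integral (Omega L) F) / of_real (L ^ 3)
    = csum N (\<lambda>i j l. F (grid_point L N i j l)) / of_nat N ^ 3 - integral (Omega L) F / of_real (L ^ 3)"
    using L by (simp add: diff_divide_distrib)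
  have "norm (((\<Sum>p\<in>grid_indices N. h ^ 3 *\<^sub>R G p) - integral (Omega L) F) / of_real (L ^ 3)) \<le> (L ^ 3 * e) / L ^ 3"
    unfolding norm_divide using b L by (simp add: norm_power pos_divide_le_eq mult.commute)
  then show ?thesis unfolding e1 using L by simp
qed

lemma riemann_sum_tendsto:
  fixes F :: "real^3 \<Rightarrow> complex"
  assumes L: "L > 0" and cont: "continuous_on UNIV F"
  shows "(\<lambda>N. csum N (\<lambda>i j l. F (grid_point L N i j l)) / of_nat N ^ 3) \<longlonglongrightarrow> integral (Omega L) F / of_real (L ^ 3)"
proof (rule tendstoI)
  fix e :: real assume e: "e > 0"
  have "uniformly_continuous_on (cbox 0 (\<chi> i. L)) F"
    by (intro compact_uniformly_continuous continuous_on_subset[OF cont] compact_cbox) auto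
  then obtain d where d: "d > 0" "\<And>x y. x \<in> cbox 0 (\<chi> i. L) \<Longrightarrow> y \<in> cbox 0 (\<chi> i. L) \<Longrightarrow> dist x y < d \<Longrightarrow> dist (F x) (F y) < e / 2"
    unfolding uniformly_continuous_on_def using e by (metis half_gt_zero dist_commute)
  obtain N0 :: nat where N0: "real N0 > 4 * L / d" using reals_Archimedean2 by blast
  have "dist (csum N (\<lambda>i j l. F (grid_point L N i j l)) / of_nat N ^ 3) (integral (Omega L) F / of_real (L ^ 3)) < e"
    if N: "N \<ge> max 1 N0" for N
  proof -
    have Np: "real N > 0" "N > 0" using N by auto
    have "4 * L / d < real N" using N N0 by linarith
    then have "4 * L < real N * d" using d by (simp add: pos_divide_less_eq)
    then have "4 * L / real N < d" using Np by (simp add: pos_divide_less_eq mult.commute)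
    then have m: "4 * mesh L N < d" by (simp add: mesh_def)
    have "cmod (csum N (\<lambda>i j l. F (grid_point L N i j l)) / of_nat N ^ 3 - integral (Omega L) F / of_real (L ^ 3)) \<le> e / 2"
    proof (rule riemann_sum_error[OF L Np(2) cont])
      fix x y :: "real^3" assume "x \<in> cbox 0 (\<chi> i. L)" "y \<in> cbox 0 (\<chi> i. L)" "dist x y < 4 * mesh L N"
      then show "dist (F x) (F y) \<le> e / 2" using d(2)[of x y] m by linarith
    qed
    then show ?thesis using e by (simp add: dist_norm)
  qed
  then show "\<forall>\<^sub>F N in sequentially. dist (csum N (\<lambda>i j l. F (grid_point L N i j l)) / of_nat N ^ 3) (integral (Omega L) F / of_real (L ^ 3)) < e"
    unfolding eventually_sequentially by blast
qed

definition fourier_mode :: "real \<Rightarrow> int^3 \<Rightarrow> real^3 \<Rightarrow> complex" where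
  "fourier_mode L k x = exp ((2 * of_real pi * \<i> / of_real L) * of_real (\<Sum>a\<in>UNIV. of_int (k $ a) * x $ a))"

lemma fourier_mode_cis: "fourier_mode L k x = cis (2 * pi / L * (\<Sum>a\<in>UNIV. of_int (k $ a) * x $ a))"
  by (simp add: fourier_mode_def cis_conv_exp mult_ac)

lemma cnj_fourier_mode: "cnj (fourier_mode L k x) = exp (- (2 * of_real pi * \<i> / of_real L) * of_real (\<Sum>a\<in>UNIV. of_int (k $ a) * x $ a))"
proof -
  have "cnj (fourier_mode L k x) = cis (- (2 * pi / L * (\<Sum>a\<in>UNIV. of_int (k $ a) * x $ a)))"
    unfolding fourier_mode_cis cis_cnj ..
  then show ?thesis by (simp add: cis_conv_exp mult_ac)
qed

lemma fourier_coeff_mode: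
  "fourier_coeff L f k = integral (Omega L) (\<lambda>x. of_real (f x) * cnj (fourier_mode L k x)) / of_real (L ^ 3)"
  unfolding fourier_coeff_def cnj_fourier_mode by simp

lemma continuous_fourier_mode: "continuous_on UNIV (fourier_mode L k)"
  unfolding fourier_mode_def[abs_def] by (intro continuous_intros)

lemma fourier_mode_wave:
  assumes L: "L > 0" and N: "N > 0"
  shows "fourier_mode L k (grid_point L N i j l) = wave N k i j l"
proof -
  have "2 * pi / L * (of_int m * ((of_int n - 1/2) * mesh L N)) = 2 * pi * (of_int m * (of_int n - 1/2)) / real N" for m n :: int
    using L N by (simp add: mesh_def)
  then show ?thesis
    unfolding fourier_mode_cis wave_def wave1_def sum_3 grid_point_nth cis_mult ring_distribs(1) by (simp only:)
qed

text \<open>As the grid is refined, discrete Fourier coefficients become Fourier coefficients: they are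
  the Riemann sums of the defining integrals.\<close>

lemma dft_tendsto:
  assumes L: "L > 0" and f: "continuous_on UNIV f"
  shows "(\<lambda>N. dft N (grid_proj L N f) k) \<longlonglongrightarrow> fourier_coeff L f k"
proof -
  have "(\<lambda>N. csum N (\<lambda>i j l. of_real (f (grid_point L N i j l)) * cnj (fourier_mode L k (grid_point L N i j l))) / of_nat N ^ 3)
     \<longlonglongrightarrow> fourier_coeff L f k"
    unfolding fourier_coeff_mode
    by (intro riemann_sum_tendsto[OF L, of "\<lambda>x. of_real (f x) * cnj (fourier_mode L k x)"] continuous_intros f continuous_fourier_mode)
  moreover have "\<forall>\<^sub>F N in sequentially. csum N (\<lambda>i j l. of_real (f (grid_point L N i j l)) * cnj (fourier_mode L k (grid_point L N i j l))) / of_nat N ^ 3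
     = dft N (grid_proj L N f) k"
    using eventually_gt_at_top[of 0]
    by eventually_elim (simp add: dft_def grid_proj_eval fourier_mode_wave[OF L])
  ultimately show ?thesis by (rule Lim_transform_eventually)
qed

lemma fourier_proj_mode:
  "fourier_proj L K f x = Re (\<Sum>k\<in>{k \<in> freqs K. l1norm k \<le> real K}. fourier_coeff L f k * fourier_mode L k x)"
proof -
  have "{k. (\<Sum>a\<in>UNIV. \<bar>k $ a\<bar>) \<le> int K} = {k \<in> freqs K. l1norm k \<le> real K}"
  proof (intro equalityI subsetI)
    fix k :: "int^3" assume k: "k \<in> {k. (\<Sum>a\<in>UNIV. \<bar>k $ a\<bar>) \<le> int K}"
    have "\<bar>k $ a\<bar> \<le> int K" for a
    proof -
      have "\<bar>k $ a\<bar> \<le> (\<Sum>a\<in>UNIV. \<bar>k $ a\<bar>)" by (intro member_le_sum) auto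
      then show ?thesis using k by simp
    qed
    moreover have "l1norm k \<le> real K"
    proof -
      have "real_of_int (\<Sum>a\<in>UNIV. \<bar>k $ a\<bar>) \<le> real_of_int (int K)" using k by (simp only: of_int_le_iff mem_Collect_eq)
      then show ?thesis by (simp only: l1norm_def of_int_of_nat_eq)
    qed
    ultimately show "k \<in> {k \<in> freqs K. l1norm k \<le> real K}" by (simp add: freqs_def)
  next
    fix k assume "k \<in> {k \<in> freqs K. l1norm k \<le> real K}"
    then have "real_of_int (\<Sum>a\<in>UNIV. \<bar>k $ a\<bar>) \<le> real_of_int (int K)" by (simp only: l1norm_def of_int_of_nat_eq mem_Collect_eq)
    then show "k \<in> {k. (\<Sum>a\<in>UNIV. \<bar>k $ a\<bar>) \<le> int K}" by (simp only: of_int_le_iff mem_Collect_eq)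
  qed
  then show ?thesis unfolding fourier_proj_def fourier_mode_def by simp
qed

lemma fourier_mode_periodic: "L > 0 \<Longrightarrow> fourier_mode L k (x + L *\<^sub>R axis i 1) = fourier_mode L k x"
proof -
  assume L: "L > 0"
  have "(\<Sum>a\<in>UNIV. of_int (k $ a) * (x + L *\<^sub>R axis i 1) $ a) = (\<Sum>a\<in>UNIV. of_int (k $ a) * x $ a) + L * of_int (k $ i)"
    using exhaust_3[of i] by (auto simp: sum_3 axis_def algebra_simps)
  then have "2 * pi / L * (\<Sum>a\<in>UNIV. of_int (k $ a) * (x + L *\<^sub>R axis i 1) $ a)
    = 2 * pi / L * (\<Sum>a\<in>UNIV. of_int (k $ a) * x $ a) + 2 * pi * of_int (k $ i)"
    using L by (simp only: ring_distribs) simp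
  then have "fourier_mode L k (x + L *\<^sub>R axis i 1) = cis (2 * pi / L * (\<Sum>a\<in>UNIV. of_int (k $ a) * x $ a) + 2 * pi * of_int (k $ i))"
    by (simp only: fourier_mode_cis)
  also have "\<dots> = fourier_mode L k x * cis (2 * pi * of_int (k $ i))" by (simp only: cis_mult[symmetric] fourier_mode_cis)
  finally show ?thesis by (simp only: cis_multiple_2pi Ints_of_int mult_1_right)
qed

lemma periodic_fourier_proj: "L > 0 \<Longrightarrow> periodic L (fourier_proj L K f)"
  unfolding periodic_def fourier_proj_mode by (simp add: fourier_mode_periodic)

text \<open>Grid sums do not see any resolved frequency except \<open>0\<close>. So the grid mass of a projected
  function is its zeroth Fourier coefficient times the number of grid points.\<close>

lemma csum_wave:
  assumes N: "N = 2 * K + 1" and k: "k \<in> freqs K"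
  shows "csum N (wave N k) = (if k = 0 then of_nat N ^ 3 else 0)"
proof -
  have N0: "N > 0" using N by simp
  have w: "(\<Sum>i=1..int N. wave1 N m i) = (if m = 0 then of_nat N else 0)" if m: "\<bar>m\<bar> \<le> int K" for m
  proof -
    have W: "wave1 N m i = root_cis N (i * m) * wave1 N m 0" for i
    proof -
      have "cnj (wave1 N m 0) * wave1 N m 0 = 1" by (simp add: wave1_def cis_cnj cis_mult)
      then have "wave1 N m i = (wave1 N m i * cnj (wave1 N m 0)) * wave1 N m 0"
        by (simp only: mult.assoc mult_1_right)
      then have "wave1 N m i = root_cis N (m * i) * wave1 N m 0" unfolding wave1_mult_cnj by simp
      then show ?thesis by (simp add: mult.commute)
    qed
    have "(\<Sum>i=1..int N. wave1 N m i) = (\<Sum>i=1..int N. root_cis N (i * m)) * wave1 N m 0"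
      unfolding sum_distrib_right by (rule sum.cong[OF refl W])
    moreover have "int N dvd m \<longleftrightarrow> m = 0"
      using dvd_imp_le_int[of m "int N"] m N by auto
    moreover have "wave1 N 0 0 = 1" by (simp add: wave1_def)
    ultimately show ?thesis unfolding sum_root_cis[OF N0] by auto
  qed
  have ka: "\<bar>k $ a\<bar> \<le> int K" for a using k by (simp add: freqs_def)
  have "csum N (wave N k) = (\<Sum>i=1..int N. \<Sum>j=1..int N. \<Sum>l=1..int N. wave1 N (k $ 1) i * (wave1 N (k $ 2) j * wave1 N (k $ 3) l))"
    by (simp add: csum_def wave_def mult.assoc)
  also have "\<dots> = (\<Sum>i=1..int N. wave1 N (k $ 1) i) * ((\<Sum>j=1..int N. wave1 N (k $ 2) j) * (\<Sum>l=1..int N. wave1 N (k $ 3) l))"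
    by (simp only: sum_distrib_left[symmetric] sum_distrib_right[symmetric])
  also have "\<dots> = (if k = 0 then of_nat N ^ 3 else 0)"
    unfolding w[OF ka] by (auto simp: vec_eq_iff forall_3 power3_eq_cube)
  finally show ?thesis .
qed

lemma Re_csum: "gsum N (\<lambda>i j l. Re (w i j l)) = Re (csum N w)"
  by (simp add: gsum_def csum_def)

lemma gsum_fourier_proj:
  assumes L: "L > 0" and N: "N = 2 * K + 1"
  shows "gsum N (grid_proj L N (fourier_proj L K f)) = real N ^ 3 * Re (fourier_coeff L f 0)"
proof -
  have N0: "N > 0" using N by simp
  let ?A = "{k \<in> freqs K. l1norm k \<le> real K}"
  have fA: "finite ?A" by (rule finite_subset[OF _ finite_freqs]) auto
  have "0 \<in> ?A" by (simp add: freqs_def l1norm_def)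
  have "csum N (\<lambda>i j l. \<Sum>k\<in>?A. fourier_coeff L f k * wave N k i j l)
     = (\<Sum>k\<in>?A. fourier_coeff L f k * csum N (wave N k))"
    unfolding csum_grid_indices sum_distrib_left split_def by (rule sum.swap)
  also have "\<dots> = (\<Sum>k\<in>?A. if k = 0 then fourier_coeff L f k * of_nat N ^ 3 else 0)"
    by (intro sum.cong refl) (simp add: csum_wave[OF N])
  also have "\<dots> = fourier_coeff L f 0 * of_nat N ^ 3" using fA \<open>0 \<in> ?A\<close> by simp
  finally have e: "csum N (\<lambda>i j l. \<Sum>k\<in>?A. fourier_coeff L f k * wave N k i j l) = fourier_coeff L f 0 * of_nat N ^ 3" .
  have "gsum N (grid_proj L N (fourier_proj L K f)) = Re (csum N (\<lambda>i j l. \<Sum>k\<in>?A. fourier_coeff L f k * wave N k i j l))"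
  proof -
    have "grid_proj L N (fourier_proj L K f) = (\<lambda>i j l. Re (\<Sum>k\<in>?A. fourier_coeff L f k * wave N k i j l))"
      by (intro ext) (simp only: grid_proj_eval fourier_proj_mode fourier_mode_wave[OF L N0])
    then show ?thesis by (simp only: Re_csum)
  qed
  also have "\<dots> = real N ^ 3 * Re (fourier_coeff L f 0)"
    unfolding e by (simp add: of_nat_power[symmetric] del: of_nat_power)
  finally show ?thesis .
qed

text \<open>With midpoint grids a grid is contained in its refinement only for odd refinement factors.\<close>

lemma grid_point_refine:
  assumes N: "N > 0"
  shows "grid_point L ((2 * r + 1) * N) (i * (2 * int r + 1) - int r) (j * (2 * int r + 1) - int r) (l * (2 * int r + 1) - int r)
    = grid_point L N i j l"
proof -
  have "(real_of_int (m * (2 * int r + 1) - int r) - 1/2) * mesh L ((2 * r + 1) * N) = (of_int m - 1/2) * mesh L N" for m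
  proof -
    have "real_of_int (m * (2 * int r + 1) - int r) - 1/2 = (of_int m - 1/2) * (2 * real r + 1)"
      by (simp add: algebra_simps)
    moreover have "(2 * real r + 1) * mesh L ((2 * r + 1) * N) = mesh L N"
    proof -
      have e: "real ((2 * r + 1) * N) = (2 * real r + 1) * real N" by (simp add: algebra_simps)
      have nz: "2 * real r + 1 \<noteq> 0" by linarith
      show ?thesis
        unfolding mesh_def times_divide_eq_right e by (rule nonzero_mult_divide_mult_cancel_left[OF nz])
    qed
    ultimately show ?thesis by (simp only: mult.assoc)
  qed
  then show ?thesis by (simp only: grid_point_def)
qed

lemma grid_indices_refine:
  assumes "(i,j,l) \<in> grid_indices N"
  shows "(i * (2 * int r + 1) - int r, j * (2 * int r + 1) - int r, l * (2 * int r + 1) - int r) \<in> grid_indices ((2 * r + 1) * N)"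
proof -
  have "1 \<le> m * (2 * int r + 1) - int r \<and> m * (2 * int r + 1) - int r \<le> int ((2 * r + 1) * N)" if "1 \<le> m" "m \<le> int N" for m
  proof
    have "1 * (2 * int r + 1) \<le> m * (2 * int r + 1)" using that by (intro mult_right_mono) auto
    moreover have "1 \<le> X - int r" if "1 * (2 * int r + 1) \<le> X" for X
      using that of_nat_0_le_iff[of r, where 'a = int] by simp
    ultimately show "1 \<le> m * (2 * int r + 1) - int r" by blast
    have "m * (2 * int r + 1) \<le> int N * (2 * int r + 1)" using that by (intro mult_right_mono) auto
    also have "\<dots> = int ((2 * r + 1) * N)" by (simp add: algebra_simps)
    finally have "m * (2 * int r + 1) \<le> int ((2 * r + 1) * N)" .
    moreover have "X - int r \<le> Y" if "X \<le> Y" for X Y :: int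
      using that of_nat_0_le_iff[of r, where 'a = int] by simp
    ultimately show "m * (2 * int r + 1) - int r \<le> int ((2 * r + 1) * N)" by blast
  qed
  then show ?thesis using assms by (auto simp: grid_indices_def)
qed

text \<open>The discrete truncation estimate is applied with the fixed cut-off \<open>K\<close> on grids refined by
  odd factors, all of which contain the given grid point; letting the refinement tend to infinity
  replaces discrete Fourier coefficients by Fourier coefficients. The function \<open>g\<close> is only a
  pointwise limit of functions with a common \<open>C\<^sup>6\<close> bound, because the exact solution has six
  derivatives only at almost every time.\<close>

lemma fourier_proj_error:
  assumes L: "L > 0"
  shows "\<exists>C>0. \<forall>M fs g K i j l. (\<forall>n. fs n \<in> Ck_per 6 L \<and> Ck_norm 6 (fs n) \<le> M) \<and>
     (\<forall>x. (\<lambda>n. fs n x) \<longlonglongrightarrow> g x) \<and> g \<in> Ck_per 0 L \<longrightarrow>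
     \<bar>grid_proj L (2 * K + 1) g i j l - grid_proj L (2 * K + 1) (fourier_proj L K g) i j l\<bar> \<le> C * M * mesh L (2 * K + 1) ^ 4"
proof -
  obtain C where C: "C > 0" "\<And>f M K K0 i j l. f \<in> Ck_per 6 L \<Longrightarrow> Ck_norm 6 f \<le> M \<Longrightarrow> (i,j,l) \<in> grid_indices (2 * K + 1) \<Longrightarrow>
    cmod (of_real (f (grid_point L (2 * K + 1) i j l))
      - (\<Sum>k\<in>{k \<in> freqs K. l1norm k \<le> real K0}. dft (2 * K + 1) (grid_proj L (2 * K + 1) f) k * wave (2 * K + 1) k i j l))
    \<le> C * M / (real K0 + 1) ^ 4"
    using dft_truncation[OF L] by blast
  define D where "D = C * 16 / L ^ 4"
  have D0: "D > 0" using C L by (simp add: D_def)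
  have "\<bar>grid_proj L N g i j l - grid_proj L N (fourier_proj L K g) i j l\<bar> \<le> D * M * mesh L N ^ 4"
    if fs: "\<And>n. fs n \<in> Ck_per 6 L" "\<And>n. Ck_norm 6 (fs n) \<le> M" and lim: "\<And>x. (\<lambda>n. fs n x) \<longlonglongrightarrow> g x"
      and g: "g \<in> Ck_per 0 L" and N: "N = 2 * K + 1" for M fs g K i j l N
  proof -
    have N0: "N > 0" using N by simp
    have gc: "continuous_on UNIV g" "periodic L g" using g by (auto simp: Ck_per_def dest: spec[of _ "[]"])
    have M0: "M \<ge> 0" using Ck_norm_bound[OF L fs(1), of "[]" 0 0] fs(2)[of 0] by simp
    let ?A = "{k \<in> freqs K. l1norm k \<le> real K}"
    have main: "\<bar>grid_proj L N g i j l - grid_proj L N (fourier_proj L K g) i j l\<bar> \<le> D * M * mesh L N ^ 4"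
      if p: "(i,j,l) \<in> grid_indices N" for i j l
    proof -
      define x where "x = grid_point L N i j l"
      (* the estimate on the refined grid, first for \<open>fs n\<close> and then for the limit \<open>g\<close> *)
      have fine: "cmod (of_real (g x) - (\<Sum>k\<in>?A. dft ((2 * r + 1) * N) (grid_proj L ((2 * r + 1) * N) g) k * fourier_mode L k x)) \<le> C * M / (real K + 1) ^ 4" for r
      proof -
        define K' where "K' = r * N + K"
        define N' where "N' = (2 * r + 1) * N"
        have N': "N' = 2 * K' + 1" by (simp add: N'_def K'_def N)
        have N'0: "N' > 0" using N' by simp
        let ?i = "i * (2 * int r + 1) - int r" and ?j = "j * (2 * int r + 1) - int r" and ?l = "l * (2 * int r + 1) - int r"
        have x': "grid_point L N' ?i ?j ?l = x" unfolding N'_def x_def by (rule grid_point_refine[OF N0])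
        have p': "(?i, ?j, ?l) \<in> grid_indices N'" unfolding N'_def by (rule grid_indices_refine[OF p])
        have "K \<le> K'" by (simp add: K'_def)
        have A': "{k \<in> freqs K'. l1norm k \<le> real K} = ?A"
        proof (intro equalityI subsetI)
          fix k assume k: "k \<in> {k \<in> freqs K'. l1norm k \<le> real K}"
          have "\<bar>k $ a\<bar> \<le> int K" for a
          proof -
            have "\<bar>k $ a\<bar> \<le> (\<Sum>a\<in>UNIV. \<bar>k $ a\<bar>)" by (intro member_le_sum) auto
            moreover have "real_of_int (\<Sum>a\<in>UNIV. \<bar>k $ a\<bar>) \<le> real_of_int (int K)"
              using k by (simp only: l1norm_def of_int_of_nat_eq mem_Collect_eq)
            then have "(\<Sum>a\<in>UNIV. \<bar>k $ a\<bar>) \<le> int K" by (simp only: of_int_le_iff)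
            ultimately show ?thesis by linarith
          qed
          then show "k \<in> ?A" using k by (simp add: freqs_def)
        next
          fix k assume k: "k \<in> ?A"
          have "\<bar>k $ a\<bar> \<le> int K'" for a
          proof -
            have "\<bar>k $ a\<bar> \<le> int K" using k by (simp add: freqs_def)
            then show ?thesis using \<open>K \<le> K'\<close> by linarith
          qed
          then show "k \<in> {k \<in> freqs K'. l1norm k \<le> real K}" using k by (simp add: freqs_def)
        qed
        have b: "cmod (of_real (fs n x) - (\<Sum>k\<in>?A. dft N' (grid_proj L N' (fs n)) k * fourier_mode L k x)) \<le> C * M / (real K + 1) ^ 4" for n
          using C(2)[OF fs(1)[of n] fs(2)[of n], of ?i ?j ?l K' K] p' unfolding N'[symmetric] A'
          by (simp add: x' fourier_mode_wave[OF L N'0, symmetric])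
        have "(\<lambda>n. cmod (of_real (fs n x) - (\<Sum>k\<in>?A. dft N' (grid_proj L N' (fs n)) k * fourier_mode L k x)))
           \<longlonglongrightarrow> cmod (of_real (g x) - (\<Sum>k\<in>?A. dft N' (grid_proj L N' g) k * fourier_mode L k x))"
          unfolding dft_def csum_def grid_proj_eval
          by (intro tendsto_norm tendsto_diff tendsto_of_real lim tendsto_sum tendsto_mult tendsto_divide tendsto_const)
            (use N'0 in simp)
        then have "cmod (of_real (g x) - (\<Sum>k\<in>?A. dft N' (grid_proj L N' g) k * fourier_mode L k x)) \<le> C * M / (real K + 1) ^ 4"
          by (rule LIMSEQ_le_const2) (use b in blast)
        then show ?thesis unfolding N'_def .
      qed
      have sub: "filterlim (\<lambda>r. (2 * r + 1) * N) at_top sequentially"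
      proof (rule filterlim_at_top_mono[OF filterlim_ident])
        show "\<forall>\<^sub>F r in sequentially. r \<le> (2 * r + 1) * N"
        proof (rule always_eventually, rule allI)
          fix r show "r \<le> (2 * r + 1) * N" using mult_le_mono[of r "2 * r + 1" 1 N] N0 by simp
        qed
      qed
      have "(\<lambda>r. cmod (of_real (g x) - (\<Sum>k\<in>?A. dft ((2 * r + 1) * N) (grid_proj L ((2 * r + 1) * N) g) k * fourier_mode L k x)))
        \<longlonglongrightarrow> cmod (of_real (g x) - (\<Sum>k\<in>?A. fourier_coeff L g k * fourier_mode L k x))"
        by (intro tendsto_norm tendsto_diff tendsto_const tendsto_sum tendsto_mult
           filterlim_compose[OF dft_tendsto[OF L gc(1)] sub])
      then have le: "cmod (of_real (g x) - (\<Sum>k\<in>?A. fourier_coeff L g k * fourier_mode L k x)) \<le> C * M / (real K + 1) ^ 4"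
        by (rule LIMSEQ_le_const2) (use fine in auto)
      have "\<bar>g x - fourier_proj L K g x\<bar> = \<bar>Re (of_real (g x) - (\<Sum>k\<in>?A. fourier_coeff L g k * fourier_mode L k x))\<bar>"
        by (simp add: fourier_proj_mode)
      also have "\<dots> \<le> C * M / (real K + 1) ^ 4" using abs_Re_le_cmod le by (rule order_trans)
      also have "\<dots> \<le> C * M / ((real N / 2) ^ 4)"
        using C M0 N by (intro divide_left_mono power_mono mult_nonneg_nonneg mult_pos_pos) auto
      also have "\<dots> = D * M * mesh L N ^ 4"
        using L N0 by (simp add: D_def mesh_def power_divide)
      finally show ?thesis by (simp add: x_def grid_proj_eval)
    qed
    define v where "v = (\<lambda>i j l. grid_proj L N g i j l - grid_proj L N (fourier_proj L K g) i j l)"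
    have "v \<in> grid_per N" unfolding v_def
      by (intro grid_per_intros(3) grid_proj_per[OF gc(2) N0] grid_proj_per[OF periodic_fourier_proj[OF L] N0])
    then obtain i' j' l' where r: "i' \<in> {1..int N}" "j' \<in> {1..int N}" "l' \<in> {1..int N}" "v i j l = v i' j' l'"
      using grid_per_representative[OF N0, of i j l] by metis
    have "\<bar>v i' j' l'\<bar> \<le> D * M * mesh L N ^ 4" unfolding v_def
      by (rule main) (use r in \<open>simp add: grid_indices_def\<close>)
    then show ?thesis using r(4) by (simp add: v_def)
  qed
  then show ?thesis using D0 by blast
qed

text \<open>The zeroth Fourier coefficient is the limit of the grid means, so it is determined by them
  up to errors that vanish under refinement.\<close>

lemma fourier_coeff_0_eqI:
  assumes L: "L > 0" and g: "continuous_on UNIV g" "continuous_on UNIV g'"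
    and le: "\<And>N. N > 0 \<Longrightarrow> \<bar>gsum N (grid_proj L N g) - gsum N (grid_proj L N g')\<bar> \<le> C * (mesh L N)\<^sup>2 * real N ^ 3"
  shows "Re (fourier_coeff L g 0) = Re (fourier_coeff L g' 0)"
proof -
  have d0: "Re (dft N (grid_proj L N f) 0) = gsum N (grid_proj L N f) / real N ^ 3" for N f
  proof -
    have "dft N (grid_proj L N f) 0 = of_real (gsum N (grid_proj L N f)) / of_real (real N ^ 3)"
      unfolding dft_def by (simp add: wave_def wave1_def csum_of_real)
    also have "\<dots> = of_real (gsum N (grid_proj L N f) / real N ^ 3)" by (simp only: of_real_divide)
    finally show ?thesis by (simp only: Re_complex_of_real)
  qed
  have lim: "(\<lambda>N. gsum N (grid_proj L N f) / real N ^ 3) \<longlonglongrightarrow> Re (fourier_coeff L f 0)" if "continuous_on UNIV f" for f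
    using tendsto_Re[OF dft_tendsto[OF L that, of 0]] unfolding d0 .
  have "(\<lambda>N. gsum N (grid_proj L N g) / real N ^ 3 - gsum N (grid_proj L N g') / real N ^ 3)
     \<longlonglongrightarrow> Re (fourier_coeff L g 0) - Re (fourier_coeff L g' 0)"
    by (intro tendsto_diff lim g)
  moreover have "(\<lambda>N. gsum N (grid_proj L N g) / real N ^ 3 - gsum N (grid_proj L N g') / real N ^ 3) \<longlonglongrightarrow> 0"
  proof (rule Lim_null_comparison)
    show "\<forall>\<^sub>F N in sequentially. norm (gsum N (grid_proj L N g) / real N ^ 3 - gsum N (grid_proj L N g') / real N ^ 3) \<le> C * (L / real N)\<^sup>2"
      using eventually_gt_at_top[of 0]
    proof eventually_elim
      case (elim N)
      have "\<bar>gsum N (grid_proj L N g) - gsum N (grid_proj L N g')\<bar> / real N ^ 3 \<le> C * (mesh L N)\<^sup>2"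
        using le[OF elim] elim by (simp add: pos_divide_le_eq)
      then show ?case by (simp add: mesh_def diff_divide_distrib[symmetric] abs_divide)
    qed
    have "(\<lambda>N. L / real N) \<longlonglongrightarrow> 0" by (rule lim_const_over_n)
    from tendsto_mult[OF tendsto_const[of C] tendsto_power[OF this, of 2]]
    show "(\<lambda>N. C * (L / real N)\<^sup>2) \<longlonglongrightarrow> 0" by simp
  qed
  ultimately have "Re (fourier_coeff L g 0) - Re (fourier_coeff L g' 0) = 0" by (rule LIMSEQ_unique)
  then show ?thesis by simp
qed

section \<open>Test functions and the lemma of du Bois-Reymond\<close>

text \<open>Differentiability \<open>n\<close> times in a form suited to induction; a function is smooth if this
  holds for all \<open>n\<close>.\<close>

definition ndiff :: "nat \<Rightarrow> (real \<Rightarrow> real) \<Rightarrow> bool" where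
  "ndiff n f \<longleftrightarrow> (\<forall>m<n. \<forall>t. (deriv ^^ m) f differentiable (at t))"

lemma ndiff_0: "ndiff 0 f" by (simp add: ndiff_def)

lemma ndiff_Suc: "ndiff (Suc n) f \<longleftrightarrow> (\<forall>t. f differentiable (at t)) \<and> ndiff n (deriv f)"
proof -
  have "(\<forall>m<Suc n. P m) \<longleftrightarrow> P 0 \<and> (\<forall>m<n. P (Suc m))" for P by (auto simp: less_Suc_eq_0_disj)
  then show ?thesis unfolding ndiff_def by (simp add: funpow_Suc_right del: funpow.simps(2))
qed

lemma ndiff_SucI:
  assumes "\<And>t. (f has_real_derivative f' t) (at t)" "ndiff n f'"
  shows "ndiff (Suc n) f"
proof -
  have "deriv f = f'" using assms(1) DERIV_imp_deriv by blast
  then show ?thesis using assms by (auto simp: ndiff_Suc real_differentiable_def)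
qed

lemma ndiff_Suc_DERIV: "ndiff (Suc n) f \<Longrightarrow> (f has_real_derivative deriv f t) (at t)"
  by (simp add: ndiff_Suc DERIV_deriv_iff_real_differentiable)

lemma ndiff_mono: "ndiff (Suc n) f \<Longrightarrow> ndiff n f" by (auto simp: ndiff_def)

lemma ndiff_const: "ndiff n (\<lambda>t. c)"
proof (induction n arbitrary: c)
  case (Suc n)
  show ?case by (rule ndiff_SucI[where f' = "\<lambda>t. 0"]) (auto simp: Suc)
qed (rule ndiff_0)

lemma ndiff_add: "ndiff n f \<Longrightarrow> ndiff n g \<Longrightarrow> ndiff n (\<lambda>t. f t + g t)"
proof (induction n arbitrary: f g)
  case (Suc n)
  show ?case
  proof (rule ndiff_SucI)
    show "((\<lambda>t. f t + g t) has_real_derivative deriv f t + deriv g t) (at t)" for t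
      by (intro DERIV_add ndiff_Suc_DERIV) (rule Suc.prems)+
    show "ndiff n (\<lambda>t. deriv f t + deriv g t)" using Suc by (simp add: ndiff_Suc)
  qed
qed (rule ndiff_0)

lemma ndiff_mult: "ndiff n f \<Longrightarrow> ndiff n g \<Longrightarrow> ndiff n (\<lambda>t. f t * g t)"
proof (induction n arbitrary: f g)
  case (Suc n)
  show ?case
  proof (rule ndiff_SucI)
    show "((\<lambda>t. f t * g t) has_real_derivative deriv f t * g t + deriv g t * f t) (at t)" for t
      by (intro DERIV_mult ndiff_Suc_DERIV) (rule Suc.prems)+
    show "ndiff n (\<lambda>t. deriv f t * g t + deriv g t * f t)"
      using Suc ndiff_mono by (intro ndiff_add Suc.IH) (auto simp: ndiff_Suc)
  qed
qed (rule ndiff_0)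

lemma ndiff_cmult: "ndiff n f \<Longrightarrow> ndiff n (\<lambda>t. c * f t)"
  by (rule ndiff_mult[OF ndiff_const])

lemma ndiff_diff: "ndiff n f \<Longrightarrow> ndiff n g \<Longrightarrow> ndiff n (\<lambda>t. f t - g t)"
  using ndiff_add[OF _ ndiff_cmult[where c = "-1"]] by fastforce

lemma ndiff_affine: "ndiff n f \<Longrightarrow> ndiff n (\<lambda>t. f (a * t + b))"
proof (induction n arbitrary: f)
  case (Suc n)
  show ?case
  proof (rule ndiff_SucI)
    show "((\<lambda>t. f (a * t + b)) has_real_derivative deriv f (a * t + b) * a) (at t)" for t
      by (rule DERIV_chain2[OF ndiff_Suc_DERIV[OF Suc.prems]]) (auto intro!: derivative_eq_intros)
    have "ndiff n (\<lambda>t. deriv f (a * t + b))" using Suc by (simp add: ndiff_Suc)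
    then show "ndiff n (\<lambda>t. deriv f (a * t + b) * a)" by (rule ndiff_mult[OF _ ndiff_const])
  qed
qed (rule ndiff_0)

lemma ndiff_inverse: "ndiff n f \<Longrightarrow> (\<And>t. f t \<noteq> 0) \<Longrightarrow> ndiff n (\<lambda>t. inverse (f t))"
proof (induction n)
  case (Suc n)
  show ?case
  proof (rule ndiff_SucI)
    show "((\<lambda>t. inverse (f t)) has_real_derivative (-1) * (deriv f t * (inverse (f t) * inverse (f t)))) (at t)" for t
      by (rule DERIV_cong[OF DERIV_inverse_fun[OF ndiff_Suc_DERIV[OF Suc.prems(1)] Suc.prems(2)]]) simp
    have "ndiff n (\<lambda>t. inverse (f t))" using Suc ndiff_mono by blast
    then show "ndiff n (\<lambda>t. (-1) * (deriv f t * (inverse (f t) * inverse (f t))))"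
      using Suc.prems by (intro ndiff_cmult ndiff_mult) (auto simp: ndiff_Suc)
  qed
qed (rule ndiff_0)

text \<open>The functions \<open>p (1/x) * exp (- 1/x)\<close> on the positive half-line, extended by \<open>0\<close>. The class
  is closed under differentiation, which makes its members smooth.\<close>

definition flat :: "real poly \<Rightarrow> real \<Rightarrow> real" where
  "flat p x = (if x > 0 then poly p (inverse x) * exp (- inverse x) else 0)"

text \<open>The power \<open>x\<^sup>2\<close> is what differentiability at \<open>0\<close> with derivative \<open>0\<close> needs.\<close>

lemma flat_bound: "\<exists>B\<ge>0. \<forall>x. \<bar>flat p x\<bar> \<le> B * x\<^sup>2"
proof -
  define B where "B = (\<Sum>k\<le>degree p. \<bar>coeff p k\<bar> * fact (k + 2))"
  have B0: "B \<ge> 0" by (simp add: B_def sum_nonneg)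
  have "\<bar>flat p x\<bar> \<le> B * x\<^sup>2" for x
  proof (cases "x > 0")
    case True
    define y where "y = inverse x"
    have y: "y > 0" using True by (simp add: y_def)
    have mono: "y ^ n * exp (- y) \<le> fact n" for n
    proof -
      have "y ^ n / fact n \<le> exp y"
      proof -
        have "(\<Sum>i\<in>{n}. inverse (fact i) *\<^sub>R y ^ i) \<le> (\<Sum>i. inverse (fact i) *\<^sub>R y ^ i)"
          using summable_exp_generic[of y] y by (intro sum_le_suminf) auto
        then show ?thesis by (simp add: exp_def divide_inverse mult.commute)
      qed
      then show ?thesis by (simp add: exp_minus field_simps)
    qed
    have "\<bar>poly p y\<bar> * (y\<^sup>2 * exp (- y)) \<le> (\<Sum>k\<le>degree p. \<bar>coeff p k\<bar> * y ^ k) * (y\<^sup>2 * exp (- y))"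
    proof (rule mult_right_mono)
      show "\<bar>poly p y\<bar> \<le> (\<Sum>k\<le>degree p. \<bar>coeff p k\<bar> * y ^ k)"
        unfolding poly_altdef by (rule order_trans[OF sum_abs]) (use y in \<open>simp add: abs_mult\<close>)
    qed simp
    also have "\<dots> = (\<Sum>k\<le>degree p. \<bar>coeff p k\<bar> * (y ^ (k + 2) * exp (- y)))"
      unfolding sum_distrib_right by (intro sum.cong refl) (simp add: power_add power2_eq_square)
    also have "\<dots> \<le> B" unfolding B_def by (intro sum_mono mult_left_mono mono) auto
    finally have "\<bar>poly p y\<bar> * (y\<^sup>2 * exp (- y)) \<le> B" .
    then have "\<bar>poly p y\<bar> * exp (- y) * y\<^sup>2 \<le> B" by (simp add: mult_ac)
    moreover have "\<bar>flat p x\<bar> = \<bar>poly p y\<bar> * exp (- y)" using True by (simp add: flat_def y_def abs_mult)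
    ultimately have "\<bar>flat p x\<bar> * y\<^sup>2 \<le> B" by simp
    then have "(\<bar>flat p x\<bar> * y\<^sup>2) * x\<^sup>2 \<le> B * x\<^sup>2" by (rule mult_right_mono) simp
    moreover have "(\<bar>flat p x\<bar> * y\<^sup>2) * x\<^sup>2 = \<bar>flat p x\<bar>"
    proof -
      have "y * x = 1" using True by (simp add: y_def)
      then have "y\<^sup>2 * x\<^sup>2 = 1" by (simp only: power_mult_distrib[symmetric]) simp
      then show ?thesis by (simp only: mult.assoc mult_1_right)
    qed
    ultimately show ?thesis by simp
  next
    case False
    then show ?thesis using B0 by (simp add: flat_def)
  qed
  then show ?thesis using B0 by blast
qed

lemma DERIV_flat: "(flat p has_real_derivative flat ((p - pderiv p) * [:0, 0, 1:]) x) (at x)"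
proof -
  consider "x > 0" | "x < 0" | "x = 0" by linarith
  then show ?thesis
  proof cases
    case 1
    have "((\<lambda>x. poly p (inverse x) * exp (- inverse x)) has_real_derivative
       flat ((p - pderiv p) * [:0, 0, 1:]) x) (at x)"
      using 1 by (auto intro!: derivative_eq_intros DERIV_chain2[OF poly_DERIV]
          simp: flat_def power2_eq_square algebra_simps)
    moreover have ev: "\<forall>\<^sub>F y in nhds x. flat p y = poly p (inverse y) * exp (- inverse y)"
      using eventually_nhds_in_open[of "{0<..}" x] 1 by (auto simp: flat_def elim: eventually_mono)
    ultimately show ?thesis using DERIV_cong_ev[OF refl ev refl] by simp
  next
    case 2
    have ev: "\<forall>\<^sub>F y in nhds x. flat p y = 0"
      using eventually_nhds_in_open[of "{..<0}" x] 2 by (auto simp: flat_def elim: eventually_mono)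
    moreover have "((\<lambda>y. 0) has_real_derivative flat ((p - pderiv p) * [:0, 0, 1:]) x) (at x)"
      using 2 by (simp add: flat_def)
    ultimately show ?thesis using DERIV_cong_ev[OF refl ev refl] by simp
  next
    case 3
    obtain B where B: "B \<ge> 0" "\<And>x. \<bar>flat p x\<bar> \<le> B * x\<^sup>2" using flat_bound by blast
    have "((\<lambda>h. (flat p (0 + h) - flat p 0) / h) \<longlongrightarrow> 0) (at 0)"
    proof (rule Lim_null_comparison)
      show "\<forall>\<^sub>F h in at 0. norm ((flat p (0 + h) - flat p 0) / h) \<le> B * \<bar>h\<bar>"
      proof (rule eventually_at_topological[THEN iffD2], intro exI[of _ UNIV] conjI ballI impI)
        fix h :: real assume h: "h \<noteq> 0"
        have "norm ((flat p (0 + h) - flat p 0) / h) = \<bar>flat p h\<bar> / \<bar>h\<bar>" by (simp add: flat_def)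
        also have "\<dots> \<le> (B * h\<^sup>2) / \<bar>h\<bar>" by (intro divide_right_mono B) simp
        also have "\<dots> = B * \<bar>h\<bar>" 
        proof -
          have e: "h\<^sup>2 = \<bar>h\<bar> * \<bar>h\<bar>" by (simp add: power2_eq_square)
          have "\<bar>h\<bar> \<noteq> 0" using h by simp
          then show ?thesis unfolding e by (metis mult.assoc nonzero_mult_div_cancel_right)
        qed
        finally show "norm ((flat p (0 + h) - flat p 0) / h) \<le> B * \<bar>h\<bar>" .
      qed auto
      have "((\<lambda>h. B * \<bar>h\<bar>) \<longlongrightarrow> B * \<bar>0\<bar>) (at 0)" by (intro tendsto_intros)
      then show "((\<lambda>h. B * \<bar>h\<bar>) \<longlongrightarrow> 0) (at 0)" by simp
    qed
    then show ?thesis using 3 by (simp add: DERIV_def flat_def)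
  qed
qed

lemma ndiff_flat: "ndiff n (flat p)"
proof (induction n arbitrary: p)
  case (Suc n)
  show ?case by (rule ndiff_SucI[OF DERIV_flat Suc])
qed (rule ndiff_0)

text \<open>The usual quotient \<open>f x / (f x + f (1 - x))\<close> with \<open>f x = exp (- 1/x)\<close>.\<close>

lemma smooth_step_exists:
  "\<exists>S::real \<Rightarrow> real. (\<forall>n. ndiff n S) \<and> (\<forall>x\<le>0. S x = 0) \<and> (\<forall>x\<ge>1. S x = 1)"
proof -
  define f where "f = flat 1"
  have f: "ndiff n f" for n unfolding f_def by (rule ndiff_flat)
  have fpos: "f x > 0" if "x > 0" for x using that by (simp add: f_def flat_def)
  have f0: "f x = 0" if "x \<le> 0" for x using that by (simp add: f_def flat_def)
  have fnn: "f x \<ge> 0" for x using fpos f0 by (metis less_eq_real_def not_le)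
  define g where "g = (\<lambda>x. f ((-1) * x + 1))"
  have g: "ndiff n g" for n unfolding g_def by (rule ndiff_affine[OF f])
  have gx: "g x = f (1 - x)" for x by (simp add: g_def)
  have nz: "f x + g x \<noteq> 0" for x
    using fpos[of x] fpos[of "1 - x"] fnn[of x] fnn[of "1 - x"] unfolding gx by (cases "x > 0") auto
  define S where "S = (\<lambda>x. f x * inverse (f x + g x))"
  have "ndiff n S" for n unfolding S_def by (intro ndiff_mult ndiff_inverse ndiff_add f g nz)
  moreover have "S x = 0" if "x \<le> 0" for x using f0[OF that] by (simp add: S_def)
  moreover have "S x = 1" if "x \<ge> 1" for x
    using f0[of "1 - x"] fpos[of x] that by (simp add: S_def gx)
  ultimately show ?thesis by blast
qed

lemma test_function_iff:
  "test_function T \<theta> \<longleftrightarrow> (\<forall>n. ndiff n \<theta>) \<and> (\<exists>a b. 0 < a \<and> b < T \<and> (\<forall>t. t \<notin> {a..b} \<longrightarrow> \<theta> t = 0))"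
  unfolding test_function_def ndiff_def by (metis lessI)

lemma test_function_DERIV: "test_function T \<theta> \<Longrightarrow> (\<theta> has_real_derivative deriv \<theta> t) (at t)"
  unfolding test_function_iff using ndiff_Suc_DERIV by blast

lemma test_function_deriv:
  assumes "test_function T \<theta>" shows "test_function T (deriv \<theta>)"
proof -
  obtain a b where ab: "0 < a" "b < T" "\<And>t. t \<notin> {a..b} \<Longrightarrow> \<theta> t = 0"
    using assms unfolding test_function_iff by blast
  have "deriv \<theta> t = 0" if t: "t \<notin> {a..b}" for t
  proof -
    have "\<forall>\<^sub>F s in nhds t. \<theta> s = 0"
    proof -
      have "\<forall>\<^sub>F s in nhds t. s \<in> - {a..b}" using t by (intro eventually_nhds_in_open) auto
      then show ?thesis by (rule eventually_mono) (use ab(3) in simp)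
    qed
    then have "(\<theta> has_real_derivative 0) (at t)" using DERIV_cong_ev[OF refl, of \<theta> "\<lambda>_. 0" t 0 0] by simp
    then show ?thesis by (rule DERIV_imp_deriv)
  qed
  moreover have "ndiff n (deriv \<theta>)" for n using assms ndiff_Suc unfolding test_function_iff by blast
  ultimately show ?thesis using ab unfolding test_function_iff by blast
qed

lemma test_function_continuous: "test_function T \<theta> \<Longrightarrow> continuous_on S \<theta>"
  using DERIV_isCont[OF test_function_DERIV] by (auto intro: continuous_at_imp_continuous_on)

lemma test_function_ends: "test_function T \<theta> \<Longrightarrow> t \<le> 0 \<or> t \<ge> T \<Longrightarrow> \<theta> t = 0"
  unfolding test_function_iff by fastforce

lemma test_function_diff_cmult:
  assumes "test_function T \<theta>" "test_function T \<eta>"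
  shows "test_function T (\<lambda>t. \<theta> t - c * \<eta> t)"
proof -
  obtain a b where ab: "0 < a" "b < T" "\<And>t. t \<notin> {a..b} \<Longrightarrow> \<theta> t = 0"
    using assms unfolding test_function_iff by blast
  obtain a' b' where ab': "0 < a'" "b' < T" "\<And>t. t \<notin> {a'..b'} \<Longrightarrow> \<eta> t = 0"
    using assms unfolding test_function_iff by blast
  have "ndiff n (\<lambda>t. \<theta> t - c * \<eta> t)" for n
    using assms unfolding test_function_iff by (intro ndiff_diff ndiff_cmult) auto
  moreover have "\<theta> t - c * \<eta> t = 0" if "t \<notin> {min a a'..max b b'}" for t
  proof -
    have "t \<notin> {a..b}" "t \<notin> {a'..b'}" using that by auto
    then show ?thesis using ab(3)[of t] ab'(3)[of t] by simp
  qed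
  moreover have "0 < min a a'" "max b b' < T" using ab ab' by auto
  ultimately show ?thesis unfolding test_function_iff by blast
qed

lemma integral_deriv_real:
  fixes f f' :: "real \<Rightarrow> real"
  assumes "a \<le> b" "\<And>t. t \<in> {a..b} \<Longrightarrow> (f has_real_derivative f' t) (at t)"
  shows "(f' has_integral (f b - f a)) {a..b}"
  using assms(2) has_real_derivative_iff_has_vector_derivative
  by (intro fundamental_theorem_of_calculus assms(1)) (blast intro: has_vector_derivative_at_within)

lemma test_function_ibp:
  assumes T: "T > 0" and \<theta>: "test_function T \<theta>"
    and g: "\<And>t. t \<in> {0..T} \<Longrightarrow> (g has_real_derivative g' t) (at t within {0..T})"
    and g': "continuous_on {0..T} g'"
  shows "integral {0..T} (\<lambda>t. deriv \<theta> t * g t) = - integral {0..T} (\<lambda>t. \<theta> t * g' t)"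
proof -
  have gc: "continuous_on {0..T} g" using g by (rule DERIV_continuous_on)
  have "((\<lambda>t. deriv \<theta> t * g t + g' t * \<theta> t) has_integral (\<theta> T * g T - \<theta> 0 * g 0)) {0..T}"
  proof (rule fundamental_theorem_of_calculus)
    fix t assume t: "t \<in> {0..T}"
    have "((\<lambda>t. \<theta> t * g t) has_real_derivative deriv \<theta> t * g t + g' t * \<theta> t) (at t within {0..T})"
      by (intro DERIV_mult g t has_field_derivative_at_within[OF test_function_DERIV[OF \<theta>]])
    then show "((\<lambda>t. \<theta> t * g t) has_vector_derivative deriv \<theta> t * g t + g' t * \<theta> t) (at t within {0..T})"
      by (simp add: has_real_derivative_iff_has_vector_derivative)
  qed (use T in simp)
  then have "integral {0..T} (\<lambda>t. deriv \<theta> t * g t + g' t * \<theta> t) = 0"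
    using test_function_ends[OF \<theta>] T by (simp add: has_integral_iff)
  moreover have "integral {0..T} (\<lambda>t. deriv \<theta> t * g t + g' t * \<theta> t)
     = integral {0..T} (\<lambda>t. deriv \<theta> t * g t) + integral {0..T} (\<lambda>t. g' t * \<theta> t)"
    by (intro Henstock_Kurzweil_Integration.integral_add integrable_continuous_real continuous_intros gc g'
       test_function_continuous[OF \<theta>] test_function_continuous[OF test_function_deriv[OF \<theta>]])
  ultimately show ?thesis by (simp add: mult.commute)
qed

lemma test_functionI:
  "(\<And>n. ndiff n \<theta>) \<Longrightarrow> 0 < a \<Longrightarrow> b < T \<Longrightarrow> (\<And>t. t \<notin> {a..b} \<Longrightarrow> \<theta> t = 0) \<Longrightarrow> test_function T \<theta>"
  unfolding test_function_iff by blast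

lemma test_function_step:
  assumes S: "\<And>n. ndiff n S" "\<And>x. x \<le> 0 \<Longrightarrow> S x = (0::real)" "\<And>x. x \<ge> 1 \<Longrightarrow> S x = 1"
    and ab: "0 < a" "a \<le> b" "b + e < T" "e > 0"
  shows "test_function T (\<lambda>t. S (inverse e * t + - (a / e)) - S (inverse e * t + - (b / e)))"
proof (rule test_functionI[where a = a and b = "b + e"])
  show "ndiff n (\<lambda>t. S (inverse e * t + - (a / e)) - S (inverse e * t + - (b / e)))" for n
    by (intro ndiff_diff ndiff_affine S)
  fix t assume t: "t \<notin> {a..b + e}"
  have arg: "inverse e * t + - (c / e) = (t - c) / e" for c by (simp add: divide_inverse algebra_simps)
  show "S (inverse e * t + - (a / e)) - S (inverse e * t + - (b / e)) = 0"
  proof (cases "t < a")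
    case True
    then have "(t - a) / e \<le> 0" "(t - b) / e \<le> 0" using ab by (auto simp: divide_nonpos_pos)
    then show ?thesis unfolding arg using S(2) by simp
  next
    case False
    then have "t > b + e" using t by simp
    then have "(t - a) / e \<ge> 1" "(t - b) / e \<ge> 1" using ab by (auto simp: pos_le_divide_eq)
    then show ?thesis unfolding arg using S(3) by simp
  qed
qed (use ab in auto)

text \<open>The primitive vanishes to the left of the support, and to the right of it because the total
  integral is \<open>0\<close>.\<close>

lemma test_function_antiderivative:
  assumes T: "T > 0" and f: "test_function T f" and int0: "integral {0..T} f = 0"
  shows "\<exists>\<theta>. test_function T \<theta> \<and> deriv \<theta> = f"
proof -
  obtain a b' where ab': "0 < a" "b' < T" "\<And>t. t \<notin> {a..b'} \<Longrightarrow> f t = 0"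
    using f unfolding test_function_iff by blast
  (* makes the right end nonnegative, so that integrals from \<open>0\<close> can be split there *)
  define b where "b = max b' (T / 2)"
  have ab: "0 < a" "b < T" "\<And>t. t \<notin> {a..b} \<Longrightarrow> f t = 0" and bpos: "0 \<le> b"
  proof -
    show "f t = 0" if "t \<notin> {a..b}" for t
    proof (rule ab'(3))
      show "t \<notin> {a..b'}" using that by (auto simp: b_def)
    qed
  qed (use ab' T in \<open>auto simp: b_def\<close>)
  define \<theta> where "\<theta> = (\<lambda>t. integral {0..t} f)"
  have fc: "continuous_on S f" for S by (rule test_function_continuous[OF f])
  have fi: "f integrable_on {s..t}" for s t by (rule integrable_continuous_real[OF fc])
  have D: "(\<theta> has_real_derivative f t) (at t)" for t
  proof (cases "t < a")
    case True
    have "\<forall>\<^sub>F s in nhds t. \<theta> s = 0"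
    proof -
      have "\<forall>\<^sub>F s in nhds t. s \<in> {..<a}" using True by (intro eventually_nhds_in_open) auto
      then show ?thesis
      proof (rule eventually_mono)
        fix s assume "s \<in> {..<a}"
        then have "integral {0..s} f = integral {0..s} (\<lambda>_. 0)"
          using ab(3) by (intro Henstock_Kurzweil_Integration.integral_cong) auto
        then show "\<theta> s = 0" by (simp add: \<theta>_def)
      qed
    qed
    then have "(\<theta> has_real_derivative 0) (at t)" using DERIV_cong_ev[OF refl, of \<theta> "\<lambda>_. 0" t 0 0] by simp
    moreover have "f t = 0" using ab(3)[of t] True by simp
    ultimately show ?thesis by simp
  next
    case False
    have "(\<theta> has_real_derivative f t) (at t within {0..t+1})"
      unfolding \<theta>_def using False ab by (intro integral_has_real_derivative fc) auto
    moreover have "at t within {0..t+1} = at t"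
      using False ab by (intro at_within_interior) auto
    ultimately show ?thesis by simp
  qed
  have nd: "ndiff n \<theta>" for n
  proof (cases n)
    case (Suc m)
    then show ?thesis using ndiff_SucI[OF D] f unfolding test_function_iff by blast
  qed (simp add: ndiff_0)
  have "\<theta> t = 0" if t: "t \<notin> {a..b}" for t
  proof (cases "t < a")
    case True
    then have "integral {0..t} f = integral {0..t} (\<lambda>_. 0)"
      using ab(3) by (intro Henstock_Kurzweil_Integration.integral_cong) auto
    then show ?thesis by (simp add: \<theta>_def)
  next
    case False
    then have tb: "t > b" "t > 0" using t ab by auto
    have z: "integral {b..s} f = 0" for s
    proof -
      have "((\<lambda>t. f t) has_integral 0) {b..s}"
        by (rule has_integral_spike_finite[of "{b}" _ _ "\<lambda>_. 0"]) (use ab(3) in auto)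
      then show ?thesis by (simp add: has_integral_iff)
    qed
    have "integral {0..t} f = integral {0..b} f + integral {b..t} f"
      using tb bpos fi by (intro Henstock_Kurzweil_Integration.integral_combine[symmetric]) auto
    moreover have "integral {0..T} f = integral {0..b} f + integral {b..T} f"
      using ab bpos fi by (intro Henstock_Kurzweil_Integration.integral_combine[symmetric]) auto
    ultimately show ?thesis using z int0 by (simp add: \<theta>_def)
  qed
  then have "test_function T \<theta>" unfolding test_function_iff using nd ab by blast
  moreover have "deriv \<theta> = f" using D DERIV_imp_deriv by blast
  ultimately show ?thesis by blast
qed

lemma unit_test_function_exists:
  assumes T: "T > 0"
  shows "\<exists>\<rho>. test_function T \<rho> \<and> integral {0..T} \<rho> = 1"
proof -
  obtain S :: "real \<Rightarrow> real" where S: "\<And>n. ndiff n S" "\<And>x. x \<le> 0 \<Longrightarrow> S x = 0" "\<And>x. x \<ge> 1 \<Longrightarrow> S x = 1"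
    using smooth_step_exists by blast
  define R where "R = (\<lambda>t. S ((4 / T) * t + - 1))"
  have nR: "ndiff n R" for n unfolding R_def by (intro ndiff_affine S)
  have RD: "(R has_real_derivative deriv R t) (at t)" for t by (rule ndiff_Suc_DERIV[OF nR])
  have R0: "R t = 0" if "t \<le> T / 4" for t
    unfolding R_def using that T by (intro S(2)) (simp add: field_simps)
  have R1: "R t = 1" if "t \<ge> T / 2" for t
    unfolding R_def using that T by (intro S(3)) (simp add: field_simps)
  have "deriv R t = 0" if t: "t \<notin> {T/4..T/2}" for t
  proof -
    have "\<exists>c. \<forall>\<^sub>F s in nhds t. R s = c"
    proof (cases "t < T / 4")
      case True
      have "\<forall>\<^sub>F s in nhds t. s \<in> {..<T/4}" using True by (intro eventually_nhds_in_open) auto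
      then have "\<forall>\<^sub>F s in nhds t. R s = 0" by (rule eventually_mono) (use R0 in simp)
      then show ?thesis by blast
    next
      case False
      then have "t > T / 2" using t by simp
      then have "\<forall>\<^sub>F s in nhds t. s \<in> {T/2<..}" by (intro eventually_nhds_in_open) auto
      then have "\<forall>\<^sub>F s in nhds t. R s = 1" by (rule eventually_mono) (use R1 in simp)
      then show ?thesis by blast
    qed
    then obtain c where "\<forall>\<^sub>F s in nhds t. R s = c" by blast
    then have "(R has_real_derivative 0) (at t)" using DERIV_cong_ev[OF refl, of R "\<lambda>_. c" t 0 0] by simp
    then show ?thesis by (rule DERIV_imp_deriv)
  qed
  moreover have "ndiff n (deriv R)" for n using nR ndiff_Suc by blast
  moreover have "0 < T / 4" "T / 2 < T" using T by auto
  ultimately have "test_function T (deriv R)" unfolding test_function_iff by blast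
  moreover have "integral {0..T} (deriv R) = 1"
    using integral_deriv_real[of 0 T R "deriv R"] RD T R0[of 0] R1[of T] by (simp add: has_integral_iff)
  ultimately show ?thesis by blast
qed

text \<open>The lemma of du Bois-Reymond for continuous functions. The test function is a smoothed
  indicator function of an interval from \<open>a\<close> to \<open>b\<close>; its derivative is the difference of two
  approximate identities, concentrated just to the right of \<open>a\<close> and of \<open>b\<close>.\<close>

lemma du_bois_reymond_1:
  assumes T: "T > 0" and q: "continuous_on {0..T} q"
    and z: "\<And>\<theta>. test_function T \<theta> \<Longrightarrow> integral {0..T} (\<lambda>t. deriv \<theta> t * q t) = 0"
  shows "\<exists>c. \<forall>t\<in>{0..T}. q t = c"
proof -
  obtain S :: "real \<Rightarrow> real" where S: "\<And>n. ndiff n S" "\<And>x. x \<le> 0 \<Longrightarrow> S x = 0" "\<And>x. x \<ge> 1 \<Longrightarrow> S x = 1"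
    using smooth_step_exists by blast
  have SD: "(S has_real_derivative deriv S x) (at x)" for x by (rule ndiff_Suc_DERIV[OF S(1)])
  have SDc: "((\<lambda>t. S ((t - c) / e)) has_real_derivative deriv S ((t - c) / e) / e) (at t)"
    if "e > 0" for e c t
  proof -
    have "((\<lambda>t. (t - c) / e) has_real_derivative 1 / e) (at t)"
      using that by (auto intro!: derivative_eq_intros)
    from DERIV_chain2[OF SD this] show ?thesis by simp
  qed
  have S'c: "continuous_on A (deriv S)" for A
  proof -
    have "ndiff 1 (deriv S)" using S(1)[of "Suc 1"] ndiff_Suc by blast
    then have "(deriv S has_real_derivative deriv (deriv S) x) (at x)" for x using ndiff_Suc_DERIV[of 0] by simp
    then show ?thesis by (auto intro!: continuous_at_imp_continuous_on DERIV_isCont)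
  qed
  have cpt: "compact (deriv S ` {0..1})" by (intro compact_continuous_image S'c compact_Icc)
  then obtain B where "\<forall>y\<in>deriv S ` {0..1}. norm y \<le> B"
    using compact_imp_bounded[OF cpt] unfolding bounded_iff by blast
  then have B: "\<bar>deriv S x\<bar> \<le> B" if "x \<in> {0..1}" for x using that by auto
  have B0: "B \<ge> 0" using B[of 0] by simp
  (* the derivative of the scaled smooth step is an approximate identity at the right of \<open>a\<close> *)
  have approx: "\<bar>integral {0..T} (\<lambda>t. deriv S ((t - a) / e) / e * q t) - q a\<bar> \<le> B * d"
    if a: "0 < a" "a + e < T" "e > 0" and d: "\<And>t. t \<in> {a..a+e} \<Longrightarrow> \<bar>q t - q a\<bar> \<le> d" for a e d
  proof -
    let ?k = "\<lambda>t. deriv S ((t - a) / e) / e"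
    have kD: "((\<lambda>t. S ((t - a) / e)) has_real_derivative ?k t) (at t)" for t
      using SDc[of e a t] a by simp
    have kc: "continuous_on A ?k" for A
      by (intro continuous_on_divide continuous_on_const continuous_on_compose2[OF S'c[of UNIV]] continuous_intros) (use a in auto)
    have k0: "?k t = 0" if t: "t \<notin> {a..a+e}" for t
    proof -
      have "\<exists>c. \<forall>\<^sub>F s in nhds t. S ((s - a) / e) = c"
      proof (cases "t < a")
        case True
        have "\<forall>\<^sub>F s in nhds t. s \<in> {..<a}" using True by (intro eventually_nhds_in_open) auto
        then have "\<forall>\<^sub>F s in nhds t. S ((s - a) / e) = 0"
          by (rule eventually_mono) (use a in \<open>auto intro!: S(2) simp: divide_nonpos_pos\<close>)
        then show ?thesis by blast
      next
        case False
        then have "t > a + e" using t by simp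
        then have "\<forall>\<^sub>F s in nhds t. s \<in> {a+e<..}" by (intro eventually_nhds_in_open) auto
        then have "\<forall>\<^sub>F s in nhds t. S ((s - a) / e) = 1"
          by (rule eventually_mono) (use a in \<open>auto intro!: S(3) simp: pos_le_divide_eq\<close>)
        then show ?thesis by blast
      qed
      then obtain c where "\<forall>\<^sub>F s in nhds t. S ((s - a) / e) = c" by blast
      then have "((\<lambda>t. S ((t - a) / e)) has_real_derivative 0) (at t)"
        using DERIV_cong_ev[OF refl, of "\<lambda>s. S ((s - a) / e)" "\<lambda>_. c" t 0 0] by simp
      then show ?thesis using DERIV_unique kD by blast
    qed
    have kb: "\<bar>?k t\<bar> \<le> B / e" if "t \<in> {a..a+e}" for t
    proof -
      have "(t - a) / e \<in> {0..1}" using that a by (simp add: pos_divide_le_eq)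
      then show ?thesis using B a by (simp add: abs_divide divide_right_mono)
    qed
    have k1: "integral {0..T} ?k = 1"
    proof -
      have "(?k has_integral (S ((T - a) / e) - S ((0 - a) / e))) {0..T}"
        by (rule integral_deriv_real[OF _ kD]) (use T in simp)
      moreover have "S ((T - a) / e) = 1" using a by (intro S(3)) (simp add: pos_le_divide_eq)
      moreover have "S ((0 - a) / e) = 0" using a by (intro S(2)) (simp add: divide_nonpos_pos)
      ultimately show ?thesis by (simp add: has_integral_iff)
    qed
    have "integral {0..T} (\<lambda>t. ?k t * q t) - q a = integral {0..T} (\<lambda>t. ?k t * q t) - integral {0..T} (\<lambda>t. ?k t * q a)"
      using k1 by simp
    also have "\<dots> = integral {0..T} (\<lambda>t. ?k t * q t - ?k t * q a)"
      by (intro Henstock_Kurzweil_Integration.integral_diff[symmetric] integrable_continuous_real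
          continuous_on_mult kc q continuous_on_const)
    also have "\<dots> = integral {0..T} (\<lambda>t. if t \<in> {a..a+e} then ?k t * (q t - q a) else 0)"
    proof (rule Henstock_Kurzweil_Integration.integral_cong)
      fix t assume "t \<in> {0..T}"
      show "?k t * q t - ?k t * q a = (if t \<in> {a..a+e} then ?k t * (q t - q a) else 0)"
        using k0[of t] by (auto simp only: right_diff_distrib mult_zero_left split: if_split) auto
    qed
    also have "\<dots> = integral {a..a+e} (\<lambda>t. ?k t * (q t - q a))"
    proof -
      have "{a..a+e} \<inter> {0..T} = {a..a+e}" using a by auto
      then show ?thesis by (simp only: integral_restrict_Int)
    qed
    finally have e: "integral {0..T} (\<lambda>t. ?k t * q t) - q a = integral {a..a+e} (\<lambda>t. ?k t * (q t - q a))" .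
    have "norm (integral {a..a+e} (\<lambda>t. ?k t * (q t - q a))) \<le> (B / e * d) * (a + e - a)"
    proof (rule integral_bound)
      show "continuous_on {a..a+e} (\<lambda>t. ?k t * (q t - q a))"
        using a by (intro continuous_on_mult kc continuous_on_diff continuous_on_const continuous_on_subset[OF q]) auto
      show "norm (?k t * (q t - q a)) \<le> B / e * d" if "t \<in> {a..a+e}" for t
        unfolding real_norm_def abs_mult using kb[OF that] d[OF that] B0 a
        by (intro mult_mono) auto
    qed (use a in simp)
    then show ?thesis unfolding e using a by simp
  qed
  have eq: "q a = q b" if ab: "0 < a" "a \<le> b" "b < T" for a b
  proof (rule ccontr)
    assume ne: "q a \<noteq> q b"
    define \<delta> where "\<delta> = \<bar>q a - q b\<bar> / (4 * (B + 1))"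
    have \<delta>: "\<delta> > 0" using ne B0 by (simp add: \<delta>_def)
    have cont_pt: "\<exists>r>0. \<forall>t\<in>{0..T}. dist t c < r \<longrightarrow> \<bar>q t - q c\<bar> \<le> \<delta>" if "c \<in> {0..T}" for c
      using q[unfolded continuous_on_iff, rule_format, OF that \<delta>] by (auto simp: dist_real_def) (meson less_imp_le)
    obtain r1 where r1: "r1 > 0" "\<And>t. t \<in> {0..T} \<Longrightarrow> dist t a < r1 \<Longrightarrow> \<bar>q t - q a\<bar> \<le> \<delta>"
      using cont_pt[of a] ab by auto
    obtain r2 where r2: "r2 > 0" "\<And>t. t \<in> {0..T} \<Longrightarrow> dist t b < r2 \<Longrightarrow> \<bar>q t - q b\<bar> \<le> \<delta>"
      using cont_pt[of b] ab by auto
    define e where "e = min (min r1 r2) (T - b) / 2"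
    have e: "e > 0" "e < r1" "e < r2" "b + e < T" 
    proof -
      have le: "e \<le> r1 / 2" "e \<le> r2 / 2" "e \<le> (T - b) / 2" unfolding e_def by simp_all
      show "e < r1" using le(1) r1(1) by linarith
      show "e < r2" using le(2) r2(1) by linarith
      show "b + e < T" using le(3) ab(3) by (simp add: field_simps)
      show "e > 0" using r1(1) r2(1) ab by (simp add: e_def)
    qed
    let ?\<theta> = "\<lambda>t. S (inverse e * t + - (a / e)) - S (inverse e * t + - (b / e))"
    have \<theta>: "test_function T ?\<theta>" by (rule test_function_step[OF S]) (use ab e in auto)
    have arg: "inverse e * t + - (c / e) = (t - c) / e" for c t by (simp add: divide_inverse algebra_simps)
    have kD: "((\<lambda>t. S ((t - c) / e)) has_real_derivative deriv S ((t - c) / e) / e) (at t)" for t c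
      using SDc[of e c t] e by simp
    have d\<theta>: "deriv ?\<theta> t = deriv S ((t - a) / e) / e - deriv S ((t - b) / e) / e" for t
      unfolding arg by (rule DERIV_imp_deriv[OF DERIV_diff[OF kD kD]])
    have kc: "continuous_on {0..T} (\<lambda>t. deriv S ((t - c) / e) / e)" for c
      by (intro continuous_on_divide continuous_on_const continuous_on_compose2[OF S'c[of UNIV]] continuous_intros) (use e in auto)
    have "0 = integral {0..T} (\<lambda>t. deriv S ((t - a) / e) / e * q t - deriv S ((t - b) / e) / e * q t)"
      using z[OF \<theta>] unfolding d\<theta> by (simp add: left_diff_distrib)
    also have "\<dots> = integral {0..T} (\<lambda>t. deriv S ((t - a) / e) / e * q t) - integral {0..T} (\<lambda>t. deriv S ((t - b) / e) / e * q t)"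
      by (intro Henstock_Kurzweil_Integration.integral_diff integrable_continuous_real continuous_on_mult kc q)
    finally have i: "integral {0..T} (\<lambda>t. deriv S ((t - a) / e) / e * q t) = integral {0..T} (\<lambda>t. deriv S ((t - b) / e) / e * q t)" by simp
    have 1: "\<bar>integral {0..T} (\<lambda>t. deriv S ((t - a) / e) / e * q t) - q a\<bar> \<le> B * \<delta>"
      by (rule approx) (use ab e r1(2) in \<open>auto simp: dist_real_def\<close>)
    have 2: "\<bar>integral {0..T} (\<lambda>t. deriv S ((t - b) / e) / e * q t) - q b\<bar> \<le> B * \<delta>"
      by (rule approx) (use ab e r2(2) in \<open>auto simp: dist_real_def\<close>)
    have "\<bar>q a - q b\<bar> \<le> 2 * (B * \<delta>)" using 1 2 i by linarith
    also have "\<dots> \<le> 2 * ((B + 1) * \<delta>)" using \<delta> by simp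
    also have "\<dots> = \<bar>q a - q b\<bar> / 2"
    proof -
      have gen: "2 * (D * (X / (4 * D))) = X / 2" if "D \<noteq> 0" for D X :: real using that by simp
      have "B + 1 \<noteq> 0" using B0 by linarith
      then show ?thesis unfolding \<delta>_def by (rule gen)
    qed
    finally show False using ne by simp
  qed
  have int: "q t = q (T / 2)" if "t \<in> {0<..<T}" for t
    using eq[of t "T/2"] eq[of "T/2" t] that T by (cases "t \<le> T / 2") auto
  have cl: "closure {0<..<T} = {0..T}" using T by simp
  have "q t = q (T / 2)" if "t \<in> {0..T}" for t
    using continuous_constant_on_closure[of "{0<..<T}" q "q (T / 2)" t] q int that unfolding cl by blast
  then show ?thesis by blast
qed

text \<open>Subtracting a multiple of a fixed test function of integral \<open>1\<close> makes any test function the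
  derivative of another one. This reduces the order by one at the price of a correction by a
  linear function.\<close>

lemma du_bois_reymond_2:
  assumes T: "T > 0" and q: "continuous_on {0..T} q"
    and z: "\<And>\<theta>. test_function T \<theta> \<Longrightarrow> integral {0..T} (\<lambda>t. deriv (deriv \<theta>) t * q t) = 0"
  shows "\<exists>c0 c1. \<forall>t\<in>{0..T}. q t = c0 + c1 * t"
proof -
  obtain \<rho> where \<rho>: "test_function T \<rho>" "integral {0..T} \<rho> = 1" using unit_test_function_exists[OF T] by blast
  define d where "d = integral {0..T} (\<lambda>t. deriv \<rho> t * q t)"
  have "integral {0..T} (\<lambda>t. deriv \<eta> t * (q t + d * t)) = 0" if \<eta>: "test_function T \<eta>" for \<eta>
  proof -
    define c where "c = integral {0..T} \<eta>"
    note tc = test_function_continuous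
    have f: "test_function T (\<lambda>t. \<eta> t - c * \<rho> t)" by (rule test_function_diff_cmult[OF \<eta> \<rho>(1)])
    have "integral {0..T} (\<lambda>t. \<eta> t - c * \<rho> t) = 0"
      using \<rho> by (subst Henstock_Kurzweil_Integration.integral_diff)
        (auto intro!: integrable_continuous_real continuous_intros tc[OF \<eta>] tc[OF \<rho>(1)] simp: c_def)
    then obtain \<theta> where \<theta>: "test_function T \<theta>" "deriv \<theta> = (\<lambda>t. \<eta> t - c * \<rho> t)"
      using test_function_antiderivative[OF T f] by blast
    have dd: "deriv (deriv \<theta>) t = deriv \<eta> t - c * deriv \<rho> t" for t
      unfolding \<theta>(2) by (intro DERIV_imp_deriv DERIV_diff DERIV_cmult test_function_DERIV[OF \<eta>] test_function_DERIV[OF \<rho>(1)])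
    note c\<eta> = tc[OF test_function_deriv[OF \<eta>]] and c\<rho> = tc[OF test_function_deriv[OF \<rho>(1)]]
    have "0 = integral {0..T} (\<lambda>t. deriv \<eta> t * q t - c * (deriv \<rho> t * q t))"
      using z[OF \<theta>(1)] unfolding dd by (simp add: left_diff_distrib mult.assoc)
    also have "\<dots> = integral {0..T} (\<lambda>t. deriv \<eta> t * q t) - c * d"
      by (subst Henstock_Kurzweil_Integration.integral_diff)
        (auto intro!: integrable_continuous_real continuous_on_mult continuous_on_const q c\<eta> c\<rho> simp: d_def)
    finally have 1: "integral {0..T} (\<lambda>t. deriv \<eta> t * q t) = c * d" by simp
    have 2: "integral {0..T} (\<lambda>t. deriv \<eta> t * t) = - c"
      using test_function_ibp[OF T \<eta>, of "\<lambda>t. t" "\<lambda>t. 1"] by (simp add: c_def)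
    have "integral {0..T} (\<lambda>t. deriv \<eta> t * (q t + d * t)) = integral {0..T} (\<lambda>t. deriv \<eta> t * q t + d * (deriv \<eta> t * t))"
      by (simp add: algebra_simps)
    also have "\<dots> = integral {0..T} (\<lambda>t. deriv \<eta> t * q t) + d * integral {0..T} (\<lambda>t. deriv \<eta> t * t)"
      by (subst Henstock_Kurzweil_Integration.integral_add)
        (auto intro!: integrable_continuous_real continuous_on_mult continuous_on_const continuous_on_id q c\<eta>)
    finally show ?thesis using 1 2 by simp
  qed
  moreover have "continuous_on {0..T} (\<lambda>t. q t + d * t)" by (intro continuous_intros q)
  ultimately obtain c0 where c0: "\<And>t. t \<in> {0..T} \<Longrightarrow> q t + d * t = c0"
    using du_bois_reymond_1[OF T, of "\<lambda>t. q t + d * t"] by blast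
  have "q t = c0 + (- d) * t" if "t \<in> {0..T}" for t using c0[OF that] by simp
  then show ?thesis by blast
qed

text \<open>The same reduction; integrating by parts twice shows that the correction is quadratic.\<close>

lemma du_bois_reymond_3:
  assumes T: "T > 0" and q: "continuous_on {0..T} q"
    and z: "\<And>\<theta>. test_function T \<theta> \<Longrightarrow> integral {0..T} (\<lambda>t. deriv (deriv (deriv \<theta>)) t * q t) = 0"
  shows "\<exists>c0 c1 c2. \<forall>t\<in>{0..T}. q t = c0 + c1 * t + c2 * t\<^sup>2"
proof -
  obtain \<rho> where \<rho>: "test_function T \<rho>" "integral {0..T} \<rho> = 1" using unit_test_function_exists[OF T] by blast
  define d where "d = integral {0..T} (\<lambda>t. deriv (deriv \<rho>) t * q t)"
  have "integral {0..T} (\<lambda>t. deriv (deriv \<eta>) t * (q t - d / 2 * t\<^sup>2)) = 0" if \<eta>: "test_function T \<eta>" for \<eta>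
  proof -
    define c where "c = integral {0..T} \<eta>"
    note tc = test_function_continuous
    have f: "test_function T (\<lambda>t. \<eta> t - c * \<rho> t)" by (rule test_function_diff_cmult[OF \<eta> \<rho>(1)])
    have "integral {0..T} (\<lambda>t. \<eta> t - c * \<rho> t) = 0"
      using \<rho> by (subst Henstock_Kurzweil_Integration.integral_diff)
        (auto intro!: integrable_continuous_real continuous_intros tc[OF \<eta>] tc[OF \<rho>(1)] simp: c_def)
    then obtain \<theta> where \<theta>: "test_function T \<theta>" "deriv \<theta> = (\<lambda>t. \<eta> t - c * \<rho> t)"
      using test_function_antiderivative[OF T f] by blast
    note \<eta>' = test_function_deriv[OF \<eta>] and \<rho>' = test_function_deriv[OF \<rho>(1)]
    have dd: "deriv (deriv \<theta>) = (\<lambda>t. deriv \<eta> t - c * deriv \<rho> t)"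
      unfolding \<theta>(2) by (intro ext DERIV_imp_deriv DERIV_diff DERIV_cmult test_function_DERIV[OF \<eta>] test_function_DERIV[OF \<rho>(1)])
    have ddd: "deriv (deriv (deriv \<theta>)) t = deriv (deriv \<eta>) t - c * deriv (deriv \<rho>) t" for t
      unfolding dd by (intro DERIV_imp_deriv DERIV_diff DERIV_cmult test_function_DERIV[OF \<eta>'] test_function_DERIV[OF \<rho>'])
    note c\<eta> = tc[OF test_function_deriv[OF \<eta>']] and c\<rho> = tc[OF test_function_deriv[OF \<rho>']]
    have "0 = integral {0..T} (\<lambda>t. deriv (deriv \<eta>) t * q t - c * (deriv (deriv \<rho>) t * q t))"
      using z[OF \<theta>(1)] unfolding ddd by (simp add: left_diff_distrib mult.assoc)
    also have "\<dots> = integral {0..T} (\<lambda>t. deriv (deriv \<eta>) t * q t) - c * d"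
      by (subst Henstock_Kurzweil_Integration.integral_diff)
        (auto intro!: integrable_continuous_real continuous_on_mult continuous_on_const q c\<eta> c\<rho> simp: d_def)
    finally have 1: "integral {0..T} (\<lambda>t. deriv (deriv \<eta>) t * q t) = c * d" by simp
    have "integral {0..T} (\<lambda>t. deriv (deriv \<eta>) t * t\<^sup>2) = - integral {0..T} (\<lambda>t. deriv \<eta> t * (2 * t))"
      by (rule test_function_ibp[OF T \<eta>']) (auto intro!: derivative_eq_intros continuous_intros)
    also have "integral {0..T} (\<lambda>t. deriv \<eta> t * (2 * t)) = - integral {0..T} (\<lambda>t. \<eta> t * 2)"
      by (rule test_function_ibp[OF T \<eta>]) (auto intro!: derivative_eq_intros continuous_intros)
    finally have 2: "integral {0..T} (\<lambda>t. deriv (deriv \<eta>) t * t\<^sup>2) = 2 * c" by (simp add: c_def)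
    have "integral {0..T} (\<lambda>t. deriv (deriv \<eta>) t * (q t - d / 2 * t\<^sup>2))
      = integral {0..T} (\<lambda>t. deriv (deriv \<eta>) t * q t - d / 2 * (deriv (deriv \<eta>) t * t\<^sup>2))"
      by (simp add: algebra_simps)
    also have "\<dots> = integral {0..T} (\<lambda>t. deriv (deriv \<eta>) t * q t) - d / 2 * integral {0..T} (\<lambda>t. deriv (deriv \<eta>) t * t\<^sup>2)"
      by (subst Henstock_Kurzweil_Integration.integral_diff)
        (auto intro!: integrable_continuous_real continuous_on_mult continuous_on_const continuous_on_power continuous_on_id q c\<eta>)
    finally show ?thesis using 1 2 by simp
  qed
  moreover have "continuous_on {0..T} (\<lambda>t. q t - d / 2 * t\<^sup>2)" by (intro continuous_intros q)
  ultimately obtain c0 c1 where c: "\<And>t. t \<in> {0..T} \<Longrightarrow> q t - d / 2 * t\<^sup>2 = c0 + c1 * t"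
    using du_bois_reymond_2[OF T, of "\<lambda>t. q t - d / 2 * t\<^sup>2"] by blast
  have "q t = c0 + c1 * t + (d / 2) * t\<^sup>2" if "t \<in> {0..T}" for t using c[OF that] by (simp add: algebra_simps)
  then show ?thesis by blast
qed

section \<open>Weak derivatives in time\<close>

abbreviation time_measure :: "real \<Rightarrow> real measure" where "time_measure T \<equiv> lebesgue_on {0<..<T}"

lemma time_measure_continuous:
  fixes f :: "real \<Rightarrow> real"
  assumes "continuous_on {0..T} f"
  shows "integrable (time_measure T) f" "(LINT t|time_measure T. f t) = integral {0..T} f"
proof -
  have "f absolutely_integrable_on {0..T}" by (rule absolutely_integrable_continuous_real[OF assms])
  then have "f absolutely_integrable_on {0<..<T}"
    using absolutely_integrable_on_open_interval[where f = f and a = 0 and b = T] by simp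
  then show i: "integrable (time_measure T) f" by (rule absolutely_integrable_imp_integrable) simp
  then have "(LINT t|time_measure T. f t) = integral {0<..<T} f" by (rule lebesgue_integral_eq_integral) simp
  then show "(LINT t|time_measure T. f t) = integral {0..T} f"
    using integral_open_interval[of 0 T f] by simp
qed

lemma time_measure_integrable_on:
  fixes p :: "real \<Rightarrow> real"
  assumes "integrable (time_measure T) p" "0 \<le> a" "b \<le> T"
  shows "p integrable_on {a..b}"
proof -
  have "p integrable_on {0<..<T}" by (rule integrable_on_lebesgue_on[OF assms(1)]) simp
  then have "p integrable_on {0..T}" using integrable_on_open_interval[of p 0 T] by simp
  then show ?thesis by (rule integrable_on_subinterval) (use assms in auto)
qed

lemma time_measure_id: "(\<lambda>x. x) \<in> borel_measurable (time_measure T)"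
  by (intro measurable_restrict_space1 measurable_completion) simp

lemma time_measure_indicator_integrable:
  fixes p :: "real \<Rightarrow> real"
  assumes p: "integrable (time_measure T) p"
  shows "integrable (time_measure T) (\<lambda>s. indicator {..t} s * p s)"
proof (rule Bochner_Integration.integrable_bound[OF p])
  have [measurable]: "p \<in> borel_measurable (time_measure T)" using p by (rule borel_measurable_integrable)
  have [measurable]: "(\<lambda>s. indicat_real {..t} s) \<in> borel_measurable (time_measure T)"
    by (rule measurable_compose[OF time_measure_id]) simp
  show "(\<lambda>s. indicator {..t} s * p s) \<in> borel_measurable (time_measure T)" by measurable
qed (simp add: indicator_def)

lemma time_measure_indicator_integral:
  fixes p :: "real \<Rightarrow> real"
  assumes p: "integrable (time_measure T) p" and t: "t \<in> {0..T}"
  shows "(LINT s|time_measure T. indicator {..t} s * p s) = integral {0..t} p"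
proof -
  note i = time_measure_indicator_integrable[OF p, of t]
  have "(LINT s|time_measure T. indicator {..t} s * p s) = integral {0<..<T} (\<lambda>s. indicator {..t} s * p s)"
    by (rule lebesgue_integral_eq_integral[OF i]) simp
  also have "\<dots> = integral {0..T} (\<lambda>s. indicator {..t} s * p s)"
    using integral_open_interval[of 0 T "\<lambda>s. indicator {..t} s * p s"] by simp
  also have "\<dots> = integral {0..T} (\<lambda>s. if s \<in> {..t} then p s else 0)"
    by (intro Henstock_Kurzweil_Integration.integral_cong) (simp add: indicator_def)
  also have "\<dots> = integral ({..t} \<inter> {0..T}) p" by (rule integral_restrict_Int)
  also have "{..t} \<inter> {0..T} = {0..t}" using t by auto
  finally show ?thesis .
qed

text \<open>Integration by parts against a function that is merely the primitive of an integrable one,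
  by exchanging the order of integration over the triangle \<open>s \<le> t\<close>.\<close>

lemma time_measure_fubini:
  fixes p :: "real \<Rightarrow> real"
  assumes T: "T > 0" and p: "integrable (time_measure T) p" and \<theta>: "test_function T \<theta>"
  shows "(LINT t|time_measure T. deriv \<theta> t * integral {0..t} p) = - (LINT t|time_measure T. \<theta> t * p t)"
proof -
  let ?M = "time_measure T"
  interpret M: finite_measure ?M by (rule finite_measure_lebesgue_on) simp
  interpret P: pair_sigma_finite ?M ?M by unfold_locales
  have \<theta>'c: "continuous_on S (deriv \<theta>)" for S by (rule test_function_continuous[OF test_function_deriv[OF \<theta>]])
  have [measurable]: "deriv \<theta> \<in> borel_measurable borel"
    by (rule borel_measurable_continuous_onI[OF \<theta>'c])
  have [measurable]: "p \<in> borel_measurable ?M" using p by (rule borel_measurable_integrable)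
  have id[measurable]: "(\<lambda>x. x) \<in> measurable ?M borel"
    by (rule time_measure_id)
  have m[measurable]: "(\<lambda>x. fst x) \<in> measurable (?M \<Otimes>\<^sub>M ?M) borel" "(\<lambda>x. snd x) \<in> measurable (?M \<Otimes>\<^sub>M ?M) borel"
    using measurable_compose[OF measurable_fst id] measurable_compose[OF measurable_snd id] by simp_all
  define f where "f = (\<lambda>t s. deriv \<theta> t * (indicator {x. snd x \<le> fst x} (t, s) * p s))"
  have meas: "case_prod f \<in> borel_measurable (?M \<Otimes>\<^sub>M ?M)"
  proof -
    have "case_prod f = (\<lambda>x. deriv \<theta> (fst x) * ((if snd x \<le> fst x then 1 else 0) * p (snd x)))"
      by (auto simp: f_def indicator_def)
    moreover have "(\<lambda>x. p (snd x)) \<in> borel_measurable (?M \<Otimes>\<^sub>M ?M)"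
      by (rule measurable_compose[OF measurable_snd]) simp
    ultimately show ?thesis by simp
  qed
  obtain B where B: "\<And>t. t \<in> {0..T} \<Longrightarrow> \<bar>deriv \<theta> t\<bar> \<le> B"
  proof -
    have cpt: "compact (deriv \<theta> ` {0..T})" by (intro compact_continuous_image \<theta>'c compact_Icc)
    then obtain B where "\<forall>y\<in>deriv \<theta> ` {0..T}. norm y \<le> B" using compact_imp_bounded[OF cpt] unfolding bounded_iff by blast
    then have "\<bar>deriv \<theta> t\<bar> \<le> B" if "t \<in> {0..T}" for t using that by auto
    then show ?thesis by (rule that)
  qed
  have pn: "integrable ?M (\<lambda>s. \<bar>p s\<bar>)" using p by (rule integrable_abs)
  have ind: "integrable ?M (\<lambda>s. f t s)" for t
  proof -
    have "integrable ?M (\<lambda>s. indicator {..t} s * p s)" by (rule time_measure_indicator_integrable[OF p])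
    then have "integrable ?M (\<lambda>s. deriv \<theta> t * (indicator {..t} s * p s))" by simp
    moreover have "f t = (\<lambda>s. deriv \<theta> t * (indicator {..t} s * p s))" by (auto simp: f_def indicator_def)
    ultimately show ?thesis by simp
  qed
  have int: "integrable (?M \<Otimes>\<^sub>M ?M) (case_prod f)"
  proof (rule P.Fubini_integrable[OF meas])
    show "AE t in ?M. integrable ?M (\<lambda>s. case_prod f (t, s))" using ind by simp
    show "integrable ?M (\<lambda>t. LINT s|?M. norm (case_prod f (t, s)))"
    proof (rule M.integrable_const_bound[where B = "B * (LINT s|?M. \<bar>p s\<bar>)"])
      show "AE t in ?M. norm (LINT s|?M. norm (case_prod f (t, s))) \<le> B * (LINT s|?M. \<bar>p s\<bar>)"
      proof (rule AE_I2)
        fix t assume "t \<in> space ?M"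
        then have t: "t \<in> {0..T}" by (simp add: space_restrict_space)
        have "(LINT s|?M. norm (f t s)) \<le> (LINT s|?M. B * \<bar>p s\<bar>)"
        proof (rule integral_mono)
          show "integrable ?M (\<lambda>s. norm (f t s))" using ind by (rule integrable_norm)
          show "integrable ?M (\<lambda>s. B * \<bar>p s\<bar>)" using pn by simp
          show "norm (f t s) \<le> B * \<bar>p s\<bar>" for s
          proof (cases "s \<le> t")
            case True
            then show ?thesis using mult_right_mono[OF B[OF t], of "\<bar>p s\<bar>"] by (simp add: f_def abs_mult)
          next
            case False
            have "0 \<le> B" using B[OF t] by linarith
            then show ?thesis using False by (simp add: f_def)
          qed
        qed
        then show "norm (LINT s|?M. norm (case_prod f (t, s))) \<le> B * (LINT s|?M. \<bar>p s\<bar>)"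
          by (simp add: abs_of_nonneg integral_nonneg_AE)
      qed
      show "(\<lambda>t. LINT s|?M. norm (case_prod f (t, s))) \<in> borel_measurable ?M"
        using meas by measurable
    qed
  qed
  have "(LINT s|?M. (LINT t|?M. f t s)) = (LINT t|?M. (LINT s|?M. f t s))"
    by (rule P.Fubini_integral[OF int])
  moreover have "(LINT t|?M. (LINT s|?M. f t s)) = (LINT t|?M. deriv \<theta> t * integral {0..t} p)"
  proof (rule Bochner_Integration.integral_cong[OF refl])
    fix t assume "t \<in> space ?M"
    then have t: "t \<in> {0..T}" by (simp add: space_restrict_space)
    have "f t = (\<lambda>s. deriv \<theta> t * (indicator {..t} s * p s))" by (auto simp: f_def indicator_def)
    then show "(LINT s|?M. f t s) = deriv \<theta> t * integral {0..t} p"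
      using time_measure_indicator_integral[OF p t] by simp
  qed
  moreover have "(LINT s|?M. (LINT t|?M. f t s)) = (LINT s|?M. - (\<theta> s * p s))"
  proof (rule Bochner_Integration.integral_cong[OF refl])
    fix s assume "s \<in> space ?M"
    then have s: "s \<in> {0..T}" by (simp add: space_restrict_space)
    have fe: "(\<lambda>t. f t s) = (\<lambda>t. (deriv \<theta> t - indicator {..s} t * deriv \<theta> t + indicator {s} t * deriv \<theta> t) * p s)"
      by (auto simp: f_def indicator_def)
    have i1: "integrable ?M (deriv \<theta>)" by (rule time_measure_continuous[OF \<theta>'c])
    (* the two sides differ only at \<open>t = s\<close> *)
    have "AE t in ?M. f t s = (deriv \<theta> t - indicator {..s} t * deriv \<theta> t) * p s"
    proof -
      have "AE t in lebesgue. t \<noteq> s" by (rule AE_I[of _ _ "{s}"]) auto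
      then have "AE t in ?M. t \<noteq> s" by (subst AE_restrict_space_iff) (auto elim: eventually_mono)
      then show ?thesis by eventually_elim (auto simp: f_def indicator_def)
    qed
    then have "(LINT t|?M. f t s) = (LINT t|?M. (deriv \<theta> t - indicator {..s} t * deriv \<theta> t) * p s)"
    proof (rule integral_cong_AE[rotated 2])
      have [measurable]: "deriv \<theta> \<in> borel_measurable ?M" by (rule borel_measurable_integrable[OF i1])
      have [measurable]: "(\<lambda>t. indicat_real {..s} t) \<in> borel_measurable ?M" "(\<lambda>t. indicat_real {s} t) \<in> borel_measurable ?M"
        by (rule measurable_compose[OF time_measure_id], simp)+
      show "(\<lambda>t. f t s) \<in> borel_measurable ?M" unfolding fe by measurable
      show "(\<lambda>t. (deriv \<theta> t - indicat_real {..s} t * deriv \<theta> t) * p s) \<in> borel_measurable ?M" by measurable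
    qed
    also have "\<dots> = ((LINT t|?M. deriv \<theta> t) - (LINT t|?M. indicator {..s} t * deriv \<theta> t)) * p s"
    proof -
      have "integrable ?M (\<lambda>t. indicator {..s} t * deriv \<theta> t)" by (rule time_measure_indicator_integrable[OF i1])
      then show ?thesis using i1 by (simp add: Bochner_Integration.integral_diff)
    qed
    also have "(LINT t|?M. deriv \<theta> t) = 0"
      using integral_deriv_real[of 0 T \<theta> "deriv \<theta>"] test_function_DERIV[OF \<theta>] T test_function_ends[OF \<theta>]
      by (simp add: time_measure_continuous(2)[OF \<theta>'c] has_integral_iff)
    also have "(LINT t|?M. indicator {..s} t * deriv \<theta> t) = \<theta> s"
      using integral_deriv_real[of 0 s \<theta> "deriv \<theta>"] test_function_DERIV[OF \<theta>] s test_function_ends[OF \<theta>, of 0]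
      by (simp add: time_measure_indicator_integral[OF i1 s] has_integral_iff)
    finally show "(LINT t|?M. f t s) = - (\<theta> s * p s)" by simp
  qed
  ultimately show ?thesis by simp
qed

lemma primitive_continuous:
  fixes p :: "real \<Rightarrow> real"
  assumes "integrable (time_measure T) p"
  shows "continuous_on {0..T} (\<lambda>t. integral {0..t} p)"
  by (intro indefinite_integral_continuous_1 time_measure_integrable_on[OF assms]) auto

lemma primitive_DERIV:
  fixes p :: "real \<Rightarrow> real"
  assumes "continuous_on {0..T} p" "t \<in> {0..T}"
  shows "((\<lambda>t. integral {0..t} p) has_real_derivative p t) (at t within {0..T})"
  by (rule integral_has_real_derivative[OF assms])

text \<open>A continuous function with an integrable weak derivative differs from the primitive of that
  derivative by a function with vanishing weak derivative.\<close>

lemma weak_time_regularity_1: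
  assumes T: "T > 0" and u0: "continuous_on {0..T} u0" and u1: "integrable (time_measure T) u1"
    and w1: "\<And>\<theta>. test_function T \<theta> \<Longrightarrow> (LINT t|time_measure T. deriv \<theta> t * u0 t) = - (LINT t|time_measure T. \<theta> t * u1 t)"
  shows "\<exists>c. \<forall>t\<in>{0..T}. u0 t = c + integral {0..t} u1"
proof -
  define P where "P = (\<lambda>t. integral {0..t} u1)"
  have Pc: "continuous_on {0..T} P" unfolding P_def by (rule primitive_continuous[OF u1])
  have "integral {0..T} (\<lambda>t. deriv \<theta> t * (u0 t - P t)) = 0" if \<theta>: "test_function T \<theta>" for \<theta>
  proof -
    have c: "continuous_on {0..T} (deriv \<theta>)" by (rule test_function_continuous[OF test_function_deriv[OF \<theta>]])
    have "integral {0..T} (\<lambda>t. deriv \<theta> t * (u0 t - P t))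
       = integral {0..T} (\<lambda>t. deriv \<theta> t * u0 t) - integral {0..T} (\<lambda>t. deriv \<theta> t * P t)"
      unfolding right_diff_distrib
      by (intro Henstock_Kurzweil_Integration.integral_diff integrable_continuous_real continuous_on_mult c u0 Pc)
    also have "integral {0..T} (\<lambda>t. deriv \<theta> t * u0 t) = (LINT t|time_measure T. deriv \<theta> t * u0 t)"
      by (intro time_measure_continuous(2)[symmetric] continuous_on_mult c u0)
    also have "integral {0..T} (\<lambda>t. deriv \<theta> t * P t) = (LINT t|time_measure T. deriv \<theta> t * P t)"
      by (intro time_measure_continuous(2)[symmetric] continuous_on_mult c Pc)
    also have "(LINT t|time_measure T. deriv \<theta> t * P t) = - (LINT t|time_measure T. \<theta> t * u1 t)"
      unfolding P_def by (rule time_measure_fubini[OF T u1 \<theta>])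
    finally show ?thesis using w1[OF \<theta>] by simp
  qed
  moreover have "continuous_on {0..T} (\<lambda>t. u0 t - P t)" by (intro continuous_on_diff u0 Pc)
  ultimately obtain c where c: "\<And>t. t \<in> {0..T} \<Longrightarrow> u0 t - P t = c"
    using du_bois_reymond_1[OF T, of "\<lambda>t. u0 t - P t"] by blast
  have "u0 t = c + integral {0..t} u1" if "t \<in> {0..T}" for t using c[OF that] by (simp add: P_def)
  then show ?thesis by blast
qed

text \<open>Three weak derivatives are removed at once, and the intermediate derivatives \<open>u1\<close> and \<open>u2\<close>
  enter only through their pairings with test functions.\<close>

lemma weak_time_regularity_3:
  fixes T :: real
  assumes T: "T > 0" and u0: "continuous_on {0..T} u0"
    and u3: "integrable (time_measure T) u3"
    and w1: "\<And>\<theta>. test_function T \<theta> \<Longrightarrow> (LINT t|time_measure T. deriv \<theta> t * u0 t) = - (LINT t|time_measure T. \<theta> t * u1 t)"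
    and w2: "\<And>\<theta>. test_function T \<theta> \<Longrightarrow> (LINT t|time_measure T. deriv \<theta> t * u1 t) = - (LINT t|time_measure T. \<theta> t * u2 t)"
    and w3: "\<And>\<theta>. test_function T \<theta> \<Longrightarrow> (LINT t|time_measure T. deriv \<theta> t * u2 t) = - (LINT t|time_measure T. \<theta> t * u3 t)"
  shows "\<exists>c0 c1 c2. \<forall>t\<in>{0..T}. u0 t = c0 + c1 * t + c2 * t\<^sup>2
    + integral {0..t} (\<lambda>t. integral {0..t} (\<lambda>t. integral {0..t} u3))"
proof -
  define P2 where "P2 = (\<lambda>t. integral {0..t} u3)"
  define P1 where "P1 = (\<lambda>t. integral {0..t} P2)"
  define P0 where "P0 = (\<lambda>t. integral {0..t} P1)"
  have P2c: "continuous_on {0..T} P2" unfolding P2_def by (rule primitive_continuous[OF u3])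
  have P1d: "(P1 has_real_derivative P2 t) (at t within {0..T})" if "t \<in> {0..T}" for t
    unfolding P1_def by (rule primitive_DERIV[OF P2c that])
  then have P1c: "continuous_on {0..T} P1" by (rule DERIV_continuous_on)
  have P0d: "(P0 has_real_derivative P1 t) (at t within {0..T})" if "t \<in> {0..T}" for t
    unfolding P0_def by (rule primitive_DERIV[OF P1c that])
  then have P0c: "continuous_on {0..T} P0" by (rule DERIV_continuous_on)
  have "integral {0..T} (\<lambda>t. deriv (deriv (deriv \<theta>)) t * (u0 t - P0 t)) = 0" if \<theta>: "test_function T \<theta>" for \<theta>
  proof -
    note \<theta>1 = test_function_deriv[OF \<theta>]
    note \<theta>2 = test_function_deriv[OF \<theta>1]
    note \<theta>3 = test_function_deriv[OF \<theta>2]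
    note c1 = test_function_continuous[OF \<theta>1, of "{0..T}"]
    note c3 = test_function_continuous[OF \<theta>3, of "{0..T}"]
    have "integral {0..T} (\<lambda>t. deriv (deriv (deriv \<theta>)) t * (u0 t - P0 t))
       = integral {0..T} (\<lambda>t. deriv (deriv (deriv \<theta>)) t * u0 t) - integral {0..T} (\<lambda>t. deriv (deriv (deriv \<theta>)) t * P0 t)"
      unfolding right_diff_distrib
      by (intro Henstock_Kurzweil_Integration.integral_diff integrable_continuous_real continuous_on_mult c3 u0 P0c)
    also have "integral {0..T} (\<lambda>t. deriv (deriv (deriv \<theta>)) t * u0 t) = (LINT t|time_measure T. deriv (deriv (deriv \<theta>)) t * u0 t)"
      by (intro time_measure_continuous(2)[symmetric] continuous_on_mult c3 u0)
    also have "\<dots> = - (LINT t|time_measure T. \<theta> t * u3 t)"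
      using w1[OF \<theta>2] w2[OF \<theta>1] w3[OF \<theta>] by simp
    also have "integral {0..T} (\<lambda>t. deriv (deriv (deriv \<theta>)) t * P0 t) = - integral {0..T} (\<lambda>t. deriv (deriv \<theta>) t * P1 t)"
      by (rule test_function_ibp[OF T \<theta>2 P0d P1c])
    also have "integral {0..T} (\<lambda>t. deriv (deriv \<theta>) t * P1 t) = - integral {0..T} (\<lambda>t. deriv \<theta> t * P2 t)"
      by (rule test_function_ibp[OF T \<theta>1 P1d P2c])
    also have "integral {0..T} (\<lambda>t. deriv \<theta> t * P2 t) = (LINT t|time_measure T. deriv \<theta> t * P2 t)"
      by (intro time_measure_continuous(2)[symmetric] continuous_on_mult c1 P2c)
    also have "\<dots> = - (LINT t|time_measure T. \<theta> t * u3 t)"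
      unfolding P2_def by (rule time_measure_fubini[OF T u3 \<theta>])
    finally show ?thesis by simp
  qed
  moreover have "continuous_on {0..T} (\<lambda>t. u0 t - P0 t)" by (intro continuous_on_diff u0 P0c)
  ultimately obtain c0 c1 c2 where c: "\<And>t. t \<in> {0..T} \<Longrightarrow> u0 t - P0 t = c0 + c1 * t + c2 * t\<^sup>2"
    using du_bois_reymond_3[OF T, of "\<lambda>t. u0 t - P0 t"] by blast
  have "u0 t = c0 + c1 * t + c2 * t\<^sup>2 + P0 t" if "t \<in> {0..T}" for t using c[OF that] by simp
  then show ?thesis unfolding P0_def P1_def P2_def by blast
qed

text \<open>Cauchy--Schwarz for the increments of a primitive, written with the increments of an
  increasing function of time; such bounds can be summed over the time steps. The proof integrates
  \<open>(G - m)\<^sup>2\<close> for the mean value \<open>m\<close>.\<close>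

lemma integral_sq_le:
  fixes G p :: "real \<Rightarrow> real"
  assumes G: "integrable (time_measure T) G" and G2: "integrable (time_measure T) (\<lambda>t. (G t)\<^sup>2)"
    and p: "integrable (time_measure T) p" and le: "\<And>t. \<bar>p t\<bar> \<le> G t"
    and st: "0 \<le> s" "s \<le> t" "t \<le> T"
  shows "(integral {0..t} p - integral {0..s} p)\<^sup>2
    \<le> (t - s) * (integral {0..t} (\<lambda>t. (G t)\<^sup>2) - integral {0..s} (\<lambda>t. (G t)\<^sup>2))"
proof (cases "s = t")
  case False
  then have d: "t - s > 0" using st by simp
  have split: "integral {0..t} f - integral {0..s} f = integral {s..t} f" if "integrable (time_measure T) f" for f :: "real \<Rightarrow> real"
    using Henstock_Kurzweil_Integration.integral_combine[of 0 s t f] time_measure_integrable_on[OF that, of 0 t] st by simp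
  have ii: "f integrable_on {s..t}" if "integrable (time_measure T) f" for f :: "real \<Rightarrow> real"
    by (rule time_measure_integrable_on[OF that]) (use st in auto)
  define \<omega> where "\<omega> = integral {s..t} G"
  define m where "m = \<omega> / (t - s)"
  have "\<bar>integral {s..t} p\<bar> \<le> \<omega>"
    using Henstock_Kurzweil_Integration.integral_norm_bound_integral[OF ii[OF p] ii[OF G]] le by (simp add: \<omega>_def)
  then have 1: "(integral {s..t} p)\<^sup>2 \<le> \<omega>\<^sup>2" by (metis abs_ge_zero power2_abs power_mono)
  have "((\<lambda>r. (G r)\<^sup>2 - (2 * m) * G r + m\<^sup>2) has_integral
     (integral {s..t} (\<lambda>t. (G t)\<^sup>2) - (2 * m) * \<omega> + (t - s) * m\<^sup>2)) {s..t}"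
    unfolding \<omega>_def
    using has_integral_const_real[of "m\<^sup>2" s t] st
    by (intro has_integral_add has_integral_diff has_integral_mult_right integrable_integral ii G G2) auto
  moreover have "0 \<le> (G r)\<^sup>2 - (2 * m) * G r + m\<^sup>2" for r
  proof -
    have "(G r)\<^sup>2 - (2 * m) * G r + m\<^sup>2 = (G r - m)\<^sup>2" by (simp add: power2_eq_square algebra_simps)
    then show ?thesis by simp
  qed
  ultimately have "0 \<le> integral {s..t} (\<lambda>t. (G t)\<^sup>2) - (2 * m) * \<omega> + (t - s) * m\<^sup>2"
    by (rule has_integral_nonneg)
  also have "\<dots> = integral {s..t} (\<lambda>t. (G t)\<^sup>2) - \<omega>\<^sup>2 / (t - s)"
    using d by (simp add: m_def power2_eq_square)
  finally have "\<omega>\<^sup>2 \<le> (t - s) * integral {s..t} (\<lambda>t. (G t)\<^sup>2)"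
    using d by (simp add: field_simps)
  then show ?thesis using 1 unfolding split[OF p] split[OF G2] by linarith
qed simp

lemma time_measure_AE_measurable:
  fixes f g :: "real \<Rightarrow> real"
  assumes f: "f \<in> borel_measurable (time_measure T)" and ae: "AE t in time_measure T. f t = g t"
  shows "g \<in> borel_measurable (time_measure T)"
proof -
  let ?S = "{0<..<T}"
  have "(\<lambda>x. indicator ?S x *\<^sub>R f x) \<in> borel_measurable lebesgue"
    using f by (subst (asm) borel_measurable_restrict_space_iff) auto
  moreover have "AE x in lebesgue. indicator ?S x *\<^sub>R f x = indicator ?S x *\<^sub>R g x"
  proof -
    have "AE x in lebesgue. x \<in> ?S \<longrightarrow> f x = g x"
      using ae by (subst (asm) AE_restrict_space_iff) auto
    then show ?thesis by eventually_elim (auto simp: indicator_def)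
  qed
  ultimately have "(\<lambda>x. indicator ?S x *\<^sub>R g x) \<in> borel_measurable lebesgue" by (rule borel_measurable_AE)
  then show ?thesis by (subst borel_measurable_restrict_space_iff) auto
qed

lemma sup_le_Ck_norm:
  assumes L: "L > 0" and f: "periodic L f" "continuous_on UNIV f"
  shows "\<bar>f x\<bar> \<le> Ck_norm k f"
proof -
  obtain B where B: "\<And>x. \<bar>f x\<bar> \<le> B"
    using periodic_bounded[OF L f] unfolding bounded_iff by auto
  have "\<bar>partials [] f x\<bar> \<le> (SUP x. \<bar>partials [] f x\<bar>)"
    by (rule cSUP_upper) (use B in \<open>auto intro!: bdd_aboveI\<close>)
  also have "\<dots> \<le> Ck_norm k f" unfolding Ck_norm_def
    by (intro Max_ge finite_imageI finite_multi_indices imageI) simp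
  finally show ?thesis by simp
qed

text \<open>Elements of the Bochner space are only given almost everywhere. Replacing them by \<open>0\<close> on the
  exceptional null set yields a representative \<open>v\<close> that is everywhere in \<open>C\<^sup>k\<close>, has measurable
  point evaluations and is dominated by one square-integrable function of time for all points of
  space.\<close>

lemma L2_Ck_pointwise:
  assumes L: "L > 0" and u: "u \<in> L2_Ck T k L"
  shows "\<exists>v G. (\<forall>t. 0 \<le> G t) \<and> integrable (time_measure T) G \<and> integrable (time_measure T) (\<lambda>t. (G t)\<^sup>2) \<and>
    (\<forall>t. v t \<in> Ck_per k L \<and> Ck_norm k (v t) \<le> G t) \<and>
    (\<forall>x. integrable (time_measure T) (\<lambda>t. v t x)) \<and>
    (\<forall>x. (\<lambda>t. u t x) \<in> borel_measurable (time_measure T)) \<and> (AE t in time_measure T. u t = v t)"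
proof -
  let ?M = "time_measure T"
  interpret M: finite_measure ?M by (rule finite_measure_lebesgue_on) simp
  obtain s :: "nat \<Rightarrow> real \<Rightarrow> real^3 \<Rightarrow> real" where s: "\<And>n. simple_function ?M (s n)" "\<And>n t. s n t \<in> Ck_per k L"
    and ae: "AE t in ?M. u t \<in> Ck_per k L \<and> (\<lambda>n. Ck_norm k (\<lambda>x. s n t x - u t x)) \<longlonglongrightarrow> 0"
    using u unfolding L2_Ck_def strongly_measurable_def by blast
  have sq: "integrable ?M (\<lambda>t. (Ck_norm k (u t))\<^sup>2)" using u by (simp add: L2_Ck_def)
  obtain N where N: "{t \<in> space ?M. \<not> (u t \<in> Ck_per k L \<and> (\<lambda>n. Ck_norm k (\<lambda>x. s n t x - u t x)) \<longlonglongrightarrow> 0)} \<subseteq> N"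
    "emeasure ?M N = 0" "N \<in> sets ?M"
    using ae by (rule AE_E)
  define A where "A = space ?M - N"
  have As[measurable]: "A \<in> sets ?M" using N(3) unfolding A_def by (rule sets.compl_sets)
  have good: "u t \<in> Ck_per k L" "(\<lambda>n. Ck_norm k (\<lambda>x. s n t x - u t x)) \<longlonglongrightarrow> 0" if "t \<in> A" for t
    using N(1) that by (auto simp: A_def)
  have aeA: "AE t in ?M. t \<in> A"
    by (rule AE_I[OF _ N(2,3)]) (auto simp: A_def)
  define v where "v = (\<lambda>t. if t \<in> A then u t else (\<lambda>x. 0))"
  define G where "G = (\<lambda>t. if t \<in> A then \<bar>Ck_norm k (u t)\<bar> else 0)"
  have p0: "partials \<alpha> (\<lambda>x. 0) = (\<lambda>x. 0)" for \<alpha>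
    by (induction \<alpha>) (auto simp: partial_def)
  have z: "(\<lambda>x. 0) \<in> Ck_per k L"
    unfolding Ck_per_def by (auto simp: periodic_def p0)
  have z0: "Ck_norm k (\<lambda>x. 0) = 0"
  proof -
    have "Ck_norm k (\<lambda>x. 0) = Max ((\<lambda>\<alpha>::3 list. 0::real) ` {\<alpha>. length \<alpha> \<le> k})"
      unfolding Ck_norm_def p0 by simp
    also have "(\<lambda>\<alpha>::3 list. 0::real) ` {\<alpha>. length \<alpha> \<le> k} = {0}"
    proof -
      have "[] \<in> {\<alpha>::3 list. length \<alpha> \<le> k}" by simp
      then show ?thesis by blast
    qed
    finally show ?thesis by simp
  qed
  have lim: "(\<lambda>n. s n t x) \<longlonglongrightarrow> u t x" if t: "t \<in> A" for t x
  proof -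
    have "\<bar>s n t x - u t x\<bar> \<le> Ck_norm k (\<lambda>x. s n t x - u t x)" for n
    proof (rule sup_le_Ck_norm[OF L])
      have "periodic L (s n t)" "continuous_on UNIV (s n t)" "periodic L (u t)" "continuous_on UNIV (u t)"
        using s(2)[of n t] good(1)[OF t] by (auto simp: Ck_per_def dest: spec[of _ "[]"])
      then show "periodic L (\<lambda>x. s n t x - u t x)" "continuous_on UNIV (\<lambda>x. s n t x - u t x)"
        by (auto simp: periodic_def intro!: continuous_intros)
    qed
    then have "(\<lambda>n. s n t x - u t x) \<longlonglongrightarrow> 0"
      by (intro Lim_null_comparison[OF _ good(2)[OF t]]) auto
    then show ?thesis by (simp add: LIM_zero_iff)
  qed
  have vm: "(\<lambda>t. v t x) \<in> borel_measurable ?M" for x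
  proof (rule borel_measurable_LIMSEQ_real)
    show "(\<lambda>n. if t \<in> A then s n t x else 0) \<longlonglongrightarrow> v t x" if "t \<in> space ?M" for t
      using lim by (auto simp: v_def)
    fix n
    have "simple_function ?M (\<lambda>t. s n t x)"
      using simple_function_compose[OF s(1)[of n], of "\<lambda>f. f x"] by (simp add: comp_def)
    then have [measurable]: "(\<lambda>t. s n t x) \<in> borel_measurable ?M" by (rule borel_measurable_simple_function)
    show "(\<lambda>t. if t \<in> A then s n t x else 0) \<in> borel_measurable ?M" by measurable
  qed
  have Gm: "G \<in> borel_measurable ?M"
  proof -
    have [measurable]: "(\<lambda>t. (Ck_norm k (u t))\<^sup>2) \<in> borel_measurable ?M" using sq by (rule borel_measurable_integrable)
    have "(\<lambda>t. if t \<in> A then sqrt ((Ck_norm k (u t))\<^sup>2) else 0) \<in> borel_measurable ?M" by measurable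
    then show ?thesis unfolding G_def real_sqrt_abs .
  qed
  have G2: "integrable ?M (\<lambda>t. (G t)\<^sup>2)"
    by (rule Bochner_Integration.integrable_bound[OF sq]) (use Gm in \<open>auto simp: G_def\<close>)
  have G1: "integrable ?M G"
  proof (rule Bochner_Integration.integrable_bound[of _ "\<lambda>t. 1 + (G t)\<^sup>2"])
    show "integrable ?M (\<lambda>t. 1 + (G t)\<^sup>2)" using G2 by simp
    show "AE t in ?M. norm (G t) \<le> norm (1 + (G t)\<^sup>2)"
    proof (rule AE_I2)
      fix t
      have "0 \<le> (\<bar>G t\<bar> - 1)\<^sup>2" by simp
      then have "2 * \<bar>G t\<bar> \<le> 1 + (G t)\<^sup>2" by (simp add: power2_eq_square algebra_simps abs_mult_self_eq)
      then show "norm (G t) \<le> norm (1 + (G t)\<^sup>2)" by simp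
    qed
  qed (rule Gm)
  have Gn: "0 \<le> G t" for t by (simp add: G_def)
  have vC: "v t \<in> Ck_per k L" "Ck_norm k (v t) \<le> G t" for t using good(1) z z0 by (auto simp: v_def G_def)
  have vi: "integrable ?M (\<lambda>t. v t x)" for x
  proof (rule Bochner_Integration.integrable_bound[OF G1 vm])
    have "\<bar>v t x\<bar> \<le> G t" for t using Ck_norm_bound[OF L vC(1)[of t], of "[]" x] vC(2)[of t] by simp
    then show "AE t in ?M. norm (v t x) \<le> norm (G t)" using Gn by simp
  qed
  have uv: "AE t in ?M. u t = v t" using aeA by eventually_elim (simp add: v_def)
  have "(\<lambda>t. u t x) \<in> borel_measurable ?M" for x
  proof (rule time_measure_AE_measurable[OF vm])
    show "AE t in ?M. v t x = u t x" using uv by eventually_elim simp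
  qed
  then show ?thesis using Gn G1 G2 vC vi uv by blast
qed

section \<open>Regularity of the exact solution\<close>

lemma Ck_per_0D: "f \<in> Ck_per k L \<Longrightarrow> periodic L f" "f \<in> Ck_per k L \<Longrightarrow> continuous_on UNIV f"
  by (auto simp: Ck_per_def dest: spec[of _ "[]"])

lemma exact_solution_time_modulus:
  assumes L: "L > 0" and ex: "exact_solution L T \<epsilon> \<Phi>" and t: "t \<in> {0..T}" and e: "e > 0"
  shows "\<exists>d>0. \<forall>s\<in>{0..T}. \<bar>s - t\<bar> < d \<longrightarrow> (\<forall>x. \<bar>\<Phi> s x - \<Phi> t x\<bar> < e)"
proof -
  have C: "\<Phi> s \<in> Ck_per 0 L" if "s \<in> {0..T}" for s using ex that by (auto simp: exact_solution_def)
  have "((\<lambda>s. Ck_norm 0 (\<lambda>x. \<Phi> s x - \<Phi> t x)) \<longlongrightarrow> 0) (at t within {0..T})"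
    using ex t by (auto simp: exact_solution_def)
  then have "\<forall>\<^sub>F s in at t within {0..T}. dist (Ck_norm 0 (\<lambda>x. \<Phi> s x - \<Phi> t x)) 0 < e"
    using e by (rule tendstoD)
  then obtain d where d: "d > 0" "\<And>s. s \<in> {0..T} \<Longrightarrow> s \<noteq> t \<Longrightarrow> dist s t < d \<Longrightarrow> dist (Ck_norm 0 (\<lambda>x. \<Phi> s x - \<Phi> t x)) 0 < e"
    unfolding eventually_at by blast
  have "\<bar>\<Phi> s x - \<Phi> t x\<bar> < e" if s: "s \<in> {0..T}" "\<bar>s - t\<bar> < d" for s x
  proof (cases "s = t")
    case False
    have "\<bar>\<Phi> s x - \<Phi> t x\<bar> \<le> Ck_norm 0 (\<lambda>x. \<Phi> s x - \<Phi> t x)"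
    proof (rule sup_le_Ck_norm[OF L])
      show "periodic L (\<lambda>x. \<Phi> s x - \<Phi> t x)" "continuous_on UNIV (\<lambda>x. \<Phi> s x - \<Phi> t x)"
        using Ck_per_0D[OF C[OF s(1)]] Ck_per_0D[OF C[OF t]] by (auto simp: periodic_def intro!: continuous_intros)
    qed
    moreover have "dist (Ck_norm 0 (\<lambda>x. \<Phi> s x - \<Phi> t x)) 0 < e" using d(2)[OF s(1) False] s(2) by (simp add: dist_real_def)
    ultimately show ?thesis by (simp add: dist_real_def)
  qed (use e in simp)
  then show ?thesis using d(1) by blast
qed

lemma exact_solution_continuous_time:
  assumes L: "L > 0" and ex: "exact_solution L T \<epsilon> \<Phi>"
  shows "continuous_on {0..T} (\<lambda>t. \<Phi> t x)"
  unfolding continuous_on_iff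
proof (intro ballI allI impI)
  fix t e :: real assume "t \<in> {0..T}" "e > 0"
  then obtain d where "d > 0" "\<And>s. s \<in> {0..T} \<Longrightarrow> \<bar>s - t\<bar> < d \<Longrightarrow> \<bar>\<Phi> s x - \<Phi> t x\<bar> < e"
    using exact_solution_time_modulus[OF L ex] by blast
  then show "\<exists>d>0. \<forall>s\<in>{0..T}. dist s t < d \<longrightarrow> dist (\<Phi> s x) (\<Phi> t x) < e"
    by (auto simp: dist_real_def)
qed

text \<open>Joint continuity on the compact set of times and points of the fundamental cell: continuity
  in time is uniform in space. In particular the solution is bounded away from \<open>0\<close>.\<close>

lemma exact_solution_bounds:
  assumes L: "L > 0" and T: "T > 0" and ex: "exact_solution L T \<epsilon> \<Phi>"
  shows "\<exists>m>0. \<exists>M. \<forall>t\<in>{0..T}. \<forall>x. m \<le> \<Phi> t x \<and> \<Phi> t x \<le> M"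
proof -
  let ?K = "cbox 0 (\<chi> i. L) :: (real^3) set"
  have C: "\<Phi> s \<in> Ck_per 0 L" if "s \<in> {0..T}" for s using ex that by (auto simp: exact_solution_def)
  have pos: "\<Phi> s x > 0" if "s \<in> {0..T}" for s x using ex that by (auto simp: exact_solution_def)
  define F where "F = (\<lambda>p. \<Phi> (fst p) (snd p))"
  have cont: "continuous_on ({0..T} \<times> ?K) F"
    unfolding continuous_on_iff
  proof (intro ballI allI impI)
    fix p and e :: real assume p: "p \<in> {0..T} \<times> ?K" and e: "e > 0"
    obtain t x where px: "p = (t, x)" "t \<in> {0..T}" using p by auto
    obtain d1 where d1: "d1 > 0" "\<And>s y. s \<in> {0..T} \<Longrightarrow> \<bar>s - t\<bar> < d1 \<Longrightarrow> \<bar>\<Phi> s y - \<Phi> t y\<bar> < e / 2"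
      using exact_solution_time_modulus[OF L ex px(2), of "e / 2"] e by auto
    obtain d2 where d2: "d2 > 0" "\<And>y. dist y x < d2 \<Longrightarrow> dist (\<Phi> t y) (\<Phi> t x) < e / 2"
      using Ck_per_0D(2)[OF C[OF px(2)]] e unfolding continuous_on_iff by (meson UNIV_I half_gt_zero)
    have "dist (F q) (F p) < e" if q: "q \<in> {0..T} \<times> ?K" "dist q p < min d1 d2" for q
    proof -
      obtain s y where qs: "q = (s, y)" "s \<in> {0..T}" using q by auto
      have "dist s t \<le> dist q p" "dist y x \<le> dist q p"
        using dist_fst_le[of q p] dist_snd_le[of q p] by (simp_all add: qs px)
      then have "\<bar>s - t\<bar> < d1" "dist y x < d2" using q(2) by (auto simp: dist_real_def)
      then have "\<bar>\<Phi> s y - \<Phi> t y\<bar> < e / 2" "dist (\<Phi> t y) (\<Phi> t x) < e / 2" using d1(2)[OF qs(2)] d2(2) by auto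
      then have "\<bar>\<Phi> s y - \<Phi> t x\<bar> < e" unfolding dist_real_def by linarith
      then show ?thesis by (simp add: F_def qs px dist_real_def)
    qed
    then show "\<exists>d>0. \<forall>q\<in>{0..T} \<times> ?K. dist q p < d \<longrightarrow> dist (F q) (F p) < e"
      using d1(1) d2(1) by (intro exI[of _ "min d1 d2"]) auto
  qed
  have cpt: "compact ({0..T} \<times> ?K)" by (intro compact_Times compact_Icc compact_cbox)
  have "(0::real^3) \<in> ?K" using L by (simp add: mem_box_cart)
  then have ne: "{0..T} \<times> ?K \<noteq> {}" using T by auto
  obtain p where p: "p \<in> {0..T} \<times> ?K" "\<And>q. q \<in> {0..T} \<times> ?K \<Longrightarrow> F p \<le> F q"
    using continuous_attains_inf[OF cpt ne cont] by blast
  obtain r where r: "r \<in> {0..T} \<times> ?K" "\<And>q. q \<in> {0..T} \<times> ?K \<Longrightarrow> F q \<le> F r"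
    using continuous_attains_sup[OF cpt ne cont] by blast
  have "F p > 0" using p(1) pos by (auto simp: F_def)
  moreover have "F p \<le> \<Phi> t x \<and> \<Phi> t x \<le> F r" if t: "t \<in> {0..T}" for t x
  proof -
    obtain y where y: "\<And>a. 0 \<le> y $ a \<and> y $ a \<le> L" "\<And>f. periodic L f \<Longrightarrow> f x = f y"
      using periodic_representative[OF L, of x] by metis
    have "(t, y) \<in> {0..T} \<times> ?K" using t y(1) by (simp add: mem_box_cart)
    then have "F p \<le> \<Phi> t y" "\<Phi> t y \<le> F r" using p(2)[of "(t,y)"] r(2)[of "(t,y)"] by (simp_all add: F_def)
    then show ?thesis using y(2)[OF Ck_per_0D(1)[OF C[OF t]]] by simp
  qed
  ultimately show ?thesis by blast
qed

lemma lap_h_integral: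
  assumes "\<And>x. \<Phi>t x = c x + integral {0..t} (\<lambda>r. v r x)" "\<And>x. \<Phi>s x = c x + integral {0..s} (\<lambda>r. v r x)"
    and int: "\<And>x. (\<lambda>r. v r x) integrable_on {0..s}" "\<And>x. (\<lambda>r. v r x) integrable_on {0..t}"
  shows "lap_h h \<Phi>t x - lap_h h \<Phi>s x = integral {0..t} (\<lambda>r. lap_h h (v r) x) - integral {0..s} (\<lambda>r. lap_h h (v r) x)"
proof -
  have gen: "integral {0..a} (\<lambda>r. lap_h h (v r) x) = (\<Sum>i\<in>UNIV. (integral {0..a} (\<lambda>r. v r (x + h *\<^sub>R axis i 1))
      + integral {0..a} (\<lambda>r. v r (x + (- h) *\<^sub>R axis i 1)) - 2 * integral {0..a} (\<lambda>r. v r x)) / h\<^sup>2)"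
    if i: "\<And>x. (\<lambda>r. v r x) integrable_on {0..a}" for a
  proof -
    have "((\<lambda>r. lap_h h (v r) x) has_integral (\<Sum>i\<in>UNIV. (integral {0..a} (\<lambda>r. v r (x + h *\<^sub>R axis i 1))
      + integral {0..a} (\<lambda>r. v r (x + (- h) *\<^sub>R axis i 1)) - 2 * integral {0..a} (\<lambda>r. v r x)) / h\<^sup>2)) {0..a}"
      unfolding lap_h_def diff2_def
      by (intro has_integral_sum has_integral_divide has_integral_diff has_integral_add has_integral_mult_right
          integrable_integral i) simp
    then show ?thesis by (simp add: has_integral_iff)
  qed
  show ?thesis
    unfolding gen[OF int(2)] gen[OF int(1)]
    unfolding lap_h_def diff2_def assms(1,2) sum_subtractf[symmetric] diff_divide_distrib[symmetric]
    by (intro sum.cong refl arg_cong2[where f = "(/)"]) simp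
qed

lemma lap_h_bound:
  assumes L: "L > 0" and f: "f \<in> Ck_per 2 L" and h: "h \<noteq> 0"
  shows "\<bar>lap_h h f x\<bar> \<le> 3 * Ck_norm 2 f"
proof -
  have "\<bar>diff2 h i f x\<bar> \<le> Ck_norm 2 f" for i
  proof (rule diff2_bound[OF _ _ _ h])
    show "has_line_deriv i f (partials [i] f)" using Ck_per_line_deriv[OF f, of "[]" i] by simp
    show "has_line_deriv i (partials [i] f) (partials [i,i] f)" using Ck_per_line_deriv[OF f, of "[i]" i] by simp
    show "\<bar>partials [i,i] f x\<bar> \<le> Ck_norm 2 f" for x using Ck_norm_bound[OF L f, of "[i,i]" x] by simp
  qed
  then have "\<bar>lap_h h f x\<bar> \<le> (\<Sum>i\<in>(UNIV::3 set). Ck_norm 2 f)"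
    unfolding lap_h_def by (intro order_trans[OF sum_abs sum_mono])
  then show ?thesis by simp
qed

text \<open>The regularity in time in the form in which it is used. Third weak derivatives in \<open>L\<^sup>2\<close> make
  \<open>\<Phi>\<close> twice differentiable in time at each point, with \<open>W = \<partial>\<^sub>t\<^sub>t \<Phi>\<close>; one weak derivative with
  values in \<open>C\<^sup>2\<close> controls increments of \<open>\<Delta>\<^sub>h \<Phi>\<close>. Both increments are measured by the increments
  of a single bounded increasing function \<open>\<Gamma>\<close>, namely the sum of the primitives of two squared
  norms.\<close>

lemma time_regularity:
  assumes L: "L > 0" and T: "T > 0" and ex: "exact_solution L T \<epsilon> \<Phi>" and cl: "\<Phi> \<in> class_R2 T L"
  obtains V W \<Gamma> B where
    "\<And>x t. t \<in> {0..T} \<Longrightarrow> ((\<lambda>s. \<Phi> s x) has_real_derivative V t x) (at t within {0..T})"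
    "\<And>x t. t \<in> {0..T} \<Longrightarrow> ((\<lambda>s. V s x) has_real_derivative W t x) (at t within {0..T})"
    "\<And>x t. t \<in> {0..T} \<Longrightarrow> \<bar>W t x\<bar> \<le> B" "\<And>t. t \<in> {0..T} \<Longrightarrow> 0 \<le> \<Gamma> t \<and> \<Gamma> t \<le> B"
    "\<And>s t x. 0 \<le> s \<Longrightarrow> s \<le> t \<Longrightarrow> t \<le> T \<Longrightarrow> (W t x - W s x)\<^sup>2 \<le> (t - s) * (\<Gamma> t - \<Gamma> s)"
    "\<And>s t x h. 0 \<le> s \<Longrightarrow> s \<le> t \<Longrightarrow> t \<le> T \<Longrightarrow> h \<noteq> 0 \<Longrightarrow> (lap_h h (\<Phi> t) x - lap_h h (\<Phi> s) x)\<^sup>2 \<le> (t - s) * (\<Gamma> t - \<Gamma> s)"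
proof -
  let ?M = "time_measure T"
  obtain w where w: "w 0 = \<Phi>" "\<And>j. j \<le> 3 \<Longrightarrow> w j \<in> L2_Ck T 0 L" "\<And>j. j < 3 \<Longrightarrow> weak_time_deriv T (w j) (w (Suc j))"
    using cl unfolding class_R2_def Hm_Ck_def by blast
  obtain w' where w': "w' 0 = \<Phi>" "\<And>j. j \<le> 2 \<Longrightarrow> w' j \<in> L2_Ck T 2 L" "\<And>j. j < 2 \<Longrightarrow> weak_time_deriv T (w' j) (w' (Suc j))"
    using cl unfolding class_R2_def Hm_Ck_def by blast
  obtain v G where vG: "\<And>t. 0 \<le> G t" "integrable ?M G" "integrable ?M (\<lambda>t. (G t)\<^sup>2)"
    "\<And>t. v t \<in> Ck_per 0 L" "\<And>t. Ck_norm 0 (v t) \<le> G t" "\<And>x. integrable ?M (\<lambda>t. v t x)"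
    "\<And>x. (\<lambda>t. w 3 t x) \<in> borel_measurable ?M" "AE t in ?M. w 3 t = v t"
    using L2_Ck_pointwise[OF L w(2)[of 3]] by auto
  obtain v' G' where vG': "\<And>t. 0 \<le> G' t" "integrable ?M G'" "integrable ?M (\<lambda>t. (G' t)\<^sup>2)"
    "\<And>t. v' t \<in> Ck_per 2 L" "\<And>t. Ck_norm 2 (v' t) \<le> G' t" "\<And>x. integrable ?M (\<lambda>t. v' t x)"
    "\<And>x. (\<lambda>t. w' 1 t x) \<in> borel_measurable ?M" "AE t in ?M. w' 1 t = v' t"
    using L2_Ck_pointwise[OF L w'(2)[of 1]] by auto
  have cont: "continuous_on {0..T} (\<lambda>t. \<Phi> t x)" for x by (rule exact_solution_continuous_time[OF L ex])
  have cong: "(LINT t|?M. \<theta> t * u t x) = (LINT t|?M. \<theta> t * z t x)"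
    if "test_function T \<theta>" "(\<lambda>t. u t x) \<in> borel_measurable ?M" "integrable ?M (\<lambda>t. z t x)" "AE t in ?M. u t = z t"
    for \<theta> and u z :: "real \<Rightarrow> real^3 \<Rightarrow> real" and x
  proof (rule integral_cong_AE)
    have \<theta>m: "\<theta> \<in> borel_measurable ?M"
      by (rule borel_measurable_integrable[OF time_measure_continuous(1)[OF test_function_continuous[OF that(1)]]])
    show "(\<lambda>t. \<theta> t * u t x) \<in> borel_measurable ?M" by (intro borel_measurable_times \<theta>m that)
    show "(\<lambda>t. \<theta> t * z t x) \<in> borel_measurable ?M"
      by (intro borel_measurable_times \<theta>m borel_measurable_integrable[OF that(3)])
    show "AE t in ?M. \<theta> t * u t x = \<theta> t * z t x" using that(4) by eventually_elim simp
  qed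
  have "\<exists>c0 c1 c2. \<forall>t\<in>{0..T}. \<Phi> t x = c0 + c1 * t + c2 * t\<^sup>2
    + integral {0..t} (\<lambda>t. integral {0..t} (\<lambda>t. integral {0..t} (\<lambda>t. v t x)))" for x
  proof (rule weak_time_regularity_3[OF T cont vG(6)])
    fix \<theta> assume \<theta>: "test_function T \<theta>"
    show "(LINT t|?M. deriv \<theta> t * \<Phi> t x) = - (LINT t|?M. \<theta> t * w 1 t x)"
      using w(3)[of 0] \<theta> w(1) unfolding weak_time_deriv_def by simp
    show "(LINT t|?M. deriv \<theta> t * w 1 t x) = - (LINT t|?M. \<theta> t * w 2 t x)"
      using w(3)[of 1] \<theta> unfolding weak_time_deriv_def by (simp add: numeral_2_eq_2)
    show "(LINT t|?M. deriv \<theta> t * w 2 t x) = - (LINT t|?M. \<theta> t * v t x)"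
      using w(3)[of 2] \<theta> cong[OF \<theta> vG(7) vG(6) vG(8)] unfolding weak_time_deriv_def by (simp add: numeral_3_eq_3)
  qed
  then obtain c0 c1 c2 where c: "\<And>x t. t \<in> {0..T} \<Longrightarrow> \<Phi> t x = c0 x + c1 x * t + c2 x * t\<^sup>2
    + integral {0..t} (\<lambda>t. integral {0..t} (\<lambda>t. integral {0..t} (\<lambda>t. v t x)))" by metis
  have "\<exists>c. \<forall>t\<in>{0..T}. \<Phi> t x = c + integral {0..t} (\<lambda>t. v' t x)" for x
  proof (rule weak_time_regularity_1[OF T cont vG'(6)])
    fix \<theta> assume \<theta>: "test_function T \<theta>"
    show "(LINT t|?M. deriv \<theta> t * \<Phi> t x) = - (LINT t|?M. \<theta> t * v' t x)"
      using w'(3)[of 0] \<theta> w'(1) cong[OF \<theta> vG'(7) vG'(6) vG'(8)] unfolding weak_time_deriv_def by simp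
  qed
  then obtain d where d: "\<And>x t. t \<in> {0..T} \<Longrightarrow> \<Phi> t x = d x + integral {0..t} (\<lambda>t. v' t x)" by metis
  define P2 where "P2 = (\<lambda>x t. integral {0..t} (\<lambda>t. v t x))"
  define P1 where "P1 = (\<lambda>x t. integral {0..t} (P2 x))"
  define P0 where "P0 = (\<lambda>x t. integral {0..t} (P1 x))"
  have P2c: "continuous_on {0..T} (P2 x)" for x unfolding P2_def by (rule primitive_continuous[OF vG(6)])
  have P1d: "(P1 x has_real_derivative P2 x t) (at t within {0..T})" if "t \<in> {0..T}" for t x
    unfolding P1_def by (rule primitive_DERIV[OF P2c that])
  have P1c: "continuous_on {0..T} (P1 x)" for x using P1d by (rule DERIV_continuous_on)
  have P0d: "(P0 x has_real_derivative P1 x t) (at t within {0..T})" if "t \<in> {0..T}" for t x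
    unfolding P0_def by (rule primitive_DERIV[OF P1c that])
  have c': "\<Phi> t x = c0 x + c1 x * t + c2 x * t\<^sup>2 + P0 x t" if "t \<in> {0..T}" for t x
    using c[OF that] by (simp add: P0_def P1_def P2_def)
  define V where "V = (\<lambda>t x. c1 x + 2 * c2 x * t + P1 x t)"
  define W where "W = (\<lambda>t x. 2 * c2 x + P2 x t)"
  have dV: "((\<lambda>s. \<Phi> s x) has_real_derivative V t x) (at t within {0..T})" if t: "t \<in> {0..T}" for t x
  proof -
    have "((\<lambda>s. c0 x + c1 x * s + c2 x * s\<^sup>2 + P0 x s) has_real_derivative V t x) (at t within {0..T})"
      unfolding V_def by (rule derivative_eq_intros P0d t refl | simp)+
    then show ?thesis
      by (rule has_field_derivative_transform_within[OF _ zero_less_one t]) (simp add: c')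
  qed
  have dW: "((\<lambda>s. V s x) has_real_derivative W t x) (at t within {0..T})" if t: "t \<in> {0..T}" for t x
    unfolding V_def W_def by (rule derivative_eq_intros P1d t refl | simp)+
  define g where "g = integral {0..T} G"
  have Gi: "G integrable_on {0..t}" if "t \<le> T" for t by (rule time_measure_integrable_on[OF vG(2)]) (use that in auto)
  have vb: "\<bar>v t x\<bar> \<le> G t" for t x using Ck_norm_bound[OF L vG(4)[of t], of "[]" x] vG(5)[of t] by simp
  have P2b: "\<bar>P2 x t\<bar> \<le> g" if t: "t \<in> {0..T}" for x t
  proof -
    have "norm (P2 x t) \<le> integral {0..t} G" unfolding P2_def
      by (rule Henstock_Kurzweil_Integration.integral_norm_bound_integral[OF time_measure_integrable_on[OF vG(6)] Gi])
        (use t vb in auto)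
    also have "\<dots> \<le> g" unfolding g_def
      by (rule integral_subset_le) (use t Gi vG(1) in auto)
    finally show ?thesis by simp
  qed
  have g0: "g \<ge> 0" using P2b[of 0 0] T by simp
  have P1b: "\<bar>P1 x t\<bar> \<le> g * T" if t: "t \<in> {0..T}" for x t
  proof -
    have "norm (P1 x t) \<le> g * (t - 0)" unfolding P1_def
      by (rule integral_bound) (use t P2b in \<open>auto intro: continuous_on_subset[OF P2c]\<close>)
    also have "\<dots> \<le> g * T" using g0 t by (intro mult_left_mono) auto
    finally show ?thesis by simp
  qed
  have P0b: "\<bar>P0 x t\<bar> \<le> g * T * T" if t: "t \<in> {0..T}" for x t
  proof -
    have "norm (P0 x t) \<le> (g * T) * (t - 0)" unfolding P0_def
      by (rule integral_bound) (use t P1b in \<open>auto intro: continuous_on_subset[OF P1c]\<close>)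
    also have "\<dots> \<le> g * T * T" using g0 t T by (intro mult_left_mono) auto
    finally show ?thesis by simp
  qed
  obtain m M where mM: "m > 0" "\<And>t x. t \<in> {0..T} \<Longrightarrow> m \<le> \<Phi> t x \<and> \<Phi> t x \<le> M"
    using exact_solution_bounds[OF L T ex] by blast
  define B0 where "B0 = M + g * T * T"
  have qb: "\<bar>c0 x + c1 x * t + c2 x * t\<^sup>2\<bar> \<le> B0" if t: "t \<in> {0..T}" for t x
    using c'[OF t, of x] P0b[OF t, of x] mM(1) mM(2)[OF t, of x] unfolding B0_def by linarith
  (* the quadratic coefficient is a second difference of three bounded values, so it is bounded
     uniformly in space *)
  have c2b: "\<bar>2 * c2 x\<bar> \<le> 16 * B0 / T\<^sup>2" for x
  proof -
    define q where "q = (\<lambda>t. c0 x + c1 x * t + c2 x * t\<^sup>2)"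
    have e: "c2 x * T\<^sup>2 = 2 * (q 0 - 2 * q (T/2) + q T)"
      by (simp add: q_def power2_eq_square algebra_simps)
    have "\<bar>q 0\<bar> \<le> B0" "\<bar>q (T/2)\<bar> \<le> B0" "\<bar>q T\<bar> \<le> B0" 
      unfolding q_def by (rule qb, use T in simp)+
    then have "\<bar>c2 x * T\<^sup>2\<bar> \<le> 8 * B0" unfolding e by (simp add: abs_le_iff)
    then have "\<bar>c2 x\<bar> * T\<^sup>2 \<le> 8 * B0" by (simp add: abs_mult)
    then have "\<bar>c2 x\<bar> \<le> 8 * B0 / T\<^sup>2" using T by (simp add: pos_le_divide_eq)
    then show ?thesis by simp
  qed
  define \<Gamma> where "\<Gamma> = (\<lambda>t. integral {0..t} (\<lambda>t. (G t)\<^sup>2) + integral {0..t} (\<lambda>t. (3 * G' t)\<^sup>2))"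
  have G3: "integrable ?M (\<lambda>t. 3 * G' t)" "integrable ?M (\<lambda>t. (3 * G' t)\<^sup>2)"
    using vG'(2,3) by (simp_all add: power_mult_distrib)
  have mono: "integral {0..s} f \<le> integral {0..t} f" if "0 \<le> s" "s \<le> t" "t \<le> T" "integrable ?M f" "\<And>r. 0 \<le> f r" for s t and f :: "real \<Rightarrow> real"
    by (rule integral_subset_le) (use that time_measure_integrable_on[OF that(4)] in auto)
  have i0: "integral {0..0} f = 0" for f :: "real \<Rightarrow> real" by simp
  define B where "B = 16 * B0 / T\<^sup>2 + g + \<Gamma> T"
  have \<Gamma>T: "0 \<le> \<Gamma> t \<and> \<Gamma> t \<le> \<Gamma> T" if t: "t \<in> {0..T}" for t
  proof -
    have "0 \<le> integral {0..t} f \<and> integral {0..t} f \<le> integral {0..T} f" if "integrable ?M f" "\<And>r. 0 \<le> f r" for f :: "real \<Rightarrow> real"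
      using mono[of 0 t f] mono[of t T f] t that by simp
    from this[OF vG(3)] this[OF G3(2)] show ?thesis unfolding \<Gamma>_def by simp
  qed
  have Bq: "0 \<le> 16 * B0 / T\<^sup>2" using c2b[of 0] by linarith
  have r1: "\<bar>W t x\<bar> \<le> B" if t: "t \<in> {0..T}" for t x
    using c2b[of x] P2b[OF t, of x] \<Gamma>T[of T] T unfolding W_def B_def by simp
  have r2: "0 \<le> \<Gamma> t \<and> \<Gamma> t \<le> B" if t: "t \<in> {0..T}" for t
    using \<Gamma>T[OF t] Bq g0 unfolding B_def by simp
  have r3: "(W t x - W s x)\<^sup>2 \<le> (t - s) * (\<Gamma> t - \<Gamma> s)" if st: "0 \<le> s" "s \<le> t" "t \<le> T" for s t x
  proof -
    have "(W t x - W s x)\<^sup>2 = (integral {0..t} (\<lambda>t. v t x) - integral {0..s} (\<lambda>t. v t x))\<^sup>2"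
      by (simp add: W_def P2_def)
    also have "\<dots> \<le> (t - s) * (integral {0..t} (\<lambda>t. (G t)\<^sup>2) - integral {0..s} (\<lambda>t. (G t)\<^sup>2))"
      by (rule integral_sq_le[OF vG(2,3,6) vb st])
    also have "\<dots> \<le> (t - s) * (\<Gamma> t - \<Gamma> s)"
      using st mono[OF st G3(2)] by (intro mult_left_mono) (auto simp: \<Gamma>_def)
    finally show ?thesis .
  qed
  have r4: "(lap_h h (\<Phi> t) x - lap_h h (\<Phi> s) x)\<^sup>2 \<le> (t - s) * (\<Gamma> t - \<Gamma> s)"
    if st: "0 \<le> s" "s \<le> t" "t \<le> T" and h: "h \<noteq> 0" for s t x h
  proof -
    have ii: "(\<lambda>r. v' r x) integrable_on {0..t}" if "t \<le> T" for x t
      by (rule time_measure_integrable_on[OF vG'(6)]) (use that in auto)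
    have e: "lap_h h (\<Phi> t) x - lap_h h (\<Phi> s) x = integral {0..t} (\<lambda>r. lap_h h (v' r) x) - integral {0..s} (\<lambda>r. lap_h h (v' r) x)"
      by (rule lap_h_integral[where c = d]) (use st d ii in auto)
    have li: "integrable ?M (\<lambda>r. lap_h h (v' r) x)"
      unfolding lap_h_def diff2_def
      by (intro Bochner_Integration.integrable_sum Bochner_Integration.integrable_divide_zero
         Bochner_Integration.integrable_diff Bochner_Integration.integrable_add integrable_mult_right vG'(6)) 
    have lb: "\<bar>lap_h h (v' r) x\<bar> \<le> 3 * G' r" for r
      using lap_h_bound[OF L vG'(4)[of r] h, of x] vG'(5)[of r] by linarith
    have "(lap_h h (\<Phi> t) x - lap_h h (\<Phi> s) x)\<^sup>2 \<le> (t - s) * (integral {0..t} (\<lambda>t. (3 * G' t)\<^sup>2) - integral {0..s} (\<lambda>t. (3 * G' t)\<^sup>2))"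
      unfolding e by (rule integral_sq_le[OF G3 li lb st])
    also have "\<dots> \<le> (t - s) * (\<Gamma> t - \<Gamma> s)"
      using st mono[OF st vG(3)] by (intro mult_left_mono) (auto simp: \<Gamma>_def)
    finally show ?thesis .
  qed
  show ?thesis by (rule that[OF dV dW r1 r2 r3 r4])
qed

text \<open>Sets of full measure are dense; together with continuity this extends the equation from
  almost every time to every time.\<close>

lemma AE_time_dense:
  assumes ae: "AE t in time_measure T. P t" and T: "T > 0" and t: "t \<in> {0..T}"
  shows "\<exists>\<sigma>. (\<forall>n. \<sigma> n \<in> {0<..<T} \<and> P (\<sigma> n)) \<and> \<sigma> \<longlonglongrightarrow> t"
proof -
  obtain N where N: "{s \<in> space (time_measure T). \<not> P s} \<subseteq> N" "emeasure (time_measure T) N = 0" "N \<in> sets (time_measure T)"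
    using ae by (rule AE_E)
  have NS: "N \<subseteq> {0<..<T}" "N \<in> sets lebesgue"
    using N(3) sets.sets_into_space[OF N(3)] by (auto simp: sets_restrict_space space_restrict_space)
  have N0: "emeasure lebesgue N = 0"
    using N(2) NS by (subst (asm) emeasure_restrict_space) auto
  have ex: "\<exists>s. s \<in> {0<..<T} \<and> P s \<and> \<bar>s - t\<bar> < e" if e: "e > 0" for e
  proof (rule ccontr)
    assume none: "\<not> ?thesis"
    define a where "a = max 0 (t - e)"
    define b where "b = min T (t + e)"
    have ab: "a < b" "0 \<le> a" "b \<le> T" using t e T by (auto simp: a_def b_def)
    have "{a<..<b} \<subseteq> N"
    proof
      fix s assume s: "s \<in> {a<..<b}"
      then have "s \<in> {0<..<T}" "\<bar>s - t\<bar> < e" by (auto simp: a_def b_def)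
      then have "\<not> P s" using none by blast
      then show "s \<in> N" using N(1) \<open>s \<in> {0<..<T}\<close> by (auto simp: space_restrict_space)
    qed
    then have "emeasure lebesgue {a<..<b} \<le> emeasure lebesgue N" using NS by (intro emeasure_mono) auto
    moreover have "emeasure lebesgue {a<..<b} = ennreal (b - a)" using ab by simp
    ultimately show False using N0 ab by simp
  qed
  then have "\<forall>n. \<exists>s. s \<in> {0<..<T} \<and> P s \<and> \<bar>s - t\<bar> < inverse (real (Suc n))" by simp
  then obtain \<sigma> where \<sigma>: "\<And>n. \<sigma> n \<in> {0<..<T} \<and> P (\<sigma> n) \<and> \<bar>\<sigma> n - t\<bar> < inverse (real (Suc n))" by metis
  have "(\<lambda>n. \<sigma> n - t) \<longlonglongrightarrow> 0"
    by (rule Lim_null_comparison[OF _ LIMSEQ_inverse_real_of_nat]) (use \<sigma> in \<open>auto intro!: always_eventually less_imp_le\<close>)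
  then have "\<sigma> \<longlonglongrightarrow> t" by (simp add: LIM_zero_iff)
  then show ?thesis using \<sigma> by blast
qed

lemma DERIV_within_bound:
  fixes f f' :: "real \<Rightarrow> real"
  assumes "\<And>r. r \<in> {0..T} \<Longrightarrow> (f has_real_derivative f' r) (at r within {0..T})"
    and ab: "0 \<le> a" "b \<le> T" and B: "\<And>r. r \<in> {a..b} \<Longrightarrow> \<bar>f' r\<bar> \<le> B" and st: "s \<in> {a..b}" "t \<in> {a..b}"
  shows "\<bar>f t - f s\<bar> \<le> B * \<bar>t - s\<bar>"
proof -
  have "norm (f t - f s) \<le> B * norm (t - s)"
  proof (rule field_differentiable_bound[of "{a..b}"])
    show "(f has_field_derivative f' r) (at r within {a..b})" if "r \<in> {a..b}" for r
      by (rule has_field_derivative_subset[OF assms(1)]) (use that ab in auto)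
    show "norm (f' r) \<le> B" if "r \<in> {a..b}" for r using B[OF that] by simp
  qed (use st in auto)
  then show ?thesis by simp
qed

text \<open>What the error analysis needs to know about the exact solution. \<open>V\<close> and \<open>W\<close> are its first
  two time derivatives, \<open>B\<close> bounds \<open>W\<close> and \<open>\<Gamma>\<close>, and \<open>m\<close> is a positive lower bound of the solution.
  Everything is stated for point values at all times; neither Sobolev spaces nor exceptional null
  sets appear any more.\<close>

locale reference_solution =
  fixes L T \<epsilon> :: real and \<Phi> V W :: "real \<Rightarrow> real^3 \<Rightarrow> real" and \<Gamma> :: "real \<Rightarrow> real" and B C m :: real
  assumes L: "L > 0" and T: "T > 0" and \<epsilon>: "\<epsilon> > 0" and C: "C > 0" and m: "m > 0"
    and per: "t \<in> {0..T} \<Longrightarrow> periodic L (\<Phi> t)"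
    and pos: "t \<in> {0..T} \<Longrightarrow> m \<le> \<Phi> t x"
    and dV: "t \<in> {0..T} \<Longrightarrow> ((\<lambda>s. \<Phi> s x) has_real_derivative V t x) (at t within {0..T})"
    and dW: "t \<in> {0..T} \<Longrightarrow> ((\<lambda>s. V s x) has_real_derivative W t x) (at t within {0..T})"
    and WB: "t \<in> {0..T} \<Longrightarrow> \<bar>W t x\<bar> \<le> B"
    and \<Gamma>B: "t \<in> {0..T} \<Longrightarrow> 0 \<le> \<Gamma> t \<and> \<Gamma> t \<le> B"
    and W2: "0 \<le> s \<Longrightarrow> s \<le> t \<Longrightarrow> t \<le> T \<Longrightarrow> (W t x - W s x)\<^sup>2 \<le> (t - s) * (\<Gamma> t - \<Gamma> s)"
    and lap2: "0 \<le> s \<Longrightarrow> s \<le> t \<Longrightarrow> t \<le> T \<Longrightarrow> h \<noteq> 0 \<Longrightarrow>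
       (lap_h h (\<Phi> t) x - lap_h h (\<Phi> s) x)\<^sup>2 \<le> (t - s) * (\<Gamma> t - \<Gamma> s)"
    and cons: "t \<in> {0..T} \<Longrightarrow> h \<noteq> 0 \<Longrightarrow> \<bar>lap_h h (chem_pot_h h \<epsilon> (\<Phi> t)) x - V t x\<bar> \<le> C * h\<^sup>2"
    and lip: "s \<ge> m / 2 \<Longrightarrow> r \<ge> m / 2 \<Longrightarrow> \<bar>nonlin s - nonlin r\<bar> \<le> C * \<bar>s - r\<bar>"
    and fourier: "t \<in> {0..T} \<Longrightarrow>
       \<bar>grid_proj L (2 * K + 1) (\<Phi> t) i j l - grid_proj L (2 * K + 1) (fourier_proj L K (\<Phi> t)) i j l\<bar> \<le> C * mesh L (2 * K + 1) ^ 4"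
    and mass: "t \<in> {0..T} \<Longrightarrow> gsum (2 * K + 1) (grid_proj L (2 * K + 1) (fourier_proj L K (\<Phi> t)))
       = gsum (2 * K + 1) (grid_proj L (2 * K + 1) (fourier_proj L K (\<Phi> 0)))"

text \<open>The discrete Laplacian of the discrete potential has grid sum \<open>0\<close> and is within \<open>C\<close> of the
  time derivative. Hence the grid mass of the exact solution, which need not be conserved, drifts
  only at the rate of the consistency error.\<close>

lemma mass_rate:
  assumes L: "L > 0" and N: "N > 0" and T: "T > 0"
    and per: "\<And>t. t \<in> {0..T} \<Longrightarrow> periodic L (\<Phi> t)"
    and dV: "\<And>t x. t \<in> {0..T} \<Longrightarrow> ((\<lambda>s. \<Phi> s x) has_real_derivative V t x) (at t within {0..T})"
    and cons: "\<And>t x. t \<in> {0..T} \<Longrightarrow> \<bar>lap_h (mesh L N) (chem_pot_h (mesh L N) \<epsilon> (\<Phi> t)) x - V t x\<bar> \<le> C"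
    and st: "s \<in> {0..T}" "t \<in> {0..T}"
  shows "\<bar>gsum N (grid_proj L N (\<Phi> t)) - gsum N (grid_proj L N (\<Phi> s))\<bar> \<le> C * real N ^ 3 * \<bar>t - s\<bar>"
proof (rule DERIV_within_bound[where T = T and a = 0 and b = T and f' = "\<lambda>t. gsum N (grid_proj L N (V t))"])
  fix r assume r: "r \<in> {0..T}"
  show "((\<lambda>t. gsum N (grid_proj L N (\<Phi> t))) has_real_derivative gsum N (grid_proj L N (V r))) (at r within {0..T})"
    unfolding gsum_def grid_proj_eval by (intro DERIV_sum dV r)
  have hper: "periodic L (chem_pot_h (mesh L N) \<epsilon> (\<Phi> r))"
  proof -
    have p: "\<Phi> r (x + L *\<^sub>R axis i 1 + z) = \<Phi> r (x + z)" for x i z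
    proof -
      have "\<Phi> r ((x + z) + L *\<^sub>R axis i 1) = \<Phi> r (x + z)" using per[OF r] unfolding periodic_def by blast
      then show ?thesis by (simp add: add.assoc add.commute add.left_commute)
    qed
    show ?thesis using per[OF r]
      unfolding periodic_def chem_pot_h_def lap_h_def diff2_def p by simp
  qed
  have z: "gsum N (\<lambda>i j l. lap_h (mesh L N) (chem_pot_h (mesh L N) \<epsilon> (\<Phi> r)) (grid_point L N i j l)) = 0"
    using gsum_lap_0[OF grid_proj_per[OF hper N], of L] by (simp add: grid_lap_grid_proj[abs_def])
  have "\<bar>gsum N (grid_proj L N (V r))\<bar> = \<bar>gsum N (\<lambda>i j l. lap_h (mesh L N) (chem_pot_h (mesh L N) \<epsilon> (\<Phi> r)) (grid_point L N i j l) - V r (grid_point L N i j l))\<bar>"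
    unfolding gsum_diff z by (simp add: grid_proj_eval[abs_def])
  also have "\<dots> \<le> gsum N (\<lambda>i j l. C)"
  proof -
    have u: "gsum N (\<lambda>i j l. lap_h (mesh L N) (chem_pot_h (mesh L N) \<epsilon> (\<Phi> r)) (grid_point L N i j l) - V r (grid_point L N i j l)) \<le> gsum N (\<lambda>i j l. C)"
      by (rule gsum_mono) (use cons[OF r] in \<open>simp add: abs_le_iff\<close>)
    have l: "gsum N (\<lambda>i j l. - C) \<le> gsum N (\<lambda>i j l. lap_h (mesh L N) (chem_pot_h (mesh L N) \<epsilon> (\<Phi> r)) (grid_point L N i j l) - V r (grid_point L N i j l))"
    proof (rule gsum_mono)
      fix i j l show "- C \<le> lap_h (mesh L N) (chem_pot_h (mesh L N) \<epsilon> (\<Phi> r)) (grid_point L N i j l) - V r (grid_point L N i j l)"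
        using cons[OF r, of "grid_point L N i j l"] by linarith
    qed
    show ?thesis using u l unfolding gsum_uminus by linarith
  qed
  finally show "\<bar>gsum N (grid_proj L N (V r))\<bar> \<le> C * real N ^ 3" by (simp add: gsum_const mult.commute)
qed (use st in auto)

text \<open>The differential equation and the \<open>C\<^sup>6\<close> bound hold at almost every time. The estimates
  derived from them involve only finitely many point values of \<open>\<Phi>\<close> and \<open>V\<close>, which are continuous
  in time, or are stable under pointwise limits; so they hold at every time.\<close>

lemma reference_solution_exists:
  assumes L: "L > 0" and T: "T > 0" and \<epsilon>: "\<epsilon> > 0" and ex: "exact_solution L T \<epsilon> \<Phi>" and cl: "\<Phi> \<in> class_R2 T L"
  shows "\<exists>V W \<Gamma> B C m. reference_solution L T \<epsilon> \<Phi> V W \<Gamma> B C m"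
proof -
  obtain V W \<Gamma> B where reg: "\<And>x t. t \<in> {0..T} \<Longrightarrow> ((\<lambda>s. \<Phi> s x) has_real_derivative V t x) (at t within {0..T})"
    "\<And>x t. t \<in> {0..T} \<Longrightarrow> ((\<lambda>s. V s x) has_real_derivative W t x) (at t within {0..T})"
    "\<And>x t. t \<in> {0..T} \<Longrightarrow> \<bar>W t x\<bar> \<le> B" "\<And>t. t \<in> {0..T} \<Longrightarrow> 0 \<le> \<Gamma> t \<and> \<Gamma> t \<le> B"
    "\<And>s t x. 0 \<le> s \<Longrightarrow> s \<le> t \<Longrightarrow> t \<le> T \<Longrightarrow> (W t x - W s x)\<^sup>2 \<le> (t - s) * (\<Gamma> t - \<Gamma> s)"
    "\<And>s t x h. 0 \<le> s \<Longrightarrow> s \<le> t \<Longrightarrow> t \<le> T \<Longrightarrow> h \<noteq> 0 \<Longrightarrow> (lap_h h (\<Phi> t) x - lap_h h (\<Phi> s) x)\<^sup>2 \<le> (t - s) * (\<Gamma> t - \<Gamma> s)"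
    by (rule time_regularity[OF L T ex cl], rule that)
  have C0: "\<Phi> t \<in> Ck_per 0 L" if "t \<in> {0..T}" for t using ex that by (auto simp: exact_solution_def)
  obtain m Mx where m: "m > 0" "\<And>t x. t \<in> {0..T} \<Longrightarrow> m \<le> \<Phi> t x \<and> \<Phi> t x \<le> Mx"
    using exact_solution_bounds[OF L T ex] by blast
  have cont: "continuous_on {0..T} (\<lambda>t. \<Phi> t x)" for x by (rule exact_solution_continuous_time[OF L ex])
  obtain M0 where M0: "AE t in time_measure T. Ck_norm 6 (\<Phi> t) \<le> M0"
    using cl unfolding class_R2_def Linf_Ck_def by blast
  define M where "M = max M0 0"
  have ae6: "AE t in time_measure T. \<Phi> t \<in> Ck_per 6 L"
  proof -
    obtain s :: "nat \<Rightarrow> real \<Rightarrow> real^3 \<Rightarrow> real" where "AE t in time_measure T. \<Phi> t \<in> Ck_per 6 L \<and> (\<lambda>n. Ck_norm 6 (\<lambda>x. s n t x - \<Phi> t x)) \<longlonglongrightarrow> 0"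
      using cl unfolding class_R2_def Linf_Ck_def strongly_measurable_def by blast
    then show ?thesis by eventually_elim simp
  qed
  have aeD: "AE t in time_measure T. \<forall>x. ((\<lambda>s. \<Phi> s x) has_real_derivative laplacian (chem_pot \<epsilon> (\<Phi> t)) x) (at t)"
    using ex by (simp add: exact_solution_def)
  define good where "good = (\<lambda>t. \<Phi> t \<in> Ck_per 6 L \<and> Ck_norm 6 (\<Phi> t) \<le> M \<and> (\<forall>x. ((\<lambda>s. \<Phi> s x) has_real_derivative laplacian (chem_pot \<epsilon> (\<Phi> t)) x) (at t)))"
  have ae: "AE t in time_measure T. good t"
    using ae6 M0 aeD by eventually_elim (auto simp: good_def M_def)
  have seq: "\<exists>\<sigma>. (\<forall>n. \<sigma> n \<in> {0<..<T} \<and> good (\<sigma> n)) \<and> \<sigma> \<longlonglongrightarrow> t" if "t \<in> {0..T}" for t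
    by (rule AE_time_dense[OF ae T that])
  have lim: "(\<lambda>n. f (\<sigma> n)) \<longlonglongrightarrow> f t" if "continuous_on {0..T} f" "\<sigma> \<longlonglongrightarrow> t" "t \<in> {0..T}" "\<And>n. \<sigma> n \<in> {0<..<T}" for f :: "real \<Rightarrow> real" and \<sigma> t
  proof (rule continuous_on_tendsto_compose[OF that(1,2,3)])
    have "\<sigma> n \<in> {0..T}" for n using that(4)[of n] by simp
    then show "\<forall>\<^sub>F n in sequentially. \<sigma> n \<in> {0..T}" by (intro always_eventually allI)
  qed
  have M: "M \<ge> 0" by (simp add: M_def)
  obtain C1 where C1: "C1 > 0" "\<And>f h x. f \<in> Ck_per 6 L \<Longrightarrow> Ck_norm 6 f \<le> M \<Longrightarrow> (\<And>x. m \<le> f x) \<Longrightarrow> h \<noteq> 0 \<Longrightarrow>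
    \<bar>lap_h h (chem_pot_h h \<epsilon> f) x - laplacian (chem_pot \<epsilon> f) x\<bar> \<le> C1 * h\<^sup>2"
    using space_consistency[OF L m(1) M, of \<epsilon>] by blast
  have Vc: "continuous_on {0..T} (\<lambda>t. V t x)" for x using reg(2) by (rule DERIV_continuous_on)
  have cons: "\<bar>lap_h h (chem_pot_h h \<epsilon> (\<Phi> t)) x - V t x\<bar> \<le> C1 * h\<^sup>2" if t: "t \<in> {0..T}" and h: "h \<noteq> 0" for t h x
  proof -
    obtain \<sigma> where \<sigma>: "\<And>n. \<sigma> n \<in> {0<..<T}" "\<And>n. good (\<sigma> n)" "\<sigma> \<longlonglongrightarrow> t" using seq[OF t] by blast
    have b: "\<bar>lap_h h (chem_pot_h h \<epsilon> (\<Phi> (\<sigma> n))) x - V (\<sigma> n) x\<bar> \<le> C1 * h\<^sup>2" for n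
    proof -
      have s: "\<sigma> n \<in> {0..T}" using \<sigma>(1)[of n] by simp
      have "at (\<sigma> n) within {0..T} = at (\<sigma> n)" using \<sigma>(1)[of n] by (intro at_within_interior) simp
      then have "((\<lambda>s. \<Phi> s x) has_real_derivative V (\<sigma> n) x) (at (\<sigma> n))" using reg(1)[OF s, of x] by simp
      moreover have "((\<lambda>s. \<Phi> s x) has_real_derivative laplacian (chem_pot \<epsilon> (\<Phi> (\<sigma> n))) x) (at (\<sigma> n))"
        using \<sigma>(2)[of n] by (simp add: good_def)
      ultimately have "V (\<sigma> n) x = laplacian (chem_pot \<epsilon> (\<Phi> (\<sigma> n))) x" by (rule DERIV_unique)
      then show ?thesis using C1(2)[of "\<Phi> (\<sigma> n)" h x] \<sigma>(2)[of n] m(2)[OF s] h by (simp add: good_def)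
    qed
    have \<Phi>l: "(\<lambda>n. \<Phi> (\<sigma> n) y) \<longlonglongrightarrow> \<Phi> t y" for y by (rule lim[OF cont \<sigma>(3) t \<sigma>(1)])
    have nl: "(\<lambda>n. nonlin (\<Phi> (\<sigma> n) y)) \<longlonglongrightarrow> nonlin (\<Phi> t y)" for y
    proof (rule isCont_tendsto_compose[OF _ \<Phi>l])
      have "\<Phi> t y > 0" using m(1) m(2)[OF t, of y] by linarith
      from DERIV_isCont[OF DERIV_nonlin_deriv[OF this, of 0]] show "isCont nonlin (\<Phi> t y)" by (simp add: nonlin_deriv_0)
    qed
    have "(\<lambda>n. \<bar>lap_h h (chem_pot_h h \<epsilon> (\<Phi> (\<sigma> n))) x - V (\<sigma> n) x\<bar>) \<longlonglongrightarrow> \<bar>lap_h h (chem_pot_h h \<epsilon> (\<Phi> t)) x - V t x\<bar>"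
      unfolding lap_h_def diff2_def chem_pot_h_def
      by (intro tendsto_rabs tendsto_diff tendsto_add tendsto_mult tendsto_divide tendsto_const tendsto_sum nl \<Phi>l
          lim[OF Vc \<sigma>(3) t \<sigma>(1)]) (use h in simp_all)
    then show ?thesis by (rule LIMSEQ_le_const2) (use b in blast)
  qed
  obtain C2 where C2: "C2 > 0" "\<And>s r. s \<ge> m / 2 \<Longrightarrow> r \<ge> m / 2 \<Longrightarrow> \<bar>nonlin s - nonlin r\<bar> \<le> C2 * \<bar>s - r\<bar>"
    using nonlin_lipschitz[of "m / 2"] m(1) by auto
  obtain C3 where C3: "C3 > 0" "\<And>M fs g K i j l. (\<And>n. fs n \<in> Ck_per 6 L \<and> Ck_norm 6 (fs n) \<le> M) \<Longrightarrow>
     (\<And>x. (\<lambda>n. fs n x) \<longlonglongrightarrow> g x) \<Longrightarrow> g \<in> Ck_per 0 L \<Longrightarrow>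
     \<bar>grid_proj L (2 * K + 1) g i j l - grid_proj L (2 * K + 1) (fourier_proj L K g) i j l\<bar> \<le> C3 * M * mesh L (2 * K + 1) ^ 4"
    using fourier_proj_error[OF L] by metis
  have four: "\<bar>grid_proj L (2 * K + 1) (\<Phi> t) i j l - grid_proj L (2 * K + 1) (fourier_proj L K (\<Phi> t)) i j l\<bar> \<le> C3 * M * mesh L (2 * K + 1) ^ 4"
    if t: "t \<in> {0..T}" for t K i j l
  proof -
    obtain \<sigma> where \<sigma>: "\<And>n. \<sigma> n \<in> {0<..<T}" "\<And>n. good (\<sigma> n)" "\<sigma> \<longlonglongrightarrow> t" using seq[OF t] by blast
    show ?thesis
      by (rule C3(2)[of "\<lambda>n. \<Phi> (\<sigma> n)"]) (use \<sigma>(2) C0[OF t] lim[OF cont \<sigma>(3) t \<sigma>(1)] in \<open>auto simp: good_def\<close>)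
  qed
  have per: "periodic L (\<Phi> t)" if "t \<in> {0..T}" for t by (rule Ck_per_0D(1)[OF C0[OF that]])
  (* grids of all sizes are used here: the mass defect on a grid is of the order of its squared
     mesh size, and the zeroth Fourier coefficient does not depend on the grid *)
  have mass: "gsum (2 * K + 1) (grid_proj L (2 * K + 1) (fourier_proj L K (\<Phi> t)))
       = gsum (2 * K + 1) (grid_proj L (2 * K + 1) (fourier_proj L K (\<Phi> 0)))" if t: "t \<in> {0..T}" for t K
  proof -
    have z: "0 \<in> {0..T}" using T by simp
    have "Re (fourier_coeff L (\<Phi> t) 0) = Re (fourier_coeff L (\<Phi> 0) 0)"
    proof (rule fourier_coeff_0_eqI[OF L Ck_per_0D(2)[OF C0[OF t]] Ck_per_0D(2)[OF C0[OF z]]])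
      fix N :: nat assume N: "N > 0"
      have h: "mesh L N \<noteq> 0" using mesh_pos[OF L N] by simp
      have "\<bar>gsum N (grid_proj L N (\<Phi> t)) - gsum N (grid_proj L N (\<Phi> 0))\<bar> \<le> (C1 * (mesh L N)\<^sup>2) * real N ^ 3 * \<bar>t - 0\<bar>"
        by (rule mass_rate[OF L N T per reg(1) cons[OF _ h] z t])
      also have "\<dots> \<le> (C1 * (mesh L N)\<^sup>2) * real N ^ 3 * T"
        using t C1 by (intro mult_left_mono) auto
      finally show "\<bar>gsum N (grid_proj L N (\<Phi> t)) - gsum N (grid_proj L N (\<Phi> 0))\<bar> \<le> (C1 * T) * (mesh L N)\<^sup>2 * real N ^ 3"
        by (simp add: mult_ac)
    qed
    then show ?thesis unfolding gsum_fourier_proj[OF L refl] by simp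
  qed
  define C where "C = C1 + C2 + C3 * M"
  have CC: "C1 \<le> C" "C2 \<le> C" "C3 * M \<le> C" "C > 0" using C1 C2 C3 M by (auto simp: C_def add_pos_nonneg)
  have "reference_solution L T \<epsilon> \<Phi> V W \<Gamma> B C m"
  proof
    show "\<bar>lap_h h (chem_pot_h h \<epsilon> (\<Phi> t)) x - V t x\<bar> \<le> C * h\<^sup>2" if "t \<in> {0..T}" "h \<noteq> 0" for t h x
      using cons[OF that, of x] mult_right_mono[OF CC(1), of "h\<^sup>2"] by simp
    show "\<bar>nonlin s - nonlin r\<bar> \<le> C * \<bar>s - r\<bar>" if "s \<ge> m / 2" "r \<ge> m / 2" for s r
      using C2(2)[OF that] mult_right_mono[OF CC(2), of "\<bar>s - r\<bar>"] by simp
    show "\<bar>grid_proj L (2 * K + 1) (\<Phi> t) i j l - grid_proj L (2 * K + 1) (fourier_proj L K (\<Phi> t)) i j l\<bar> \<le> C * mesh L (2 * K + 1) ^ 4"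
      if "t \<in> {0..T}" for t K i j l
by (rule order_trans[OF four[OF that] mult_right_mono[OF CC(3)]]) simp
  qed ((rule L T \<epsilon> CC(4) m(1) m(2)[THEN conjunct1] per reg mass; assumption)+)
  then show ?thesis by blast
qed

section \<open>Consistency of the time stepping\<close>

lemma grid_lap_bound:
  assumes "\<And>i j k. \<bar>v i j k\<bar> \<le> M"
  shows "\<bar>grid_lap L N v i j k\<bar> \<le> 12 * M / (mesh L N)\<^sup>2"
proof -
  let ?s = "v (i+1) j k + v (i-1) j k + v i (j+1) k + v i (j-1) k + v i j (k+1) + v i j (k-1) - 6 * v i j k"
  have "\<bar>?s\<bar> \<le> 12 * M"
    using assms[of "i+1" j k] assms[of "i-1" j k] assms[of i "j+1" k] assms[of i "j-1" k]
      assms[of i j "k+1"] assms[of i j "k-1"] assms[of i j k] unfolding abs_le_iff by simp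
  then have "\<bar>?s\<bar> / (mesh L N)\<^sup>2 \<le> 12 * M / (mesh L N)\<^sup>2" by (intro divide_right_mono) auto
  then show ?thesis by (simp add: grid_lap_def abs_mult)
qed

lemma gradsum_bound:
  assumes "\<And>i j k. \<bar>v i j k\<bar> \<le> M"
  shows "gradsum N v v \<le> real N ^ 3 * (12 * M\<^sup>2)"
proof -
  have d: "(a - b) * (a - b) \<le> 4 * M\<^sup>2" if "\<bar>a\<bar> \<le> M" "\<bar>b\<bar> \<le> M" for a b :: real
  proof -
    have "\<bar>a - b\<bar> \<le> 2 * M" using that by linarith
    then have "\<bar>a - b\<bar>\<^sup>2 \<le> (2 * M)\<^sup>2" by (intro power_mono) auto
    then show ?thesis by (simp add: power2_eq_square)
  qed
  have "gradsum N v v \<le> gsum N (\<lambda>i j k. 4 * M\<^sup>2 + 4 * M\<^sup>2 + 4 * M\<^sup>2)"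
    unfolding gradsum_def by (intro gsum_mono add_mono d assms)
  then show ?thesis by (simp add: gsum_const)
qed

lemma gsum_sq_bound:
  assumes "\<And>i j k. (v i j k)\<^sup>2 \<le> M"
  shows "gsum N (\<lambda>i j k. (v i j k)\<^sup>2) \<le> real N ^ 3 * M"
  using gsum_mono[of "\<lambda>i j k. (v i j k)\<^sup>2" "\<lambda>i j k. M" N] assms by (simp add: gsum_const)

lemma sq_sum_le: "(a + b)\<^sup>2 \<le> 2 * a\<^sup>2 + 2 * (b::real)\<^sup>2"
proof -
  have "0 \<le> (a - b)\<^sup>2" by simp
  then show ?thesis unfolding power2_sum power2_diff by linarith
qed

lemma abs_le_sum_sqD:
  fixes x a b :: real
  assumes "\<bar>x\<bar> \<le> a + b" shows "x\<^sup>2 \<le> 2 * a\<^sup>2 + 2 * b\<^sup>2"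
proof -
  have "\<bar>x\<bar>\<^sup>2 \<le> (a + b)\<^sup>2" using assms by (intro power_mono) auto
  then show ?thesis using sq_sum_le[of a b] by simp
qed

text \<open>The free grid functions \<open>m\<close> and \<open>\<eta>\<close> only distribute the consistency error over \<open>\<alpha>\<close>, \<open>\<beta>\<close> and
  \<open>\<eta>\<close>. The intended \<open>m\<close> is the discrete potential of the exact solution, for which \<open>\<alpha>\<close> is small.\<close>

lemma scheme_error_equation:
  fixes U2 U1 U0 \<phi>2 \<phi>1 \<phi>0 :: grid
  assumes scheme: "\<And>i j k. (3/2 * \<phi>2 i j k - 2 * \<phi>1 i j k + 1/2 * \<phi>0 i j k) / dt
      = grid_lap L N (discrete_chem_pot L N \<epsilon> A A0 dt \<phi>2 \<phi>1 \<phi>0) i j k"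
    and e: "\<And>i j k. e2 i j k = U2 i j k - \<phi>2 i j k" "\<And>i j k. e1 i j k = U1 i j k - \<phi>1 i j k"
      "\<And>i j k. e0 i j k = U0 i j k - \<phi>0 i j k"
    and \<alpha>: "\<And>i j k. \<alpha> i j k = (3/2 * U2 i j k - 2 * U1 i j k + 1/2 * U0 i j k) / dt - grid_lap L N m i j k"
    and \<beta>: "\<And>i j k. \<beta> i j k + grid_lap L N \<eta> i j k = m i j k - discrete_chem_pot L N \<epsilon> A A0 dt U2 U1 U0 i j k"
  shows "(3/2 * e2 i j k - 2 * e1 i j k + 1/2 * e0 i j k) / dt
      = grid_lap L N (\<lambda>i j k. nonlin (U2 i j k) - nonlin (\<phi>2 i j k)
          + (8/3 * A0) * (e2 i j k - 2 * e1 i j k + e0 i j k)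
          - A * dt * grid_lap L N (\<lambda>i j k. e2 i j k - e1 i j k) i j k
          - \<epsilon>\<^sup>2 * grid_lap L N e2 i j k) i j k
        + \<alpha> i j k + grid_lap L N (\<lambda>i j k. \<beta> i j k + grid_lap L N \<eta> i j k) i j k"
proof -
  let ?P = "discrete_chem_pot L N \<epsilon> A A0 dt U2 U1 U0"
  let ?Q = "discrete_chem_pot L N \<epsilon> A A0 dt \<phi>2 \<phi>1 \<phi>0"
  have e': "e2 = (\<lambda>i j k. U2 i j k - \<phi>2 i j k)" "e1 = (\<lambda>i j k. U1 i j k - \<phi>1 i j k)"
    by (intro ext e)+
  have l: "grid_lap L N e2 i j k = grid_lap L N U2 i j k - grid_lap L N \<phi>2 i j k"
    "grid_lap L N (\<lambda>i j k. e2 i j k - e1 i j k) i j k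
      = grid_lap L N (\<lambda>i j k. U2 i j k - U1 i j k) i j k - grid_lap L N (\<lambda>i j k. \<phi>2 i j k - \<phi>1 i j k) i j k" for i j k
    unfolding e' grid_lap_diff by simp_all
  have gen: "(nu - np) + k * ((u2 - p2) - 2 * (u1 - p1) + (u0 - p0)) - a * (lu - lp) - s * (lu' - lp')
     = (nu + k * (u2 - (2 * u1 - u0)) - a * lu - s * lu') - (np + k * (p2 - (2 * p1 - p0)) - a * lp - s * lp')"
    for nu np k u2 p2 u1 p1 u0 p0 a lu lp s lu' lp' :: real
    by (simp add: algebra_simps)
  have m: "(\<lambda>i j k. nonlin (U2 i j k) - nonlin (\<phi>2 i j k) + (8/3 * A0) * (e2 i j k - 2 * e1 i j k + e0 i j k)
          - A * dt * grid_lap L N (\<lambda>i j k. e2 i j k - e1 i j k) i j k - \<epsilon>\<^sup>2 * grid_lap L N e2 i j k)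
     = (\<lambda>i j k. ?P i j k - ?Q i j k)"
    unfolding l unfolding discrete_chem_pot_def e by (intro ext gen)
  have "(3/2 * e2 i j k - 2 * e1 i j k + 1/2 * e0 i j k) / dt
    = (3/2 * U2 i j k - 2 * U1 i j k + 1/2 * U0 i j k) / dt - (3/2 * \<phi>2 i j k - 2 * \<phi>1 i j k + 1/2 * \<phi>0 i j k) / dt"
    unfolding e diff_divide_distrib[symmetric] by (simp add: algebra_simps)
  also have "\<dots> = \<alpha> i j k + grid_lap L N m i j k - grid_lap L N ?Q i j k" unfolding scheme \<alpha> by simp
  finally show ?thesis unfolding m unfolding \<beta> grid_lap_diff by simp
qed

context reference_solution begin

lemma \<Gamma>_mono: "0 \<le> s \<Longrightarrow> s \<le> t \<Longrightarrow> t \<le> T \<Longrightarrow> \<Gamma> s \<le> \<Gamma> t"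
proof (cases "s = t")
  case False
  assume st: "0 \<le> s" "s \<le> t" "t \<le> T"
  have "0 \<le> (t - s) * (\<Gamma> t - \<Gamma> s)" using W2[OF st, of undefined] by (meson order_trans zero_le_power2)
  then show ?thesis using False st by (simp add: zero_le_mult_iff)
qed simp

text \<open>Two applications of the mean value inequality; \<open>\<omega>\<close> is the oscillation of the second time
  derivative, which need not be Lipschitz in time.\<close>

lemma taylor_2:
  assumes ac: "0 \<le> a" "c \<le> T" and b: "b \<in> {a..c}" and s: "s \<in> {a..c}"
    and \<delta>: "\<And>r. r \<in> {a..c} \<Longrightarrow> \<bar>r - b\<bar> \<le> \<delta>" and \<omega>: "\<And>r. r \<in> {a..c} \<Longrightarrow> \<bar>W r x - W b x\<bar> \<le> \<omega>"
  shows "\<bar>V s x - V b x - (s - b) * W b x\<bar> \<le> \<delta> * \<omega>"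
    and "\<bar>\<Phi> s x - \<Phi> b x - (s - b) * V b x - (s - b)\<^sup>2 / 2 * W b x\<bar> \<le> \<delta>\<^sup>2 * \<omega>"
proof -
  have \<omega>0: "\<omega> \<ge> 0" using \<omega>[OF s] by linarith
  have \<delta>0: "\<delta> \<ge> 0" using \<delta>[OF s] by linarith
  have V: "\<bar>V r x - V b x - (r - b) * W b x\<bar> \<le> \<delta> * \<omega>" if r: "r \<in> {a..c}" for r
  proof -
    have "\<bar>(V r x - r * W b x) - (V b x - b * W b x)\<bar> \<le> \<omega> * \<bar>r - b\<bar>"
    proof (rule DERIV_within_bound[OF _ ac _ b r])
      show "((\<lambda>r. V r x - r * W b x) has_real_derivative (W r x - W b x)) (at r within {0..T})" if "r \<in> {0..T}" for r
        using that by (auto intro!: derivative_eq_intros dW)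
    qed (rule \<omega>)
    also have "\<dots> \<le> \<omega> * \<delta>" using \<omega>0 \<delta>[OF r] by (intro mult_left_mono) auto
    finally show ?thesis by (simp add: algebra_simps)
  qed
  show "\<bar>V s x - V b x - (s - b) * W b x\<bar> \<le> \<delta> * \<omega>" by (rule V[OF s])
  have "\<bar>(\<Phi> s x - s * V b x - (s - b)\<^sup>2 / 2 * W b x) - (\<Phi> b x - b * V b x - (b - b)\<^sup>2 / 2 * W b x)\<bar> \<le> (\<delta> * \<omega>) * \<bar>s - b\<bar>"
  proof (rule DERIV_within_bound[OF _ ac _ b s])
    show "((\<lambda>r. \<Phi> r x - r * V b x - (r - b)\<^sup>2 / 2 * W b x) has_real_derivative (V r x - V b x - (r - b) * W b x)) (at r within {0..T})"
      if "r \<in> {0..T}" for r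
      using that by (auto intro!: derivative_eq_intros dV)
  qed (rule V)
  also have "\<dots> \<le> (\<delta> * \<omega>) * \<delta>" using \<omega>0 \<delta>0 \<delta>[OF s] by (intro mult_left_mono) auto
  finally show "\<bar>\<Phi> s x - \<Phi> b x - (s - b) * V b x - (s - b)\<^sup>2 / 2 * W b x\<bar> \<le> \<delta>\<^sup>2 * \<omega>"
    by (simp add: algebra_simps power2_eq_square)
qed

text \<open>Expansion at the middle time. The error of the difference formula is of order \<open>dt\<close> times the
  oscillation of \<open>W\<close>, and the square of this oscillation is at most \<open>dt\<close> times an increment of
  \<open>\<Gamma>\<close>. So the squared error is of order \<open>dt ^ 3\<close> times an increment that telescopes.\<close>

lemma bdf2_consistency:
  assumes a: "0 \<le> a" and dt: "dt > 0" and b: "b = a + dt" and c: "c = a + 2 * dt" "c \<le> T"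
  shows "\<bar>(3/2 * \<Phi> c x - 2 * \<Phi> b x + 1/2 * \<Phi> a x) / dt - V c x\<bar> \<le> 3 * dt * sqrt (dt * (\<Gamma> c - \<Gamma> a))"
    and "\<bar>\<Phi> c x - 2 * \<Phi> b x + \<Phi> a x\<bar> \<le> 5 * B * dt\<^sup>2"
proof -
  have mem: "a \<in> {a..c}" "b \<in> {a..c}" "c \<in> {a..c}" using b c dt by auto
  have \<delta>: "\<bar>r - b\<bar> \<le> dt" if "r \<in> {a..c}" for r using that b c by auto
  have \<omega>: "\<bar>W r x - W b x\<bar> \<le> sqrt (dt * (\<Gamma> c - \<Gamma> a))" if r: "r \<in> {a..c}" for r
  proof (rule real_le_rsqrt)
    have bm: "0 \<le> b" "b \<le> T" "0 \<le> r" "r \<le> T" "a \<le> r" "r \<le> c" "a \<le> T" using b c a dt r by auto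
    have m: "\<Gamma> a \<le> \<Gamma> r" "\<Gamma> r \<le> \<Gamma> c" "\<Gamma> a \<le> \<Gamma> b" "\<Gamma> b \<le> \<Gamma> c"
      using \<Gamma>_mono[of a r] \<Gamma>_mono[of r c] \<Gamma>_mono[of a b] \<Gamma>_mono[of b c] a bm c b dt by auto
    show "\<bar>W r x - W b x\<bar>\<^sup>2 \<le> dt * (\<Gamma> c - \<Gamma> a)"
    proof (cases "r \<le> b")
      case True
      have "\<bar>W r x - W b x\<bar>\<^sup>2 \<le> (b - r) * (\<Gamma> b - \<Gamma> r)"
        using W2[of r b x] True bm by (simp add: power2_commute)
      also have "\<dots> \<le> dt * (\<Gamma> c - \<Gamma> a)" using m dt \<delta>[OF r] \<Gamma>_mono[of r b] True bm by (intro mult_mono) auto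
      finally show ?thesis .
    next
      case False
      have "\<bar>W r x - W b x\<bar>\<^sup>2 \<le> (r - b) * (\<Gamma> r - \<Gamma> b)"
        using W2[of b r x] False bm by simp
      also have "\<dots> \<le> dt * (\<Gamma> c - \<Gamma> a)" using m dt \<delta>[OF r] \<Gamma>_mono[of b r] False bm by (intro mult_mono) auto
      finally show ?thesis .
    qed
  qed
  define \<omega>' where "\<omega>' = sqrt (dt * (\<Gamma> c - \<Gamma> a))"
  define \<rho> where "\<rho> = (\<lambda>s. \<Phi> s x - \<Phi> b x - (s - b) * V b x - (s - b)\<^sup>2 / 2 * W b x)"
  have t: "\<bar>V s x - V b x - (s - b) * W b x\<bar> \<le> dt * \<omega>'" "\<bar>\<rho> s\<bar> \<le> dt\<^sup>2 * \<omega>'" if "s \<in> {a..c}" for s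
    unfolding \<omega>'_def \<rho>_def using taylor_2[OF a c(2) mem(2) that \<delta> \<omega>] by blast+
  define D where "D = 3/2 * \<rho> c + 1/2 * \<rho> a - dt * (V c x - V b x - (c - b) * W b x)"
  have D: "3/2 * \<Phi> c x - 2 * \<Phi> b x + 1/2 * \<Phi> a x = dt * V c x + D"
    unfolding D_def \<rho>_def b c by (simp add: algebra_simps power2_eq_square)
  have "\<bar>dt * (V c x - V b x - (c - b) * W b x)\<bar> \<le> dt * (dt * \<omega>')"
    using t(1)[OF mem(3)] dt by (simp add: abs_mult)
  then have "\<bar>D\<bar> \<le> 3/2 * (dt\<^sup>2 * \<omega>') + 1/2 * (dt\<^sup>2 * \<omega>') + dt * (dt * \<omega>')"
    using t(2)[OF mem(3)] t(2)[OF mem(1)] unfolding D_def by linarith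
  also have "\<dots> = 3 * dt * \<omega>' * dt" by (simp add: power2_eq_square)
  finally have "\<bar>D / dt\<bar> \<le> 3 * dt * \<omega>'" using dt by (simp add: abs_divide divide_le_eq)
  moreover have "(3/2 * \<Phi> c x - 2 * \<Phi> b x + 1/2 * \<Phi> a x) / dt - V c x = D / dt"
    unfolding D using dt by (simp add: add_divide_distrib)
  ultimately show "\<bar>(3/2 * \<Phi> c x - 2 * \<Phi> b x + 1/2 * \<Phi> a x) / dt - V c x\<bar> \<le> 3 * dt * sqrt (dt * (\<Gamma> c - \<Gamma> a))"
    unfolding \<omega>'_def by (simp only:)
  have sub: "r \<in> {0..T}" if "r \<in> {a..c}" for r using that a c by auto
  have WB2: "\<bar>W r x - W b x\<bar> \<le> 2 * B" if "r \<in> {a..c}" for r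
    using WB[OF sub[OF that], of x] WB[OF sub[OF mem(2)], of x] by linarith
  have t': "\<bar>\<rho> s\<bar> \<le> dt\<^sup>2 * (2 * B)" if "s \<in> {a..c}" for s
    unfolding \<rho>_def using taylor_2(2)[OF a c(2) mem(2) that \<delta> WB2] by blast
  have WBb: "\<bar>dt\<^sup>2 * W b x\<bar> \<le> dt\<^sup>2 * B" using WB[OF sub[OF mem(2)], of x] by (simp add: abs_mult mult_left_mono)
  have "\<Phi> c x - 2 * \<Phi> b x + \<Phi> a x = dt\<^sup>2 * W b x + \<rho> c + \<rho> a"
    unfolding \<rho>_def b c by (simp add: algebra_simps power2_eq_square)
  then have "\<bar>\<Phi> c x - 2 * \<Phi> b x + \<Phi> a x\<bar> \<le> dt\<^sup>2 * B + dt\<^sup>2 * (2 * B) + dt\<^sup>2 * (2 * B)"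
    using t'[OF mem(3)] t'[OF mem(1)] WBb by linarith
  then show "\<bar>\<Phi> c x - 2 * \<Phi> b x + \<Phi> a x\<bar> \<le> 5 * B * dt\<^sup>2" by (simp add: algebra_simps)
qed

lemma euler_consistency:
  assumes dt: "dt > 0" "dt \<le> T"
  shows "\<bar>V dt x - V 0 x\<bar> \<le> B * dt" and "\<bar>\<Phi> dt x - \<Phi> 0 x - dt * V 0 x\<bar> \<le> B * dt\<^sup>2"
proof -
  have m: "0 \<in> {0..dt}" "dt \<in> {0..dt}" using dt by auto
  have B0: "B \<ge> 0" using WB[of 0 undefined] T by simp
  have V: "\<bar>V r x - V 0 x\<bar> \<le> B * dt" if r: "r \<in> {0..dt}" for r
  proof -
    have "\<bar>V r x - V 0 x\<bar> \<le> B * \<bar>r - 0\<bar>"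
      by (rule DERIV_within_bound[OF dW order_refl dt(2) _ m(1) r]) (use WB dt in auto)
    also have "\<dots> \<le> B * dt" using B0 r by (intro mult_left_mono) auto
    finally show ?thesis .
  qed
  show "\<bar>V dt x - V 0 x\<bar> \<le> B * dt" by (rule V[OF m(2)])
  have "\<bar>(\<Phi> dt x - dt * V 0 x) - (\<Phi> 0 x - 0 * V 0 x)\<bar> \<le> (B * dt) * \<bar>dt - 0\<bar>"
  proof (rule DERIV_within_bound[OF _ order_refl dt(2) _ m])
    show "((\<lambda>r. \<Phi> r x - r * V 0 x) has_real_derivative (V r x - V 0 x)) (at r within {0..T})" if "r \<in> {0..T}" for r
      using that by (auto intro!: derivative_eq_intros dV)
  qed (rule V)
  then show "\<bar>\<Phi> dt x - \<Phi> 0 x - dt * V 0 x\<bar> \<le> B * dt\<^sup>2" using dt by (simp add: power2_eq_square algebra_simps)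
qed

end

section \<open>The error estimate\<close>

text \<open>One run of the scheme, on a grid so fine that the comparison function below stays above
  \<open>m / 2\<close>.\<close>

locale error_analysis = reference_solution +
  fixes A A0 dt h :: real and K N :: nat and \<phi> :: "int \<Rightarrow> grid"
  assumes A: "A \<ge> 0" and A0: "A0 \<ge> 0" and dt: "dt > 0" "dt \<le> 1"
    and N_def: "N = 2 * K + 1" and h_def: "h = mesh L N" and h1: "h \<le> 1"
    and hm: "2 * (C * (1 + T)) * h\<^sup>2 \<le> m"
    and sol: "numerical_solution L K \<epsilon> A A0 \<Phi> dt \<phi>"
begin

definition "\<kappa> = 8/3 * A0"
text \<open>The comparison function \<open>U\<close>. The samples \<open>G\<close> of the exact solution are changed by the
  initial interpolation error \<open>res\<close>, which makes \<open>U 0\<close> equal to the initial value of the scheme,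
  and by the spatial constant \<open>drift\<close>, which gives \<open>U\<close> the mass of the scheme. So the difference
  to the numerical solution starts at \<open>0\<close> and has mean zero. Moreover \<open>res\<close> does not depend on
  time, hence it drops out of all time differences, and its Laplacian is still of order \<open>h\<^sup>2\<close>
  since \<open>res\<close> is of order \<open>h ^ 4\<close>; and \<open>drift\<close> drops out of all space differences. The grid
  function \<open>q\<close> is the resulting change of the potential.\<close>

definition "G t = grid_proj L N (\<Phi> t)"
definition "res = (\<lambda>i j k. \<phi> 0 i j k - G 0 i j k)"
definition "drift t = (gsum N (G t) - gsum N (G 0)) / real N ^ 3"
definition "U t = (\<lambda>i j k. G t i j k + res i j k - drift t)"
definition "potG t = (\<lambda>i j k. nonlin (G t i j k) - \<epsilon>\<^sup>2 * grid_lap L N (G t) i j k)"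
definition "q t = (\<lambda>i j k. (nonlin (U t i j k) - nonlin (G t i j k)) - \<epsilon>\<^sup>2 * (grid_lap L N (U t) i j k - grid_lap L N (G t) i j k))"
definition "cU = C * (1 + T)"
definition "cq = C * cU + 12 * C * \<epsilon>\<^sup>2"

lemma N0: "N > 0" by (simp add: N_def)
lemma h0: "h > 0" using mesh_pos[OF L N0] by (simp add: h_def)
lemma T0: "0 \<in> {0..T}" using T by simp
lemma \<kappa>0: "\<kappa> \<ge> 0" using A0 by (simp add: \<kappa>_def)
lemma B0: "B \<ge> 0" using \<Gamma>B[OF T0] by linarith
lemma h_power_le: "h ^ 4 \<le> h\<^sup>2" using h0 h1 by (intro power_decreasing) auto
lemma cU: "cU > 0" "2 * cU * h\<^sup>2 \<le> m" using C T hm by (simp_all add: cU_def)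
lemma cq: "cq \<ge> 0" using C cU by (simp add: cq_def)

lemma sol_init: "\<phi> 0 = grid_proj L N (fourier_proj L K (\<Phi> 0))"
  and sol_ghost: "\<phi> (- 1) = (\<lambda>i j k. \<phi> 0 i j k - dt * grid_lap L N (discrete_chem_pot_init L N \<epsilon> (\<phi> 0)) i j k)"
  and sol_per: "n \<ge> 0 \<Longrightarrow> \<phi> (n + 1) \<in> grid_per N"
  and sol_pos: "n \<ge> 0 \<Longrightarrow> \<phi> (n + 1) i j k > 0"
  and sol_mean: "n \<ge> 0 \<Longrightarrow> grid_mean L N (\<phi> (n + 1)) = grid_mean L N (\<phi> n)"
  and sol_step: "n \<ge> 0 \<Longrightarrow> (3/2 * \<phi> (n + 1) i j k - 2 * \<phi> n i j k + 1/2 * \<phi> (n - 1) i j k) / dt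
           = grid_lap L N (discrete_chem_pot L N \<epsilon> A A0 dt (\<phi> (n + 1)) (\<phi> n) (\<phi> (n - 1))) i j k"
  using sol unfolding numerical_solution_def Let_def N_def[symmetric] by blast+

lemma sol_per_nat: "\<phi> (int n) \<in> grid_per N"
proof (cases n)
  case 0
  then show ?thesis using grid_proj_per[OF periodic_fourier_proj[OF L] N0] by (simp add: sol_init)
next
  case (Suc k)
  then show ?thesis using sol_per[of "int k"] by (simp add: add.commute)
qed

lemma sol_sum: "gsum N (\<phi> (int n)) = gsum N (\<phi> 0)"
proof (induction n)
  case (Suc n)
  have "mesh L N ^ 3 / L ^ 3 \<noteq> 0" using h0 L by (simp add: h_def)
  then show ?case using sol_mean[of "int n"] Suc by (simp add: grid_mean_gsum add.commute)
qed simp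

lemma G_eval: "G t i j k = \<Phi> t (grid_point L N i j k)" by (simp add: G_def grid_proj_eval)
lemma lap_G: "grid_lap L N (G t) i j k = lap_h h (\<Phi> t) (grid_point L N i j k)" by (simp add: G_def h_def grid_lap_grid_proj)
lemma potG_eval: "potG t = grid_proj L N (chem_pot_h h \<epsilon> (\<Phi> t))"
  unfolding potG_def lap_G G_eval by (intro ext) (simp add: grid_proj_eval chem_pot_h_def)
lemma lap_potG: "t \<in> {0..T} \<Longrightarrow> \<bar>grid_lap L N (potG t) i j k - V t (grid_point L N i j k)\<bar> \<le> C * h\<^sup>2"
  using cons[of t h] h0 unfolding potG_eval by (simp add: grid_lap_grid_proj h_def)

lemma G_per: "t \<in> {0..T} \<Longrightarrow> G t \<in> grid_per N"
  unfolding G_def by (rule grid_proj_per[OF per N0])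

lemma res_bound: "\<bar>res i j k\<bar> \<le> C * h ^ 4"
  using fourier[OF T0, of K i j k, folded N_def, folded h_def] unfolding res_def sol_init G_def by (simp only: abs_minus_commute)

lemma drift_lipschitz: "s \<in> {0..T} \<Longrightarrow> t \<in> {0..T} \<Longrightarrow> \<bar>drift t - drift s\<bar> \<le> C * h\<^sup>2 * \<bar>t - s\<bar>"
proof -
  assume st: "s \<in> {0..T}" "t \<in> {0..T}"
  have h: "mesh L N \<noteq> 0" using h0 by (simp add: h_def)
  have "\<bar>gsum N (G t) - gsum N (G s)\<bar> \<le> C * h\<^sup>2 * real N ^ 3 * \<bar>t - s\<bar>"
    unfolding G_def h_def by (rule mass_rate[OF L N0 T per dV cons[OF _ h] st])
  then have "\<bar>gsum N (G t) - gsum N (G s)\<bar> / real N ^ 3 \<le> C * h\<^sup>2 * \<bar>t - s\<bar>"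
    using N0 by (simp add: divide_le_eq mult_ac)
  moreover have "drift t - drift s = (gsum N (G t) - gsum N (G s)) / real N ^ 3"
    by (simp add: drift_def diff_divide_distrib)
  ultimately show ?thesis by (simp add: abs_divide)
qed

lemma drift_bound: "t \<in> {0..T} \<Longrightarrow> \<bar>drift t\<bar> \<le> C * h\<^sup>2 * T"
proof -
  assume t: "t \<in> {0..T}"
  have "\<bar>drift t\<bar> \<le> C * h\<^sup>2 * t" using drift_lipschitz[OF T0 t] t by (simp add: drift_def)
  also have "\<dots> \<le> C * h\<^sup>2 * T" using t C by (intro mult_left_mono) auto
  finally show ?thesis .
qed

lemma U_G: "t \<in> {0..T} \<Longrightarrow> \<bar>U t i j k - G t i j k\<bar> \<le> cU * h\<^sup>2"
proof -
  assume t: "t \<in> {0..T}"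
  have "C * h ^ 4 \<le> C * h\<^sup>2" using C h_power_le by (intro mult_left_mono) auto
  then have "\<bar>res i j k - drift t\<bar> \<le> C * h\<^sup>2 + C * h\<^sup>2 * T" using res_bound[of i j k] drift_bound[OF t] by linarith
  then show ?thesis by (simp add: U_def cU_def algebra_simps)
qed

lemma U_lower: "t \<in> {0..T} \<Longrightarrow> U t i j k \<ge> m / 2"
  using U_G[of t i j k] pos[of t "grid_point L N i j k"] cU unfolding G_eval by linarith

lemma U_per: "t \<in> {0..T} \<Longrightarrow> U t \<in> grid_per N"
  using sol_per_nat[of 0] unfolding U_def res_def by (intro grid_per_intros(1-3) G_per T0) auto

lemma U_sum: "gsum N (U t) = gsum N (\<phi> 0)"
  using N0 unfolding U_def gsum_diff gsum_add res_def gsum_const drift_def by simp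

lemma U_0: "U 0 = \<phi> 0"
  by (simp add: U_def res_def drift_def)

lemma lap_U: "grid_lap L N (U t) i j k = grid_lap L N (G t) i j k + grid_lap L N res i j k"
  unfolding U_def grid_lap_diff grid_lap_add grid_lap_const by simp

lemma lap_res: "\<bar>grid_lap L N res i j k\<bar> \<le> 12 * C * h\<^sup>2"
proof -
  have "\<bar>grid_lap L N res i j k\<bar> \<le> 12 * (C * h ^ 4) / h\<^sup>2"
    unfolding h_def by (rule grid_lap_bound) (use res_bound in \<open>simp add: h_def\<close>)
  also have "\<dots> = 12 * C * h\<^sup>2" using h0 by (simp add: field_simps power_eq_if)
  finally show ?thesis .
qed

lemma q_bound: "t \<in> {0..T} \<Longrightarrow> \<bar>q t i j k\<bar> \<le> cq * h\<^sup>2"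
proof -
  assume t: "t \<in> {0..T}"
  have "G t i j k \<ge> m / 2" using pos[OF t, of "grid_point L N i j k"] m unfolding G_eval by linarith
  then have "\<bar>nonlin (U t i j k) - nonlin (G t i j k)\<bar> \<le> C * \<bar>U t i j k - G t i j k\<bar>"
    using U_lower[OF t] by (intro lip)
  also have "\<dots> \<le> C * (cU * h\<^sup>2)" using C U_G[OF t] by (intro mult_left_mono) auto
  finally have 1: "\<bar>nonlin (U t i j k) - nonlin (G t i j k)\<bar> \<le> C * (cU * h\<^sup>2)" .
  have 2: "\<bar>\<epsilon>\<^sup>2 * grid_lap L N res i j k\<bar> \<le> \<epsilon>\<^sup>2 * (12 * C * h\<^sup>2)"
    using lap_res[of i j k] by (simp add: abs_mult mult_left_mono)
  have "\<bar>q t i j k\<bar> \<le> C * (cU * h\<^sup>2) + \<epsilon>\<^sup>2 * (12 * C * h\<^sup>2)" using 1 2 unfolding q_def lap_U by simp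
  then show ?thesis by (simp add: cq_def algebra_simps)
qed

lemma pot_U: "nonlin (U t i j k) - \<epsilon>\<^sup>2 * grid_lap L N (U t) i j k = potG t i j k + q t i j k"
  by (simp add: potG_def q_def algebra_simps)

lemma lap_U_diff_sq: "0 \<le> s \<Longrightarrow> s \<le> t \<Longrightarrow> t \<le> T \<Longrightarrow>
    (grid_lap L N (\<lambda>i j k. U t i j k - U s i j k) i j k)\<^sup>2 \<le> (t - s) * (\<Gamma> t - \<Gamma> s)"
  using lap2[of s t h "grid_point L N i j k"] h0 unfolding grid_lap_diff lap_U lap_G by simp

lemma potG_per: "t \<in> {0..T} \<Longrightarrow> potG t \<in> grid_per N"
  unfolding potG_def by (intro grid_per_intros(1,3,4) grid_per_comp[where F = nonlin] grid_per_lap G_per)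

lemma q_per: "t \<in> {0..T} \<Longrightarrow> q t \<in> grid_per N"
  unfolding q_def by (intro grid_per_intros(1,3,4) grid_per_comp[where F = nonlin] grid_per_lap G_per U_per)

text \<open>Times are cut off at \<open>T\<close>, so that the sequences of errors are defined for all indices.\<close>

definition "\<tau> n = min (real n * dt) T"
definition "e n = (\<lambda>i j k. U (\<tau> n) i j k - \<phi> (int n) i j k)"
definition "\<psi> n = neg_lap_inv L N (e n)"
definition "sq v = gsum N (\<lambda>i j k. (v i j k)\<^sup>2)"
definition "gr v = gradsum N v v / h\<^sup>2"

lemma \<tau>: "\<tau> n \<in> {0..T}" using dt T by (simp add: \<tau>_def)
lemma \<tau>_0: "\<tau> 0 = 0" using T by (simp add: \<tau>_def)
lemma \<tau>_eq: "real n * dt \<le> T \<Longrightarrow> \<tau> n = real n * dt" by (simp add: \<tau>_def)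
lemma \<tau>_mono: "n \<le> n' \<Longrightarrow> \<tau> n \<le> \<tau> n'" unfolding \<tau>_def using dt by (intro min.mono mult_right_mono) auto

lemma e_per: "e n \<in> grid_per N" unfolding e_def by (intro grid_per_intros(3) U_per sol_per_nat \<tau>)
lemma e_sum: "gsum N (e n) = 0" unfolding e_def gsum_diff U_sum sol_sum by simp
lemma e_0: "e 0 = (\<lambda>i j k. 0)" by (simp add: e_def \<tau>_0 U_0)
lemma \<psi>: "is_inv_lap L N (e n) (\<psi> n)" unfolding \<psi>_def by (rule is_inv_lap_neg_lap_inv[OF L N0 e_per e_sum])
lemma \<psi>_0: "\<psi> 0 = (\<lambda>i j k. 0)"
proof (rule is_inv_lap_unique[OF L N0 \<psi>])
  show "is_inv_lap L N (e 0) (\<lambda>i j k. 0)"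
    unfolding is_inv_lap_def e_0 grid_lap_const by (simp add: grid_per_intros(1) gsum_const)
qed

text \<open>For \<open>n = 0\<close> the truncated difference \<open>n - 1\<close> is \<open>0\<close>, and \<open>e 0 = 0\<close> serves as the error at
  time \<open>- dt\<close>: the ghost value of the scheme is its own comparison function, that is,
  \<open>U0 = \<phi> (- 1)\<close>.\<close>

lemma energy_step:
  assumes n: "real (Suc n) * dt \<le> T" and \<rho>: "\<rho> > 0"
    and U0: "\<And>i j k. e (n - 1) i j k = U0 i j k - \<phi> (int n - 1) i j k"
    and per: "\<beta> \<in> grid_per N" "\<eta> \<in> grid_per N"
    and \<alpha>: "\<And>i j k. \<alpha> i j k = (3/2 * U (\<tau> (Suc n)) i j k - 2 * U (\<tau> n) i j k + 1/2 * U0 i j k) / dt - grid_lap L N pot i j k"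
    and \<beta>: "\<And>i j k. \<beta> i j k + grid_lap L N \<eta> i j k = pot i j k
        - discrete_chem_pot L N \<epsilon> A A0 dt (U (\<tau> (Suc n))) (U (\<tau> n)) U0 i j k"
  shows "(gr (\<psi> (Suc n)) + gr (\<lambda>i j k. 2 * \<psi> (Suc n) i j k - \<psi> n i j k) - gr (\<psi> n)
       - gr (\<lambda>i j k. 2 * \<psi> n i j k - \<psi> (n - 1) i j k)) / (4 * dt)
     + A * dt / 2 * (gr (e (Suc n)) - gr (e n)) + 3/4 * \<epsilon>\<^sup>2 * gr (e (Suc n))
    \<le> (9 + 3 * \<kappa>) * (sq (e (Suc n)) + sq (e n) + sq (e (n - 1))) + \<rho> * gr (\<psi> (Suc n))
     + L\<^sup>2 / (8 * \<rho>) * sq \<alpha> + 1/2 * sq \<beta> + gr \<eta> / \<epsilon>\<^sup>2"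
proof -
  have i: "int n + 1 = int (Suc n)" by simp
  have U2p: "U (\<tau> (Suc n)) i j k > 0" for i j k using U_lower[OF \<tau>, of "Suc n" i j k] m by linarith
  have \<phi>p: "\<phi> (int (Suc n)) i j k > 0" for i j k using sol_pos[of "int n"] unfolding i by simp
  have s: "(3/2 * \<phi> (int (Suc n)) i j k - 2 * \<phi> (int n) i j k + 1/2 * \<phi> (int n - 1) i j k) / dt
      = grid_lap L N (discrete_chem_pot L N \<epsilon> A A0 dt (\<phi> (int (Suc n))) (\<phi> (int n)) (\<phi> (int n - 1))) i j k" for i j k
    using sol_step[of "int n"] unfolding i by simp
  have e2: "e (Suc n) i j k = U (\<tau> (Suc n)) i j k - \<phi> (int (Suc n)) i j k" for i j k by (simp only: e_def)
  have e1: "e n i j k = U (\<tau> n) i j k - \<phi> (int n) i j k" for i j k by (simp only: e_def)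
  show ?thesis
    by (rule bdf2_energy_step[OF L N0 dt(1) A \<kappa>0 \<epsilon> \<rho> \<psi> \<psi> \<psi> e_per e_per e_per U_per[OF \<tau>] sol_per_nat per U2p \<phi>p e2
          scheme_error_equation[OF s e2 e1 U0 \<alpha> \<beta>, folded \<kappa>_def], folded h_def, folded sq_def gr_def])
qed

definition "E = dt\<^sup>2 + h\<^sup>2"

lemma E: "dt\<^sup>2 \<le> E" "h\<^sup>2 \<le> E" "E \<ge> 0" by (simp_all add: E_def)

lemma dt_power_le: "dt ^ 4 \<le> E\<^sup>2"
proof -
  have "(dt\<^sup>2)\<^sup>2 \<le> E\<^sup>2" using E by (intro power_mono) auto
  then show ?thesis by simp
qed

text \<open>The constants of the sources: \<open>Q1\<close> goes with the increments of \<open>\<Gamma>\<close> and \<open>Q2\<close> with the squared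
  order of convergence.\<close>

definition "Q1 = 9/4 * L\<^sup>2 + A\<^sup>2"
definition "Q2 = 9/4 * L\<^sup>2 * C\<^sup>2 + (cq + \<kappa> * (5 * B + 2 * C))\<^sup>2"

lemma gsum_sq_bound': "(\<And>i j k. (v i j k)\<^sup>2 \<le> M) \<Longrightarrow> sq v \<le> real N ^ 3 * M"
  unfolding sq_def by (rule gsum_sq_bound)

text \<open>For \<open>n \<ge> 1\<close> the three levels of the comparison function are taken at three times of the
  exact solution and \<open>\<eta> = 0\<close>. \<open>\<alpha>\<close> contains the difference formula in time and \<open>\<Delta>\<^sub>h\<close> of the
  potential; \<open>\<beta>\<close> contains \<open>q\<close>, the second time difference and the Douglas--Dupont term.\<close>

lemma energy_step_later:
  assumes n: "n \<ge> 1" "real (Suc n) * dt \<le> T"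
  shows "(gr (\<psi> (Suc n)) + gr (\<lambda>i j k. 2 * \<psi> (Suc n) i j k - \<psi> n i j k) - gr (\<psi> n)
       - gr (\<lambda>i j k. 2 * \<psi> n i j k - \<psi> (n - 1) i j k)) / (4 * dt)
     + A * dt / 2 * (gr (e (Suc n)) - gr (e n)) + 3/4 * \<epsilon>\<^sup>2 * gr (e (Suc n))
    \<le> (9 + 3 * \<kappa>) * (sq (e (Suc n)) + sq (e n) + sq (e (n - 1))) + gr (\<psi> (Suc n))
     + real N ^ 3 * (Q1 * dt ^ 3 * (\<Gamma> (\<tau> (Suc n)) - \<Gamma> (\<tau> (n - 1))) + Q2 * E\<^sup>2)"
proof -
  define a where "a = \<tau> (n - 1)"
  define b where "b = \<tau> n"
  define c where "c = \<tau> (Suc n)"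
  have le: "real (n - 1) * dt \<le> real (Suc n) * dt" "real n * dt \<le> real (Suc n) * dt" using dt by (intro mult_right_mono; simp)+
  have abc: "b = a + dt" "c = a + 2 * dt" "0 \<le> a" "c \<le> T"
    using \<tau>_eq[of "n - 1"] \<tau>_eq[of n] \<tau>_eq[of "Suc n"] \<tau>[of "n - 1"] n le dt by (simp_all add: a_def b_def c_def of_nat_diff algebra_simps)
  have mem: "a \<in> {0..T}" "b \<in> {0..T}" "c \<in> {0..T}" by (simp_all only: a_def b_def c_def \<tau>)
  define \<Delta> where "\<Delta> = \<Gamma> c - \<Gamma> a"
  have mono: "\<Gamma> a \<le> \<Gamma> b" "\<Gamma> b \<le> \<Gamma> c" using \<Gamma>_mono[of a b] \<Gamma>_mono[of b c] abc dt by auto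
  have \<Delta>: "\<Delta> \<ge> 0" "\<Gamma> c - \<Gamma> b \<le> \<Delta>" using mono by (simp_all add: \<Delta>_def)
  define \<alpha> where "\<alpha> = (\<lambda>i j k. (3/2 * U c i j k - 2 * U b i j k + 1/2 * U a i j k) / dt - grid_lap L N (potG c) i j k)"
  define \<beta> where "\<beta> = (\<lambda>i j k. potG c i j k - discrete_chem_pot L N \<epsilon> A A0 dt (U c) (U b) (U a) i j k)"
  have d1: "\<bar>drift c - drift b\<bar> \<le> C * h\<^sup>2 * dt" "\<bar>drift b - drift a\<bar> \<le> C * h\<^sup>2 * dt"
    using drift_lipschitz[OF mem(2,3)] drift_lipschitz[OF mem(1,2)] abc dt by auto
  have \<alpha>b: "\<bar>\<alpha> i j k\<bar> \<le> 3 * dt * sqrt (dt * \<Delta>) + 3 * C * h\<^sup>2" for i j k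
  proof -
    let ?x = "grid_point L N i j k"
    define D where "D = 3/2 * (drift c - drift b) - 1/2 * (drift b - drift a)"
    have "\<bar>3/2 * x - 1/2 * z\<bar> \<le> 2 * y" if "\<bar>x\<bar> \<le> y" "\<bar>z\<bar> \<le> y" for x y z :: real
      using that by (simp add: abs_le_iff)
    from this[OF d1] have "\<bar>D\<bar> \<le> 2 * C * h\<^sup>2 * dt" unfolding D_def by (simp add: mult.assoc)
    then have D: "\<bar>D / dt\<bar> \<le> 2 * C * h\<^sup>2" using dt by (simp add: abs_divide divide_le_eq)
    have "3/2 * U c i j k - 2 * U b i j k + 1/2 * U a i j k = (3/2 * \<Phi> c ?x - 2 * \<Phi> b ?x + 1/2 * \<Phi> a ?x) - D"
      unfolding U_def G_eval D_def by (simp add: algebra_simps)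
    then have "\<alpha> i j k = ((3/2 * \<Phi> c ?x - 2 * \<Phi> b ?x + 1/2 * \<Phi> a ?x) / dt - V c ?x) - D / dt
       - (grid_lap L N (potG c) i j k - V c ?x)"
      unfolding \<alpha>_def by (simp add: diff_divide_distrib)
    then show ?thesis
      using bdf2_consistency(1)[OF abc(3) dt(1) abc(1,2,4), of ?x, folded \<Delta>_def] D lap_potG[OF mem(3), of i j k]
      by linarith
  qed
  have "(\<alpha> i j k)\<^sup>2 \<le> 18 * dt ^ 3 * \<Delta> + 18 * C\<^sup>2 * E\<^sup>2" for i j k
  proof -
    have "(\<alpha> i j k)\<^sup>2 \<le> 2 * (3 * dt * sqrt (dt * \<Delta>))\<^sup>2 + 2 * (3 * C * h\<^sup>2)\<^sup>2"
      by (rule abs_le_sum_sqD[OF \<alpha>b])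
    also have "\<dots> = 18 * dt ^ 3 * \<Delta> + 18 * C\<^sup>2 * (h\<^sup>2)\<^sup>2"
      using \<Delta> dt by (simp add: power_mult_distrib power3_eq_cube power2_eq_square)
    also have "\<dots> \<le> 18 * dt ^ 3 * \<Delta> + 18 * C\<^sup>2 * E\<^sup>2"
      using E by (intro add_left_mono mult_left_mono power_mono) auto
    finally show ?thesis .
  qed
  then have \<alpha>2: "sq \<alpha> \<le> real N ^ 3 * (18 * dt ^ 3 * \<Delta> + 18 * C\<^sup>2 * E\<^sup>2)" by (rule gsum_sq_bound')
  let ?lapd = "\<lambda>i j k. grid_lap L N (\<lambda>i j k. U c i j k - U b i j k) i j k"
  have \<beta>b: "\<bar>\<beta> i j k\<bar> \<le> (cq + \<kappa> * (5 * B + 2 * C)) * E + A * dt * \<bar>?lapd i j k\<bar>" for i j k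
  proof -
    let ?x = "grid_point L N i j k"
    define X where "X = U c i j k - (2 * U b i j k - U a i j k)"
    have Xe: "X = (\<Phi> c ?x - 2 * \<Phi> b ?x + \<Phi> a ?x) - ((drift c - drift b) - (drift b - drift a))"
      unfolding X_def U_def G_eval by (simp add: algebra_simps)
    have "C * h\<^sup>2 * dt \<le> C * h\<^sup>2 * 1" using dt C by (intro mult_left_mono) auto
    then have "\<bar>X\<bar> \<le> 5 * B * dt\<^sup>2 + 2 * C * h\<^sup>2"
      unfolding Xe using bdf2_consistency(2)[OF abc(3) dt(1) abc(1,2,4), of ?x] d1 by linarith
    also have "\<dots> \<le> 5 * B * E + 2 * C * E" using B0 C E by (intro add_mono mult_left_mono) auto
    finally have "\<bar>\<kappa> * X\<bar> \<le> \<kappa> * (5 * B * E + 2 * C * E)" using \<kappa>0 by (simp add: abs_mult mult_left_mono)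
    moreover have "\<bar>q c i j k\<bar> \<le> cq * E"
      using q_bound[OF mem(3), of i j k] mult_left_mono[OF E(2) cq] by linarith
    moreover have "\<beta> i j k = - q c i j k - \<kappa> * X + A * dt * ?lapd i j k"
      using pot_U[of c i j k] unfolding \<beta>_def discrete_chem_pot_def X_def \<kappa>_def by linarith
    moreover have "\<bar>A * dt * ?lapd i j k\<bar> = A * dt * \<bar>?lapd i j k\<bar>" using A dt by (simp add: abs_mult)
    ultimately have "\<bar>\<beta> i j k\<bar> \<le> cq * E + \<kappa> * (5 * B * E + 2 * C * E) + A * dt * \<bar>?lapd i j k\<bar>" by linarith
    then show ?thesis by (simp add: algebra_simps)
  qed
  have "(\<beta> i j k)\<^sup>2 \<le> 2 * (cq + \<kappa> * (5 * B + 2 * C))\<^sup>2 * E\<^sup>2 + 2 * A\<^sup>2 * dt ^ 3 * \<Delta>" for i j k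
  proof -
    have "(?lapd i j k)\<^sup>2 \<le> (c - b) * (\<Gamma> c - \<Gamma> b)" by (rule lap_U_diff_sq) (use mem abc dt in auto)
    also have "\<dots> \<le> dt * \<Delta>" using abc dt \<Delta> by (simp add: mult_left_mono)
    finally have "(A * dt)\<^sup>2 * (?lapd i j k)\<^sup>2 \<le> (A * dt)\<^sup>2 * (dt * \<Delta>)" by (intro mult_left_mono) auto
    then have "(A * dt * \<bar>?lapd i j k\<bar>)\<^sup>2 \<le> A\<^sup>2 * dt ^ 3 * \<Delta>"
      by (simp add: power_mult_distrib power3_eq_cube power2_eq_square mult_ac)
    moreover have "(\<beta> i j k)\<^sup>2 \<le> 2 * ((cq + \<kappa> * (5 * B + 2 * C)) * E)\<^sup>2 + 2 * (A * dt * \<bar>?lapd i j k\<bar>)\<^sup>2"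
      by (rule abs_le_sum_sqD[OF \<beta>b])
    ultimately show ?thesis by (simp add: power_mult_distrib)
  qed
  then have \<beta>2: "sq \<beta> \<le> real N ^ 3 * (2 * (cq + \<kappa> * (5 * B + 2 * C))\<^sup>2 * E\<^sup>2 + 2 * A\<^sup>2 * dt ^ 3 * \<Delta>)" by (rule gsum_sq_bound')
  have \<beta>p: "\<beta> \<in> grid_per N"
    unfolding \<beta>_def discrete_chem_pot_def
    by (intro grid_per_intros(1-4) grid_per_comp[where F = nonlin] grid_per_lap potG_per U_per mem)
  have st: "(gr (\<psi> (Suc n)) + gr (\<lambda>i j k. 2 * \<psi> (Suc n) i j k - \<psi> n i j k) - gr (\<psi> n)
       - gr (\<lambda>i j k. 2 * \<psi> n i j k - \<psi> (n - 1) i j k)) / (4 * dt)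
     + A * dt / 2 * (gr (e (Suc n)) - gr (e n)) + 3/4 * \<epsilon>\<^sup>2 * gr (e (Suc n))
    \<le> (9 + 3 * \<kappa>) * (sq (e (Suc n)) + sq (e n) + sq (e (n - 1))) + 1 * gr (\<psi> (Suc n))
     + L\<^sup>2 / (8 * 1) * sq \<alpha> + 1/2 * sq \<beta> + gr (\<lambda>i j k. 0) / \<epsilon>\<^sup>2"
  proof (rule energy_step[OF n(2) zero_less_one _ \<beta>p grid_per_intros(1)])
    show "e (n - 1) i j k = U a i j k - \<phi> (int n - 1) i j k" for i j k
      using n by (simp add: e_def a_def of_nat_diff)
  qed (simp_all add: \<alpha>_def \<beta>_def a_def b_def c_def grid_lap_const)
  have g0: "gr (\<lambda>i j k. 0) = 0" by (simp add: gr_def gradsum_def gsum_const)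
  have "L\<^sup>2 / 8 * sq \<alpha> + 1/2 * sq \<beta> \<le> L\<^sup>2 / 8 * (real N ^ 3 * (18 * dt ^ 3 * \<Delta> + 18 * C\<^sup>2 * E\<^sup>2))
     + 1/2 * (real N ^ 3 * (2 * (cq + \<kappa> * (5 * B + 2 * C))\<^sup>2 * E\<^sup>2 + 2 * A\<^sup>2 * dt ^ 3 * \<Delta>))"
    using \<alpha>2 \<beta>2 by (intro add_mono mult_left_mono) auto
  also have "\<dots> = real N ^ 3 * (Q1 * dt ^ 3 * \<Delta> + Q2 * E\<^sup>2)"
    unfolding Q1_def Q2_def by (simp add: algebra_simps)
  finally show ?thesis using st unfolding g0 \<Delta>_def c_def a_def by simp
qed

text \<open>The constant of the source of the first step; its summands stem from \<open>\<alpha>\<close>, from the two parts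
  of \<open>\<beta>\<close> and from \<open>\<eta>\<close>.\<close>

definition "P = 2 * L\<^sup>2 * (5/2 * B + 3 * C)\<^sup>2 + (3/2 * cq + \<kappa> * (B + 2 * C))\<^sup>2 + A\<^sup>2 * B + 12 * \<kappa>\<^sup>2 * cq\<^sup>2 / \<epsilon>\<^sup>2"

text \<open>The ghost value is obtained from the discrete potential \<open>\<mu>\<close> of \<open>U 0\<close>, which differs from the
  one of the exact solution by \<open>q 0\<close>. Of \<open>q 0\<close> only the size \<open>h\<^sup>2\<close> is known and not its Laplacian.
  So its occurrence in the time difference is shifted into \<open>\<beta>\<close> by the choice of \<open>pot\<close>, and its
  occurrence in the extrapolation, \<open>\<kappa> * dt * \<Delta>\<^sub>h (q 0)\<close> inside the potential, is the term \<open>\<eta>\<close>; its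
  first difference quotients are still of order \<open>dt * h\<close>. The remaining \<open>\<alpha>\<close> is merely of first
  order in \<open>dt\<close>, and the weight \<open>1 / (16 * dt)\<close> compensates for that.\<close>

lemma energy_step_first:
  assumes T1: "real (Suc 0) * dt \<le> T"
  shows "(gr (\<psi> (Suc 0)) + gr (\<lambda>i j k. 2 * \<psi> (Suc 0) i j k - \<psi> 0 i j k) - gr (\<psi> 0)
       - gr (\<lambda>i j k. 2 * \<psi> 0 i j k - \<psi> (0 - 1) i j k)) / (4 * dt)
     + A * dt / 2 * (gr (e (Suc 0)) - gr (e 0)) + 3/4 * \<epsilon>\<^sup>2 * gr (e (Suc 0))
    \<le> (9 + 3 * \<kappa>) * (sq (e (Suc 0)) + sq (e 0) + sq (e (0 - 1))) + 1 / (16 * dt) * gr (\<psi> (Suc 0))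
     + real N ^ 3 * (P * E\<^sup>2 / dt)"
proof -
  have \<tau>1: "\<tau> (Suc 0) = dt" using \<tau>_eq[OF T1] by simp
  have dtT: "dt \<le> T" using T1 by simp
  have dT: "dt \<in> {0..T}" using dt dtT by simp
  define ghost where "ghost = \<phi> (- 1)"
  define pot where "pot = (\<lambda>i j k. potG dt i j k - 1/2 * q 0 i j k)"
  define \<eta> where "\<eta> = (\<lambda>i j k. (\<kappa> * dt) * q 0 i j k)"
  define \<alpha> where "\<alpha> = (\<lambda>i j k. (3/2 * U dt i j k - 2 * U 0 i j k + 1/2 * ghost i j k) / dt - grid_lap L N pot i j k)"
  define \<beta> where "\<beta> = (\<lambda>i j k. pot i j k - discrete_chem_pot L N \<epsilon> A A0 dt (U dt) (U 0) ghost i j k - grid_lap L N \<eta> i j k)"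
  have init: "discrete_chem_pot_init L N \<epsilon> (\<phi> 0) = (\<lambda>i j k. potG 0 i j k + q 0 i j k)"
    using pot_U[of 0] unfolding U_0 by (intro ext) (simp add: discrete_chem_pot_init_def)
  have ghost: "ghost i j k = U 0 i j k - dt * (grid_lap L N (potG 0) i j k + grid_lap L N (q 0) i j k)" for i j k
    unfolding ghost_def sol_ghost init grid_lap_add U_0 by simp
  have lpot: "grid_lap L N pot i j k = grid_lap L N (potG dt) i j k - 1/2 * grid_lap L N (q 0) i j k" for i j k
    unfolding pot_def grid_lap_diff grid_lap_cmult by simp
  have l\<eta>: "grid_lap L N \<eta> i j k = (\<kappa> * dt) * grid_lap L N (q 0) i j k" for i j k
    unfolding \<eta>_def grid_lap_cmult by simp
  have drift: "\<bar>drift dt - drift 0\<bar> \<le> C * h\<^sup>2 * dt" using drift_lipschitz[OF T0 dT] dt by simp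
  have hdt: "h\<^sup>2 * dt \<le> E" 
  proof -
    have "h\<^sup>2 * dt \<le> h\<^sup>2 * 1" using dt by (intro mult_left_mono) auto
    then show ?thesis using E by linarith
  qed
  have Edt: "x * E\<^sup>2 \<le> x * E\<^sup>2 / dt" if "x \<ge> 0" for x
    using that dt by (simp add: pos_le_divide_eq mult_left_le)
  have scale: "\<bar>dt * x\<bar> \<le> dt * y" if "\<bar>x\<bar> \<le> y" for x y
    using that dt by (simp add: abs_mult)
  have incr: "U dt i j k - U 0 i j k = \<Phi> dt (grid_point L N i j k) - \<Phi> 0 (grid_point L N i j k) - (drift dt - drift 0)" for i j k
    unfolding U_def G_eval by simp
  have split: "\<bar>3/2 * a - 3/2 * b - 1/2 * c - d - e\<bar> \<le> 3/2 * a' + 3/2 * b' + 1/2 * c' + d' + e'"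
    if "\<bar>a\<bar> \<le> a'" "\<bar>b\<bar> \<le> b'" "\<bar>c\<bar> \<le> c'" "\<bar>d\<bar> \<le> d'" "\<bar>e\<bar> \<le> e'" for a b c d e a' b' c' d' e' :: real
    using that by (simp add: abs_le_iff)
  have "(\<alpha> i j k)\<^sup>2 \<le> (5/2 * B + 3 * C)\<^sup>2 * E\<^sup>2 / dt\<^sup>2" for i j k
  proof -
    let ?x = "grid_point L N i j k"
    have "3/2 * U dt i j k - 2 * U 0 i j k + 1/2 * ghost i j k = 3/2 * (U dt i j k - U 0 i j k)
        - dt * (1/2 * grid_lap L N (potG 0) i j k + 1/2 * grid_lap L N (q 0) i j k)"
      unfolding ghost by (simp add: algebra_simps)
    then have "dt * \<alpha> i j k = 3/2 * (U dt i j k - U 0 i j k)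
        - dt * (1/2 * grid_lap L N (potG 0) i j k + 1/2 * grid_lap L N (q 0) i j k) - dt * grid_lap L N pot i j k"
      unfolding \<alpha>_def using dt by (simp add: right_diff_distrib)
    also have "\<dots> = 3/2 * (\<Phi> dt ?x - \<Phi> 0 ?x - dt * V 0 ?x) - 3/2 * (drift dt - drift 0)
        - 1/2 * (dt * (grid_lap L N (potG 0) i j k - V 0 ?x)) - dt * (grid_lap L N (potG dt) i j k - V dt ?x)
        - dt * (V dt ?x - V 0 ?x)"
      unfolding incr lpot by (simp add: algebra_simps)
    also have "\<bar>\<dots>\<bar> \<le> 3/2 * (B * dt\<^sup>2) + 3/2 * (C * h\<^sup>2 * dt) + 1/2 * (dt * (C * h\<^sup>2)) + dt * (C * h\<^sup>2) + dt * (B * dt)"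
      by (rule split[OF euler_consistency(2)[OF dt(1) dtT] drift scale[OF lap_potG[OF T0]]
          scale[OF lap_potG[OF dT]] scale[OF euler_consistency(1)[OF dt(1) dtT]]])
    also have "\<dots> = 5/2 * B * dt\<^sup>2 + 3 * C * (h\<^sup>2 * dt)" by (simp add: power2_eq_square algebra_simps)
    also have "\<dots> \<le> 5/2 * B * E + 3 * C * E" using B0 C E hdt by (intro add_mono mult_left_mono) auto
    finally have "\<bar>dt * \<alpha> i j k\<bar>\<^sup>2 \<le> ((5/2 * B + 3 * C) * E)\<^sup>2" by (intro power_mono) (simp_all add: algebra_simps)
    then show ?thesis using dt by (simp add: power_mult_distrib pos_le_divide_eq mult_ac)
  qed
  then have \<alpha>2: "sq \<alpha> \<le> real N ^ 3 * ((5/2 * B + 3 * C)\<^sup>2 * E\<^sup>2 / dt\<^sup>2)" by (rule gsum_sq_bound')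
  let ?lapd = "\<lambda>i j k. grid_lap L N (\<lambda>i j k. U dt i j k - U 0 i j k) i j k"
  have \<beta>b: "\<bar>\<beta> i j k\<bar> \<le> (3/2 * cq + \<kappa> * (B + 2 * C)) * E + A * dt * \<bar>?lapd i j k\<bar>" for i j k
  proof -
    let ?x = "grid_point L N i j k"
    define Y where "Y = U dt i j k - U 0 i j k - dt * grid_lap L N (potG 0) i j k"
    have "Y = (\<Phi> dt ?x - \<Phi> 0 ?x - dt * V 0 ?x) - (drift dt - drift 0) - dt * (grid_lap L N (potG 0) i j k - V 0 ?x)"
      unfolding Y_def incr by (simp add: algebra_simps)
    also have "\<bar>\<dots>\<bar> \<le> B * dt\<^sup>2 + C * h\<^sup>2 * dt + dt * (C * h\<^sup>2)"
      using euler_consistency(2)[OF dt(1) dtT, of ?x] drift scale[OF lap_potG[OF T0, of i j k]] by linarith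
    also have "\<dots> = B * dt\<^sup>2 + 2 * C * (h\<^sup>2 * dt)" by (simp add: algebra_simps)
    also have "\<dots> \<le> B * E + 2 * C * E" using B0 C E hdt by (intro add_mono mult_left_mono) auto
    finally have "\<bar>\<kappa> * Y\<bar> \<le> \<kappa> * (B * E + 2 * C * E)" using \<kappa>0 by (simp add: abs_mult mult_left_mono)
    moreover have "\<bar>q t i j k\<bar> \<le> cq * E" if "t \<in> {0..T}" for t
      using q_bound[OF that, of i j k] mult_left_mono[OF E(2) cq] by linarith
    note this[OF T0] this[OF dT]
    moreover have "\<beta> i j k = - (1/2 * q 0 i j k) - q dt i j k - \<kappa> * Y + A * dt * ?lapd i j k"
    proof -
      have "discrete_chem_pot L N \<epsilon> A A0 dt (U dt) (U 0) ghost i j k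
        = (nonlin (U dt i j k) - \<epsilon>\<^sup>2 * grid_lap L N (U dt) i j k) + \<kappa> * (Y - dt * grid_lap L N (q 0) i j k) - A * dt * ?lapd i j k"
        unfolding discrete_chem_pot_def \<kappa>_def Y_def ghost by (simp add: algebra_simps)
      then show ?thesis unfolding \<beta>_def l\<eta> pot_U pot_def by (simp add: algebra_simps)
    qed
    moreover have "\<bar>A * dt * ?lapd i j k\<bar> = A * dt * \<bar>?lapd i j k\<bar>" using A dt by (simp add: abs_mult)
    ultimately have "\<bar>\<beta> i j k\<bar> \<le> 3/2 * (cq * E) + \<kappa> * (B * E + 2 * C * E) + A * dt * \<bar>?lapd i j k\<bar>" by linarith
    then show ?thesis by (simp add: algebra_simps)
  qed
  have "(\<beta> i j k)\<^sup>2 \<le> 2 * ((3/2 * cq + \<kappa> * (B + 2 * C))\<^sup>2 * E\<^sup>2 / dt + A\<^sup>2 * B * E\<^sup>2 / dt)" for i j k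
  proof -
    have "(?lapd i j k)\<^sup>2 \<le> (dt - 0) * (\<Gamma> dt - \<Gamma> 0)" by (rule lap_U_diff_sq) (use dt dtT in auto)
    also have "\<dots> \<le> dt * B" using dt \<Gamma>B[OF T0] \<Gamma>B[OF dT] by (simp add: mult_left_mono)
    finally have "(A * dt)\<^sup>2 * (?lapd i j k)\<^sup>2 \<le> (A * dt)\<^sup>2 * (dt * B)" by (intro mult_left_mono) auto
    then have "(A * dt * \<bar>?lapd i j k\<bar>)\<^sup>2 \<le> A\<^sup>2 * B * dt ^ 4 / dt"
      using dt by (simp add: power_mult_distrib power4_eq_xxxx power2_eq_square mult_ac)
    also have "\<dots> \<le> A\<^sup>2 * B * E\<^sup>2 / dt" using dt_power_le B0 dt by (intro divide_right_mono mult_left_mono) auto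
    finally have 1: "(A * dt * \<bar>?lapd i j k\<bar>)\<^sup>2 \<le> A\<^sup>2 * B * E\<^sup>2 / dt" .
    have 2: "(\<beta> i j k)\<^sup>2 \<le> 2 * ((3/2 * cq + \<kappa> * (B + 2 * C)) * E)\<^sup>2 + 2 * (A * dt * \<bar>?lapd i j k\<bar>)\<^sup>2"
      by (rule abs_le_sum_sqD[OF \<beta>b])
    show ?thesis using 1 2 Edt[of "(3/2 * cq + \<kappa> * (B + 2 * C))\<^sup>2"] unfolding power_mult_distrib by simp
  qed
  then have \<beta>2: "sq \<beta> \<le> real N ^ 3 * (2 * ((3/2 * cq + \<kappa> * (B + 2 * C))\<^sup>2 * E\<^sup>2 / dt + A\<^sup>2 * B * E\<^sup>2 / dt))"
    by (rule gsum_sq_bound')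
  have "\<bar>\<eta> i j k\<bar> \<le> \<kappa> * dt * (cq * h\<^sup>2)" for i j k
    using q_bound[OF T0, of i j k] \<kappa>0 dt unfolding \<eta>_def by (simp add: abs_mult mult_left_mono)
  then have "gr \<eta> \<le> real N ^ 3 * (12 * (\<kappa> * dt * (cq * h\<^sup>2))\<^sup>2) / h\<^sup>2"
    unfolding gr_def by (intro divide_right_mono gradsum_bound) auto
  also have "\<dots> = real N ^ 3 * (12 * \<kappa>\<^sup>2 * cq\<^sup>2) * (dt\<^sup>2 * h\<^sup>2)"
    using h0 by (simp add: power_mult_distrib power2_eq_square)
  also have "\<dots> \<le> real N ^ 3 * (12 * \<kappa>\<^sup>2 * cq\<^sup>2) * E\<^sup>2"
    using E unfolding power2_eq_square[of E] by (intro mult_left_mono mult_mono) auto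
  finally have "gr \<eta> / \<epsilon>\<^sup>2 \<le> real N ^ 3 * (12 * \<kappa>\<^sup>2 * cq\<^sup>2) * E\<^sup>2 / \<epsilon>\<^sup>2" by (intro divide_right_mono) auto
  also have "\<dots> = real N ^ 3 * ((12 * \<kappa>\<^sup>2 * cq\<^sup>2 / \<epsilon>\<^sup>2) * E\<^sup>2)" by simp
  also have "\<dots> \<le> real N ^ 3 * ((12 * \<kappa>\<^sup>2 * cq\<^sup>2 / \<epsilon>\<^sup>2) * E\<^sup>2 / dt)" by (intro mult_left_mono Edt) auto
  finally have \<eta>2: "gr \<eta> / \<epsilon>\<^sup>2 \<le> real N ^ 3 * ((12 * \<kappa>\<^sup>2 * cq\<^sup>2 / \<epsilon>\<^sup>2) * E\<^sup>2 / dt)" .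
  have perU: "U dt \<in> grid_per N" "U 0 \<in> grid_per N" "potG dt \<in> grid_per N" "potG 0 \<in> grid_per N" "q 0 \<in> grid_per N"
    using U_per potG_per q_per T0 dT by auto
  have pp: "ghost = (\<lambda>i j k. U 0 i j k - dt * (grid_lap L N (potG 0) i j k + grid_lap L N (q 0) i j k))"
    by (intro ext ghost)
  have ghp: "ghost \<in> grid_per N" unfolding pp by (intro grid_per_intros(1-4) grid_per_lap perU)
  have \<eta>p: "\<eta> \<in> grid_per N" unfolding \<eta>_def by (intro grid_per_intros(1,4) perU)
  have \<beta>p: "\<beta> \<in> grid_per N"
    unfolding \<beta>_def discrete_chem_pot_def pot_def
    by (intro grid_per_intros(1-4) grid_per_comp[where F = nonlin] grid_per_lap perU ghp \<eta>p)
  have st: "(gr (\<psi> (Suc 0)) + gr (\<lambda>i j k. 2 * \<psi> (Suc 0) i j k - \<psi> 0 i j k) - gr (\<psi> 0)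
       - gr (\<lambda>i j k. 2 * \<psi> 0 i j k - \<psi> (0 - 1) i j k)) / (4 * dt)
     + A * dt / 2 * (gr (e (Suc 0)) - gr (e 0)) + 3/4 * \<epsilon>\<^sup>2 * gr (e (Suc 0))
    \<le> (9 + 3 * \<kappa>) * (sq (e (Suc 0)) + sq (e 0) + sq (e (0 - 1))) + (1 / (16 * dt)) * gr (\<psi> (Suc 0))
     + L\<^sup>2 / (8 * (1 / (16 * dt))) * sq \<alpha> + 1/2 * sq \<beta> + gr \<eta> / \<epsilon>\<^sup>2"
  proof (rule energy_step[OF T1 _ _ \<beta>p \<eta>p])
    show "e (0 - 1) i j k = ghost i j k - \<phi> (int 0 - 1) i j k" for i j k
      by (simp add: e_0 ghost_def)
  qed (use dt in \<open>simp_all add: \<alpha>_def \<beta>_def \<tau>1 \<tau>_0\<close>)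
  have c: "L\<^sup>2 / (8 * (1 / (16 * dt))) = 2 * L\<^sup>2 * dt" using dt by simp
  have "2 * L\<^sup>2 * dt * sq \<alpha> \<le> 2 * L\<^sup>2 * dt * (real N ^ 3 * ((5/2 * B + 3 * C)\<^sup>2 * E\<^sup>2 / dt\<^sup>2))"
    using \<alpha>2 dt by (intro mult_left_mono) auto
  also have "\<dots> = real N ^ 3 * (2 * L\<^sup>2 * (5/2 * B + 3 * C)\<^sup>2 * E\<^sup>2 / dt)"
    using dt by (simp add: power2_eq_square[of dt])
  finally have \<alpha>3: "2 * L\<^sup>2 * dt * sq \<alpha> \<le> real N ^ 3 * (2 * L\<^sup>2 * (5/2 * B + 3 * C)\<^sup>2 * E\<^sup>2 / dt)" .
  have half: "1/2 * x \<le> y * z" if "x \<le> y * (2 * z)" for x y z :: real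
    using that by (simp add: mult.left_commute)
  have "1/2 * sq \<beta> \<le> real N ^ 3 * ((3/2 * cq + \<kappa> * (B + 2 * C))\<^sup>2 * E\<^sup>2 / dt + A\<^sup>2 * B * E\<^sup>2 / dt)"
    by (rule half[OF \<beta>2])
  moreover have "real N ^ 3 * (P * E\<^sup>2 / dt) = real N ^ 3 * (2 * L\<^sup>2 * (5/2 * B + 3 * C)\<^sup>2 * E\<^sup>2 / dt)
     + real N ^ 3 * ((3/2 * cq + \<kappa> * (B + 2 * C))\<^sup>2 * E\<^sup>2 / dt + A\<^sup>2 * B * E\<^sup>2 / dt)
     + real N ^ 3 * ((12 * \<kappa>\<^sup>2 * cq\<^sup>2 / \<epsilon>\<^sup>2) * E\<^sup>2 / dt)"
    unfolding P_def by (simp only: distrib_left[symmetric] distrib_right add_divide_distrib add.assoc)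
  ultimately show ?thesis using st \<alpha>3 \<eta>2 unfolding c by linarith
qed

text \<open>The sources summed over time, the rate in the Gronwall argument, and the resulting bound of
  the squared error in units of \<open>E\<^sup>2\<close>.\<close>

definition "F = P + 2 * B * Q1 + T * Q2"
definition "R = 9 * (9 + 3 * \<kappa>)\<^sup>2 / \<epsilon>\<^sup>2 + 1"
definition "D = (32 * R * T * exp (6 * R * T) + 6) * (L ^ 3 * F)"

lemma gr_nonneg: "gr v \<ge> 0" unfolding gr_def by (intro divide_nonneg_nonneg gradsum_nonneg) auto

lemma source_constants_nonneg: "P \<ge> 0" "Q1 \<ge> 0" "Q2 \<ge> 0"
  using B0 C by (simp_all add: P_def Q1_def Q2_def)

lemma cell_volume: "h ^ 3 * real N ^ 3 = L ^ 3"
proof -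
  have "h * real N = L" using N0 by (simp add: h_def mesh_def)
  then show ?thesis by (metis power_mult_distrib)
qed

text \<open>The increments of \<open>\<Gamma>\<close> over two time steps telescope to at most \<open>2 * B\<close>.\<close>

lemma energy_estimate:
  assumes small: "16 * R * dt \<le> 1" and M: "1 \<le> M" "real M * dt \<le> T"
  shows "h ^ 3 * gr (\<psi> M) + 2 * dt * \<epsilon>\<^sup>2 * (\<Sum>n=1..M. h ^ 3 * gr (e n)) \<le> D * E\<^sup>2"
proof -
  define f where "f = (\<lambda>n. \<Gamma> (\<tau> n))"
  (* the source of all steps; for \<open>n = 0\<close> the last two summands merely enlarge it *)
  define r where "r = (\<lambda>n. L ^ 3 * ((if n = 0 then P * E\<^sup>2 / dt else 0) + Q1 * dt ^ 3 * (f (Suc n) - f (n - 1)) + Q2 * E\<^sup>2))"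
  have h3: "h ^ 3 > 0" using h0 by simp
  have fm: "f n \<le> f n'" if "n \<le> n'" for n n'
    unfolding f_def using \<tau>[of n] \<tau>[of n'] \<tau>_mono[OF that] by (intro \<Gamma>_mono) auto
  have fB: "0 \<le> f n" "f n \<le> B" for n using \<Gamma>B[OF \<tau>] by (simp_all add: f_def)
  have fd: "f (Suc n) - f (n - 1) \<ge> 0" for n using fm[of "n - 1" "Suc n"] by simp
  have Q: "0 \<le> Q1 * dt ^ 3 * (f (Suc n) - f (n - 1))" for n using source_constants_nonneg dt fd by (intro mult_nonneg_nonneg) auto
  have r0: "r n \<ge> 0" for n
    unfolding r_def by (intro mult_nonneg_nonneg add_nonneg_nonneg Q) (use L dt source_constants_nonneg in auto)
  define C1 where "C1 = 9 + 3 * \<kappa>"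
  have Re: "R = 9 * C1\<^sup>2 / \<epsilon>\<^sup>2 + 1" by (simp only: R_def C1_def)
  have C1: "C1 > 0" using \<kappa>0 by (simp add: C1_def)
  have nng: "0 \<le> h ^ 3 * gr v" for v using h3 gr_nonneg[of v] by simp
  have zero: "gr (\<lambda>i j k. 0) = 0" "sq (\<lambda>i j k. 0) = 0" by (simp_all add: gr_def sq_def gradsum_def gsum_const)
  have step: "(h ^ 3 * gr (\<psi> (Suc n)) + h ^ 3 * gr (\<lambda>i j k. 2 * \<psi> (Suc n) i j k - \<psi> (Suc n - 1) i j k)
       - h ^ 3 * gr (\<psi> n) - h ^ 3 * gr (\<lambda>i j k. 2 * \<psi> n i j k - \<psi> (n - 1) i j k)) / (4 * dt)
     + A * dt / 2 * (h ^ 3 * gr (e (Suc n)) - h ^ 3 * gr (e n)) + 3/4 * \<epsilon>\<^sup>2 * (h ^ 3 * gr (e (Suc n)))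
    \<le> C1 * (h ^ 3 * sq (e (Suc n)) + h ^ 3 * sq (e n) + h ^ 3 * sq (e (n - 1)))
      + (if n = 0 then 1 / (16 * dt) else 1) * (h ^ 3 * gr (\<psi> (Suc n))) + r n" if n: "n < M" for n
  proof -
    have t: "real (Suc n) * dt \<le> T"
    proof -
      have "real (Suc n) * dt \<le> real M * dt" using n dt by (intro mult_right_mono) auto
      then show ?thesis using M by linarith
    qed
    define S where "S = (if n = 0 then P * E\<^sup>2 / dt else 0) + Q1 * dt ^ 3 * (f (Suc n) - f (n - 1)) + Q2 * E\<^sup>2"
    have "(gr (\<psi> (Suc n)) + gr (\<lambda>i j k. 2 * \<psi> (Suc n) i j k - \<psi> (Suc n - 1) i j k)
       - gr (\<psi> n) - gr (\<lambda>i j k. 2 * \<psi> n i j k - \<psi> (n - 1) i j k)) / (4 * dt)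
     + A * dt / 2 * (gr (e (Suc n)) - gr (e n)) + 3/4 * \<epsilon>\<^sup>2 * gr (e (Suc n))
      \<le> C1 * (sq (e (Suc n)) + sq (e n) + sq (e (n - 1)))
      + (if n = 0 then 1 / (16 * dt) else 1) * gr (\<psi> (Suc n)) + real N ^ 3 * S" (is "?l \<le> ?r")
    proof (cases "n = 0")
      case True
      have "0 \<le> Q1 * dt ^ 3 * (f (Suc 0) - f (0 - 1)) + Q2 * E\<^sup>2" using Q[of 0] source_constants_nonneg by (intro add_nonneg_nonneg) auto
      then have "real N ^ 3 * (P * E\<^sup>2 / dt) \<le> real N ^ 3 * S" unfolding S_def True by (intro mult_left_mono) auto
      then show ?thesis using energy_step_first t unfolding C1_def True by simp
    next
      case False
      then show ?thesis using energy_step_later[of n] t unfolding S_def C1_def f_def by simp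
    qed
    then have "h ^ 3 * ?l \<le> h ^ 3 * ?r" using h3 by (intro mult_left_mono) auto
    moreover have "h ^ 3 * (real N ^ 3 * S) = r n" unfolding r_def S_def mult.assoc[symmetric] cell_volume by simp
    moreover have gen: "x * ((a + b - c - d) / y + z * (g - g') + w * g) = (x * a + x * b - x * c - x * d) / y + z * (x * g - x * g') + w * (x * g)"
      "x * (c1 * (a + b + c) + d * g + y) = c1 * (x * a + x * b + x * c) + d * (x * g) + x * y"
      for x a b c d y z g g' w c1 :: real
      by (simp_all add: algebra_simps add_divide_distrib diff_divide_distrib)
    ultimately show ?thesis unfolding gen by linarith
  qed
  have "h ^ 3 * gr (\<psi> M) + 2 * dt * \<epsilon>\<^sup>2 * (\<Sum>n=1..M. h ^ 3 * gr (e n))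
    \<le> (32 * R * T * exp (6 * R * T) + 6) * (dt * (\<Sum>n<M. r n))"
    unfolding Re
  proof (rule bdf2_energy_sum[where a = "\<lambda>n. h ^ 3 * gr (\<psi> n)" and c = "\<lambda>n. h ^ 3 * gr (\<lambda>i j k. 2 * \<psi> n i j k - \<psi> (n - 1) i j k)"
        and g = "\<lambda>n. h ^ 3 * gr (e n)" and s = "\<lambda>n. h ^ 3 * sq (e n)" and r = r, OF dt(1) \<epsilon> A C1 M(2) _ _ _ _ r0 _ _ _ _ _ step])
    show "h ^ 3 * sq (e n) \<le> (\<epsilon>\<^sup>2 / (12 * C1)) * (h ^ 3 * gr (e n)) + h ^ 3 * gr (\<psi> n) / (4 * (\<epsilon>\<^sup>2 / (12 * C1)))" for n
    proof -
      have p: "\<epsilon>\<^sup>2 / (12 * C1) > 0" using \<epsilon> C1 by simp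
      have "h ^ 3 * sq (e n) \<le> h ^ 3 * ((\<epsilon>\<^sup>2 / (12 * C1)) * gr (e n) + gr (\<psi> n) / (4 * (\<epsilon>\<^sup>2 / (12 * C1))))"
        using interpolation_l2[OF \<psi> e_per p, of n, folded h_def, folded sq_def gr_def] h3 by (intro mult_left_mono) auto
      then show ?thesis by (simp only: distrib_left mult.left_commute times_divide_eq_right)
    qed
    show "16 * (9 * C1\<^sup>2 / \<epsilon>\<^sup>2 + 1) * dt \<le> 1" using small by (simp only: Re)
    show "0 \<le> h ^ 3 * sq (e n)" for n unfolding sq_def using h0 by (intro mult_nonneg_nonneg gsum_nonneg) auto
  qed (use M in \<open>auto simp: nng \<psi>_0 e_0 zero\<close>)
  also have "\<dots> \<le> (32 * R * T * exp (6 * R * T) + 6) * (L ^ 3 * F * E\<^sup>2)"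
  proof (rule mult_left_mono)
    have tele: "(\<Sum>n<m. f (Suc n) - f (n - 1)) = f m + f (m - 1) - 2 * f 0" for m by (induction m) auto
    have z: "(\<Sum>n<M. if n = 0 then P * E\<^sup>2 / dt else 0) = P * E\<^sup>2 / dt"
      using M by (simp add: sum.delta)
    have "(\<Sum>n<M. r n) = L ^ 3 * (P * E\<^sup>2 / dt + Q1 * dt ^ 3 * (f M + f (M - 1) - 2 * f 0) + real M * (Q2 * E\<^sup>2))"
      unfolding r_def sum_distrib_left[symmetric] sum.distrib z tele by simp
    then have "dt * (\<Sum>n<M. r n) = L ^ 3 * (P * E\<^sup>2 + Q1 * (f M + f (M - 1) - 2 * f 0) * dt ^ 4 + (real M * dt) * (Q2 * E\<^sup>2))"
    proof -
      have "dt * (l * (p / dt + q * dt ^ 3 * x + y * z)) = l * (p + q * x * dt ^ 4 + (y * dt) * z)" for l p q x y z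
        using dt by (simp add: distrib_left power4_eq_xxxx power3_eq_cube mult_ac)
      then show "(\<Sum>n<M. r n) = L ^ 3 * (P * E\<^sup>2 / dt + Q1 * dt ^ 3 * (f M + f (M - 1) - 2 * f 0) + real M * (Q2 * E\<^sup>2)) \<Longrightarrow> ?thesis"
        by (simp only:)
    qed
    also have "\<dots> \<le> L ^ 3 * (P * E\<^sup>2 + Q1 * (2 * B) * E\<^sup>2 + T * (Q2 * E\<^sup>2))"
    proof -
      have "f M + f (M - 1) - 2 * f 0 \<le> 2 * B" using fB[of M] fB[of "M - 1"] fB[of 0] by linarith
      then have "Q1 * (f M + f (M - 1) - 2 * f 0) * dt ^ 4 \<le> Q1 * (2 * B) * E\<^sup>2"
        using source_constants_nonneg dt_power_le B0 by (intro mult_mono mult_left_mono) auto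
      moreover have "(real M * dt) * (Q2 * E\<^sup>2) \<le> T * (Q2 * E\<^sup>2)" using M source_constants_nonneg by (intro mult_right_mono) auto
      ultimately show ?thesis using L by (intro mult_left_mono) auto
    qed
    also have "\<dots> = L ^ 3 * F * E\<^sup>2" by (simp add: F_def algebra_simps)
    finally show "dt * (\<Sum>n<M. r n) \<le> L ^ 3 * F * E\<^sup>2" .
    show "0 \<le> 32 * R * T * exp (6 * R * T) + 6" using T by (simp add: R_def)
  qed
  finally show ?thesis by (simp add: D_def mult.assoc)
qed

text \<open>The projected exact solution of the error estimate is not the comparison function; this is
  their difference, a consistency error of order \<open>h\<^sup>2\<close> in both norms.\<close>

definition "w n = (\<lambda>i j k. grid_proj L N (fourier_proj L K (\<Phi> (real n * dt))) i j k - U (\<tau> n) i j k)"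

lemma error_grid_split: "error_grid L K \<Phi> dt \<phi> n = (\<lambda>i j k. 1 * e n i j k + 1 * w n i j k)"
  unfolding error_grid_def N_def[symmetric] w_def e_def by simp

lemma w_per: "w n \<in> grid_per N"
  unfolding w_def by (intro grid_per_intros(3) grid_proj_per periodic_fourier_proj L N0 U_per \<tau>)

lemma w_sum: "real n * dt \<le> T \<Longrightarrow> gsum N (w n) = 0"
  unfolding w_def gsum_diff U_sum sol_init using mass[of "real n * dt" K, folded N_def] dt by simp

lemma w_split:
  assumes "real n * dt \<le> T"
  shows "\<exists>v. (\<forall>i j k. \<bar>v i j k\<bar> \<le> 2 * C * h ^ 4 \<and> w n i j k = v i j k + drift (\<tau> n))"
proof (intro exI[of _ "\<lambda>i j k. (grid_proj L N (fourier_proj L K (\<Phi> (\<tau> n))) i j k - G (\<tau> n) i j k) - res i j k"] allI conjI)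
  fix i j k
  show "\<bar>(grid_proj L N (fourier_proj L K (\<Phi> (\<tau> n))) i j k - G (\<tau> n) i j k) - res i j k\<bar> \<le> 2 * C * h ^ 4"
    using fourier[OF \<tau>[of n], of K i j k, folded N_def, folded h_def, folded G_def] res_bound[of i j k] by linarith
  show "w n i j k = (grid_proj L N (fourier_proj L K (\<Phi> (\<tau> n))) i j k - G (\<tau> n) i j k) - res i j k + drift (\<tau> n)"
    by (simp add: w_def U_def \<tau>_eq[OF assms])
qed

text \<open>The part of order \<open>h\<^sup>2\<close> is constant in space, hence invisible to gradients; the other part
  is of order \<open>h ^ 4\<close> and loses one power of \<open>h\<close>.\<close>

lemma w_bounds:
  assumes n: "real n * dt \<le> T"
  shows "h ^ 3 * sq (w n) \<le> 4 * L ^ 3 * cU\<^sup>2 * E\<^sup>2" and "h ^ 3 * gr (w n) \<le> 48 * L ^ 3 * C\<^sup>2 * E\<^sup>2"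
proof -
  obtain v where v: "\<And>i j k. \<bar>v i j k\<bar> \<le> 2 * C * h ^ 4" "\<And>i j k. w n i j k = v i j k + drift (\<tau> n)"
    using w_split[OF n] by blast
  have h4E: "(h\<^sup>2)\<^sup>2 \<le> E\<^sup>2" using E by (intro power_mono) auto
  have "(w n i j k)\<^sup>2 \<le> 4 * cU\<^sup>2 * E\<^sup>2" for i j k
  proof -
    have "2 * C * h ^ 4 \<le> 2 * C * h\<^sup>2" using C h_power_le by (intro mult_left_mono) auto
    moreover have "0 \<le> C * h\<^sup>2 * T" using C T by simp
    ultimately have "\<bar>w n i j k\<bar> \<le> 2 * (C * h\<^sup>2) + 2 * (C * h\<^sup>2 * T)"
      unfolding v(2) using v(1)[of i j k] drift_bound[OF \<tau>, of n] by linarith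
    then have "\<bar>w n i j k\<bar>\<^sup>2 \<le> (2 * cU * h\<^sup>2)\<^sup>2" by (intro power_mono) (simp_all add: cU_def algebra_simps)
    also have "\<dots> = 4 * cU\<^sup>2 * (h\<^sup>2)\<^sup>2" by (simp add: power_mult_distrib)
    also have "\<dots> \<le> 4 * cU\<^sup>2 * E\<^sup>2" using h4E by (intro mult_left_mono) auto
    finally show ?thesis by simp
  qed
  then have "h ^ 3 * sq (w n) \<le> h ^ 3 * (real N ^ 3 * (4 * cU\<^sup>2 * E\<^sup>2))"
    using h0 by (intro mult_left_mono gsum_sq_bound') auto
  also have "\<dots> = 4 * L ^ 3 * cU\<^sup>2 * E\<^sup>2" unfolding mult.assoc[symmetric] cell_volume by simp
  finally show "h ^ 3 * sq (w n) \<le> 4 * L ^ 3 * cU\<^sup>2 * E\<^sup>2" .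
  have "gradsum N (w n) (w n) = gradsum N v v" unfolding gradsum_def v(2) by simp
  also have "\<dots> \<le> real N ^ 3 * (12 * (2 * C * h ^ 4)\<^sup>2)" by (rule gradsum_bound[OF v(1)])
  also have "\<dots> = real N ^ 3 * (48 * C\<^sup>2 * (h ^ 4 * h\<^sup>2)) * h\<^sup>2" by (simp add: power_mult_distrib power_eq_if)
  also have "\<dots> \<le> real N ^ 3 * (48 * C\<^sup>2 * E\<^sup>2) * h\<^sup>2"
  proof -
    have "h ^ 4 * h\<^sup>2 \<le> h\<^sup>2 * h\<^sup>2" using h_power_le by (intro mult_right_mono) auto
    then have "h ^ 4 * h\<^sup>2 \<le> E\<^sup>2" using h4E by (simp add: power2_eq_square)
    then show ?thesis by (intro mult_left_mono mult_right_mono) auto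
  qed
  finally have "gr (w n) \<le> real N ^ 3 * (48 * C\<^sup>2 * E\<^sup>2)" using h0 unfolding gr_def by (simp add: divide_le_eq)
  then have "h ^ 3 * gr (w n) \<le> h ^ 3 * (real N ^ 3 * (48 * C\<^sup>2 * E\<^sup>2))" using h0 by (intro mult_left_mono) auto
  also have "\<dots> = 48 * L ^ 3 * C\<^sup>2 * E\<^sup>2" unfolding mult.assoc[symmetric] cell_volume by simp
  finally show "h ^ 3 * gr (w n) \<le> 48 * L ^ 3 * C\<^sup>2 * E\<^sup>2" .
qed

lemma gr_add: "gr (\<lambda>i j k. 1 * u i j k + 1 * v i j k) \<le> 2 * gr u + 2 * gr v"
proof -
  have "gradsum N u v \<le> 1/2 * gradsum N u u + gradsum N v v / (4 * (1/2))" by (rule gradsum_young) simp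
  then have "gradsum N (\<lambda>i j k. 1 * u i j k + 1 * v i j k) (\<lambda>i j k. 1 * u i j k + 1 * v i j k)
     \<le> 2 * gradsum N u u + 2 * gradsum N v v"
    by (simp add: gradsum_add_left gradsum_add_right gradsum_commute[of N v u])
  then have "gr (\<lambda>i j k. 1 * u i j k + 1 * v i j k) \<le> (2 * gradsum N u u + 2 * gradsum N v v) / h\<^sup>2"
    unfolding gr_def by (rule divide_right_mono) simp
  then show ?thesis by (simp add: gr_def add_divide_distrib)
qed

lemma error_estimate:
  assumes small: "16 * R * dt \<le> 1" and M: "1 \<le> M" "real M * dt \<le> T"
  shows "norm_minus1 L N (error_grid L K \<Phi> dt \<phi> M)
       + sqrt (\<epsilon>\<^sup>2 * dt * (\<Sum>n=1..M. grad_norm_sq L N (error_grid L K \<Phi> dt \<phi> n)))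
    \<le> (sqrt (2 * D + 4 * L ^ 5 * cU\<^sup>2) + sqrt (D + 96 * \<epsilon>\<^sup>2 * T * L ^ 3 * C\<^sup>2)) * E"
proof -
  note en = energy_estimate[OF assms]
  have nn: "0 \<le> h ^ 3 * gr v" for v using h0 gr_nonneg[of v] by simp
  have S0: "0 \<le> 2 * dt * \<epsilon>\<^sup>2 * (\<Sum>n=1..M. h ^ 3 * gr (e n))" 
    by (rule mult_nonneg_nonneg[OF _ sum_nonneg[OF nn]]) (use dt in simp)
  define \<psi>w where "\<psi>w = neg_lap_inv L N (w M)"
  have \<psi>w: "is_inv_lap L N (w M) \<psi>w" unfolding \<psi>w_def by (rule is_inv_lap_neg_lap_inv[OF L N0 w_per w_sum[OF M(2)]])
  have inv: "is_inv_lap L N (error_grid L K \<Phi> dt \<phi> M) (\<lambda>i j k. 1 * \<psi> M i j k + 1 * \<psi>w i j k)"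
    unfolding error_grid_split by (rule is_inv_lap_combine[OF \<psi> \<psi>w])
  have ep: "error_grid L K \<Phi> dt \<phi> M \<in> grid_per N"
    unfolding error_grid_split by (intro grid_per_intros(1,2,4) e_per w_per)
  have em: "gsum N (error_grid L K \<Phi> dt \<phi> M) = 0"
    unfolding error_grid_split by (simp add: gsum_add e_sum w_sum[OF M(2)])
  have hg: "h ^ 3 * gr v = h * gradsum N v v" for v using h0 by (simp add: gr_def power3_eq_cube power2_eq_square)
  have "norm_minus1 L N (error_grid L K \<Phi> dt \<phi> M) = sqrt (h ^ 3 * gr (\<lambda>i j k. 1 * \<psi> M i j k + 1 * \<psi>w i j k))"
    unfolding hg norm_minus1_is_inv_lap[OF L N0 inv ep em, folded h_def] ..
  also have "\<dots> \<le> sqrt ((2 * D + 4 * L ^ 5 * cU\<^sup>2) * E\<^sup>2)"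
  proof (rule real_sqrt_le_mono)
    have "h ^ 3 * gr (\<lambda>i j k. 1 * \<psi> M i j k + 1 * \<psi>w i j k) \<le> h ^ 3 * (2 * gr (\<psi> M) + 2 * gr \<psi>w)"
      using h0 gr_add by (intro mult_left_mono) auto
    moreover have "h ^ 3 * gr \<psi>w \<le> h ^ 3 * (L\<^sup>2 / 2 * sq (w M))"
      using inv_lap_gradsum_le[OF L N0 \<psi>w, folded h_def, folded sq_def gr_def] h0 by (intro mult_left_mono) auto
    moreover have "L\<^sup>2 / 2 * (h ^ 3 * sq (w M)) \<le> L\<^sup>2 / 2 * (4 * L ^ 3 * cU\<^sup>2 * E\<^sup>2)"
      by (intro mult_left_mono w_bounds M) simp
    moreover have "L\<^sup>2 / 2 * (4 * L ^ 3 * cU\<^sup>2 * E\<^sup>2) = 2 * L ^ 5 * cU\<^sup>2 * E\<^sup>2" by (simp add: power_eq_if)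
    moreover have "h ^ 3 * gr (\<psi> M) \<le> D * E\<^sup>2" using en S0 by linarith
    ultimately show "h ^ 3 * gr (\<lambda>i j k. 1 * \<psi> M i j k + 1 * \<psi>w i j k) \<le> (2 * D + 4 * L ^ 5 * cU\<^sup>2) * E\<^sup>2"
      by (simp add: algebra_simps)
  qed
  also have "\<dots> = sqrt (2 * D + 4 * L ^ 5 * cU\<^sup>2) * E" using E(3) by (simp add: real_sqrt_mult)
  finally have 1: "norm_minus1 L N (error_grid L K \<Phi> dt \<phi> M) \<le> sqrt (2 * D + 4 * L ^ 5 * cU\<^sup>2) * E" .
  have g: "grad_norm_sq L N (error_grid L K \<Phi> dt \<phi> n) \<le> 2 * (h ^ 3 * gr (e n)) + 96 * L ^ 3 * C\<^sup>2 * E\<^sup>2" if n: "n \<in> {1..M}" for n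
  proof -
    have "real n * dt \<le> real M * dt" using n dt by (intro mult_right_mono) auto
    then have t: "real n * dt \<le> T" using M by linarith
    have "grad_norm_sq L N (error_grid L K \<Phi> dt \<phi> n) = h ^ 3 * gr (\<lambda>i j k. 1 * e n i j k + 1 * w n i j k)"
        unfolding grad_norm_sq_gradsum gr_def h_def[symmetric] error_grid_split by simp
    also have "\<dots> \<le> h ^ 3 * (2 * gr (e n) + 2 * gr (w n))" using h0 gr_add by (intro mult_left_mono) auto
    finally show ?thesis using w_bounds(2)[OF t] by (simp add: algebra_simps)
  qed
  have "\<epsilon>\<^sup>2 * dt * (\<Sum>n=1..M. grad_norm_sq L N (error_grid L K \<Phi> dt \<phi> n))
     \<le> \<epsilon>\<^sup>2 * dt * (\<Sum>n=1..M. 2 * (h ^ 3 * gr (e n)) + 96 * L ^ 3 * C\<^sup>2 * E\<^sup>2)"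
    using dt g by (intro mult_left_mono sum_mono) auto
  also have "\<dots> = 2 * dt * \<epsilon>\<^sup>2 * (\<Sum>n=1..M. h ^ 3 * gr (e n)) + (real M * dt) * (96 * \<epsilon>\<^sup>2 * L ^ 3 * C\<^sup>2 * E\<^sup>2)"
    unfolding sum.distrib sum_distrib_left[symmetric] by (simp add: algebra_simps)
  also have "\<dots> \<le> D * E\<^sup>2 + T * (96 * \<epsilon>\<^sup>2 * L ^ 3 * C\<^sup>2 * E\<^sup>2)"
  proof (rule add_mono)
    show "2 * dt * \<epsilon>\<^sup>2 * (\<Sum>n=1..M. h ^ 3 * gr (e n)) \<le> D * E\<^sup>2" using en nn[of "\<psi> M"] by linarith
  qed (use M L in \<open>intro mult_right_mono; simp\<close>)
  also have "\<dots> = (D + 96 * \<epsilon>\<^sup>2 * T * L ^ 3 * C\<^sup>2) * E\<^sup>2" by (simp add: algebra_simps)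
  finally have "sqrt (\<epsilon>\<^sup>2 * dt * (\<Sum>n=1..M. grad_norm_sq L N (error_grid L K \<Phi> dt \<phi> n)))
     \<le> sqrt ((D + 96 * \<epsilon>\<^sup>2 * T * L ^ 3 * C\<^sup>2) * E\<^sup>2)" by (rule real_sqrt_le_mono)
  also have "\<dots> = sqrt (D + 96 * \<epsilon>\<^sup>2 * T * L ^ 3 * C\<^sup>2) * E" using E(3) by (simp add: real_sqrt_mult)
  finally show ?thesis using 1 by (simp add: distrib_right)
qed

end

theorem theorem4p3:
  fixes L \<epsilon> T A A0 :: real and \<Phi> :: "real \<Rightarrow> real^3 \<Rightarrow> real"
  assumes "L > 0" and "\<epsilon> > 0" and "T > 0" and "A \<ge> 0"
    and "A0 \<ge> 9/5 * (2/15) powr (2/3)"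
    and "\<Phi> 0 \<in> Ck_per 6 L"
    and "exact_solution L T \<epsilon> \<Phi>"
    and "\<Phi> \<in> class_R2 T L"
  shows "\<exists>C>0. \<exists>dt0>0. \<exists>h0>0. \<forall>dt K \<phi>.
    0 < dt \<and> dt \<le> dt0 \<and> mesh L (2 * K + 1) \<le> h0 \<and>
    numerical_solution L K \<epsilon> A A0 \<Phi> dt \<phi> \<longrightarrow>
    (\<forall>n::nat. n \<ge> 1 \<and> real n * dt \<le> T \<longrightarrow>
       norm_minus1 L (2 * K + 1) (error_grid L K \<Phi> dt \<phi> n)
       + sqrt (\<epsilon>\<^sup>2 * dt * (\<Sum>m=1..n. grad_norm_sq L (2 * K + 1) (error_grid L K \<Phi> dt \<phi> m)))
       \<le> C * (dt\<^sup>2 + (mesh L (2 * K + 1))\<^sup>2))"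
proof -
  obtain V W \<Gamma> B C m where ref: "reference_solution L T \<epsilon> \<Phi> V W \<Gamma> B C m"
    using reference_solution_exists[OF assms(1,3,2,7,8)] by blast
  have Cm: "C > 0" "m > 0" using ref by (auto simp: reference_solution_def)
  have A0: "A0 \<ge> 0"
  proof -
    have "0 \<le> 9/5 * (2/15) powr (2/3 :: real)" by simp
    then show ?thesis using assms(5) by linarith
  qed
  (* the constants of the error analysis, written out in order to show that they do not depend on
     \<open>dt\<close>, \<open>K\<close> and \<open>\<phi>\<close> *)
  define \<kappa> where "\<kappa> = 8/3 * A0"
  define cU where "cU = C * (1 + T)"
  define cq where "cq = C * cU + 12 * C * \<epsilon>\<^sup>2"
  define R where "R = 9 * (9 + 3 * \<kappa>)\<^sup>2 / \<epsilon>\<^sup>2 + 1"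
  define F where "F = (2 * L\<^sup>2 * (5/2 * B + 3 * C)\<^sup>2 + (3/2 * cq + \<kappa> * (B + 2 * C))\<^sup>2 + A\<^sup>2 * B + 12 * \<kappa>\<^sup>2 * cq\<^sup>2 / \<epsilon>\<^sup>2)
    + 2 * B * (9/4 * L\<^sup>2 + A\<^sup>2) + T * (9/4 * L\<^sup>2 * C\<^sup>2 + (cq + \<kappa> * (5 * B + 2 * C))\<^sup>2)"
  define D where "D = (32 * R * T * exp (6 * R * T) + 6) * (L ^ 3 * F)"
  define Z where "Z = sqrt (2 * D + 4 * L ^ 5 * cU\<^sup>2) + sqrt (D + 96 * \<epsilon>\<^sup>2 * T * L ^ 3 * C\<^sup>2)"
  have R0: "R > 0" by (simp add: R_def add_nonneg_pos)
  have cU0: "cU > 0" using Cm assms by (simp add: cU_def)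
  (* keeps the comparison function above \<open>m / 2\<close> *)
  define h0 where "h0 = min 1 (sqrt (m / (2 * cU)))"
  (* the smallness that the Gronwall argument needs to absorb the newest level *)
  define dt0 where "dt0 = min 1 (1 / (16 * R))"
  show ?thesis
  proof (intro exI conjI allI impI)
    show "\<bar>Z\<bar> + 1 > 0" by linarith
    show "dt0 > 0" using R0 by (simp add: dt0_def)
    show "h0 > 0" using Cm cU0 by (simp add: h0_def)
    fix dt K \<phi> and n :: nat
    assume hyp: "0 < dt \<and> dt \<le> dt0 \<and> mesh L (2 * K + 1) \<le> h0 \<and> numerical_solution L K \<epsilon> A A0 \<Phi> dt \<phi>"
      and n: "n \<ge> 1 \<and> real n * dt \<le> T"
    define N where "N = 2 * K + 1"
    define h where "h = mesh L N"
    have hp: "h > 0" using mesh_pos[OF assms(1), of N] by (simp add: h_def N_def)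
    have hh: "h \<le> 1" "h \<le> sqrt (m / (2 * cU))" using hyp by (simp_all add: h_def N_def h0_def)
    have "h\<^sup>2 \<le> (sqrt (m / (2 * cU)))\<^sup>2" using hh hp by (intro power_mono) auto
    also have "\<dots> = m / (2 * cU)" using Cm cU0 by simp
    finally have "h\<^sup>2 * (2 * cU) \<le> m" 
      by (subst (asm) pos_le_divide_eq) (use cU0 in simp_all)
    then have hm: "2 * (C * (1 + T)) * h\<^sup>2 \<le> m" by (simp add: cU_def mult_ac)
    have dt: "dt \<le> 1" "16 * R * dt \<le> 1" using hyp R0 by (simp_all add: dt0_def pos_le_divide_eq mult_ac)
    interpret ea: error_analysis L T \<epsilon> \<Phi> V W \<Gamma> B C m A A0 dt h K N \<phi>
      by (intro error_analysis.intro error_analysis_axioms.intro ref) (use assms A0 hyp hh hm dt in \<open>auto simp: N_def h_def\<close>)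
    have k: "ea.\<kappa> = \<kappa>" by (simp only: ea.\<kappa>_def \<kappa>_def)
    have c: "ea.cU = cU" by (simp only: ea.cU_def cU_def)
    have q: "ea.cq = cq" by (simp only: ea.cq_def cq_def c)
    have R: "ea.R = R" by (simp only: ea.R_def R_def k)
    have D: "ea.D = D" by (simp only: ea.D_def D_def R ea.F_def F_def ea.P_def ea.Q1_def ea.Q2_def k q)
    have "norm_minus1 L N (error_grid L K \<Phi> dt \<phi> n)
       + sqrt (\<epsilon>\<^sup>2 * dt * (\<Sum>m=1..n. grad_norm_sq L N (error_grid L K \<Phi> dt \<phi> m))) \<le> Z * ea.E"
      using ea.error_estimate[of n] dt n unfolding R D c Z_def by simp
    also have "\<dots> \<le> (\<bar>Z\<bar> + 1) * (dt\<^sup>2 + h\<^sup>2)"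
      unfolding ea.E_def by (intro mult_right_mono) auto
    finally show "norm_minus1 L (2 * K + 1) (error_grid L K \<Phi> dt \<phi> n)
       + sqrt (\<epsilon>\<^sup>2 * dt * (\<Sum>m=1..n. grad_norm_sq L (2 * K + 1) (error_grid L K \<Phi> dt \<phi> m)))
       \<le> (\<bar>Z\<bar> + 1) * (dt\<^sup>2 + (mesh L (2 * K + 1))\<^sup>2)"
      unfolding h_def N_def .
  qed
qed

end
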